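(* Let $0<\alpha<1$, let $k$ be a non-negative integer and let $b\in BMO$. If $0<p<\infty$, $\varepsilon>0$ and $w$ is a weight with $w\in C^+_{\max\{p,1\}+\varepsilon}$, then there is a constant $C>0$, independent of $f$ and $b$, such that $$\|(I_{\alpha}^{+})_{b}^{k}f\|_{L^{p}(w)}\le C\,\|b\|_{BMO}^{k}\,\|M_{(\alpha),L(\log L)^{k}}^{+}f\|_{L^{p}(w)}$$ for every locally integrable $f$ on $\mathbb{R}$ for which the integral defining $(I_\alpha^+)_b^kf(x)$ converges absolutely for almost every $x$.
   Context: A weight is a nonnegative locally integrable function $w$ on $\mathbb{R}$; $\|g\|_{L^p(w)}=\left(\int_{\mathbb{R}}|g|^p w\right)^{1/p}$ for $0<p<\infty$. $M^{+}f(x)=\sup_{h>0}\frac1h\int_x^{x+h}|f(y)|\,dy$. $BMO$ is the usual space of functions of bounded mean oscillation on $\mathbb{R}$; for $k=0$, $\|b\|_{BMO}^0$ is read as $1$. For $1<r<\infty$, $w\in C_r^+$ means: there exist $\varepsilon_0>0$ and $C>0$ such that for all $a<b'<c$ with $c-b'<b'-a$ and every measurable $E\subset(a,b')$, $\int_E w\le C\left(\frac{|E|}{c-b'}\right)^{\varepsilon_0}\int_{\mathbb{R}}\left(M^+\chi_{(a,c)}\right)^r w$. The Weyl fractional integral and its commutators are given by $$(I_{\alpha}^{+})_{b}^{k}f(x)=\int_{x}^{\infty}(b(x)-b(y))^{k}\frac{f(y)}{(y-x)^{1-\alpha}}\,dy,$$ so that $(I_\alpha^+)_b^0f=I_\alpha^+f=\int_x^\infty\frac{f(y)}{(y-x)^{1-\alpha}}dy$.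 For a Young function $\Phi$, $\|f\|_{\Phi,E}=\inf\{\lambda>0:\frac1{|E|}\int_E\Phi(|f|/\lambda)\le1\}$; $\|f\|_{L(\log L)^k,E}$ denotes $\|f\|_{\Phi,E}$ with $\Phi(t)=t(1+\log^+t)^k$ (for $k=0$ the usual average $\frac1{|E|}\int_E|f|$). The maximal operator is $$M_{(\alpha),L(\log L)^{k}}^{+}f(x)=\sup_{h>0}h^{\alpha}\|f\|_{L(\log L)^{k},(x,x+h)}.$$ *)

theory Defs
  imports "HOL-Analysis.Analysis"
begin

definition loc_integrable :: "(real \<Rightarrow> real) \<Rightarrow> bool" where
  "loc_integrable f \<longleftrightarrow> (\<forall>K. compact K \<longrightarrow> set_integrable lebesgue K f)"

definition weight :: "(real \<Rightarrow> real) \<Rightarrow> bool" where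
  "weight w \<longleftrightarrow> (\<forall>x. 0 \<le> w x) \<and> loc_integrable w"

text \<open>Norms, maximal functions and weighted integrals may be infinite, so they take values in
  \<^typ>\<open>ennreal\<close>. The power below is meant for exponents \<open>p > 0\<close>.\<close>

definition epowr :: "ennreal \<Rightarrow> real \<Rightarrow> ennreal" (infixr "epowr" 80) where
  "x epowr p = (if x = top then top else ennreal (enn2real x powr p))"

definition weighted_Lp_norm :: "real \<Rightarrow> (real \<Rightarrow> real) \<Rightarrow> (real \<Rightarrow> ennreal) \<Rightarrow> ennreal" where
  "weighted_Lp_norm p w g = (\<integral>\<^sup>+x. (g x epowr p) * ennreal (w x) \<partial>lebesgue) epowr (1 / p)"

definition average :: "(real \<Rightarrow> real) \<Rightarrow> real \<Rightarrow> real \<Rightarrow> real" where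
  "average f a c = (LINT x:{a<..<c}|lebesgue. f x) / (c - a)"

definition bmo_norm :: "(real \<Rightarrow> real) \<Rightarrow> ennreal" where
  "bmo_norm b = (SUP (a, c) \<in> {(a, c). a < c}.
     (\<integral>\<^sup>+x\<in>{a<..<c}. ennreal \<bar>b x - average b a c\<bar> \<partial>lebesgue) / ennreal (c - a))"

definition BMO :: "(real \<Rightarrow> real) set" where
  "BMO = {b. loc_integrable b \<and> bmo_norm b < top}"

definition M_plus :: "(real \<Rightarrow> real) \<Rightarrow> real \<Rightarrow> ennreal" where
  "M_plus f x = (SUP h \<in> {0<..}.
     (\<integral>\<^sup>+y\<in>{x<..<x + h}. ennreal \<bar>f y\<bar> \<partial>lebesgue) / ennreal h)"

definition C_plus :: "real \<Rightarrow> (real \<Rightarrow> real) set" where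
  "C_plus r = {w. weight w \<and>
     (\<exists>\<epsilon>\<^sub>0 > 0. \<exists>C > 0. \<forall>a b c. a < b \<and> b < c \<and> c - b < b - a \<longrightarrow>
       (\<forall>E \<in> sets lebesgue. E \<subseteq> {a<..<b} \<longrightarrow>
         (\<integral>\<^sup>+x\<in>E. ennreal (w x) \<partial>lebesgue)
           \<le> ennreal (C * (measure lebesgue E / (c - b)) powr \<epsilon>\<^sub>0)
              * (\<integral>\<^sup>+x. (M_plus (indicat_real {a<..<c}) x epowr r) * ennreal (w x) \<partial>lebesgue)))}"

definition commutator_integrand ::
    "real \<Rightarrow> nat \<Rightarrow> (real \<Rightarrow> real) \<Rightarrow> (real \<Rightarrow> real) \<Rightarrow> real \<Rightarrow> real \<Rightarrow> real" where
  "commutator_integrand \<alpha> k b f x y = (b x - b y) ^ k * (f y / (y - x) powr (1 - \<alpha>))"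

definition weyl_commutator ::
    "real \<Rightarrow> nat \<Rightarrow> (real \<Rightarrow> real) \<Rightarrow> (real \<Rightarrow> real) \<Rightarrow> real \<Rightarrow> real" where
  "weyl_commutator \<alpha> k b f x = (LINT y:{x<..}|lebesgue. commutator_integrand \<alpha> k b f x y)"

text \<open>The infimum of the empty set is \<open>\<infinity>\<close> here.\<close>

definition luxemburg_avg :: "(real \<Rightarrow> real) \<Rightarrow> (real \<Rightarrow> real) \<Rightarrow> real set \<Rightarrow> ennreal" where
  "luxemburg_avg \<Phi> f E = (INF t \<in> {t::real. 0 < t \<and>
       (\<integral>\<^sup>+y\<in>E. ennreal (\<Phi> (\<bar>f y\<bar> / t)) \<partial>lebesgue) / emeasure lebesgue E \<le> 1}. ennreal t)"

text \<open>The term \<open>max 0 (ln t)\<close> is the positive part of the logarithm, also at \<open>t = 0\<close>, where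
  \<open>ln 0 = 0\<close>. For \<open>k = 0\<close> the function is \<open>t\<close> and the Luxemburg average is the usual average of
  \<open>\<bar>f\<bar>\<close>.\<close>

definition LlogL :: "nat \<Rightarrow> real \<Rightarrow> real" where
  "LlogL k t = t * (1 + max 0 (ln t)) ^ k"

definition M_plus_frac_LlogL :: "real \<Rightarrow> nat \<Rightarrow> (real \<Rightarrow> real) \<Rightarrow> real \<Rightarrow> ennreal" where
  "M_plus_frac_LlogL \<alpha> k f x =
     (SUP h \<in> {0<..}. ennreal (h powr \<alpha>) * luxemburg_avg (LlogL k) f {x<..<x + h})"

end

theory Submission
  imports Defs
begin

text \<open>The commutator is dominated pointwise by the positive operator
  \<open>T f x = \<integral> \<bar>b x - b y\<bar>^k \<bar>f y\<bar> (y - x)^(\<alpha> - 1) dy\<close>, the integral being over \<open>y > x\<close>, and the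
  proof bounds \<open>T f\<close> (\<open>positive_commutator_bound\<close>). By monotone convergence \<open>f\<close> may be taken
  nonnegative, bounded and supported in some \<open>[-R, R]\<close>.

  \<^bold>\<open>Good points.\<close> Put \<open>\<Phi>(u) = u (1 + log\<^sup>+ u)^k\<close> and let \<open>\<Omega>\<^sub>t\<close> (\<open>level\<close>) be the open set of the
  points \<open>x\<close> such that the integral of \<open>\<Phi>(f h^\<alpha> / t)\<close> over \<open>(x, x + h)\<close> exceeds \<open>h\<close> for some
  \<open>h > 0\<close>. On \<open>\<Omega>\<^sub>t\<close> the maximal function is at least \<open>t\<close>, and a point outside \<open>\<Omega>\<^sub>t\<close> controls \<open>f\<close>
  on its right at all scales at once. Let \<open>c\<^sub>t(x)\<close> be the first point outside \<open>\<Omega>\<^sub>t\<close> at or after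
  \<open>x\<close>. As \<open>t\<close> decreases to \<open>0\<close>, the points \<open>c\<^sub>t(x)\<close> start at \<open>x\<close> and in the end leave almost no
  mass of \<open>f\<close> beyond them. So \<open>T f x\<close> is the limit, for small \<open>t\<close>, of the sum over \<open>s = 2^n t\<close>
  of the integrals over \<open>(c\<^sub>2\<^sub>s(x), c\<^sub>s(x))\<close>.

  \<^bold>\<open>Local estimate.\<close> Let \<open>(a, c)\<close> be a component of \<open>\<Omega>\<^sub>s\<close> and \<open>(u, v)\<close> one of its Whitney
  intervals, with \<open>v - u = c - v\<close>. There the piece between \<open>c\<^sub>2\<^sub>s(x)\<close> and \<open>c\<^sub>s(x) = c\<close> is at
  most \<open>2 \<lambda> \<parallel>b\<parallel>^k s\<close> outside a set of measure \<open>C \<lambda>^(-m) (v - u)\<close>, for every \<open>m\<close>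
  (\<open>local_estimate\<close>). The John-Nirenberg inequality and Young's inequality between \<open>\<Phi>\<close> and the
  exponential function absorb the oscillation of \<open>b\<close>, and the positive order \<open>\<alpha>\<close> makes the
  contributions of the scales summable.

  \<^bold>\<open>Weights.\<close> On Whitney intervals the condition \<open>C\<^sub>q\<^sup>+\<close> turns small Lebesgue measure into small
  weight, relative to the weighted integral of the tail \<open>(M\<^sup>+ \<chi>)^q\<close> of the component \<open>(a, c)\<close>
  (\<open>C_plus_imp_whitney_bound\<close>). With \<open>m\<close> large the powers of \<open>\<lambda>\<close> can be summed for every
  \<open>p > 0\<close>, and it remains to bound the sum over \<open>s = 2^n t\<close> of \<open>s^p\<close> times the integrals of the
  tails of the components of \<open>\<Omega>\<^sub>s\<close> by the integral of the \<open>p\<close>-th power of the maximal function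
  (\<open>tail_sum_bound\<close>).

  This last bound is a one-sided form of an argument of Sawyer. Take the components of \<open>\<Omega>\<close> at
  level \<open>2^N s\<close> that lie in one component \<open>V\<close> of \<open>\<Omega>\<^sub>s\<close>. Inside \<open>V\<close> the sum of their tails has
  exponentially decaying distribution (\<open>disjoint_tails_distribution\<close>). To the left of \<open>V\<close> that
  sum is small, because the left endpoint of \<open>V\<close> is a good point and therefore these components
  fill at most the proportion \<open>20 / 2^N\<close> of every interval starting there (\<open>level_density\<close>).
  This wins a factor \<open>2^(-N q)\<close>, more than the loss \<open>2^(N p)\<close> since \<open>p < q\<close>, so the tails at
  level \<open>2^N s\<close> are bounded by the weight of \<open>\<Omega>\<^sub>s\<close> plus a small multiple of the tails at level
  \<open>s\<close>, which is absorbed. The \<open>N\<close> lowest levels have no level below them; they are compared with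
  the convex hull of a lower level set, whose tail is dominated by the maximal function up to an
  error, \<open>t^p\<close> times the weight of \<open>[-R, R]\<close>. This error vanishes as \<open>t\<close> tends to \<open>0\<close>.\<close>

section \<open>Averages and the John-Nirenberg inequality\<close>

lemma loc_integrable_on_interval:
  assumes "loc_integrable b"
  shows "set_integrable lebesgue {a<..<c} b" "set_integrable lebesgue {a..<c} b" "set_integrable lebesgue {a..c} b"
proof -
  show *: "set_integrable lebesgue {a..c} b"
    using assms unfolding loc_integrable_def by auto
  show "set_integrable lebesgue {a<..<c} b" "set_integrable lebesgue {a..<c} b"
    by (rule set_integrable_subset[OF *]; auto)+
qed

lemma loc_integrable_measurable:
  assumes "loc_integrable b"
  shows "b \<in> borel_measurable lebesgue"
proof -
  have m: "(\<lambda>x. indicat_real {- real n..real n} x *\<^sub>R b x) \<in> borel_measurable lebesgue" for n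
    using loc_integrable_on_interval(3)[OF assms, of "- real n" "real n"]
    unfolding set_integrable_def by (rule borel_measurable_integrable)
  show ?thesis
  proof (rule borel_measurable_LIMSEQ_real[OF _ m])
    fix x :: real
    obtain N where N: "\<bar>x\<bar> \<le> real N" using real_arch_simple by blast
    have "\<forall>\<^sub>F n in sequentially. indicat_real {- real n..real n} x *\<^sub>R b x = b x"
      unfolding eventually_sequentially
      by (rule exI[of _ N]) (use N in \<open>auto simp: indicator_def\<close>)
    then show "(\<lambda>n. indicat_real {- real n..real n} x *\<^sub>R b x) \<longlonglongrightarrow> b x"
      by (rule tendsto_eventually)
  qed
qed

lemma average_eq_integral:
  assumes "loc_integrable b" "a < c"
  shows "average b a c = integral {a..c} b / (c - a)"
proof -
  have "(LINT x:{a<..<c}|lebesgue. b x) = (LINT x:{a..c}|lebesgue. b x)"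
    unfolding set_lebesgue_integral_def
  proof (rule integral_cong_AE)
    show "(\<lambda>x. indicat_real {a<..<c} x *\<^sub>R b x) \<in> borel_measurable lebesgue"
         "(\<lambda>x. indicat_real {a..c} x *\<^sub>R b x) \<in> borel_measurable lebesgue"
      using loc_integrable_on_interval[OF assms(1), of a c] unfolding set_integrable_def by auto
    have "AE x in lebesgue. x \<noteq> a" "AE x in lebesgue. x \<noteq> c"
      by (auto simp: AE_iff_null_sets intro!: AE_completion AE_lborel_singleton)
    then show "AE x in lebesgue. indicat_real {a<..<c} x *\<^sub>R b x = indicat_real {a..c} x *\<^sub>R b x"
      by eventually_elim (auto simp: indicator_def)
  qed
  also have "\<dots> = integral {a..c} b"
    using set_lebesgue_integral_eq_integral(2)[OF loc_integrable_on_interval(3)[OF assms(1)]] .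
  finally show ?thesis by (simp add: average_def)
qed

lemma nn_integral_open_halfopen:
  fixes g :: "real \<Rightarrow> ennreal"
  shows "(\<integral>\<^sup>+x\<in>{a<..<c}. g x \<partial>lebesgue) = (\<integral>\<^sup>+x\<in>{a..<c}. g x \<partial>lebesgue)"
proof (rule nn_integral_cong_AE)
  have "AE x in lebesgue. x \<noteq> a"
    by (auto intro!: AE_completion AE_lborel_singleton)
  then show "AE x in lebesgue. g x * indicator {a<..<c} x = g x * indicator {a..<c} x"
    by eventually_elim (auto simp: indicator_def)
qed

lemma bmo_norm_le_imp_oscillation:
  assumes "bmo_norm b \<le> ennreal B" "0 \<le> B" "a < c"
  shows "(\<integral>\<^sup>+x\<in>{a..<c}. ennreal \<bar>b x - average b a c\<bar> \<partial>lebesgue) \<le> ennreal (B * (c - a))"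
proof -
  let ?X = "\<integral>\<^sup>+x\<in>{a<..<c}. ennreal \<bar>b x - average b a c\<bar> \<partial>lebesgue"
  have "?X / ennreal (c - a) \<le> bmo_norm b"
    unfolding bmo_norm_def by (rule SUP_upper2[of "(a,c)"]) (use assms in auto)
  also have "\<dots> \<le> ennreal B" by fact
  finally have "?X / ennreal (c - a) * ennreal (c - a) \<le> ennreal B * ennreal (c - a)"
    by (rule mult_right_mono) auto
  moreover have "?X / ennreal (c - a) * ennreal (c - a) = ?X"
    using assms by (simp add: ennreal_divide_times)
  ultimately show ?thesis using assms by (simp add: ennreal_mult nn_integral_open_halfopen)
qed

text \<open>The average of \<open>b\<close> over the interval of generation \<open>n\<close> containing \<open>x\<close>, when \<open>[a, c)\<close> is halved
  repeatedly. A recursion on the interval keeps inductions on \<open>n\<close> free of index arithmetic.\<close>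

primrec dyadic_avg :: "(real \<Rightarrow> real) \<Rightarrow> nat \<Rightarrow> real \<Rightarrow> real \<Rightarrow> real \<Rightarrow> real" where
  "dyadic_avg b 0 a c x = average b a c"
| "dyadic_avg b (Suc n) a c x =
     (if x < (a + c) / 2 then dyadic_avg b n a ((a + c) / 2) x else dyadic_avg b n ((a + c) / 2) c x)"

lemma dyadic_avg_measurable [measurable]: "dyadic_avg b n a c \<in> borel_measurable borel"
proof (induction n arbitrary: a c)
  case (Suc n)
  have [measurable]: "dyadic_avg b n a' c' \<in> borel_measurable borel" for a' c' by (rule Suc.IH)
  have "dyadic_avg b (Suc n) a c = (\<lambda>x. if x < (a + c) / 2 then dyadic_avg b n a ((a + c) / 2) x
          else dyadic_avg b n ((a + c) / 2) c x)" by (rule ext) simp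
  also have "\<dots> \<in> borel_measurable borel" by measurable
  finally show ?case .
next
  case 0
  have "dyadic_avg b 0 a c = (\<lambda>x. average b a c)" by (rule ext) simp
  then show ?case by simp
qed

lemma dyadic_avg_is_average:
  assumes "a \<le> x" "x < c"
  shows "\<exists>a' c'. a' \<le> x \<and> x < c' \<and> c' - a' = (c - a) / 2 ^ n \<and> dyadic_avg b n a c x = average b a' c'"
  using assms
proof (induction n arbitrary: a c)
  case 0 then show ?case by auto
next
  case (Suc n)
  show ?case
  proof (cases "x < (a + c) / 2")
    case True
    from Suc.IH[OF Suc.prems(1) True] show ?thesis using True by (auto simp: field_simps)
  next
    case False
    with Suc.IH[of "(a+c)/2" c] Suc.prems show ?thesis by (auto simp: field_simps)
  qed
qed

lemma nn_integral_halfopen_split: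
  fixes g :: "real \<Rightarrow> ennreal"
  assumes "a \<le> m" "m \<le> c" and [measurable]: "g \<in> borel_measurable lebesgue"
  shows "(\<integral>\<^sup>+x\<in>{a..<c}. g x \<partial>lebesgue) = (\<integral>\<^sup>+x\<in>{a..<m}. g x \<partial>lebesgue) + (\<integral>\<^sup>+x\<in>{m..<c}. g x \<partial>lebesgue)"
proof -
  have "(\<integral>\<^sup>+x\<in>{a..<c}. g x \<partial>lebesgue) = (\<integral>\<^sup>+x. g x * indicator {a..<m} x + g x * indicator {m..<c} x \<partial>lebesgue)"
    by (rule nn_integral_cong) (use assms in \<open>auto simp: indicator_def\<close>)
  also have "\<dots> = (\<integral>\<^sup>+x\<in>{a..<m}. g x \<partial>lebesgue) + (\<integral>\<^sup>+x\<in>{m..<c}. g x \<partial>lebesgue)"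
    by (rule nn_integral_add) (auto intro!: borel_measurable_times_ennreal borel_measurable_indicator)
  finally show ?thesis .
qed

lemma abs_average_diff_le:
  assumes "loc_integrable b" "a < c"
  shows "ennreal (\<bar>average b a c - \<beta>\<bar> * (c - a)) \<le> (\<integral>\<^sup>+x\<in>{a..<c}. ennreal \<bar>b x - \<beta>\<bar> \<partial>lebesgue)"
proof -
  have ib: "set_integrable lebesgue {a<..<c} b" by (rule loc_integrable_on_interval[OF assms(1)])
  have ic: "set_integrable lebesgue {a<..<c} (\<lambda>x. \<beta>)"
    unfolding set_integrable_def real_scaleR_def by (intro integrable_mult_left integrable_real_indicator) (use assms in auto)
  have "(average b a c - \<beta>) * (c - a) = (LINT x:{a<..<c}|lebesgue. b x - \<beta>)"
    using assms by (subst set_integral_diff(2)[OF ib ic]) (simp add: average_def set_lebesgue_integral_def field_simps)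
  then have "\<bar>average b a c - \<beta>\<bar> * (c - a) = norm (LINT x:{a<..<c}|lebesgue. b x - \<beta>)"
    using assms by (metis abs_mult abs_of_pos diff_gt_0_iff_gt real_norm_def)
  also have "ennreal \<dots> \<le> (\<integral>\<^sup>+x. ennreal (norm (indicat_real {a<..<c} x *\<^sub>R (b x - \<beta>))) \<partial>lebesgue)"
    unfolding set_lebesgue_integral_def
    by (rule integral_norm_bound_ennreal) (use set_integral_diff(1)[OF ib ic] in \<open>simp add: set_integrable_def\<close>)
  also have "\<dots> = (\<integral>\<^sup>+x\<in>{a<..<c}. ennreal \<bar>b x - \<beta>\<bar> \<partial>lebesgue)"
    by (rule nn_integral_cong) (auto simp: indicator_def)
  finally show ?thesis by (simp add: nn_integral_open_halfopen)
qed

text \<open>The one-sided Lebesgue differentiation theorem, read off from the differentiability of the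
  Henstock-Kurzweil integral. The left-sided version follows by reflection.\<close>

lemma one_sided_averages_tendsto:
  assumes "loc_integrable b"
  shows "AE x in lebesgue. ((\<lambda>h. average b x (x + h)) \<longlongrightarrow> b x) (at_right 0)"
proof -
  have int: "b integrable_on cbox a c" for a c
    using loc_integrable_on_interval(3)[OF assms] set_lebesgue_integral_eq_integral(1) by (metis box_real(2))
  obtain N where N: "negligible N" and
    k: "\<And>x e. \<lbrakk>x \<notin> N; 0 < e\<rbrakk> \<Longrightarrow> \<exists>d>0. \<forall>h. 0 < h \<and> h < d \<longrightarrow>
         norm(integral (cbox x (x + h *\<^sub>R One)) b /\<^sub>R h ^ DIM(real) - b x) < e"
    using integrable_ccontinuous_explicit[of b] int by blast
  have "AE x in lebesgue. x \<notin> N"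
    using N by (simp add: negligible_iff_null_sets AE_not_in)
  then show ?thesis
  proof eventually_elim
    case (elim x)
    show ?case
      unfolding tendsto_iff
    proof (intro allI impI)
      fix e :: real assume "0 < e"
      from k[OF elim this] obtain d where d: "d > 0" and
        *: "\<And>h. 0 < h \<Longrightarrow> h < d \<Longrightarrow> norm(integral (cbox x (x + h)) b /\<^sub>R h - b x) < e"
        by auto
      have "dist (average b x (x + h)) (b x) < e" if "0 < h" "h < d" for h
        using *[OF that] that by (simp add: average_eq_integral[OF assms] dist_norm divide_inverse mult.commute)
      then show "\<forall>\<^sub>F h in at_right 0. dist (average b x (x + h)) (b x) < e"
        unfolding eventually_at_right_field using d by auto
    qed
  qed
qed

text \<open>These bounds fix the constants below: \<open>1/5\<close> and \<open>3/10\<close> are \<open>4 B\<close> and \<open>6 B\<close> divided by the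
  scale \<open>20 B\<close> of the exponential.\<close>

lemma exp_rational_bounds: "exp (1/5) \<le> (3/2::real)" "exp (3/10) \<le> (3/2::real)"
proof -
  have "exp (1/5::real) ^ 5 \<le> (3/2) ^ 5"
    using exp_le by (simp flip: exp_of_nat_mult) (simp add: power_divide)
  then show "exp (1/5) \<le> (3/2::real)" by (subst (asm) power_mono_iff) auto
  have "exp (3/10::real) ^ 10 = exp 1 ^ 3"
    by (simp flip: exp_of_nat_mult)
  also have "\<dots> \<le> 3 ^ 3" by (rule power_mono) (use exp_le in auto)
  also have "\<dots> \<le> (3/2) ^ 10" by (simp add: power_divide)
  finally show "exp (3/10) \<le> (3/2::real)" by (subst (asm) power_mono_iff) auto
qed

lemma average_half_diff:
  assumes b: "loc_integrable b" and B: "bmo_norm b \<le> ennreal B" "0 < B" and "a < c"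
    and sub: "{a'..<c'} \<subseteq> {a..<c}" "c' - a' = (c - a) / 2"
  shows "\<bar>average b a' c' - average b a c\<bar> \<le> 2 * B"
proof -
  have "a' < c'" using assms by auto
  have "ennreal (\<bar>average b a' c' - average b a c\<bar> * (c' - a'))
      \<le> (\<integral>\<^sup>+x\<in>{a'..<c'}. ennreal \<bar>b x - average b a c\<bar> \<partial>lebesgue)"
    by (rule abs_average_diff_le) fact+
  also have "\<dots> \<le> (\<integral>\<^sup>+x\<in>{a..<c}. ennreal \<bar>b x - average b a c\<bar> \<partial>lebesgue)"
    by (rule nn_set_integral_set_mono) fact
  also have "\<dots> \<le> ennreal (B * (c - a))"
    by (rule bmo_norm_le_imp_oscillation) (use assms in auto)
  finally have "\<bar>average b a' c' - average b a c\<bar> * (c' - a') \<le> B * (c - a)"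
    using ennreal_le_iff[of "B * (c - a)"] \<open>0 < B\<close> \<open>a < c\<close> by simp
  then have "(c - a) * \<bar>average b a' c' - average b a c\<bar> \<le> (c - a) * (2 * B)"
    by (simp add: sub(2) mult_ac)
  then show ?thesis
    using \<open>a < c\<close> mult_le_cancel_left_pos[of "c - a"] by auto
qed

text \<open>The exponential integral of generation \<open>n\<close> around a constant \<open>\<beta>\<close> that is already known to be
  within \<open>4 B\<close> of the average. The integral of \<open>\<bar>b - \<beta>\<bar>\<close> on the right is additive in the
  interval, so that the inequality survives the halving of the interval; a bound by a multiple
  of the length alone would deteriorate from one generation to the next.\<close>

definition stopped_bound :: "(real \<Rightarrow> real) \<Rightarrow> real \<Rightarrow> nat \<Rightarrow> bool" where
  "stopped_bound b B n \<longleftrightarrow> (\<forall>a c \<beta>. a < c \<longrightarrow> \<bar>average b a c - \<beta>\<bar> \<le> 4 * B \<longrightarrow>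
     (\<integral>\<^sup>+x\<in>{a..<c}. ennreal (exp (\<bar>dyadic_avg b n a c x - \<beta>\<bar> / (20 * B))) \<partial>lebesgue)
       \<le> ennreal (3/2 * (c - a)) + ennreal (9 / (8 * B)) * (\<integral>\<^sup>+x\<in>{a..<c}. ennreal \<bar>b x - \<beta>\<bar> \<partial>lebesgue))"

lemma stopped_bound_imp_exp_bound:
  assumes b: "loc_integrable b" and B: "bmo_norm b \<le> ennreal B" "0 < B" and "a < c"
    and st: "stopped_bound b B n"
  shows "(\<integral>\<^sup>+x\<in>{a..<c}. ennreal (exp (\<bar>dyadic_avg b n a c x - average b a c\<bar> / (20 * B))) \<partial>lebesgue)
       \<le> ennreal (3 * (c - a))"
proof -
  have "(\<integral>\<^sup>+x\<in>{a..<c}. ennreal (exp (\<bar>dyadic_avg b n a c x - average b a c\<bar> / (20 * B))) \<partial>lebesgue)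
      \<le> ennreal (3/2 * (c - a)) + ennreal (9 / (8 * B)) * (\<integral>\<^sup>+x\<in>{a..<c}. ennreal \<bar>b x - average b a c\<bar> \<partial>lebesgue)"
    using st \<open>a < c\<close> B(2) unfolding stopped_bound_def by auto
  also have "\<dots> \<le> ennreal (3/2 * (c - a)) + ennreal (9 / (8 * B)) * ennreal (B * (c - a))"
    by (intro add_left_mono mult_left_mono bmo_norm_le_imp_oscillation) (use assms in auto)
  also have "\<dots> = ennreal (3/2 * (c - a) + 9 / (8 * B) * (B * (c - a)))"
    using assms by (simp only: ennreal_mult[symmetric] ennreal_plus[symmetric] divide_nonneg_nonneg mult_nonneg_nonneg)
  also have "\<dots> \<le> ennreal (3 * (c - a))"
    using assms by (intro ennreal_leI) (simp add: field_simps)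
  finally show ?thesis .
qed

text \<open>A Calderon-Zygmund stopping argument done as an induction on the generation. On a half whose
  average is still within \<open>4 B\<close> of \<open>\<beta>\<close> the induction hypothesis applies with the same \<open>\<beta>\<close>. On
  the other halves the average is more than \<open>4 B\<close> but at most \<open>6 B\<close> away from \<open>\<beta>\<close>: one restarts
  there with the new average, and the restart is paid for by the integral of \<open>\<bar>b - \<beta>\<bar>\<close>, which is
  at least \<open>4 B\<close> times the length of the half.\<close>

lemma stopped_bound_holds:
  assumes b: "loc_integrable b" and B: "bmo_norm b \<le> ennreal B" "0 < B"
  shows "stopped_bound b B n"
proof (induction n)
  case 0
  show ?case unfolding stopped_bound_def
  proof (intro allI impI)
    fix a c \<beta> :: real assume ac: "a < c" and le: "\<bar>average b a c - \<beta>\<bar> \<le> 4 * B"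
    have "exp (\<bar>average b a c - \<beta>\<bar> / (20 * B)) \<le> exp (1/5)"
      using le B(2) by (simp add: field_simps)
    also note exp_rational_bounds(1)
    finally have "(\<integral>\<^sup>+x\<in>{a..<c}. ennreal (exp (\<bar>dyadic_avg b 0 a c x - \<beta>\<bar> / (20 * B))) \<partial>lebesgue)
       \<le> (\<integral>\<^sup>+x\<in>{a..<c}. ennreal (3/2) \<partial>lebesgue)"
      by (intro nn_integral_mono mult_right_mono) (auto intro!: ennreal_leI)
    also have "\<dots> = ennreal (3/2 * (c - a))"
      using ac by (subst nn_integral_cmult_indicator) (auto simp flip: ennreal_mult)
    also have "\<dots> \<le> ennreal (3/2 * (c - a)) + ennreal (9 / (8 * B)) * (\<integral>\<^sup>+x\<in>{a..<c}. ennreal \<bar>b x - \<beta>\<bar> \<partial>lebesgue)"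
      by simp
    finally show "(\<integral>\<^sup>+x\<in>{a..<c}. ennreal (exp (\<bar>dyadic_avg b 0 a c x - \<beta>\<bar> / (20 * B))) \<partial>lebesgue)
       \<le> ennreal (3/2 * (c - a)) + ennreal (9 / (8 * B)) * (\<integral>\<^sup>+x\<in>{a..<c}. ennreal \<bar>b x - \<beta>\<bar> \<partial>lebesgue)" .
  qed
next
  case (Suc n)
  have bm [measurable]: "b \<in> borel_measurable lebesgue" by (rule loc_integrable_measurable) fact
  have dm [measurable]: "dyadic_avg b n a c \<in> borel_measurable lebesgue" for n a c
    by (rule measurable_completion) simp
  show ?case unfolding stopped_bound_def
  proof (intro allI impI)
    fix a c \<beta> :: real assume ac: "a < c" and le: "\<bar>average b a c - \<beta>\<bar> \<le> 4 * B"
    define m where "m = (a + c) / 2"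
    have half: "(\<integral>\<^sup>+x\<in>{a'..<c'}. ennreal (exp (\<bar>dyadic_avg b n a' c' x - \<beta>\<bar> / (20 * B))) \<partial>lebesgue)
       \<le> ennreal (3/2 * (c' - a')) + ennreal (9 / (8 * B)) * (\<integral>\<^sup>+x\<in>{a'..<c'}. ennreal \<bar>b x - \<beta>\<bar> \<partial>lebesgue)"
      if sub: "{a'..<c'} \<subseteq> {a..<c}" "c' - a' = (c - a) / 2" for a' c'
    proof (cases "\<bar>average b a' c' - \<beta>\<bar> \<le> 4 * B")
      case True
      with Suc.IH sub ac show ?thesis unfolding stopped_bound_def by auto
    next
      case False
      have ac': "a' < c'" using sub ac by auto
      let ?A = "average b a' c'"
      \<comment> \<open>The parent average is within \<open>4 B\<close> of \<open>\<beta>\<close> and halving moves it by at most \<open>2 B\<close>.\<close>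
      have "\<bar>?A - average b a c\<bar> \<le> 2 * B"
        by (rule average_half_diff[OF b B ac sub])
      then have A6: "\<bar>?A - \<beta>\<bar> \<le> 6 * B" using le by linarith
      have pw: "exp (\<bar>y - \<beta>\<bar> / (20 * B)) \<le> 3/2 * exp (\<bar>y - ?A\<bar> / (20 * B))" for y
      proof -
        have "\<bar>y - \<beta>\<bar> \<le> 6 * B + \<bar>y - ?A\<bar>" using A6 by linarith
        then have "\<bar>y - \<beta>\<bar> / (20 * B) \<le> 3/10 + \<bar>y - ?A\<bar> / (20 * B)"
          using B(2) by (simp add: field_simps)
        then have "exp (\<bar>y - \<beta>\<bar> / (20 * B)) \<le> exp (3/10) * exp (\<bar>y - ?A\<bar> / (20 * B))"
          by (simp flip: exp_add)
        also have "\<dots> \<le> 3/2 * exp (\<bar>y - ?A\<bar> / (20 * B))"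
          by (rule mult_right_mono[OF exp_rational_bounds(2)]) simp
        finally show ?thesis .
      qed
      have "(\<integral>\<^sup>+x\<in>{a'..<c'}. ennreal (exp (\<bar>dyadic_avg b n a' c' x - \<beta>\<bar> / (20 * B))) \<partial>lebesgue)
        \<le> (\<integral>\<^sup>+x. ennreal (3/2) * (ennreal (exp (\<bar>dyadic_avg b n a' c' x - ?A\<bar> / (20 * B))) * indicator {a'..<c'} x) \<partial>lebesgue)"
        using pw by (intro nn_integral_mono) (auto simp: indicator_def simp flip: ennreal_mult intro!: ennreal_leI)
      also have "\<dots> = ennreal (3/2) * (\<integral>\<^sup>+x\<in>{a'..<c'}. ennreal (exp (\<bar>dyadic_avg b n a' c' x - ?A\<bar> / (20 * B))) \<partial>lebesgue)"
        by (rule nn_integral_cmult) (auto intro!: borel_measurable_times_ennreal borel_measurable_indicator)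
      also have "\<dots> \<le> ennreal (3/2) * ennreal (3 * (c' - a'))"
        by (intro mult_left_mono stopped_bound_imp_exp_bound[OF b B ac' Suc.IH]) auto
      also have "\<dots> = ennreal (9/2 * (c' - a'))"
        using ac' by (simp flip: ennreal_mult)
      \<comment> \<open>This is where stopping pays: here \<open>\<bar>?A - \<beta>\<bar>\<close> is larger than \<open>4 B\<close>.\<close>
      also have "\<dots> \<le> ennreal (9 / (8 * B) * (\<bar>?A - \<beta>\<bar> * (c' - a')))"
      proof (rule ennreal_leI)
        have "9/2 * (c' - a') = 9 / (8 * B) * (4 * B * (c' - a'))" using B(2) by simp
        also have "\<dots> \<le> 9 / (8 * B) * (\<bar>?A - \<beta>\<bar> * (c' - a'))"
          using False B(2) ac' by (intro mult_left_mono mult_right_mono) auto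
        finally show "9/2 * (c' - a') \<le> 9 / (8 * B) * (\<bar>?A - \<beta>\<bar> * (c' - a'))" .
      qed
      also have "\<dots> = ennreal (9 / (8 * B)) * ennreal (\<bar>?A - \<beta>\<bar> * (c' - a'))"
        using B(2) ac' by (intro ennreal_mult) auto
      also have "\<dots> \<le> ennreal (9 / (8 * B)) * (\<integral>\<^sup>+x\<in>{a'..<c'}. ennreal \<bar>b x - \<beta>\<bar> \<partial>lebesgue)"
        by (intro mult_left_mono abs_average_diff_le b ac') auto
      finally show ?thesis by (simp add: add_increasing)
    qed
    have am: "a \<le> m" "m \<le> c" using ac by (auto simp: m_def)
    let ?F = "\<lambda>x. ennreal (exp (\<bar>dyadic_avg b (Suc n) a c x - \<beta>\<bar> / (20 * B)))"
    let ?G = "\<lambda>a c. (\<integral>\<^sup>+x\<in>{a..<c}. ennreal \<bar>b x - \<beta>\<bar> \<partial>lebesgue)"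
    have "(\<integral>\<^sup>+x\<in>{a..<c}. ?F x \<partial>lebesgue) = (\<integral>\<^sup>+x\<in>{a..<m}. ?F x \<partial>lebesgue) + (\<integral>\<^sup>+x\<in>{m..<c}. ?F x \<partial>lebesgue)"
      by (rule nn_integral_halfopen_split[OF am]) measurable
    also have "(\<integral>\<^sup>+x\<in>{a..<m}. ?F x \<partial>lebesgue) = (\<integral>\<^sup>+x\<in>{a..<m}. ennreal (exp (\<bar>dyadic_avg b n a m x - \<beta>\<bar> / (20 * B))) \<partial>lebesgue)"
      by (rule nn_integral_cong) (auto simp: indicator_def m_def)
    also have "(\<integral>\<^sup>+x\<in>{m..<c}. ?F x \<partial>lebesgue) = (\<integral>\<^sup>+x\<in>{m..<c}. ennreal (exp (\<bar>dyadic_avg b n m c x - \<beta>\<bar> / (20 * B))) \<partial>lebesgue)"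
      by (rule nn_integral_cong) (auto simp: indicator_def m_def)
    also have "(\<integral>\<^sup>+x\<in>{a..<m}. ennreal (exp (\<bar>dyadic_avg b n a m x - \<beta>\<bar> / (20 * B))) \<partial>lebesgue) +
        (\<integral>\<^sup>+x\<in>{m..<c}. ennreal (exp (\<bar>dyadic_avg b n m c x - \<beta>\<bar> / (20 * B))) \<partial>lebesgue)
      \<le> (ennreal (3/2 * (m - a)) + ennreal (9 / (8 * B)) * ?G a m) + (ennreal (3/2 * (c - m)) + ennreal (9 / (8 * B)) * ?G m c)"
      by (intro add_mono half) (use ac in \<open>auto simp: m_def field_simps\<close>)
    also have "\<dots> = (ennreal (3/2 * (m - a)) + ennreal (3/2 * (c - m))) + ennreal (9 / (8 * B)) * (?G a m + ?G m c)"
      by (simp add: algebra_simps distrib_left)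
    also have "ennreal (3/2 * (m - a)) + ennreal (3/2 * (c - m)) = ennreal (3/2 * (c - a))"
    proof -
      have "3/2 * (m - a) + 3/2 * (c - m) = 3/2 * (c - a)" by (simp add: field_simps)
      moreover have "ennreal (3/2 * (m - a)) + ennreal (3/2 * (c - m)) = ennreal (3/2 * (m - a) + 3/2 * (c - m))"
        using am by (intro ennreal_plus[symmetric]) auto
      ultimately show ?thesis by (simp only:)
    qed
    also have "?G a m + ?G m c = ?G a c"
      by (rule nn_integral_halfopen_split[OF am, symmetric]) measurable
    finally show "(\<integral>\<^sup>+x\<in>{a..<c}. ?F x \<partial>lebesgue) \<le> ennreal (3/2 * (c - a)) + ennreal (9 / (8 * B)) * ?G a c" .
  qed
qed

lemma loc_integrable_reflect:
  assumes "loc_integrable b"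
  shows "loc_integrable (\<lambda>x. b (- x))"
  unfolding loc_integrable_def
proof (intro allI impI)
  fix K :: "real set" assume K: "compact K"
  then obtain r where r: "K \<subseteq> {-r..r}"
    using compact_imp_bounded[OF K] unfolding bounded_iff by (metis abs_le_iff atLeastAtMost_iff minus_le_iff real_norm_def subsetI)
  have "(\<lambda>x. b (- x)) absolutely_integrable_on {-r..r}"
    using loc_integrable_on_interval(3)[OF assms, of "-r" r]
      absolutely_integrable_reflect_real[where f = b and a = "-r" and b = r] by simp
  moreover have "K \<in> sets lebesgue" using K by (simp add: borel_compact)
  ultimately show "set_integrable lebesgue K (\<lambda>x. b (- x))"
    using r by (auto intro: set_integrable_subset)
qed

lemma average_reflect:
  assumes "loc_integrable b" "a < c"
  shows "average (\<lambda>x. b (- x)) a c = average b (- c) (- a)"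
  using assms Henstock_Kurzweil_Integration.integral_reflect_real[where f = b and a = "-c" and b = "-a"]
  by (simp add: average_eq_integral loc_integrable_reflect)

lemma AE_lebesgue_reflect:
  assumes "AE x in lebesgue. P (x::real)"
  shows "AE x in lebesgue. P (- x)"
proof -
  obtain N where N: "N \<in> null_sets lebesgue" "{x. \<not> P x} \<subseteq> N"
    using assms by (auto simp: eventually_ae_filter)
  have "negligible (uminus ` N)"
  proof (rule negligible_differentiable_image_negligible[OF order_refl])
    show "negligible N" using N(1) by (simp add: negligible_iff_null_sets)
    show "uminus differentiable_on N"
      using differentiable_on_minus[OF differentiable_on_ident] by simp
  qed
  then have "AE x in lebesgue. x \<notin> uminus ` N"
    by (simp add: negligible_iff_null_sets AE_not_in)
  then show ?thesis
    by eventually_elim (use N(2) in force)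
qed

text \<open>An interval around \<open>x\<close> need not be centred at \<open>x\<close>, but its average is a convex combination of
  a left-sided and a right-sided average at \<open>x\<close>.\<close>

lemma dyadic_avg_tendsto:
  assumes "loc_integrable b"
  shows "AE x in lebesgue. x \<in> {a..<c} \<longrightarrow> (\<lambda>n. dyadic_avg b n a c x) \<longlonglongrightarrow> b x"
proof -
  have R: "AE x in lebesgue. ((\<lambda>h. average b x (x + h)) \<longlongrightarrow> b x) (at_right 0)"
    by (rule one_sided_averages_tendsto) fact
  have "AE x in lebesgue. ((\<lambda>h. average (\<lambda>x. b (- x)) x (x + h)) \<longlongrightarrow> b (- x)) (at_right 0)"
    using one_sided_averages_tendsto[OF loc_integrable_reflect[OF assms]] .
  then have L: "AE x in lebesgue. ((\<lambda>h. average (\<lambda>x. b (- x)) (- x) (- x + h)) \<longlongrightarrow> b (- (- x))) (at_right 0)"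
    by (rule AE_lebesgue_reflect)
  from R L show ?thesis
  proof eventually_elim
    case (elim x)
    show ?case
    proof
      assume x: "x \<in> {a..<c}"
      show "(\<lambda>n. dyadic_avg b n a c x) \<longlonglongrightarrow> b x"
        unfolding tendsto_iff
      proof (intro allI impI)
        fix e :: real assume e: "0 < e"
        from tendstoD[OF elim(1) e] obtain d1 where d1: "d1 > 0" and
          r: "\<And>h. 0 < h \<Longrightarrow> h < d1 \<Longrightarrow> \<bar>average b x (x + h) - b x\<bar> < e"
          unfolding eventually_at_right_field dist_real_def by auto
        from tendstoD[OF elim(2) e] obtain d2 where d2: "d2 > 0" and
          l: "\<And>h. 0 < h \<Longrightarrow> h < d2 \<Longrightarrow> \<bar>average (\<lambda>x. b (- x)) (- x) (- x + h) - b x\<bar> < e"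
          unfolding eventually_at_right_field dist_real_def by auto
        have l': "\<bar>average b (x - h) x - b x\<bar> < e" if "0 < h" "h < d2" for h
          using l[OF that] that average_reflect[OF assms, of "-x" "-x + h"] by simp
        have "(\<lambda>n. (c - a) * (1/2) ^ n) \<longlonglongrightarrow> (c - a) * 0"
          by (intro tendsto_intros) auto
        then have "\<forall>\<^sub>F n in sequentially. (c - a) * (1/2) ^ n < min d1 d2"
          by (rule order_tendstoD) (use d1 d2 in auto)
        then show "\<forall>\<^sub>F n in sequentially. dist (dyadic_avg b n a c x) (b x) < e"
        proof eventually_elim
          case (elim n)
          obtain a' c' where ac: "a' \<le> x" "x < c'" "c' - a' = (c - a) / 2 ^ n"
            and eq: "dyadic_avg b n a c x = average b a' c'"
          proof -
            have "\<exists>a' c'. a' \<le> x \<and> x < c' \<and> c' - a' = (c - a) / 2 ^ n \<and> dyadic_avg b n a c x = average b a' c'"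
              by (rule dyadic_avg_is_average) (use x in auto)
            then show thesis using that by (elim exE conjE)
          qed
          have small: "c' - a' < d1" "c' - a' < d2"
            using elim unfolding ac(3) power_one_over by (auto simp only: min_less_iff_conj divide_inverse mult_1_left)
          have R: "\<bar>average b x c' - b x\<bar> < e"
            using r[of "c' - x"] ac(1,2) small by auto
          have int: "b integrable_on {a'..c'}"
            using loc_integrable_on_interval(3)[OF assms] set_lebesgue_integral_eq_integral(1) by metis
          have "\<bar>average b a' c' - b x\<bar> < e"
          proof (cases "a' = x")
            case True then show ?thesis using R by simp
          next
            case False
            then have ax: "a' < x" using ac by auto
            have L: "\<bar>average b a' x - b x\<bar> < e"
              using l'[of "x - a'"] ax ac(1,2) small by auto
            have "integral {a'..x} b + integral {x..c'} b = integral {a'..c'} b"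
              by (rule Henstock_Kurzweil_Integration.integral_combine) (use ac(1,2) int in auto)
            then have "(c' - a') * average b a' c' = (x - a') * average b a' x + (c' - x) * average b x c'"
              using ax ac(1,2) by (simp add: average_eq_integral[OF assms])
            then have "(c' - a') * (average b a' c' - b x) = (x - a') * (average b a' x - b x) + (c' - x) * (average b x c' - b x)"
              by (simp add: algebra_simps)
            then have "\<bar>c' - a'\<bar> * \<bar>average b a' c' - b x\<bar> = \<bar>(x - a') * (average b a' x - b x) + (c' - x) * (average b x c' - b x)\<bar>"
              by (simp only: abs_mult[symmetric])
            moreover have "\<bar>c' - a'\<bar> = c' - a'" using ax ac(1,2) by linarith
            ultimately have "(c' - a') * \<bar>average b a' c' - b x\<bar> = \<bar>(x - a') * (average b a' x - b x) + (c' - x) * (average b x c' - b x)\<bar>"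
              by (simp only:)
            also have "\<dots> \<le> (x - a') * \<bar>average b a' x - b x\<bar> + (c' - x) * \<bar>average b x c' - b x\<bar>"
              using ax ac(1,2) by (intro order_trans[OF abs_triangle_ineq]) (simp add: abs_mult)
            also have "\<dots> < (x - a') * e + (c' - x) * e"
              using ax ac(1,2) L R by (intro add_strict_mono mult_strict_left_mono) auto
            also have "\<dots> = (c' - a') * e" by (simp add: algebra_simps)
            finally show ?thesis using ax ac(1,2) mult_less_cancel_left_pos[of "c' - a'"] by auto
          qed
          then show ?case by (simp add: eq dist_real_def)
        qed
      qed
    qed
  qed
qed

text \<open>The dyadic averages satisfy the exponential bound uniformly in the generation and converge
  almost everywhere, so Fatou's lemma gives the bound for \<open>b\<close>.\<close>

theorem john_nirenberg:
  assumes b: "loc_integrable b" and B: "bmo_norm b \<le> ennreal B" "0 < B" and "a < c"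
  shows "(\<integral>\<^sup>+x\<in>{a<..<c}. ennreal (exp (\<bar>b x - average b a c\<bar> / (20 * B))) \<partial>lebesgue) \<le> ennreal (3 * (c - a))"
proof -
  have bm [measurable]: "b \<in> borel_measurable lebesgue" by (rule loc_integrable_measurable) fact
  have dm [measurable]: "dyadic_avg b n a c \<in> borel_measurable lebesgue" for n a c
    by (rule measurable_completion) simp
  define u where "u = (\<lambda>n x. ennreal (exp (\<bar>dyadic_avg b n a c x - average b a c\<bar> / (20 * B))) * indicator {a..<c} x)"
  have um: "u n \<in> borel_measurable lebesgue" for n
    unfolding u_def by (auto intro!: borel_measurable_times_ennreal borel_measurable_indicator)
  have "(\<integral>\<^sup>+x\<in>{a..<c}. ennreal (exp (\<bar>b x - average b a c\<bar> / (20 * B))) \<partial>lebesgue)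
      = (\<integral>\<^sup>+x. liminf (\<lambda>n. u n x) \<partial>lebesgue)"
  proof (rule nn_integral_cong_AE)
    show "AE x in lebesgue. ennreal (exp (\<bar>b x - average b a c\<bar> / (20 * B))) * indicator {a..<c} x = liminf (\<lambda>n. u n x)"
      using dyadic_avg_tendsto[OF b, of a c]
    proof eventually_elim
      case (elim x)
      show ?case
      proof (cases "x \<in> {a..<c}")
        case True
        then have "(\<lambda>n. dyadic_avg b n a c x) \<longlonglongrightarrow> b x" using elim by blast
        then have "(\<lambda>n. u n x) \<longlonglongrightarrow> ennreal (exp (\<bar>b x - average b a c\<bar> / (20 * B)))"
          unfolding u_def using True B(2) by (auto intro!: tendsto_intros)
        then have "liminf (\<lambda>n. u n x) = ennreal (exp (\<bar>b x - average b a c\<bar> / (20 * B)))"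
          by (rule lim_imp_Liminf[rotated]) auto
        then show ?thesis using True by simp
      next
        case False
        then show ?thesis by (simp add: u_def Liminf_const)
      qed
    qed
  qed
  also have "\<dots> \<le> liminf (\<lambda>n. integral\<^sup>N lebesgue (u n))"
    by (rule nn_integral_liminf) (rule um)
  also have "\<dots> \<le> limsup (\<lambda>n. integral\<^sup>N lebesgue (u n))"
    by (rule Liminf_le_Limsup) simp
  also have "\<dots> \<le> ennreal (3 * (c - a))"
  proof (rule Limsup_bounded, rule always_eventually, rule allI)
    show "integral\<^sup>N lebesgue (u n) \<le> ennreal (3 * (c - a))" for n
      using stopped_bound_imp_exp_bound[OF assms stopped_bound_holds[OF b B]] by (simp add: u_def)
  qed
  finally show ?thesis by (simp add: nn_integral_open_halfopen)
qed

section \<open>A weak type estimate of Vitali type\<close>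

lemma emeasure_UN_le_nn_integral:
  assumes C: "countable C" and X: "\<And>i. i \<in> C \<Longrightarrow> X i \<in> sets M"
  shows "emeasure M (\<Union>i\<in>C. X i) \<le> (\<integral>\<^sup>+i. emeasure M (X i) \<partial>count_space C)"
proof -
  have U: "(\<Union>i\<in>C. X i) \<in> sets M" using C X by (intro sets.countable_UN'') auto
  have "emeasure M (\<Union>i\<in>C. X i) = (\<integral>\<^sup>+x. indicator (\<Union>i\<in>C. X i) x \<partial>M)"
    using U by simp
  also have "\<dots> \<le> (\<integral>\<^sup>+x. (\<integral>\<^sup>+i. indicator (X i) x \<partial>count_space C) \<partial>M)"
  proof (rule nn_integral_mono)
    fix x
    show "indicator (\<Union>i\<in>C. X i) x \<le> (\<integral>\<^sup>+i. (indicator (X i) x :: ennreal) \<partial>count_space C)"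
    proof (cases "x \<in> (\<Union>i\<in>C. X i)")
      case True
      then obtain i where i: "i \<in> C" "x \<in> X i" by auto
      have "(1::ennreal) = (\<integral>\<^sup>+j. indicator {i} j \<partial>count_space C)"
        using i by (subst nn_integral_indicator) (auto simp: emeasure_count_space)
      also have "\<dots> \<le> (\<integral>\<^sup>+j. indicator (X j) x \<partial>count_space C)"
        by (rule nn_integral_mono) (use i in \<open>auto simp: indicator_def\<close>)
      finally show ?thesis using True by simp
    qed simp
  qed
  also have "\<dots> = (\<integral>\<^sup>+i. (\<integral>\<^sup>+x. indicator (X i) x \<partial>M) \<partial>count_space C)"
    by (rule nn_integral_count_space_nn_integral) (use C X in auto)
  also have "\<dots> = (\<integral>\<^sup>+i. emeasure M (X i) \<partial>count_space C)"
    by (rule nn_integral_cong) (use X in auto)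
  finally show ?thesis .
qed

lemma nn_integral_disjoint_le:
  fixes g :: "'a \<Rightarrow> ennreal"
  assumes C: "countable C" and X: "\<And>i. i \<in> C \<Longrightarrow> X i \<in> sets M" and d: "disjoint_family_on X C"
    and [measurable]: "g \<in> borel_measurable M" and Y: "\<And>i. i \<in> C \<Longrightarrow> X i \<subseteq> Y"
  shows "(\<integral>\<^sup>+i. (\<integral>\<^sup>+x\<in>X i. g x \<partial>M) \<partial>count_space C) \<le> (\<integral>\<^sup>+x\<in>Y. g x \<partial>M)"
proof -
  have "(\<integral>\<^sup>+i. (\<integral>\<^sup>+x\<in>X i. g x \<partial>M) \<partial>count_space C) = (\<integral>\<^sup>+i. emeasure (density M g) (X i) \<partial>count_space C)"
    by (rule nn_integral_cong) (use X in \<open>auto simp: emeasure_density\<close>)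
  also have "\<dots> = emeasure (density M g) (\<Union>i\<in>C. X i)"
    by (rule emeasure_UN_countable[symmetric]) (use C X d in auto)
  also have "\<dots> = (\<integral>\<^sup>+x\<in>(\<Union>i\<in>C. X i). g x \<partial>M)"
    using C X by (intro emeasure_density) auto
  also have "\<dots> \<le> (\<integral>\<^sup>+x\<in>Y. g x \<partial>M)"
    by (rule nn_set_integral_set_mono) (use Y in auto)
  finally show ?thesis .
qed

text \<open>The weak type \<open>(1, 1)\<close> inequality of the maximal function in a form without suprema: \<open>A\<close> is
  covered by intervals \<open>(x - r, x + r)\<close> on which \<open>g\<close> has mass at least \<open>r\<close>. The constant is the
  length of the fivefold enlargement of such an interval divided by \<open>r\<close>.\<close>

lemma vitali_weak_type:
  fixes g :: "real \<Rightarrow> ennreal"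
  assumes g [measurable]: "g \<in> borel_measurable lebesgue" and A: "A \<in> sets lebesgue"
    and cov: "\<And>x. x \<in> A \<Longrightarrow> \<exists>r. 0 < r \<and> r \<le> B \<and> ennreal r \<le> (\<integral>\<^sup>+y\<in>{x - r<..<x + r}. g y \<partial>lebesgue)"
  shows "emeasure lebesgue A \<le> 10 * (\<integral>\<^sup>+y. g y \<partial>lebesgue)"
proof -
  obtain r where r: "\<And>x. x \<in> A \<Longrightarrow> 0 < r x \<and> r x \<le> B \<and> ennreal (r x) \<le> (\<integral>\<^sup>+y\<in>{x - r x<..<x + r x}. g y \<partial>lebesgue)"
    using cov by metis
  have r': "\<And>i. i \<in> A \<Longrightarrow> 0 < r i \<and> r i \<le> B" using r by auto
  have "A \<subseteq> (\<Union>i\<in>A. ball i (r i))" using r' by force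
  then obtain C where C: "countable C" "C \<subseteq> A"
     and pw: "pairwise (\<lambda>i j. disjnt (ball i (r i)) (ball j (r j))) C"
     and sub: "A \<subseteq> (\<Union>i\<in>C. ball i (5 * r i))"
    by (rule Vitali_covering_lemma_balls[where a = "\<lambda>i. i" and r = r, OF _ r'])
  have "emeasure lebesgue A \<le> emeasure lebesgue (\<Union>i\<in>C. ball i (5 * r i))"
    by (rule emeasure_mono[OF sub]) (use C in \<open>auto intro!: sets.countable_UN''\<close>)
  also have "\<dots> \<le> (\<integral>\<^sup>+i. emeasure lebesgue (ball i (5 * r i)) \<partial>count_space C)"
    by (rule emeasure_UN_le_nn_integral) (use C in auto)
  also have "\<dots> \<le> (\<integral>\<^sup>+i. 10 * (\<integral>\<^sup>+y\<in>ball i (r i). g y \<partial>lebesgue) \<partial>count_space C)"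
  proof (rule nn_integral_mono)
    fix i assume "i \<in> space (count_space C)"
    then have i: "i \<in> A" using C by auto
    have "emeasure lebesgue (ball i (5 * r i)) = ennreal (10 * r i)"
      using r'[OF i] by (simp add: ball_eq_greaterThanLessThan)
    also have "\<dots> = 10 * ennreal (r i)"
      using r'[OF i] by (simp add: ennreal_mult)
    also have "\<dots> \<le> 10 * (\<integral>\<^sup>+y\<in>ball i (r i). g y \<partial>lebesgue)"
      using r[OF i] by (intro mult_left_mono) (auto simp: ball_eq_greaterThanLessThan)
    finally show "emeasure lebesgue (ball i (5 * r i)) \<le> 10 * (\<integral>\<^sup>+y\<in>ball i (r i). g y \<partial>lebesgue)" .
  qed
  also have "\<dots> = 10 * (\<integral>\<^sup>+i. (\<integral>\<^sup>+y\<in>ball i (r i). g y \<partial>lebesgue) \<partial>count_space C)"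
    by (rule nn_integral_cmult) simp
  also have "\<dots> \<le> 10 * (\<integral>\<^sup>+y\<in>UNIV. g y \<partial>lebesgue)"
    using C pw by (intro mult_left_mono nn_integral_disjoint_le)
      (auto simp: disjoint_family_on_def pairwise_def disjnt_def)
  finally show ?thesis by simp
qed

section \<open>Tails of intervals and the one-sided weight condition\<close>

lemma two_power_powr: "((2::real) ^ n) powr p = (2 powr p) ^ n"
  by (simp only: powr_realpow[symmetric] powr_gt_zero zero_less_numeral powr_powr mult.commute)

lemma dyadic_scale:
  fixes r :: real assumes "1 \<le> r"
  obtains j where "2 ^ j \<le> r" "r < 2 ^ Suc j"
proof -
  obtain n where n: "r < 2 ^ n" using real_arch_pow[of 2 r] by auto
  define m where "m = (LEAST n. r < (2::real) ^ n)"
  have m: "r < 2 ^ m" unfolding m_def by (rule LeastI[of "\<lambda>n. r < 2 ^ n"]) (rule n)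
  have "m \<noteq> 0" using m assms by (intro notI) simp
  then obtain j where j: "m = Suc j" using not0_implies_Suc by blast
  have "\<not> r < 2 ^ j" using not_less_Least[of j "\<lambda>n. r < 2 ^ n"] j by (simp add: m_def)
  with m j show ?thesis by (intro that[of j]) auto
qed

text \<open>An explicit majorant of the \<open>q\<close>-th power of the one-sided maximal function of the indicator of
  \<open>(a, c)\<close>: it is \<open>1\<close> on the interval, decays to its left and vanishes to its right.\<close>

definition tail :: "real \<Rightarrow> real \<Rightarrow> real \<Rightarrow> real \<Rightarrow> real" where
  "tail q a c x = (if x < c then min 1 ((c - a) / (c - x)) powr q else 0)"

lemma tail_nonneg [simp]: "0 \<le> tail q a c x" by (simp add: tail_def)

lemma tail_le_1: "a \<le> c \<Longrightarrow> 0 \<le> q \<Longrightarrow> tail q a c x \<le> 1"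
  by (auto simp: tail_def intro!: powr_le1)

lemma tail_inside: "a \<le> x \<Longrightarrow> x < c \<Longrightarrow> tail q a c x = 1"
  by (simp add: tail_def min_def)

lemma tail_measurable [measurable]: "tail q a c \<in> borel_measurable borel"
  unfolding tail_def[abs_def] by measurable

lemma tail_measurable_lebesgue [measurable]: "tail q a c \<in> borel_measurable lebesgue"
  by (rule measurable_completion) simp

lemma epowr_mono: "x \<le> y \<Longrightarrow> 0 \<le> p \<Longrightarrow> x epowr p \<le> y epowr p"
  unfolding epowr_def
  by (auto intro!: ennreal_leI powr_mono2 enn2real_mono simp: less_top top_unique)

lemma epowr_ennreal: "0 \<le> x \<Longrightarrow> ennreal x epowr p = ennreal (x powr p)"
  by (simp add: epowr_def)

lemma M_plus_indicator_le:
  assumes "a < c" "0 < q"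
  shows "M_plus (indicat_real {a<..<c}) x epowr q \<le> ennreal (tail q a c x)"
proof -
  define t where "t = (if x < c then min 1 ((c - a) / (c - x)) else 0)"
  have t0: "0 \<le> t" using assms by (auto simp: t_def)
  have "M_plus (indicat_real {a<..<c}) x \<le> ennreal t"
    unfolding M_plus_def
  proof (rule SUP_least)
    fix h :: real assume "h \<in> {0<..}"
    then have h: "0 < h" by simp
    have "(\<integral>\<^sup>+y\<in>{x<..<x + h}. ennreal \<bar>indicat_real {a<..<c} y\<bar> \<partial>lebesgue)
        = (\<integral>\<^sup>+y. indicator ({a<..<c} \<inter> {x<..<x+h}) y \<partial>lebesgue)"
      by (rule nn_integral_cong) (auto simp: indicator_def)
    also have "\<dots> = emeasure lebesgue {max a x<..<min c (x + h)}"
      by (subst nn_integral_indicator) (auto simp: greaterThanLessThan_def lessThan_Int_lessThan greaterThan_Int_greaterThan intro!: arg_cong[where f="emeasure lborel"])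
    also have "\<dots> \<le> ennreal (t * h)"
    proof (cases "max a x < min c (x + h)")
      case True
      then have xc: "x < c" and "a < x + h" by auto
      have 1: "min c (x + h) - max a x \<le> h" by linarith
      have 2: "min c (x + h) - max a x \<le> (c - a) / (c - x) * h"
      proof (cases "a \<le> x")
        case True
        then have "(c - a) / (c - x) \<ge> 1" using xc by simp
        then have "1 * h \<le> (c - a) / (c - x) * h" by (rule mult_right_mono) (use h in simp)
        with 1 show ?thesis by linarith
      next
        case False
        \<comment> \<open>The overlap of \<open>(a, c)\<close> with \<open>(x, x + h)\<close> is at most \<open>h\<close>, and relative to \<open>h\<close> it is
          largest when \<open>x + h\<close> reaches \<open>c\<close>.\<close>
        have "(min c (x + h) - a) * (c - x) \<le> (c - a) * h"
        proof (cases "c \<le> x + h")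
          case True
          then have "(c - a) * (c - x) \<le> (c - a) * h" using assms by (intro mult_left_mono) auto
          then show ?thesis using True by (simp add: min_def)
        next
          case F2: False
          have "0 \<le> (a - x) * (c - x - h)" using False F2 by (intro mult_nonneg_nonneg) auto
          then show ?thesis using F2 by (simp add: min_def algebra_simps)
        qed
        then show ?thesis using False xc by (simp add: field_simps)
      qed
      have "min c (x + h) - max a x \<le> t * h"
        using 1 2 xc by (auto simp: t_def min_def)
      then show ?thesis using True by (simp add: ennreal_leI)
    next
      case False
      then have "{max a x<..<min c (x + h)} = {}" by auto
      then show ?thesis by simp
    qed
    finally have "(\<integral>\<^sup>+y\<in>{x<..<x + h}. ennreal \<bar>indicat_real {a<..<c} y\<bar> \<partial>lebesgue) \<le> ennreal h * ennreal t"
      using h t0 by (simp add: ennreal_mult mult.commute)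
    then show "(\<integral>\<^sup>+y\<in>{x<..<x + h}. ennreal \<bar>indicat_real {a<..<c} y\<bar> \<partial>lebesgue) / ennreal h \<le> ennreal t"
      by (rule divide_le_posI_ennreal[rotated]) (use h in simp)
  qed
  then have "M_plus (indicat_real {a<..<c}) x epowr q \<le> ennreal t epowr q"
    using assms by (intro epowr_mono) auto
  also have "\<dots> = ennreal (tail q a c x)"
    using t0 assms by (simp add: epowr_ennreal t_def tail_def)
  finally show ?thesis .
qed

lemma shifted_geometric_sum_le:
  "(\<Sum>j. ennreal (if J \<le> Suc j then 4 * (1/2) ^ (Suc j - J) else 0)) \<le> ennreal 8"
proof -
  \<comment> \<open>The series in question is that of \<open>h\<close>, whose sum is \<open>8\<close>, without the term of index \<open>0\<close>.\<close>
  define h where "h j = (if J \<le> j then 4 * (1/2::real) ^ (j - J) else 0)" for j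
  have "(\<lambda>i. 4 * (1/2::real) ^ i) sums (4 * (1 / (1 - 1/2)))"
    by (intro sums_mult geometric_sums) simp
  then have "(\<lambda>i. h (i + J)) sums 8" by (simp add: h_def)
  then have h8: "h sums 8"
    by (subst (asm) sums_zero_iff_shift) (auto simp: h_def)
  then have S: "(\<lambda>j. h (Suc j)) sums (8 - h 0)"
    by (subst sums_Suc_iff) simp
  have "(\<Sum>j. ennreal (h (Suc j))) = ennreal (8 - h 0)"
    using S by (subst suminf_ennreal_eq[of _ "8 - h 0"]) (auto simp: h_def)
  also have "\<dots> \<le> ennreal 8" by (intro ennreal_leI) (simp add: h_def)
  finally show ?thesis by (simp add: h_def)
qed

text \<open>The intervals \<open>(c - L / 2^j, c - L / 2^(j + 2))\<close> shrink geometrically towards \<open>c\<close>. Put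
  \<open>\<rho> = L / (c - x)\<close>. The tail of the \<open>j\<close>-th interval at \<open>x\<close> is at most \<open>min 1 (\<rho> / 2^j)\<close> to the
  power \<open>q\<close>, and it vanishes once the interval lies left of \<open>x\<close>, that is, for \<open>\<rho> / 2^j \<ge> 4\<close>. So
  the remaining terms decay geometrically, starting from at most a multiple of the tail of
  \<open>(a, c)\<close> at \<open>x\<close>.\<close>

lemma whitney_tails_sum_le:
  assumes "a < c" "1 \<le> q"
  shows "(\<Sum>j. ennreal (tail q (c - (c - a) / 2 ^ j) (c - (c - a) / 2 ^ (j + 2)) x)) \<le> ennreal (8 * tail q a c x)"
proof (cases "x < c")
  case False
  have "0 < (c - a) / 2 ^ (j + 2)" for j using assms by auto
  then have "tail q (c - (c - a) / 2 ^ j) (c - (c - a) / 2 ^ (j + 2)) x = 0" for j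
    using False unfolding tail_def by (smt (verit))
  then show ?thesis by simp
next
  case True
  define L where "L = c - a"
  define \<rho> where "\<rho> = L / (c - x)"
  have L: "0 < L" using assms by (simp add: L_def)
  have \<rho>: "0 < \<rho>" using L True by (simp add: \<rho>_def)
  have eq: "(c - x) * \<rho> = L" using True by (simp add: \<rho>_def)
  let ?t = "\<lambda>j. tail q (c - L / 2 ^ j) (c - L / 2 ^ (j + 2)) x"
  have t: "?t j \<le> (if \<rho> / 2 ^ j < 4 then min 1 (\<rho> / 2 ^ j) powr q else 0)" for j
  proof (cases "x < c - L / 2 ^ (j + 2)")
    case False
    then show ?thesis by (auto simp: tail_def)
  next
    case x: True
    define d where "d = L / 2 ^ j"
    have d: "0 < d" using L by (simp add: d_def)
    have d4: "L / 2 ^ (j + 2) = d / 4" by (simp add: d_def)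
    have r: "\<rho> / 2 ^ j = d / (c - x)" by (simp add: \<rho>_def d_def)
    have lt: "d / 4 < c - x" using x d4 by linarith
    have *: "min 1 ((c - d / 4 - (c - d)) / (c - d / 4 - x)) \<le> min 1 (d / (c - x))"
    proof (cases "c - x \<le> d")
      case True
      then have "1 \<le> d / (c - x)" using \<open>x < c\<close> by (simp add: divide_simps mult.commute)
      then show ?thesis by linarith
    next
      case False
      have "(3 / 4 * d) / (c - d / 4 - x) \<le> d / (c - x)"
      proof -
        define e where "e = d"
        define y where "y = c - x"
        have ey: "0 < e" "e < y" using d False by (auto simp: e_def y_def)
        have "3 / 4 * e * y \<le> e * (y - e / 4)"
        proof -
          have "e * e \<le> e * y" using ey by (intro mult_left_mono) auto
          then show ?thesis by (simp add: algebra_simps)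
        qed
        then have "(3 / 4 * e) / (y - e / 4) \<le> e / y" using ey by (simp add: divide_simps mult_ac)
        then show ?thesis by (simp add: e_def y_def algebra_simps)
      qed
      then show ?thesis by (simp add: algebra_simps)
    qed
    have "?t j = min 1 ((c - d / 4 - (c - d)) / (c - d / 4 - x)) powr q"
      using x unfolding d4 by (simp add: tail_def flip: d_def)
    also have "\<dots> \<le> min 1 (d / (c - x)) powr q"
    proof (rule powr_mono2)
      have "0 \<le> (c - d / 4 - (c - d)) / (c - d / 4 - x)"
        by (rule divide_nonneg_nonneg) (use lt d in linarith)+
      then show "0 \<le> min 1 ((c - d / 4 - (c - d)) / (c - d / 4 - x))" by linarith
    qed (use assms * in auto)
    also have "d / (c - x) < 4" using lt True by (simp add: divide_simps)
    then have "min 1 (d / (c - x)) powr q = (if \<rho> / 2 ^ j < 4 then min 1 (\<rho> / 2 ^ j) powr q else 0)"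
      unfolding r by simp
    finally show ?thesis .
  qed
  have T: "tail q a c x = min 1 \<rho> powr q" using True by (simp add: tail_def \<rho>_def L_def)
  have "(\<Sum>j. ennreal (?t j)) \<le> ennreal (8 * tail q a c x)"
  proof (cases "\<rho> \<le> 1")
    case small: True
    have "?t j \<le> tail q a c x * (1/2) ^ j" for j
    proof -
      have "?t j \<le> min 1 (\<rho> / 2 ^ j) powr q" using t[of j] by (auto split: if_splits intro: order_trans)
      also have "\<dots> \<le> (\<rho> / 2 ^ j) powr q" using \<rho> assms by (intro powr_mono2) auto
      also have "\<dots> = \<rho> powr q * ((1 / 2 ^ j) powr q)" using \<rho> by (simp flip: powr_mult)
      also have "(1 / 2 ^ j) powr q \<le> ((1 / 2 ^ j) powr 1 :: real)"
        using assms by (intro powr_mono') auto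
      finally show ?thesis using small T \<rho> by (simp add: min_def power_one_over mult_left_mono)
    qed
    then have "(\<Sum>j. ennreal (?t j)) \<le> (\<Sum>j. ennreal (tail q a c x * (1/2) ^ j))"
      by (intro suminf_le ennreal_leI) auto
    also have "\<dots> = ennreal (tail q a c x * 2)"
    proof (rule suminf_ennreal_eq)
      have "(\<lambda>j. tail q a c x * (1/2) ^ j) sums (tail q a c x * (1 / (1 - 1/2)))"
        by (intro sums_mult geometric_sums) simp
      then show "(\<lambda>j. tail q a c x * (1/2) ^ j) sums (tail q a c x * 2)" by simp
    qed simp
    also have "\<dots> \<le> ennreal (8 * tail q a c x)" by (intro ennreal_leI) auto
    finally show ?thesis .
  next
    case False
    then obtain J where J: "2 ^ J \<le> \<rho>" "\<rho> < 2 ^ Suc J" using dyadic_scale[of \<rho>] by auto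
    have "?t j \<le> (if J \<le> Suc j then 4 * (1/2) ^ (Suc j - J) else 0)" for j
    proof (cases "\<rho> / 2 ^ j < 4")
      case False
      have "?t j \<le> 0" using t[of j] False by simp
      also have "0 \<le> (if J \<le> Suc j then 4 * (1/2) ^ (Suc j - J) else (0::real))" by simp
      finally show ?thesis .
    next
      case lt4: True
      have "(2::real) ^ J < 2 ^ (j + 2)"
        using J(1) lt4 by (simp add: divide_simps mult.commute)
      then have Jj: "J \<le> Suc j" by (subst (asm) power_strict_increasing_iff) auto
      have "?t j \<le> min 1 (\<rho> / 2 ^ j) powr q" using t[of j] lt4 by auto
      also have "\<dots> \<le> min 1 (\<rho> / 2 ^ j) powr 1" using \<rho> assms by (intro powr_mono') auto
      also have "\<dots> = min 1 (\<rho> / 2 ^ j)" using \<rho> by simp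
      also have "\<dots> \<le> 4 * (1/2) ^ (Suc j - J)"
      proof (cases "Suc j = J")
        case True then show ?thesis by simp
      next
        case False
        with Jj obtain i where i: "j = J + i" by (metis Suc_leI le_SucE less_eq_Suc_le le_neq_implies_less nat_le_iff_add not_less_eq_eq)
        have "\<rho> / 2 ^ j \<le> 2 ^ Suc J / 2 ^ j" using J(2) by (intro divide_right_mono) auto
        also have "\<dots> = 4 * (1/2) ^ (Suc j - J)" by (simp add: i power_add power_one_over Suc_diff_le)
        finally show ?thesis by linarith
      qed
      finally show ?thesis using Jj by simp
    qed
    then have "(\<Sum>j. ennreal (?t j)) \<le> (\<Sum>j. ennreal (if J \<le> Suc j then 4 * (1/2) ^ (Suc j - J) else 0))"
      by (intro suminf_le ennreal_leI) auto
    also have "\<dots> \<le> ennreal 8" by (rule shifted_geometric_sum_le)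
    also have "\<dots> = ennreal (8 * tail q a c x)" using False T by (simp add: min_def)
    finally show ?thesis .
  qed
  then show ?thesis by (simp add: L_def)
qed

text \<open>The form in which the weight condition is used. The intervals in the hypothesis are the
  Whitney intervals of \<open>(a, c)\<close> relative to \<open>c\<close>, each as long as its distance to \<open>c\<close>. A set of
  density \<open>\<eta>\<close> in every one of them has weight at most \<open>D \<eta>^e\<close> times the integral of the tail of
  \<open>(a, c)\<close>.\<close>

definition whitney_bound :: "real measure \<Rightarrow> real \<Rightarrow> real \<Rightarrow> real \<Rightarrow> bool" where
  "whitney_bound W q e D \<longleftrightarrow> (\<forall>a c E \<eta>. a < c \<and> 0 \<le> \<eta> \<and> E \<in> sets lebesgue \<and> E \<subseteq> {a<..<c} \<and>
     (\<forall>j. emeasure lebesgue (E \<inter> {c - (c - a) / 2 ^ j<..<c - (c - a) / 2 ^ Suc j}) \<le> ennreal (\<eta> * ((c - a) / 2 ^ Suc j))) \<longrightarrow>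
     emeasure W E \<le> ennreal (D * \<eta> powr e) * (\<integral>\<^sup>+x. ennreal (tail q a c x) \<partial>W))"

text \<open>The condition \<open>C_plus\<close> compares a set on the left of a point \<open>b\<close> with the length of an
  interval on the right of \<open>b\<close> which has to be shorter than the left one. It is applied to the
  Whitney interval on the left and half of the interval between it and \<open>c\<close> on the right, whence
  the constant \<open>2 \<eta>\<close>; the enlarged intervals have summable tails by \<open>whitney_tails_sum_le\<close>.\<close>

lemma C_plus_imp_whitney_bound:
  assumes w: "w \<in> C_plus q" and q: "1 \<le> q"
  shows "\<exists>e>0. \<exists>D>0. whitney_bound (density lebesgue (\<lambda>x. ennreal (w x))) q e D"
proof -
  let ?W = "density lebesgue (\<lambda>x. ennreal (w x))"
  let ?T = "\<lambda>a c. \<integral>\<^sup>+x. ennreal (tail q a c x) \<partial>?W"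
  have wm [measurable]: "w \<in> borel_measurable lebesgue"
    using w unfolding C_plus_def weight_def by (auto intro: loc_integrable_measurable)
  have "\<exists>e > 0. \<exists>C > 0. \<forall>a b c. a < b \<and> b < c \<and> c - b < b - a \<longrightarrow>
       (\<forall>E \<in> sets lebesgue. E \<subseteq> {a<..<b} \<longrightarrow>
         (\<integral>\<^sup>+x\<in>E. ennreal (w x) \<partial>lebesgue)
           \<le> ennreal (C * (measure lebesgue E / (c - b)) powr e)
              * (\<integral>\<^sup>+x. (M_plus (indicat_real {a<..<c}) x epowr q) * ennreal (w x) \<partial>lebesgue))"
    using w unfolding C_plus_def by simp
  then obtain e C where e: "0 < e" and C: "0 < C" and
    ex: "\<forall>a b c. a < b \<and> b < c \<and> c - b < b - a \<longrightarrow>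
       (\<forall>E \<in> sets lebesgue. E \<subseteq> {a<..<b} \<longrightarrow>
         (\<integral>\<^sup>+x\<in>E. ennreal (w x) \<partial>lebesgue)
           \<le> ennreal (C * (measure lebesgue E / (c - b)) powr e)
              * (\<integral>\<^sup>+x. (M_plus (indicat_real {a<..<c}) x epowr q) * ennreal (w x) \<partial>lebesgue))"
    by (elim exE conjE) (rule that)
  have *: "(\<integral>\<^sup>+x\<in>E. ennreal (w x) \<partial>lebesgue)
           \<le> ennreal (C * (measure lebesgue E / (c - b)) powr e)
              * (\<integral>\<^sup>+x. (M_plus (indicat_real {a<..<c}) x epowr q) * ennreal (w x) \<partial>lebesgue)"
    if "a < b" "b < c" "c - b < b - a" "E \<in> sets lebesgue" "E \<subseteq> {a<..<b}" for a b c E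
    by (rule ex[rule_format]) (use that in auto)
  have tm: "(\<lambda>x. ennreal (tail q a c x)) \<in> borel_measurable lebesgue" for a c by measurable
  have **: "emeasure ?W E \<le> ennreal (C * (measure lebesgue E / (c - b)) powr e) * ?T a c"
    if h: "a < b" "b < c" "c - b < b - a" "E \<in> sets lebesgue" "E \<subseteq> {a<..<b}" for a b c E
  proof -
    have "emeasure ?W E = (\<integral>\<^sup>+x\<in>E. ennreal (w x) \<partial>lebesgue)"
      using h by (intro emeasure_density) auto
    also note *[OF h]
    also have "(\<integral>\<^sup>+x. (M_plus (indicat_real {a<..<c}) x epowr q) * ennreal (w x) \<partial>lebesgue)
        \<le> (\<integral>\<^sup>+x. ennreal (w x) * ennreal (tail q a c x) \<partial>lebesgue)"
      using h q by (intro nn_integral_mono) (auto simp: mult.commute intro!: mult_left_mono M_plus_indicator_le)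
    also have "\<dots> = ?T a c"
      by (rule nn_integral_density[symmetric]) (use tm in auto)
    finally show ?thesis by (simp add: mult_left_mono)
  qed
  have "whitney_bound ?W q e (8 * C * 2 powr e)"
    unfolding whitney_bound_def
  proof (intro allI impI, elim conjE)
    fix a c E \<eta> assume ac: "a < c" and \<eta>: "(0::real) \<le> \<eta>" and E [measurable]: "E \<in> sets lebesgue" and sub: "E \<subseteq> {a<..<c}"
      and dens: "\<forall>j. emeasure lebesgue (E \<inter> {c - (c - a) / 2 ^ j<..<c - (c - a) / 2 ^ Suc j}) \<le> ennreal (\<eta> * ((c - a) / 2 ^ Suc j))"
    define L where "L = c - a"
    define P where "P j = {c - L / 2 ^ j<..<c - L / 2 ^ Suc j}" for j
    \<comment> \<open>The endpoints of the Whitney intervals, a countable set left out by the open intervals.\<close>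
    define N where "N = range (\<lambda>j::nat. c - L / 2 ^ j)"
    have L: "0 < L" using ac by (simp add: L_def)
    have N: "N \<in> null_sets lebesgue"
      unfolding N_def by (intro null_sets_completionI countable_imp_null_set_lborel) auto
    then have NW: "N \<in> null_sets ?W"
      using AE_not_in[OF N] by (auto simp: null_sets_density_iff elim: eventually_mono)
    have cov: "E \<subseteq> (\<Union>j. E \<inter> P j) \<union> N"
    proof
      fix x assume x: "x \<in> E"
      then have xx: "a < x" "x < c" using sub by auto
      then have "1 \<le> L / (c - x)" by (simp add: L_def)
      then obtain j where j: "2 ^ j \<le> L / (c - x)" "L / (c - x) < 2 ^ Suc j" using dyadic_scale by auto
      have "2 ^ j * (c - x) \<le> L" "L < 2 ^ Suc j * (c - x)"
        using j xx by (auto simp: divide_simps mult.commute)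
      then have "c - x \<le> L / 2 ^ j" "L / 2 ^ Suc j < c - x" by (auto simp: divide_simps mult.commute)
      then have "x = c - L / 2 ^ j \<or> x \<in> P j" unfolding P_def greaterThanLessThan_iff by linarith
      then show "x \<in> (\<Union>j. E \<inter> P j) \<union> N" using x by (auto simp: N_def)
    qed
    have "emeasure ?W E \<le> emeasure ?W ((\<Union>j. E \<inter> P j) \<union> N)"
    proof (rule emeasure_mono[OF cov])
      have "(\<Union>j. E \<inter> P j) \<in> sets lebesgue"
        by (intro sets.countable_UN) (auto simp: P_def)
      then show "(\<Union>j. E \<inter> P j) \<union> N \<in> sets ?W"
        using null_setsD2[OF N] by (simp only: sets_density sets.Un)
    qed
    also have "\<dots> = emeasure ?W (\<Union>j. E \<inter> P j)"
      using NW by (intro emeasure_Un_null_set) (auto simp: P_def)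
    also have "\<dots> \<le> (\<Sum>j. emeasure ?W (E \<inter> P j))"
      by (intro emeasure_subadditive_countably) (auto simp: P_def)
    also have "\<dots> \<le> (\<Sum>j. ennreal (C * (2 * \<eta>) powr e) * ?T (c - L / 2 ^ j) (c - L / 2 ^ (j + 2)))"
    proof (rule suminf_le)
      fix j
      have lt: "L / 2 ^ (j + 2) < L / 2 ^ Suc j" "L / 2 ^ Suc j < L / 2 ^ j"
        using L by (auto simp: divide_simps)
      have eq: "c - L / 2 ^ (j + 2) - (c - L / 2 ^ Suc j) = L / 2 ^ (j + 2)"
        by (simp add: field_simps)
      have eq2: "c - L / 2 ^ Suc j - (c - L / 2 ^ j) = L / 2 ^ Suc j"
        by (simp add: field_simps)
      have "emeasure ?W (E \<inter> P j) \<le> ennreal (C * (measure lebesgue (E \<inter> P j) / (c - L / 2 ^ (j + 2) - (c - L / 2 ^ Suc j))) powr e)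
          * ?T (c - L / 2 ^ j) (c - L / 2 ^ (j + 2))"
        by (rule **) (use lt in \<open>auto simp: P_def eq eq2\<close>)
      also have "\<dots> \<le> ennreal (C * (2 * \<eta>) powr e) * ?T (c - L / 2 ^ j) (c - L / 2 ^ (j + 2))"
      proof (intro mult_right_mono ennreal_leI mult_left_mono powr_mono2)
        have "measure lebesgue (E \<inter> P j) \<le> \<eta> * (L / 2 ^ Suc j)"
          unfolding measure_def using dens \<eta> L by (intro enn2real_leI) (auto simp: P_def L_def)
        then have "measure lebesgue (E \<inter> P j) / (L / 2 ^ (j + 2)) \<le> \<eta> * (L / 2 ^ Suc j) / (L / 2 ^ (j + 2))"
          by (rule divide_right_mono) (use L in simp)
        also have "\<dots> = 2 * \<eta>" using L by simp
        finally show "measure lebesgue (E \<inter> P j) / (c - L / 2 ^ (j + 2) - (c - L / 2 ^ Suc j)) \<le> 2 * \<eta>" unfolding eq .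
        show "0 \<le> measure lebesgue (E \<inter> P j) / (c - L / 2 ^ (j + 2) - (c - L / 2 ^ Suc j))"
          unfolding eq using L by simp
      qed (use e C in auto)
      finally show "emeasure ?W (E \<inter> P j) \<le> ennreal (C * (2 * \<eta>) powr e) * ?T (c - L / 2 ^ j) (c - L / 2 ^ (j + 2))" .
    qed auto
    also have "\<dots> = ennreal (C * (2 * \<eta>) powr e) * (\<Sum>j. ?T (c - L / 2 ^ j) (c - L / 2 ^ (j + 2)))"
      by (rule ennreal_suminf_cmult)
    also have "(\<Sum>j. ?T (c - L / 2 ^ j) (c - L / 2 ^ (j + 2))) = (\<integral>\<^sup>+x. (\<Sum>j. ennreal (tail q (c - L / 2 ^ j) (c - L / 2 ^ (j + 2)) x)) \<partial>?W)"
    proof (subst nn_integral_suminf)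
      show "(\<lambda>x. ennreal (tail q (c - L / 2 ^ i) (c - L / 2 ^ (i + 2)) x)) \<in> borel_measurable ?W" for i
        using tm by simp
    qed (rule refl)
    also have "\<dots> \<le> (\<integral>\<^sup>+x. ennreal 8 * ennreal (tail q a c x) \<partial>?W)"
    proof (rule nn_integral_mono)
      fix x
      have "ennreal 8 * ennreal (tail q a c x) = ennreal (8 * tail q a c x)"
        by (rule ennreal_mult[symmetric]) auto
      then show "(\<Sum>j. ennreal (tail q (c - L / 2 ^ j) (c - L / 2 ^ (j + 2)) x)) \<le> ennreal 8 * ennreal (tail q a c x)"
        using whitney_tails_sum_le[OF ac q, of x] unfolding L_def by (simp only:)
    qed
    also have "\<dots> = ennreal 8 * ?T a c"
      by (rule nn_integral_cmult) (use tm in simp)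
    finally have "emeasure ?W E \<le> ennreal (C * (2 * \<eta>) powr e) * (ennreal 8 * ?T a c)"
      by (simp add: mult_left_mono)
    also have "\<dots> = (ennreal (C * (2 * \<eta>) powr e) * ennreal 8) * ?T a c" by (simp only: mult.assoc)
    also have "ennreal (C * (2 * \<eta>) powr e) * ennreal 8 = ennreal (8 * C * 2 powr e * \<eta> powr e)"
      using C \<eta> by (subst ennreal_mult[symmetric]) (auto simp: powr_mult mult_ac)
    finally show "emeasure ?W E \<le> ennreal (8 * C * 2 powr e * \<eta> powr e) * ?T a c" .
  qed
  then show ?thesis using e C by (intro exI[of _ e] conjI exI[of _ "8 * C * 2 powr e"]) auto
qed

section \<open>Sums of tails of disjoint intervals\<close>

definition interval_family :: "(real \<times> real) set \<Rightarrow> bool" where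
  "interval_family \<U> \<longleftrightarrow> countable \<U> \<and> (\<forall>U\<in>\<U>. fst U < snd U) \<and>
     disjoint_family_on (\<lambda>U. {fst U<..<snd U}) \<U>"

text \<open>The integral against the counting measure keeps the sum meaningful for every family of
  intervals and lets it be interchanged with integrals by Tonelli's theorem.\<close>

definition tails :: "real \<Rightarrow> (real \<times> real) set \<Rightarrow> real \<Rightarrow> ennreal" where
  "tails q \<U> x = (\<integral>\<^sup>+U. ennreal (tail q (fst U) (snd U) x) \<partial>count_space \<U>)"

lemma interval_family_subset: "interval_family \<U> \<Longrightarrow> \<V> \<subseteq> \<U> \<Longrightarrow> interval_family \<V>"
  unfolding interval_family_def by (auto intro: countable_subset disjoint_family_on_mono)

lemma nn_integral_tails:
  assumes "interval_family \<U>" and s: "sets M = sets lebesgue" and [measurable]: "g \<in> borel_measurable M"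
  shows "(\<integral>\<^sup>+x. tails q \<U> x * g x \<partial>M) = (\<integral>\<^sup>+U. (\<integral>\<^sup>+x. ennreal (tail q (fst U) (snd U) x) * g x \<partial>M) \<partial>count_space \<U>)"
proof -
  have tm [measurable]: "tail q a c \<in> borel_measurable M" for a c
    using tail_measurable_lebesgue measurable_cong_sets[OF s refl] by blast
  have "(\<integral>\<^sup>+x. tails q \<U> x * g x \<partial>M) = (\<integral>\<^sup>+x. (\<integral>\<^sup>+U. ennreal (tail q (fst U) (snd U) x) * g x \<partial>count_space \<U>) \<partial>M)"
    unfolding tails_def by (intro nn_integral_cong nn_integral_multc[symmetric]) simp
  also have "\<dots> = (\<integral>\<^sup>+U. (\<integral>\<^sup>+x. ennreal (tail q (fst U) (snd U) x) * g x \<partial>M) \<partial>count_space \<U>)"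
    by (rule nn_integral_count_space_nn_integral) (use assms in \<open>auto simp: interval_family_def\<close>)
  finally show ?thesis .
qed

lemma tails_measurable:
  assumes "interval_family \<U>"
  shows "tails q \<U> \<in> borel_measurable lebesgue"
  unfolding tails_def[abs_def]
proof (rule sigma_finite_measure.borel_measurable_nn_integral[OF sigma_finite_measure_count_space_countable])
  show c: "countable \<U>" using assms by (simp add: interval_family_def)
  show "(\<lambda>(x, U). ennreal (tail q (fst U) (snd U) x)) \<in> borel_measurable (lebesgue \<Otimes>\<^sub>M count_space \<U>)"
    unfolding case_prod_beta
    by (rule measurable_compose_countable'[where f = "\<lambda>U z. ennreal (tail q (fst U) (snd U) (fst z))" and g = snd, OF _ _ c])
      (simp_all add: measurable_compose[OF measurable_fst])
qed

lemma tail_le_dyadic_sum: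
  assumes "a < c" "0 < q"
  shows "ennreal (tail q a c x) \<le> (\<Sum>j. ennreal ((1 / 2 powr q) ^ j) * indicator {c - 2 ^ Suc j * (c - a)<..<c} x)"
proof (cases "x < c")
  case False then show ?thesis by (simp add: tail_def)
next
  case xc: True
  define L where "L = c - a"
  have L: "0 < L" using assms by (simp add: L_def)
  have "\<exists>j. ennreal (tail q a c x) \<le> ennreal ((1 / 2 powr q) ^ j) * indicator {c - 2 ^ Suc j * L<..<c} x"
  proof (cases "c - x < L")
    case True
    then have "x \<in> {c - 2 ^ Suc 0 * L<..<c}" using xc L by auto
    then show ?thesis using tail_le_1[of a c q x] assms by (intro exI[of _ 0]) auto
  next
    case False
    then have "1 \<le> (c - x) / L" using L by simp
    then obtain j where j: "2 ^ j \<le> (c - x) / L" "(c - x) / L < 2 ^ Suc j" using dyadic_scale by auto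
    then have j': "2 ^ j * L \<le> c - x" "c - x < 2 ^ Suc j * L" using L by (auto simp: field_simps)
    have "x \<in> {c - 2 ^ Suc j * L<..<c}" unfolding greaterThanLessThan_iff using j'(2) xc by linarith
    moreover have "tail q a c x \<le> (1 / 2 powr q) ^ j"
    proof -
      have "tail q a c x \<le> (L / (c - x)) powr q"
        using xc L assms by (auto simp: tail_def L_def intro!: powr_mono2)
      also have "L / (c - x) \<le> 1 / 2 ^ j" using j'(1) xc by (simp add: field_simps)
      then have "(L / (c - x)) powr q \<le> (1 / 2 ^ j) powr q" using xc L assms by (intro powr_mono2) auto
      also have "\<dots> = (1 / 2 powr q) ^ j"
        by (simp add: powr_divide power_divide powr_powr mult.commute flip: powr_realpow)
      finally show ?thesis .
    qed
    ultimately show ?thesis by (intro exI[of _ j]) (auto intro!: ennreal_leI)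
  qed
  then obtain j where "ennreal (tail q a c x) \<le> ennreal ((1 / 2 powr q) ^ j) * indicator {c - 2 ^ Suc j * L<..<c} x" by blast
  also have "\<dots> \<le> (\<Sum>j. ennreal ((1 / 2 powr q) ^ j) * indicator {c - 2 ^ Suc j * L<..<c} x)"
    (is "?F j \<le> _")
  proof -
    have "?F j = sum ?F {j}" by (simp only: sum.insert finite.emptyI empty_iff not_False_eq_True sum.empty add_0_right)
    also have "\<dots> \<le> suminf ?F" by (rule sum_le_suminf) auto
    finally show ?thesis .
  qed
  finally show ?thesis by (simp add: L_def)
qed

text \<open>The sum of the geometric series in \<open>nn_integral_tail_le_density\<close>; it converges because
  \<open>q > 1\<close>.\<close>

definition dual_const :: "real \<Rightarrow> real" where
  "dual_const q = 2 / (1 - 2 / 2 powr q)"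

lemma dual_const_bounds: assumes "1 < q" shows "2 / 2 powr q < 1" "2 < dual_const q"
proof -
  have "(2::real) powr 1 < 2 powr q" using assms by (intro powr_less_mono) auto
  then show *: "2 / 2 powr q < 1" by simp
  have "0 < 2 / 2 powr q" by simp
  then show "2 < dual_const q" using * unfolding dual_const_def by (simp add: less_divide_eq)
qed

text \<open>If \<open>E\<close> has density at most \<open>\<delta>\<close> in all intervals around some point \<open>y\<close> of \<open>(a, c)\<close> whose radius
  is at least \<open>c - a\<close>, then the layers of the tail, of width \<open>2^(j + 1) (c - a)\<close> and height
  \<open>2^(-j q)\<close>, contribute a geometric series.\<close>

lemma nn_integral_tail_le_density:
  assumes ac: "a < c" and q: "1 < q" and E [measurable]: "E \<in> sets lebesgue" and y: "a < y" "y < c" and \<delta>: "0 \<le> \<delta>"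
    and dens: "\<And>h. c - a \<le> h \<Longrightarrow> emeasure lebesgue (E \<inter> {y - h<..<y + h}) \<le> ennreal (\<delta> * h)"
  shows "(\<integral>\<^sup>+x\<in>E. ennreal (tail q a c x) \<partial>lebesgue) \<le> ennreal (dual_const q * \<delta> * (c - a))"
proof -
  define L where "L = c - a"
  have L: "0 < L" using ac by (simp add: L_def)
  define r where "r = 2 / 2 powr q"
  have r: "0 < r" "r < 1" using dual_const_bounds[OF q] by (auto simp: r_def)
  have "(\<integral>\<^sup>+x\<in>E. ennreal (tail q a c x) \<partial>lebesgue)
     \<le> (\<integral>\<^sup>+x. (\<Sum>j. ennreal ((1 / 2 powr q) ^ j) * indicator (E \<inter> {c - 2 ^ Suc j * L<..<c}) x) \<partial>lebesgue)"
  proof (rule nn_integral_mono)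
    fix x
    show "ennreal (tail q a c x) * indicator E x \<le> (\<Sum>j. ennreal ((1 / 2 powr q) ^ j) * indicator (E \<inter> {c - 2 ^ Suc j * L<..<c}) x)"
      using tail_le_dyadic_sum[of a c q x] ac q by (cases "x \<in> E") (auto simp: L_def indicator_def)
  qed
  also have "\<dots> = (\<Sum>j. \<integral>\<^sup>+x. ennreal ((1 / 2 powr q) ^ j) * indicator (E \<inter> {c - 2 ^ Suc j * L<..<c}) x \<partial>lebesgue)"
  proof (rule nn_integral_suminf)
    have "E \<inter> {c - 2 ^ Suc j * L<..<c} \<in> sets lebesgue" for j by (rule sets.Int[OF E]) simp
    then show "(\<lambda>x. ennreal ((1 / 2 powr q) ^ j) * indicator (E \<inter> {c - 2 ^ Suc j * L<..<c}) x) \<in> borel_measurable lebesgue" for j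
      by (intro borel_measurable_times_ennreal borel_measurable_indicator borel_measurable_const)
  qed
  also have "\<dots> \<le> (\<Sum>j. ennreal (2 * \<delta> * L * r ^ j))"
  proof (rule suminf_le)
    fix j
    have "(1::real) \<le> 2 ^ Suc j" by (rule one_le_power) simp
    then have "1 * L \<le> 2 ^ Suc j * L" by (rule mult_right_mono) (use L in simp)
    then have h: "c - a \<le> 2 ^ Suc j * L" by (simp add: L_def)
    have "{c - 2 ^ Suc j * L<..<c} \<subseteq> {y - 2 ^ Suc j * L<..<y + 2 ^ Suc j * L}"
      using y h by auto
    then have "emeasure lebesgue (E \<inter> {c - 2 ^ Suc j * L<..<c}) \<le> emeasure lebesgue (E \<inter> {y - 2 ^ Suc j * L<..<y + 2 ^ Suc j * L})"
      by (intro emeasure_mono) auto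
    also note dens[OF h]
    finally have "ennreal ((1 / 2 powr q) ^ j) * emeasure lebesgue (E \<inter> {c - 2 ^ Suc j * L<..<c})
        \<le> ennreal ((1 / 2 powr q) ^ j) * ennreal (\<delta> * (2 ^ Suc j * L))" by (rule mult_left_mono) simp
    also have "\<dots> = ennreal ((1 / 2 powr q) ^ j * (\<delta> * (2 ^ Suc j * L)))"
      using \<delta> L by (intro ennreal_mult[symmetric]) auto
    also have "(1 / 2 powr q) ^ j * (\<delta> * (2 ^ Suc j * L)) = 2 * \<delta> * L * r ^ j"
      by (simp add: r_def power_divide)
    finally show "(\<integral>\<^sup>+x. ennreal ((1 / 2 powr q) ^ j) * indicator (E \<inter> {c - 2 ^ Suc j * L<..<c}) x \<partial>lebesgue)
        \<le> ennreal (2 * \<delta> * L * r ^ j)" by (subst nn_integral_cmult_indicator) (use E in auto)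
  qed auto
  also have "\<dots> = ennreal (2 * \<delta> * L * (1 / (1 - r)))"
  proof (rule suminf_ennreal_eq)
    show "(\<lambda>j. 2 * \<delta> * L * r ^ j) sums (2 * \<delta> * L * (1 / (1 - r)))"
      by (intro sums_mult geometric_sums) (use r in auto)
  qed (use \<delta> L r in auto)
  also have "2 * \<delta> * L * (1 / (1 - r)) = dual_const q * \<delta> * (c - a)"
    by (simp add: dual_const_def r_def L_def)
  finally show ?thesis .
qed

lemma open_density_set:
  fixes s :: real
  assumes "E \<in> sets lebesgue" "0 < s"
  shows "open {y. \<exists>h>0. ennreal (h * s) < emeasure lebesgue (E \<inter> {y - h<..<y + h})}"
  unfolding open_dist
proof clarify
  fix y h :: real assume h: "0 < h" and lt: "ennreal (h * s) < emeasure lebesgue (E \<inter> {y - h<..<y + h})"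
  have fin: "emeasure lebesgue (E \<inter> {y - h<..<y + h}) < top"
  proof -
    have "emeasure lebesgue (E \<inter> {y - h<..<y + h}) \<le> emeasure lebesgue {y - h<..<y + h}" by (rule emeasure_mono) auto
    also have "\<dots> < top" using h by simp
    finally show ?thesis .
  qed
  define m where "m = measure lebesgue (E \<inter> {y - h<..<y + h})"
  have em: "emeasure lebesgue (E \<inter> {y - h<..<y + h}) = ennreal m"
    unfolding m_def using fin by (intro emeasure_eq_ennreal_measure) auto
  have "h * s < m" using lt h assms unfolding em by (simp add: ennreal_less_iff)
  define h' where "h' = (h + m / s) / 2"
  have h': "h < h'" "h' * s < m" using \<open>h * s < m\<close> assms by (auto simp: h'_def field_simps)
  show "\<exists>e>0. \<forall>y'. dist y' y < e \<longrightarrow> y' \<in> {y. \<exists>h>0. ennreal (h * s) < emeasure lebesgue (E \<inter> {y - h<..<y + h})}"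
  proof (intro exI[of _ "h' - h"] conjI allI impI)
    show "0 < h' - h" using h' by simp
    fix y' assume d: "dist y' y < h' - h"
    have "{y - h<..<y + h} \<subseteq> {y' - h'<..<y' + h'}" using d by (auto simp: dist_real_def)
    then have "ennreal m \<le> emeasure lebesgue (E \<inter> {y' - h'<..<y' + h'})"
      unfolding em[symmetric] using assms by (intro emeasure_mono) auto
    moreover have "ennreal (h' * s) < ennreal m" using h' h assms by (intro ennreal_lessI) (auto intro: le_less_trans[of 0 "h' * s"])
    ultimately show "y' \<in> {y. \<exists>h>0. ennreal (h * s) < emeasure lebesgue (E \<inter> {y - h<..<y + h})}"
      using h h' by (auto intro!: exI[of _ h'])
  qed
qed

text \<open>Exponential decay by duality. Let \<open>E\<close> be the set where the sum exceeds \<open>\<Lambda>\<close>, so that \<open>\<Lambda> \<bar>E\<bar>\<close> is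
  at most the sum of the integrals over \<open>E\<close> of the single tails. By
  \<open>nn_integral_tail_le_density\<close> such an integral is, up to constants, at most the length of the
  interval times the least value that the maximal function of the indicator of \<open>E\<close> takes on it.
  With \<open>A = dual_const q\<close>, the values \<open>2^(-l)\<close> for \<open>l \<le> n\<close> contribute at most \<open>20 A \<bar>E\<bar>\<close> each,
  by the weak type estimate and the disjointness of the intervals, and the smaller values
  contribute at most \<open>A (c - u) / 2^n\<close> in all. If \<open>\<Lambda>\<close> is twice what the first \<open>n + 1\<close> levels
  need, the second contribution bounds \<open>\<bar>E\<bar>\<close>.\<close>

lemma disjoint_tails_distribution:
  assumes \<U>: "interval_family \<U>" and q: "1 < q" and uc: "u < c"
    and sub: "\<And>U. U \<in> \<U> \<Longrightarrow> u \<le> fst U \<and> snd U \<le> c"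
  shows "emeasure lebesgue {x \<in> {u<..<c}. ennreal (40 * dual_const q * (real n + 1)) < tails q \<U> x} \<le> ennreal ((c - u) / 2 ^ n)"
proof -
  define L where "L = c - u"
  define A where "A = dual_const q"
  define \<Lambda> where "\<Lambda> = 40 * A * (real n + 1)"
  define E where "E = {x \<in> {u<..<c}. ennreal \<Lambda> < tails q \<U> x}"
  \<comment> \<open>\<open>M l\<close> is the set where the maximal function of the indicator of \<open>E\<close> exceeds \<open>2^(-l)\<close>.\<close>
  define M where "M l = {y \<in> {u<..<c}. \<exists>h>0. ennreal (h * (1 / 2 ^ l)) < emeasure lebesgue (E \<inter> {y - h<..<y + h})}" for l :: nat
  have L: "0 < L" using uc by (simp add: L_def)
  have A: "2 < A" using dual_const_bounds[OF q] by (simp add: A_def)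
  have tm [measurable]: "tails q \<U> \<in> borel_measurable lebesgue" by (rule tails_measurable[OF \<U>])
  have E: "E \<in> sets lebesgue"
  proof -
    have "E = {u<..<c} \<inter> (tails q \<U> -` {ennreal \<Lambda><..} \<inter> space lebesgue)" by (auto simp: E_def)
    also have "\<dots> \<in> sets lebesgue" by (intro sets.Int measurable_sets[OF tm]) auto
    finally show ?thesis .
  qed
  have Efin: "emeasure lebesgue E \<le> ennreal L"
  proof -
    have "emeasure lebesgue E \<le> emeasure lebesgue {u<..<c}" by (rule emeasure_mono) (auto simp: E_def)
    then show ?thesis using uc by (simp add: L_def)
  qed
  define m where "m = measure lebesgue E"
  have m0: "0 \<le> m" by (simp add: m_def)
  have em: "emeasure lebesgue E = ennreal m"
    unfolding m_def using Efin by (intro emeasure_eq_ennreal_measure) (auto simp: top_unique)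
  have M: "M l \<in> sets lebesgue" for l
  proof -
    have "M l = {u<..<c} \<inter> {y. \<exists>h>0. ennreal (h * (1 / 2 ^ l)) < emeasure lebesgue (E \<inter> {y - h<..<y + h})}"
      by (auto simp: M_def)
    moreover have "open \<dots>" by (intro open_Int open_density_set E) auto
    ultimately show ?thesis using borel_open lborelD by (metis sets_completionI_sets sets_lborel)
  qed
  have Mm: "emeasure lebesgue (M l) \<le> ennreal (10 * 2 ^ l * m)" for l
  proof -
    have "emeasure lebesgue (M l) \<le> 10 * (\<integral>\<^sup>+y. ennreal (2 ^ l) * indicator E y \<partial>lebesgue)"
    proof (rule vitali_weak_type[where B = "2 ^ l * L"])
      show "(\<lambda>y. ennreal (2 ^ l) * indicator E y) \<in> borel_measurable lebesgue"
        by (intro borel_measurable_times_ennreal borel_measurable_indicator borel_measurable_const E)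
      show "M l \<in> sets lebesgue" by (rule M)
      fix x assume "x \<in> M l"
      then obtain h where h: "0 < h" and lt: "ennreal (h * (1 / 2 ^ l)) < emeasure lebesgue (E \<inter> {x - h<..<x + h})"
        by (auto simp: M_def)
      have "ennreal h = ennreal (2 ^ l) * ennreal (h * (1 / 2 ^ l))"
        using h by (simp flip: ennreal_mult)
      also have "\<dots> \<le> ennreal (2 ^ l) * emeasure lebesgue (E \<inter> {x - h<..<x + h})"
        using lt by (intro mult_left_mono) auto
      also have "\<dots> = (\<integral>\<^sup>+y. ennreal (2 ^ l) * indicator (E \<inter> {x - h<..<x + h}) y \<partial>lebesgue)"
        by (rule nn_integral_cmult_indicator[symmetric]) (rule sets.Int[OF E], simp)
      also have "\<dots> = (\<integral>\<^sup>+y\<in>{x - h<..<x + h}. ennreal (2 ^ l) * indicator E y \<partial>lebesgue)"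
        by (rule nn_integral_cong) (auto simp: indicator_def)
      finally have 1: "ennreal h \<le> (\<integral>\<^sup>+y\<in>{x - h<..<x + h}. ennreal (2 ^ l) * indicator E y \<partial>lebesgue)" .
      have "ennreal (h * (1 / 2 ^ l)) < emeasure lebesgue E"
        using lt by (rule less_le_trans) (rule emeasure_mono, use E in auto)
      also note Efin
      finally have "h * (1 / 2 ^ l) < L" using h by (simp add: ennreal_less_iff)
      then have 2: "h \<le> 2 ^ l * L" by (simp add: field_simps)
      show "\<exists>r>0. r \<le> 2 ^ l * L \<and> ennreal r \<le> (\<integral>\<^sup>+y\<in>{x - r<..<x + r}. ennreal (2 ^ l) * indicator E y \<partial>lebesgue)"
        using 1 2 h by blast
    qed
    also have "(\<integral>\<^sup>+y. ennreal (2 ^ l) * indicator E y \<partial>lebesgue) = ennreal (2 ^ l) * ennreal m"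
      using E by (simp add: nn_integral_cmult_indicator em)
    also have "10 * (ennreal (2 ^ l) * ennreal m) = ennreal (10 * 2 ^ l * m)"
      using m0 by (simp add: ennreal_mult mult.assoc)
    finally show ?thesis .
  qed
  let ?I = "\<lambda>U. {fst U<..<snd U}"
  have single: "(\<integral>\<^sup>+x\<in>E. ennreal (tail q (fst U) (snd U) x) \<partial>lebesgue)
      \<le> ennreal (A / 2 ^ n) * emeasure lebesgue (?I U)
         + (\<Sum>l\<le>n. ennreal (A * 2 / 2 ^ l) * emeasure lebesgue (?I U \<inter> M l))" (is "?lhs \<le> ?rhs") if U: "U \<in> \<U>" for U
  proof -
    define len where "len = snd U - fst U"
    have lt: "fst U < snd U" using U \<U> by (auto simp: interval_family_def)
    have IU: "?I U \<subseteq> {u<..<c}" using sub[OF U] by auto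
    have eI: "emeasure lebesgue (?I U) = ennreal len" using lt by (simp add: len_def)
    have good: "?lhs \<le> ennreal (A * \<delta> * len)" if y: "y \<in> ?I U" and \<delta>: "0 \<le> \<delta>" and
      d: "\<And>h. 0 < h \<Longrightarrow> emeasure lebesgue (E \<inter> {y - h<..<y + h}) \<le> ennreal (\<delta> * h)" for y \<delta>
      unfolding A_def len_def
      by (rule nn_integral_tail_le_density[OF lt q E _ _ \<delta>, of y]) (use y lt d in auto)
    have dM: "emeasure lebesgue (E \<inter> {y - h<..<y + h}) \<le> ennreal (1 / 2 ^ l * h)" if "y \<in> ?I U" "y \<notin> M l" "0 < h" for y l h
    proof -
      have "y \<in> {u<..<c}" using that(1) IU by blast
      then have "\<not> ennreal (h * (1 / 2 ^ l)) < emeasure lebesgue (E \<inter> {y - h<..<y + h})"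
        using that(2,3) unfolding M_def by blast
      then show ?thesis by (simp only: not_less mult.commute)
    qed
    show ?thesis
    proof (cases "?I U \<subseteq> M n")
      case False
      then obtain y where y: "y \<in> ?I U" "y \<notin> M n" by blast
      have "?lhs \<le> ennreal (A * (1 / 2 ^ n) * len)" by (rule good[OF y(1)]) (use dM[OF y] in auto)
      also have "\<dots> = ennreal (A / 2 ^ n) * emeasure lebesgue (?I U)"
        unfolding eI using A lt by (subst ennreal_mult[symmetric]) (auto simp: len_def)
      also have "\<dots> \<le> ?rhs" by simp
      finally show ?thesis .
    next
      case True
      \<comment> \<open>The least \<open>l\<close> such that the maximal function exceeds \<open>2^(-l)\<close> on the whole interval.
        Some point of the interval then has density at most \<open>2 / 2^l\<close> at every scale; for
        \<open>l = 0\<close> this is trivial.\<close>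
      define l where "l = (LEAST l. ?I U \<subseteq> M l)"
      have lM: "?I U \<subseteq> M l" unfolding l_def by (rule LeastI[of _ n]) (rule True)
      have ln: "l \<le> n" unfolding l_def by (rule Least_le) (rule True)
      have "?lhs \<le> ennreal (A * (2 / 2 ^ l) * len)"
      proof (cases l)
        case 0
        obtain y where y: "y \<in> ?I U" using lt dense by (metis greaterThanLessThan_iff)
        show ?thesis unfolding 0
        proof (rule good[OF y])
          fix h :: real assume h: "0 < h"
          have "emeasure lebesgue (E \<inter> {y - h<..<y + h}) \<le> emeasure lebesgue {y - h<..<y + h}"
            by (rule emeasure_mono) auto
          then show "emeasure lebesgue (E \<inter> {y - h<..<y + h}) \<le> ennreal (2 / 2 ^ 0 * h)" using h by simp
        qed simp
      next
        case (Suc k)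
        have "\<not> ?I U \<subseteq> M k"
          using not_less_Least[of k "\<lambda>l. ?I U \<subseteq> M l"] Suc by (simp add: l_def)
        then obtain y where y: "y \<in> ?I U" "y \<notin> M k" by blast
        show ?thesis unfolding Suc
          by (rule good[OF y(1)]) (use dM[OF y] in auto)
      qed
      also have "\<dots> = ennreal (A * 2 / 2 ^ l) * emeasure lebesgue (?I U \<inter> M l)"
        using lM A lt unfolding Int_absorb2[OF lM] eI by (subst ennreal_mult[symmetric]) (auto simp: len_def)
      also have "\<dots> \<le> (\<Sum>l\<le>n. ennreal (A * 2 / 2 ^ l) * emeasure lebesgue (?I U \<inter> M l))"
        by (rule member_le_sum) (use ln in auto)
      also have "\<dots> \<le> ?rhs" by simp
      finally show ?thesis .
    qed
  qed
  have cU: "countable \<U>" and dU: "disjoint_family_on ?I \<U>" using \<U> by (auto simp: interval_family_def)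
  have s1: "(\<integral>\<^sup>+U. emeasure lebesgue (?I U) \<partial>count_space \<U>) \<le> ennreal L"
  proof -
    have "(\<integral>\<^sup>+U. emeasure lebesgue (?I U) \<partial>count_space \<U>) = (\<integral>\<^sup>+U. (\<integral>\<^sup>+x\<in>?I U. 1 \<partial>lebesgue) \<partial>count_space \<U>)"
      by (rule nn_integral_cong) simp
    also have "\<dots> \<le> (\<integral>\<^sup>+x\<in>{u<..<c}. 1 \<partial>lebesgue)"
      by (rule nn_integral_disjoint_le[OF cU _ dU]) (use sub in fastforce)+
    finally show ?thesis using uc by (simp add: L_def)
  qed
  have s2: "(\<integral>\<^sup>+U. emeasure lebesgue (?I U \<inter> M l) \<partial>count_space \<U>) \<le> ennreal (10 * 2 ^ l * m)" for l
  proof -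
    have "(\<integral>\<^sup>+U. emeasure lebesgue (?I U \<inter> M l) \<partial>count_space \<U>) = (\<integral>\<^sup>+U. (\<integral>\<^sup>+x\<in>?I U. indicator (M l) x \<partial>lebesgue) \<partial>count_space \<U>)"
    proof (rule nn_integral_cong)
      fix U
      have "emeasure lebesgue (?I U \<inter> M l) = (\<integral>\<^sup>+x. indicator (?I U \<inter> M l) x \<partial>lebesgue)"
        using M[of l] by (intro nn_integral_indicator[symmetric] sets.Int) auto
      also have "\<dots> = (\<integral>\<^sup>+x\<in>?I U. indicator (M l) x \<partial>lebesgue)"
        by (rule nn_integral_cong) (auto simp: indicator_def)
      finally show "emeasure lebesgue (?I U \<inter> M l) = (\<integral>\<^sup>+x\<in>?I U. indicator (M l) x \<partial>lebesgue)" .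
    qed
    also have "\<dots> \<le> (\<integral>\<^sup>+x\<in>UNIV. indicator (M l) x \<partial>lebesgue)"
      by (rule nn_integral_disjoint_le[OF cU _ dU]) (use M in auto)
    also have "\<dots> = emeasure lebesgue (M l)" using M by simp
    also note Mm
    finally show ?thesis .
  qed
  have "ennreal (\<Lambda> * m) = ennreal \<Lambda> * emeasure lebesgue E"
    using A m0 unfolding em by (intro ennreal_mult) (auto simp: \<Lambda>_def)
  also have "\<dots> = (\<integral>\<^sup>+x. ennreal \<Lambda> * indicator E x \<partial>lebesgue)"
    using E by (simp add: nn_integral_cmult_indicator)
  also have "\<dots> \<le> (\<integral>\<^sup>+x. tails q \<U> x * indicator E x \<partial>lebesgue)"
    by (rule nn_integral_mono) (auto simp: E_def indicator_def less_imp_le)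
  also have "\<dots> = (\<integral>\<^sup>+U. (\<integral>\<^sup>+x\<in>E. ennreal (tail q (fst U) (snd U) x) \<partial>lebesgue) \<partial>count_space \<U>)"
    by (rule nn_integral_tails[OF \<U> refl]) (intro borel_measurable_indicator E)
  also have "\<dots> \<le> (\<integral>\<^sup>+U. ennreal (A / 2 ^ n) * emeasure lebesgue (?I U)
         + (\<Sum>l\<le>n. ennreal (A * 2 / 2 ^ l) * emeasure lebesgue (?I U \<inter> M l)) \<partial>count_space \<U>)"
    by (rule nn_integral_mono) (use single in auto)
  also have "\<dots> = ennreal (A / 2 ^ n) * (\<integral>\<^sup>+U. emeasure lebesgue (?I U) \<partial>count_space \<U>)
         + (\<Sum>l\<le>n. ennreal (A * 2 / 2 ^ l) * (\<integral>\<^sup>+U. emeasure lebesgue (?I U \<inter> M l) \<partial>count_space \<U>))"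
    by (simp add: nn_integral_add nn_integral_sum nn_integral_cmult)
  also have "\<dots> \<le> ennreal (A / 2 ^ n) * ennreal L + (\<Sum>l\<le>n. ennreal (A * 2 / 2 ^ l) * ennreal (10 * 2 ^ l * m))"
    by (intro add_mono mult_left_mono sum_mono s1 s2) auto
  also have "\<dots> = ennreal (A * (L / 2 ^ n)) + (\<Sum>l\<le>n. ennreal (20 * A * m))"
  proof -
    have "ennreal (A / 2 ^ n) * ennreal L = ennreal (A * (L / 2 ^ n))"
      using A L by (subst ennreal_mult[symmetric]) auto
    moreover have "ennreal (A * 2 / 2 ^ l) * ennreal (10 * 2 ^ l * m) = ennreal (20 * A * m)" for l
      using A m0 by (subst ennreal_mult[symmetric]) auto
    ultimately show ?thesis by simp
  qed
  also have "\<dots> = ennreal (A * (L / 2 ^ n) + (real n + 1) * (20 * A * m))"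
  proof -
    have "(\<Sum>l\<le>n. ennreal (20 * A * m)) = ennreal ((real n + 1) * (20 * A * m))"
      using A m0 by (subst sum_ennreal) (auto simp: algebra_simps)
    then show ?thesis using A L m0 by (simp add: ennreal_plus)
  qed
  finally have "\<Lambda> * m \<le> A * (L / 2 ^ n) + (real n + 1) * (20 * A * m)"
    using A L m0 by (subst (asm) ennreal_le_iff) auto
  then have "A * (20 * (real n + 1) * m) \<le> A * (L / 2 ^ n)" by (simp add: \<Lambda>_def algebra_simps)
  moreover have "0 < A" using A by simp
  ultimately have "20 * (real n + 1) * m \<le> L / 2 ^ n" using mult_le_cancel_left_pos by blast
  moreover have "m \<le> 20 * (real n + 1) * m" using m0 mult_right_mono[of 1 "20 * (real n + 1)" m] by simp
  ultimately have "m \<le> L / 2 ^ n" by linarith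
  then have "emeasure lebesgue E \<le> ennreal (L / 2 ^ n)" by (simp add: em ennreal_leI)
  then show ?thesis by (simp add: E_def \<Lambda>_def A_def L_def)
qed

lemma ennreal_layer_bound:
  assumes "0 \<le> \<beta>" "0 < \<theta>"
  shows "(y::ennreal) \<le> ennreal \<beta> + (\<Sum>n. ennreal \<theta> * (if ennreal (\<beta> + real n * \<theta>) < y then 1 else 0))"
proof (cases "y = top")
  case True
  have "(\<Sum>n::nat. ennreal \<theta>) = top"
  proof (rule ccontr)
    assume "(\<Sum>n::nat. ennreal \<theta>) \<noteq> top"
    then obtain s where s: "(\<Sum>n::nat. ennreal \<theta>) = ennreal s" "0 \<le> s" by (cases "\<Sum>n::nat. ennreal \<theta>") auto
    obtain N :: nat where N: "s / \<theta> < real N" using reals_Archimedean2 by blast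
    have "ennreal (real N * \<theta>) = (\<Sum>n<N. ennreal \<theta>)"
      using assms by (simp add: ennreal_mult ennreal_of_nat_eq_real_of_nat)
    also have "\<dots> \<le> (\<Sum>n. ennreal \<theta>)" by (rule sum_le_suminf) auto
    finally have "real N * \<theta> \<le> s" using s by simp
    then show False using N assms by (simp add: field_simps)
  qed
  then show ?thesis using True by simp
next
  case False
  then obtain r where r: "y = ennreal r" "0 \<le> r" by (cases y) auto
  define N where "N = nat \<lceil>(r - \<beta>) / \<theta>\<rceil>"
  have "(r - \<beta>) / \<theta> \<le> real N" unfolding N_def by linarith
  then have rN: "r \<le> \<beta> + real N * \<theta>" using assms by (simp add: field_simps)
  have lt: "\<beta> + real n * \<theta> < r" if "n < N" for n
  proof -
    have "real n < (r - \<beta>) / \<theta>" using that unfolding N_def by linarith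
    then show ?thesis using assms by (simp add: field_simps)
  qed
  have "y \<le> ennreal (\<beta> + real N * \<theta>)" unfolding r using rN by (rule ennreal_leI)
  also have "\<dots> = ennreal \<beta> + (\<Sum>n<N. ennreal \<theta>)" using assms by (simp add: ennreal_plus ennreal_mult ennreal_of_nat_eq_real_of_nat)
  also have "(\<Sum>n<N. ennreal \<theta>) = (\<Sum>n<N. ennreal \<theta> * (if ennreal (\<beta> + real n * \<theta>) < y then 1 else 0))"
    using lt assms by (intro sum.cong) (auto simp: r ennreal_less_iff simp flip: ennreal_plus)
  also have "\<dots> \<le> (\<Sum>n. ennreal \<theta> * (if ennreal (\<beta> + real n * \<theta>) < y then 1 else 0))"
    by (rule sum_le_suminf) auto
  finally show ?thesis by (simp add: add_left_mono)
qed

lemma tails_eq_UNIV: "tails q \<U> x = (\<integral>\<^sup>+U. ennreal (tail q (fst U) (snd U) x) * indicator \<U> U \<partial>count_space UNIV)"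
  unfolding tails_def by (rule nn_integral_count_space_indicator) simp

text \<open>Of the intervals that are not entirely to the right of \<open>u\<close>, those ending before \<open>u\<close> have no
  tail at \<open>x > u\<close>, and disjointness leaves at most one that contains \<open>u\<close>.\<close>

lemma tails_right_of:
  assumes \<U>: "interval_family \<U>" and ux: "u < x" and q: "0 < q"
  shows "tails q \<U> x \<le> 1 + tails q {U \<in> \<U>. u \<le> fst U} x"
proof -
  let ?t = "\<lambda>U. ennreal (tail q (fst U) (snd U) x)"
  define S where "S = {U \<in> \<U>. fst U < u \<and> u < snd U}"
  have "U = U'" if "U \<in> S" "U' \<in> S" for U U'
  proof (rule ccontr)
    assume "U \<noteq> U'"
    then have "{fst U<..<snd U} \<inter> {fst U'<..<snd U'} = {}"
      using \<U> that unfolding interval_family_def disjoint_family_on_def S_def by auto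
    moreover have "u \<in> {fst U<..<snd U} \<inter> {fst U'<..<snd U'}" using that by (auto simp: S_def)
    ultimately show False by blast
  qed
  then have "S = {} \<or> (\<exists>U. S = {U})" by blast
  then have S1: "emeasure (count_space UNIV) S \<le> 1" by (auto simp: emeasure_count_space)
  have "tails q \<U> x \<le> (\<integral>\<^sup>+U. indicator S U + ?t U * indicator {U \<in> \<U>. u \<le> fst U} U \<partial>count_space UNIV)"
    unfolding tails_eq_UNIV
  proof (rule nn_integral_mono)
    fix U :: "real \<times> real"
    have "tail q (fst U) (snd U) x \<le> 1" if "U \<in> \<U>"
      using \<U> that q by (intro tail_le_1) (auto simp: interval_family_def)
    moreover have "tail q (fst U) (snd U) x = 0" if "snd U \<le> u" using ux that by (simp add: tail_def)
    ultimately show "?t U * indicator \<U> U \<le> indicator S U + ?t U * indicator {U \<in> \<U>. u \<le> fst U} U"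
      by (cases "u \<le> fst U"; cases "snd U \<le> u") (auto simp: S_def indicator_def)
  qed
  also have "\<dots> = emeasure (count_space UNIV) S + tails q {U \<in> \<U>. u \<le> fst U} x"
    unfolding tails_eq_UNIV by (subst nn_integral_add) auto
  also have "\<dots> \<le> 1 + tails q {U \<in> \<U>. u \<le> fst U} x" by (intro add_right_mono S1)
  finally show ?thesis .
qed

text \<open>The exponential decay on every Whitney interval of \<open>(a, c)\<close> turns, by \<open>whitney_bound\<close>, into
  geometric decay of the weight of the superlevel sets \<open>E n\<close> of the sum of tails. Cutting the
  layers at a large level \<open>N\<close> makes the coefficient of the integral of the tail of \<open>(a, c)\<close> as
  small as desired; the layers below \<open>N\<close> are bounded by a multiple of the weight of \<open>(a, c)\<close>.\<close>

lemma weighted_tails_bound: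
  assumes sW: "sets W = sets lebesgue" and wb: "whitney_bound W q e D" and q: "1 < q" and e: "0 < e" and D: "0 < D" and \<eta>: "0 < \<eta>"
  shows "\<exists>K>0. \<forall>a c \<U>. a < c \<longrightarrow> interval_family \<U> \<longrightarrow> (\<forall>U\<in>\<U>. a \<le> fst U \<and> snd U \<le> c) \<longrightarrow>
     (\<integral>\<^sup>+x\<in>{a<..<c}. tails q \<U> x \<partial>W) \<le> ennreal K * emeasure W {a<..<c} + ennreal \<eta> * (\<integral>\<^sup>+x. ennreal (tail q a c x) \<partial>W)"
proof -
  define \<theta> where "\<theta> = 40 * dual_const q"
  define \<rho> where "\<rho> = 1 / 2 powr e"
  have \<theta>: "0 < \<theta>" using dual_const_bounds[OF q] by (simp add: \<theta>_def)
  have "(2::real) powr 0 < 2 powr e" using e by (intro powr_less_mono) auto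
  then have \<rho>: "0 < \<rho>" "\<rho> < 1" by (auto simp: \<rho>_def)
  define Z where "Z = \<theta> * D * 2 powr e / (1 - \<rho>)"
  have Z: "0 < Z" using \<theta> D \<rho> by (simp add: Z_def)
  obtain N where N: "\<rho> ^ N < \<eta> / Z" using real_arch_pow_inv[of "\<eta> / Z" \<rho>] \<rho> \<eta> Z by auto
  define \<beta> where "\<beta> = 1 + \<theta> * (real N + 1)"
  have \<beta>: "0 < \<beta>" using \<theta> by (simp add: \<beta>_def add_pos_pos)
  show ?thesis
  proof (intro exI[of _ \<beta>] conjI allI impI \<beta>)
    fix a c :: real and \<U> assume ac: "a < c" and \<U>: "interval_family \<U>" and sub: "\<forall>U\<in>\<U>. a \<le> fst U \<and> snd U \<le> c"
    define L where "L = c - a"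
    have L: "0 < L" using ac by (simp add: L_def)
    let ?T = "\<integral>\<^sup>+x. ennreal (tail q a c x) \<partial>W"
    define E where "E n = {x \<in> {a<..<c}. ennreal (1 + \<theta> * (real n + 1)) < tails q \<U> x}" for n
    have tm: "tails q \<U> \<in> borel_measurable lebesgue" by (rule tails_measurable[OF \<U>])
    have E: "E n \<in> sets lebesgue" for n
    proof -
      have "E n = {a<..<c} \<inter> (tails q \<U> -` {ennreal (1 + \<theta> * (real n + 1))<..} \<inter> space lebesgue)" by (auto simp: E_def)
      also have "\<dots> \<in> sets lebesgue" by (intro sets.Int measurable_sets[OF tm]) auto
      finally show ?thesis .
    qed
    have WE: "emeasure W (E n) \<le> ennreal (D * (2 / 2 ^ n) powr e) * ?T" for n
    proof (rule wb[unfolded whitney_bound_def, rule_format], intro conjI allI ac E)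
      show "0 \<le> (2::real) / 2 ^ n" by simp
      show "E n \<subseteq> {a<..<c}" by (auto simp: E_def)
      fix j
      define u where "u = c - (c - a) / 2 ^ j"
      have u: "u < c" using ac by (simp add: u_def)
      let ?V = "{U \<in> \<U>. u \<le> fst U}"
      \<comment> \<open>On the Whitney interval starting at \<open>u\<close> at most one interval of the family that does
        not lie in \<open>(u, c)\<close> matters, and it adds at most \<open>1\<close>; this is the \<open>1\<close> in the
        definition of \<open>E\<close>.\<close>
      have "E n \<inter> {u<..<c - (c - a) / 2 ^ Suc j} \<subseteq> {x \<in> {u<..<c}. ennreal (40 * dual_const q * (real n + 1)) < tails q ?V x}"
      proof
        fix x assume x: "x \<in> E n \<inter> {u<..<c - (c - a) / 2 ^ Suc j}"
        have "0 < (c - a) / 2 ^ Suc j" using ac by simp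
        then have xx: "u < x" "x < c" using x unfolding Int_iff greaterThanLessThan_iff by linarith+
        have "ennreal 1 + ennreal (\<theta> * (real n + 1)) = ennreal (1 + \<theta> * (real n + 1))"
          using \<theta> by (intro ennreal_plus[symmetric]) auto
        also have "\<dots> < tails q \<U> x" using x by (simp add: E_def)
        also have "\<dots> \<le> 1 + tails q ?V x" using q by (intro tails_right_of[OF \<U> xx(1)]) auto
        finally have "ennreal (\<theta> * (real n + 1)) < tails q ?V x" by (simp add: ennreal_add_left_cancel_less)
        then show "x \<in> {x \<in> {u<..<c}. ennreal (40 * dual_const q * (real n + 1)) < tails q ?V x}"
          using xx by (simp add: \<theta>_def)
      qed
      then have "emeasure lebesgue (E n \<inter> {u<..<c - (c - a) / 2 ^ Suc j})
         \<le> emeasure lebesgue {x \<in> {u<..<c}. ennreal (40 * dual_const q * (real n + 1)) < tails q ?V x}"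
      proof (rule emeasure_mono)
        have fV: "interval_family ?V" by (rule interval_family_subset[OF \<U>]) auto
        have "{x \<in> {u<..<c}. ennreal (40 * dual_const q * (real n + 1)) < tails q ?V x}
          = {u<..<c} \<inter> (tails q ?V -` {ennreal (40 * dual_const q * (real n + 1))<..} \<inter> space lebesgue)" by auto
        also have "\<dots> \<in> sets lebesgue" by (intro sets.Int measurable_sets[OF tails_measurable[OF fV]]) auto
        finally show "{x \<in> {u<..<c}. ennreal (40 * dual_const q * (real n + 1)) < tails q ?V x} \<in> sets lebesgue" .
      qed
      also have "\<dots> \<le> ennreal ((c - u) / 2 ^ n)"
        by (rule disjoint_tails_distribution[OF interval_family_subset[OF \<U>] q u]) (use sub in auto)
      also have "(c - u) / 2 ^ n = 2 / 2 ^ n * ((c - a) / 2 ^ Suc j)" by (simp add: u_def field_simps)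
      finally show "emeasure lebesgue (E n \<inter> {c - (c - a) / 2 ^ j<..<c - (c - a) / 2 ^ Suc j})
        \<le> ennreal (2 / 2 ^ n * ((c - a) / 2 ^ Suc j))" by (simp only: u_def)
    qed
    have iW: "{a<..<c} \<in> sets W" "E n \<in> sets W" for n using E by (auto simp: sW)
    have "(\<integral>\<^sup>+x\<in>{a<..<c}. tails q \<U> x \<partial>W) \<le> (\<integral>\<^sup>+x. ennreal \<beta> * indicator {a<..<c} x + (\<Sum>n. ennreal \<theta> * indicator (E (N + n)) x) \<partial>W)"
    proof (rule nn_integral_mono)
      fix x
      show "tails q \<U> x * indicator {a<..<c} x \<le> ennreal \<beta> * indicator {a<..<c} x + (\<Sum>n. ennreal \<theta> * indicator (E (N + n)) x)"
      proof (cases "x \<in> {a<..<c}")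
        case True
        have "tails q \<U> x \<le> ennreal \<beta> + (\<Sum>n. ennreal \<theta> * (if ennreal (\<beta> + real n * \<theta>) < tails q \<U> x then 1 else 0))"
          by (rule ennreal_layer_bound) (use \<beta> \<theta> in auto)
        also have "(\<lambda>n. ennreal \<theta> * (if ennreal (\<beta> + real n * \<theta>) < tails q \<U> x then 1 else 0)) = (\<lambda>n. ennreal \<theta> * indicator (E (N + n)) x)"
        proof
          fix n
          have "\<beta> + real n * \<theta> = 1 + \<theta> * (real (N + n) + 1)" by (simp add: \<beta>_def algebra_simps)
          then show "ennreal \<theta> * (if ennreal (\<beta> + real n * \<theta>) < tails q \<U> x then 1 else 0) = ennreal \<theta> * indicator (E (N + n)) x"
            using True by (simp add: E_def indicator_def)
        qed
        finally show ?thesis using True by simp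
      qed simp
    qed
    also have "\<dots> = (\<integral>\<^sup>+x. ennreal \<beta> * indicator {a<..<c} x \<partial>W) + (\<integral>\<^sup>+x. (\<Sum>n. ennreal \<theta> * indicator (E (N + n)) x) \<partial>W)"
      by (rule nn_integral_add) (use iW in \<open>auto intro!: borel_measurable_suminf_order borel_measurable_times_ennreal borel_measurable_indicator\<close>)
    also have "(\<integral>\<^sup>+x. ennreal \<beta> * indicator {a<..<c} x \<partial>W) = ennreal \<beta> * emeasure W {a<..<c}"
      by (rule nn_integral_cmult_indicator) (rule iW)
    also have "(\<integral>\<^sup>+x. (\<Sum>n. ennreal \<theta> * indicator (E (N + n)) x) \<partial>W) = (\<Sum>n. ennreal \<theta> * emeasure W (E (N + n)))"
      using iW by (subst nn_integral_suminf) (auto simp: nn_integral_cmult_indicator)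
    also have "\<dots> \<le> (\<Sum>n. ennreal (Z * (1 - \<rho>) * \<rho> ^ N * \<rho> ^ n) * ?T)"
    proof (rule suminf_le)
      fix n
      have "(2 / 2 ^ (N + n)) powr e = 2 powr e * \<rho> ^ (N + n)"
        by (simp add: powr_divide \<rho>_def power_divide powr_powr mult.commute flip: powr_realpow)
      then have eq: "\<theta> * (D * (2 / 2 ^ (N + n)) powr e) = Z * (1 - \<rho>) * \<rho> ^ N * \<rho> ^ n"
        using \<rho> by (simp add: Z_def power_add)
      have "ennreal \<theta> * emeasure W (E (N + n)) \<le> ennreal \<theta> * (ennreal (D * (2 / 2 ^ (N + n)) powr e) * ?T)"
        by (intro mult_left_mono WE) auto
      also have "\<dots> = ennreal (\<theta> * (D * (2 / 2 ^ (N + n)) powr e)) * ?T"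
        using \<theta> D by (subst ennreal_mult) (auto simp: mult.assoc)
      finally show "ennreal \<theta> * emeasure W (E (N + n)) \<le> ennreal (Z * (1 - \<rho>) * \<rho> ^ N * \<rho> ^ n) * ?T"
        unfolding eq .
    qed auto
    also have "\<dots> = (\<Sum>n. ennreal (Z * (1 - \<rho>) * \<rho> ^ N * \<rho> ^ n)) * ?T"
      by (rule ennreal_suminf_multc)
    also have "(\<Sum>n. ennreal (Z * (1 - \<rho>) * \<rho> ^ N * \<rho> ^ n)) = ennreal (Z * (1 - \<rho>) * \<rho> ^ N * (1 / (1 - \<rho>)))"
    proof (rule suminf_ennreal_eq)
      show "(\<lambda>n. Z * (1 - \<rho>) * \<rho> ^ N * \<rho> ^ n) sums (Z * (1 - \<rho>) * \<rho> ^ N * (1 / (1 - \<rho>)))"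
        by (intro sums_mult geometric_sums) (use \<rho> in auto)
    qed (use Z \<rho> in auto)
    also have "Z * (1 - \<rho>) * \<rho> ^ N * (1 / (1 - \<rho>)) = Z * \<rho> ^ N" using \<rho> by simp
    also have "ennreal (Z * \<rho> ^ N) * ?T \<le> ennreal \<eta> * ?T"
    proof (intro mult_right_mono ennreal_leI)
      show "Z * \<rho> ^ N \<le> \<eta>" using N Z by (simp add: field_simps)
    qed simp
    finally show "(\<integral>\<^sup>+x\<in>{a<..<c}. tails q \<U> x \<partial>W) \<le> ennreal \<beta> * emeasure W {a<..<c} + ennreal \<eta> * ?T"
      by (simp add: add_left_mono)
  qed
qed

section \<open>The Young function\<close>

lemma LlogL_0 [simp]: "LlogL k 0 = 0" by (simp add: LlogL_def)

lemma LlogL_nonneg [simp]: "0 \<le> u \<Longrightarrow> 0 \<le> LlogL k u" by (simp add: LlogL_def)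

lemma LlogL_ge: "0 \<le> u \<Longrightarrow> u \<le> LlogL k u"
  unfolding LlogL_def by (simp add: mult_le_cancel_left1 one_le_power)

lemma LlogL_le_1: "0 \<le> u \<Longrightarrow> u \<le> 1 \<Longrightarrow> LlogL k u = u"
  by (cases "u = 0") (auto simp: LlogL_def)

lemma max_ln_mono: "0 \<le> u \<Longrightarrow> u \<le> v \<Longrightarrow> max 0 (ln u) \<le> max 0 (ln (v::real))"
  by (cases "u = 0") (auto simp: le_max_iff_disj)

lemma LlogL_scale:
  assumes "0 \<le> u" "1 \<le> l" shows "l * LlogL k u \<le> LlogL k (l * u)"
proof -
  have "u \<le> l * u" using mult_right_mono[of 1 l u] assms by simp
  then have "(1 + max 0 (ln u)) ^ k \<le> (1 + max 0 (ln (l * u))) ^ k"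
    using assms by (intro power_mono add_left_mono max_ln_mono) auto
  then have "l * u * (1 + max 0 (ln u)) ^ k \<le> l * u * (1 + max 0 (ln (l * u))) ^ k"
    using assms by (intro mult_left_mono) auto
  then show ?thesis by (simp add: LlogL_def mult.assoc)
qed

lemma LlogL_mono:
  assumes "0 \<le> u" "u \<le> v" shows "LlogL k u \<le> LlogL k v"
  unfolding LlogL_def using assms
  by (intro mult_mono power_mono add_left_mono max_ln_mono) auto

lemma LlogL_measurable [measurable]: "LlogL k \<in> borel_measurable borel"
  unfolding LlogL_def[abs_def] by measurable

text \<open>Any power above the first dominates \<open>L (log L)^k\<close>. It is used with a power below \<open>1 / \<alpha>\<close>.\<close>

lemma LlogL_growth:
  assumes "1 < \<gamma>"
  obtains C where "0 < C" "\<And>u. 1 \<le> u \<Longrightarrow> LlogL k u \<le> C * u powr \<gamma>"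
proof (cases "k = 0")
  case True
  show ?thesis
  proof (rule that[of 1])
    fix u :: real assume "1 \<le> u"
    then have "u powr 1 \<le> u powr \<gamma>" using assms by (intro powr_mono) auto
    then show "LlogL k u \<le> 1 * u powr \<gamma>" using True \<open>1 \<le> u\<close> by (simp add: LlogL_def)
  qed simp
next
  case False
  define s where "s = (\<gamma> - 1) / k"
  have s: "0 < s" using assms False by (simp add: s_def)
  show ?thesis
  proof (rule that[of "(1 + 1 / s) ^ k"])
    show "0 < (1 + 1 / s) ^ k" using s by (intro zero_less_power) (simp add: add_pos_pos)
    fix u :: real assume u: "1 \<le> u"
    have "ln u \<le> u powr s / s" by (rule ln_powr_bound[OF u s])
    moreover have "1 \<le> u powr s" using u s by (simp add: ge_one_powr_ge_zero)
    ultimately have "1 + max 0 (ln u) \<le> (1 + 1 / s) * u powr s" using u by (simp add: algebra_simps)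
    then have "(1 + max 0 (ln u)) ^ k \<le> ((1 + 1 / s) * u powr s) ^ k"
      by (rule power_mono) auto
    also have "\<dots> = (1 + 1 / s) ^ k * u powr (\<gamma> - 1)"
    proof -
      have "(u powr s) ^ k = u powr (s * real k)"
        using u by (subst powr_realpow[symmetric]) (auto simp: powr_powr)
      then show ?thesis using False by (simp add: power_mult_distrib s_def)
    qed
    finally have "LlogL k u \<le> u * ((1 + 1 / s) ^ k * u powr (\<gamma> - 1))"
      unfolding LlogL_def using u by (intro mult_left_mono) auto
    also have "\<dots> = (1 + 1 / s) ^ k * (u powr 1 * u powr (\<gamma> - 1))" using u by simp
    also have "\<dots> = (1 + 1 / s) ^ k * u powr \<gamma>" by (simp only: powr_add[symmetric]) simp
    finally show "LlogL k u \<le> (1 + 1 / s) ^ k * u powr \<gamma>" .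
  qed
qed

lemma power_le_fact_exp: "0 \<le> (v::real) \<Longrightarrow> v ^ n \<le> fact n * exp v"
proof -
  assume v: "0 \<le> v"
  have "(\<Sum>i\<in>{n}. inverse (fact i) * v ^ i) \<le> (\<Sum>i. inverse (fact i) * v ^ i)"
  proof (rule sum_le_suminf)
    show "summable (\<lambda>i. inverse (fact i) * v ^ i)" by (rule summable_exp)
    show "0 \<le> inverse (fact i) * v ^ i" for i using v by (intro mult_nonneg_nonneg zero_le_power) auto
  qed simp
  moreover have "exp v = (\<Sum>i. inverse (fact i) * v ^ i)" unfolding exp_def by simp
  ultimately have "inverse (fact n) * v ^ n \<le> exp v" by simp
  then have "fact n * (inverse (fact n) * v ^ n) \<le> fact n * exp v" by (rule mult_left_mono) simp
  moreover have "fact n * (inverse (fact n) * v ^ n) = v ^ n" by (simp add: mult.assoc[symmetric])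
  ultimately show ?thesis by (simp only:)
qed

text \<open>Young's inequality between \<open>L (log L)^k\<close> and the exponential: if \<open>v\<close> is at most
  \<open>2 (1 + log\<^sup>+ u)\<close>, then \<open>v^k\<close> is absorbed by the logarithmic factor; otherwise
  \<open>u \<le> exp (v / 2)\<close>, and the other half of the exponent absorbs \<open>v^k\<close>.\<close>

lemma LlogL_young:
  assumes "0 \<le> u" "0 \<le> v"
  shows "u * v ^ k \<le> 2 ^ k * LlogL k u + 2 ^ k * fact k * exp v"
proof (cases "v \<le> 2 * (1 + max 0 (ln u))")
  case True
  have "u * v ^ k \<le> u * (2 * (1 + max 0 (ln u))) ^ k"
    using True assms by (intro mult_left_mono power_mono) auto
  also have "\<dots> = 2 ^ k * LlogL k u" by (simp only: LlogL_def power_mult_distrib mult_ac)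
  finally show ?thesis by (simp add: add_increasing2)
next
  case False
  have u: "u \<le> exp (v / 2)"
  proof (cases "u = 0")
    case nz: False
    define M where "M = max 0 (ln u)"
    have "\<not> v \<le> 2 * (1 + M)" "ln u \<le> M" "0 \<le> M" using False by (auto simp: M_def)
    then have "ln u \<le> v / 2" by (simp add: field_simps)
    then show ?thesis using nz assms by (metis exp_le_cancel_iff exp_ln less_le)
  qed simp
  have "2 ^ k * (v / 2) ^ k \<le> 2 ^ k * (fact k * exp (v / 2))"
    using assms by (intro mult_left_mono power_le_fact_exp) auto
  then have v: "v ^ k \<le> 2 ^ k * fact k * exp (v / 2)" by (simp add: power_divide mult.assoc)
  have "u * v ^ k \<le> exp (v / 2) * (2 ^ k * fact k * exp (v / 2))"
    using u v assms by (intro mult_mono) auto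
  also have "\<dots> = 2 ^ k * fact k * exp v" by (simp add: mult_ac flip: exp_add)
  finally show ?thesis using assms by (simp add: add_increasing)
qed

section \<open>Components of open sets and the next point outside\<close>

text \<open>The bounded components of an open set, as pairs of endpoints. The endpoints stay available
  because the left endpoint of a component is a point outside the set, from which the estimates
  start.\<close>

definition comps :: "real set \<Rightarrow> (real \<times> real) set" where
  "comps \<Omega> = {U. fst U < snd U \<and> fst U \<notin> \<Omega> \<and> snd U \<notin> \<Omega> \<and> {fst U<..<snd U} \<subseteq> \<Omega>}"

definition next_good :: "real set \<Rightarrow> real \<Rightarrow> real" where
  "next_good \<Omega> x = Inf {z. x \<le> z \<and> z \<notin> \<Omega>}"

lemma next_good:
  assumes "open \<Omega>" "bdd_above \<Omega>"
  shows "x \<le> next_good \<Omega> x" "next_good \<Omega> x \<notin> \<Omega>" "\<And>z. x \<le> z \<Longrightarrow> z \<notin> \<Omega> \<Longrightarrow> next_good \<Omega> x \<le> z"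
    "\<And>z. x \<le> z \<Longrightarrow> z < next_good \<Omega> x \<Longrightarrow> z \<in> \<Omega>"
proof -
  let ?S = "{z. x \<le> z \<and> z \<notin> \<Omega>}"
  obtain B where B: "\<And>z. z \<in> \<Omega> \<Longrightarrow> z \<le> B" using assms(2) by (auto simp: bdd_above_def)
  have ne: "?S \<noteq> {}"
  proof -
    have "max x (B + 1) \<in> ?S" using B[of "max x (B + 1)"] by auto
    then show ?thesis by blast
  qed
  have bdd: "bdd_below ?S" by (auto intro: bdd_belowI[of _ x])
  have "?S = {x..} \<inter> - \<Omega>" by auto
  then have cl: "closed ?S" using assms(1) by (auto intro: closed_Int)
  have "next_good \<Omega> x \<in> ?S" unfolding next_good_def by (rule closed_contains_Inf[OF ne bdd cl])
  then show 1: "x \<le> next_good \<Omega> x" "next_good \<Omega> x \<notin> \<Omega>" by auto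
  show 2: "next_good \<Omega> x \<le> z" if "x \<le> z" "z \<notin> \<Omega>" for z
    unfolding next_good_def by (rule cInf_lower[OF _ bdd]) (use that in auto)
  show "z \<in> \<Omega>" if "x \<le> z" "z < next_good \<Omega> x" for z using 2[of z] that by auto
qed

lemma next_good_mono:
  assumes "open \<Omega>" "bdd_above \<Omega>" shows "mono (next_good \<Omega>)"
proof
  fix x y :: real assume "x \<le> y"
  then show "next_good \<Omega> x \<le> next_good \<Omega> y"
    using next_good(3)[OF assms, of x "next_good \<Omega> y"] next_good(1,2)[OF assms, of y] by auto
qed

lemma next_good_outside: "open \<Omega> \<Longrightarrow> bdd_above \<Omega> \<Longrightarrow> x \<notin> \<Omega> \<Longrightarrow> next_good \<Omega> x = x"
  using next_good(1)[of \<Omega> x] next_good(3)[of \<Omega> x x] by fastforce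

lemma next_good_antimono_set:
  assumes "open \<Omega>" "bdd_above \<Omega>" "open \<Omega>'" "bdd_above \<Omega>'" "\<Omega>' \<subseteq> \<Omega>"
  shows "next_good \<Omega>' x \<le> next_good \<Omega> x"
  by (rule next_good(3)[OF assms(3,4)]) (use next_good(1,2)[OF assms(1,2)] assms(5) in auto)

lemma next_good_comps:
  assumes "open \<Omega>" "bdd_above \<Omega>" "U \<in> comps \<Omega>" "x \<in> {fst U<..<snd U}"
  shows "next_good \<Omega> x = snd U"
proof (rule antisym)
  show "next_good \<Omega> x \<le> snd U" by (rule next_good(3)[OF assms(1,2)]) (use assms in \<open>auto simp: comps_def\<close>)
  show "snd U \<le> next_good \<Omega> x"
  proof (rule ccontr)
    assume "\<not> snd U \<le> next_good \<Omega> x"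
    then have "next_good \<Omega> x \<in> {fst U<..<snd U}" using next_good(1)[OF assms(1,2), of x] assms(4) by auto
    then show False using assms(3) next_good(2)[OF assms(1,2), of x] by (auto simp: comps_def)
  qed
qed

lemma comps_nested:
  assumes "U \<in> comps \<Omega>" "V \<in> comps \<Omega>'" "\<Omega> \<subseteq> \<Omega>'" "x \<in> {fst U<..<snd U}" "x \<in> {fst V<..<snd V}"
  shows "fst V \<le> fst U \<and> snd U \<le> snd V"
proof
  show "fst V \<le> fst U"
  proof (rule ccontr)
    assume "\<not> ?thesis"
    then have "fst V \<in> {fst U<..<snd U}" using assms(4,5) by auto
    then show False using assms(1-3) by (auto simp: comps_def)
  qed
  show "snd U \<le> snd V"
  proof (rule ccontr)
    assume "\<not> ?thesis"
    then have "snd V \<in> {fst U<..<snd U}" using assms(4,5) by auto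
    then show False using assms(1-3) by (auto simp: comps_def)
  qed
qed

lemma comps_disjoint:
  assumes "U \<in> comps \<Omega>" "V \<in> comps \<Omega>" "x \<in> {fst U<..<snd U}" "x \<in> {fst V<..<snd V}"
  shows "U = V"
  using comps_nested[OF assms(1,2) order_refl assms(3,4)] comps_nested[OF assms(2,1) order_refl assms(4,3)]
  by (intro prod_eqI antisym) auto

lemma interval_family_comps: "interval_family (comps \<Omega>)"
  unfolding interval_family_def
proof (intro conjI ballI)
  let ?I = "\<lambda>U. {fst U<..<snd U} :: real set"
  have ne: "?I U \<noteq> {}" if "U \<in> comps \<Omega>" for U using that by (auto simp: comps_def)
  show dis: "disjoint_family_on ?I (comps \<Omega>)"
    unfolding disjoint_family_on_def using comps_disjoint by blast
  have "countable (?I ` comps \<Omega>)"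
  proof (rule countable_disjoint_open_subsets)
    show "pairwise disjnt (?I ` comps \<Omega>)"
      unfolding pairwise_image using dis by (auto simp: pairwise_def disjoint_family_on_def disjnt_def)
  qed auto
  moreover have "inj_on ?I (comps \<Omega>)"
  proof (rule inj_onI)
    fix U V assume UV: "U \<in> comps \<Omega>" "V \<in> comps \<Omega>" "?I U = ?I V"
    obtain x where "x \<in> ?I U" using ne[OF UV(1)] by blast
    then show "U = V" using comps_disjoint[OF UV(1,2), of x] UV(3) by blast
  qed
  ultimately show "countable (comps \<Omega>)" by (rule countable_image_inj_on)
qed (auto simp: comps_def)

lemma comps_cover:
  assumes op: "open \<Omega>" and "bdd_above \<Omega>" "bdd_below \<Omega>" "x \<in> \<Omega>"
  obtains U where "U \<in> comps \<Omega>" "x \<in> {fst U<..<snd U}"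
proof -
  define c where "c = next_good \<Omega> x"
  let ?S = "{z. z \<le> x \<and> z \<notin> \<Omega>}"
  define a where "a = Sup ?S"
  obtain B where B: "\<And>z. z \<in> \<Omega> \<Longrightarrow> B \<le> z" using assms(3) by (auto simp: bdd_below_def)
  have ne: "?S \<noteq> {}"
  proof -
    have "min x (B - 1) \<in> ?S" using B[of "min x (B - 1)"] by auto
    then show ?thesis by blast
  qed
  have bdd: "bdd_above ?S" by (auto intro: bdd_aboveI[of _ x])
  have "?S = {..x} \<inter> - \<Omega>" by auto
  then have cl: "closed ?S" using op by (auto intro: closed_Int)
  have "a \<in> ?S" unfolding a_def by (rule closed_contains_Sup[OF ne bdd cl])
  then have a: "a \<le> x" "a \<notin> \<Omega>" by auto
  have a2: "z \<le> a" if "z \<le> x" "z \<notin> \<Omega>" for z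
    unfolding a_def by (rule cSup_upper[OF _ bdd]) (use that in auto)
  have c: "x \<le> c" "c \<notin> \<Omega>" "\<And>z. x \<le> z \<Longrightarrow> z < c \<Longrightarrow> z \<in> \<Omega>"
    unfolding c_def using next_good[OF op assms(2)] by auto
  have lt: "a < x" "x < c" using a c assms(4) by (auto simp: less_le)
  have "{a<..<c} \<subseteq> \<Omega>"
  proof
    fix z assume z: "z \<in> {a<..<c}"
    show "z \<in> \<Omega>"
    proof (cases "x \<le> z")
      case True then show ?thesis using c(3) z by auto
    next
      case False then show ?thesis using a2[of z] z by auto
    qed
  qed
  then show thesis using a c lt by (intro that[of "(a, c)"]) (auto simp: comps_def)
qed

section \<open>Orlicz masses and level sets\<close>

text \<open>A modular rather than a norm: the condition \<open>orlicz_mass k f (h powr \<alpha> / t) {x<..<x + h} \<le> h\<close>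
  says that \<open>h powr \<alpha>\<close> times the Luxemburg average over \<open>(x, x + h)\<close> is at most \<open>t\<close>.\<close>

definition orlicz_mass :: "nat \<Rightarrow> (real \<Rightarrow> real) \<Rightarrow> real \<Rightarrow> real set \<Rightarrow> ennreal" where
  "orlicz_mass k f s A = (\<integral>\<^sup>+y\<in>A. ennreal (LlogL k (f y * s)) \<partial>lebesgue)"

definition level :: "real \<Rightarrow> nat \<Rightarrow> (real \<Rightarrow> real) \<Rightarrow> real \<Rightarrow> real set" where
  "level \<alpha> k f t = {x. \<exists>h>0. ennreal h < orlicz_mass k f (h powr \<alpha> / t) {x<..<x + h}}"

lemma orlicz_mass_mono:
  assumes "\<And>y. 0 \<le> f y" "\<And>y. f y \<le> g y" "0 \<le> s" "s \<le> s'" "A \<subseteq> A'"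
  shows "orlicz_mass k f s A \<le> orlicz_mass k g s' A'"
  unfolding orlicz_mass_def
proof (rule nn_integral_mono)
  fix y
  have "f y * s \<le> g y * s'" "0 \<le> f y * s" using assms(1)[of y] assms(2)[of y] assms(3,4) by (auto intro: mult_mono)
  then show "ennreal (LlogL k (f y * s)) * indicator A y \<le> ennreal (LlogL k (g y * s')) * indicator A' y"
    using assms(5) by (auto simp: indicator_def intro!: ennreal_leI LlogL_mono)
qed

text \<open>The convexity of the Young function, in the only form needed: its modular grows at least
  linearly in the scaling parameter.\<close>

lemma orlicz_mass_scale:
  assumes "\<And>y. 0 \<le> f y" "0 \<le> s" "1 \<le> l" and [measurable]: "f \<in> borel_measurable lebesgue" "A \<in> sets lebesgue"
  shows "ennreal l * orlicz_mass k f s A \<le> orlicz_mass k f (l * s) A"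
proof -
  have "ennreal l * orlicz_mass k f s A = (\<integral>\<^sup>+y\<in>A. ennreal l * ennreal (LlogL k (f y * s)) \<partial>lebesgue)"
    unfolding orlicz_mass_def by (subst nn_integral_cmult[symmetric]) (auto simp: mult.assoc)
  also have "\<dots> \<le> orlicz_mass k f (l * s) A"
    unfolding orlicz_mass_def
  proof (rule nn_integral_mono)
    fix y
    have "l * LlogL k (f y * s) \<le> LlogL k (f y * (l * s))"
      using LlogL_scale[of "f y * s" l k] assms by (simp add: mult_ac)
    then show "ennreal l * ennreal (LlogL k (f y * s)) * indicator A y \<le> ennreal (LlogL k (f y * (l * s))) * indicator A y"
      using assms by (intro mult_right_mono) (auto simp flip: ennreal_mult intro!: ennreal_leI)
  qed
  finally show ?thesis .
qed

lemma level_antimono: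
  assumes "\<And>y. 0 \<le> f y" "0 < t" "t \<le> t'"
  shows "level \<alpha> k f t' \<subseteq> level \<alpha> k f t"
proof
  fix x assume "x \<in> level \<alpha> k f t'"
  then obtain h where h: "0 < h" "ennreal h < orlicz_mass k f (h powr \<alpha> / t') {x<..<x + h}" by (auto simp: level_def)
  have "orlicz_mass k f (h powr \<alpha> / t') {x<..<x + h} \<le> orlicz_mass k f (h powr \<alpha> / t) {x<..<x + h}"
    using assms by (intro orlicz_mass_mono divide_left_mono divide_nonneg_nonneg mult_pos_pos) auto
  with h(2) have "ennreal h < orlicz_mass k f (h powr \<alpha> / t) {x<..<x + h}" by (rule less_le_trans)
  with h(1) show "x \<in> level \<alpha> k f t" unfolding level_def by blast
qed

lemma good_point_mass_le:
  assumes "z \<notin> level \<alpha> k f t" "0 < h"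
  shows "orlicz_mass k f (h powr \<alpha> / t) {z<..<z + h} \<le> ennreal h"
  by (rule ccontr) (use assms in \<open>auto simp: level_def not_le\<close>)

lemma orlicz_mass_left_continuous:
  assumes [measurable]: "f \<in> borel_measurable lebesgue" and lt: "m < orlicz_mass k f s {x<..<c}"
  obtains d where "0 < d" "m < orlicz_mass k f s {x + d<..<c}"
proof -
  let ?D = "density lebesgue (\<lambda>y. ennreal (LlogL k (f y * s)))"
  have eq: "orlicz_mass k f s {u<..<c} = emeasure ?D {u<..<c}" for u
    unfolding orlicz_mass_def by (subst emeasure_density) auto
  have "{x<..<c} = (\<Union>n. {x + 1 / real (Suc n)<..<c})"
  proof (intro equalityI subsetI)
    fix y assume y: "y \<in> {x<..<c}"
    then obtain n where "1 / real (Suc n) < y - x" using reals_Archimedean[of "y - x"] by (auto simp: inverse_eq_divide)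
    then show "y \<in> (\<Union>n. {x + 1 / real (Suc n)<..<c})" using y by (auto intro!: exI[of _ n])
  next
    fix y assume "y \<in> (\<Union>n. {x + 1 / real (Suc n)<..<c})"
    then obtain n where n: "x + 1 / real (Suc n) < y" "y < c" by auto
    have "0 < 1 / real (Suc n)" by simp
    then show "y \<in> {x<..<c}" using n unfolding greaterThanLessThan_iff by linarith
  qed
  then have "emeasure ?D {x<..<c} = emeasure ?D (\<Union>n. {x + 1 / real (Suc n)<..<c})" by simp
  also have "\<dots> = (SUP n. emeasure ?D {x + 1 / real (Suc n)<..<c})"
  proof (rule SUP_emeasure_incseq[symmetric])
    show "incseq (\<lambda>n. {x + 1 / real (Suc n)<..<c})"
    proof (rule incseq_SucI)
      fix n
      have "1 / real (Suc (Suc n)) \<le> 1 / real (Suc n)" by (simp add: frac_le)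
      then show "{x + 1 / real (Suc n)<..<c} \<subseteq> {x + 1 / real (Suc (Suc n))<..<c}" by auto
    qed
  qed auto
  finally have "m < (SUP n. emeasure ?D {x + 1 / real (Suc n)<..<c})" using lt eq by simp
  then obtain n where "m < emeasure ?D {x + 1 / real (Suc n)<..<c}" by (auto simp: less_SUP_iff)
  then show thesis using eq by (intro that[of "1 / real (Suc n)"]) auto
qed

text \<open>A witness \<open>(x, x + h)\<close> stays one when it is shortened slightly on the left and \<open>h\<close> is
  increased slightly, because the inequality is strict.\<close>

lemma open_level:
  assumes fm: "f \<in> borel_measurable lebesgue" and f0: "\<And>y. 0 \<le> f y" and "0 < t" "0 < \<alpha>"
  shows "open (level \<alpha> k f t)"
  unfolding open_dist
proof
  fix x assume "x \<in> level \<alpha> k f t"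
  then obtain h where h: "0 < h" and lt: "ennreal h < orlicz_mass k f (h powr \<alpha> / t) {x<..<x + h}" by (auto simp: level_def)
  from orlicz_mass_left_continuous[OF fm lt] obtain d where d: "0 < d" and
    lt2: "ennreal h < orlicz_mass k f (h powr \<alpha> / t) {x + d<..<x + h}" by auto
  have "\<exists>h'>h. ennreal h' < orlicz_mass k f (h powr \<alpha> / t) {x + d<..<x + h}"
  proof -
    obtain y where y: "ennreal h < y" "y < orlicz_mass k f (h powr \<alpha> / t) {x + d<..<x + h}" using lt2 dense by blast
    then obtain r where r: "y = ennreal r" "0 \<le> r" by (cases y) (auto simp: top.not_eq_extremum)
    then show ?thesis using y h by (auto simp: ennreal_less_iff intro!: exI[of _ r])
  qed
  then obtain h' where h': "h < h'" and lt3: "ennreal h' < orlicz_mass k f (h powr \<alpha> / t) {x + d<..<x + h}" by blast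
  show "\<exists>e>0. \<forall>y. dist y x < e \<longrightarrow> y \<in> level \<alpha> k f t"
  proof (intro exI[of _ "min d (h' - h)"] conjI allI impI)
    show "0 < min d (h' - h)" using d h' by simp
    fix y assume "dist y x < min d (h' - h)"
    then have sub: "{x + d<..<x + h} \<subseteq> {y<..<y + h'}" by (auto simp: dist_real_def)
    have "orlicz_mass k f (h powr \<alpha> / t) {x + d<..<x + h} \<le> orlicz_mass k f (h' powr \<alpha> / t) {y<..<y + h'}"
      using h h' assms sub by (intro orlicz_mass_mono divide_right_mono powr_mono2) auto
    with lt3 have "ennreal h' < orlicz_mass k f (h' powr \<alpha> / t) {y<..<y + h'}" by (rule less_le_trans)
    moreover have "0 < h'" using h h' by simp
    ultimately show "y \<in> level \<alpha> k f t" unfolding level_def by blast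
  qed
qed

text \<open>A good point \<open>z\<close> for \<open>t\<close> makes the level set for \<open>2^N t\<close> sparse on its right. A witness
  interval of length \<open>r\<close> starting at \<open>x\<close> cannot be longer than \<open>x - z\<close>: otherwise \<open>(z, x + r)\<close>,
  of length at most \<open>2 r\<close>, would carry too much mass for \<open>z\<close> to be good. So all witness
  intervals lie in \<open>(z, z + 2 h)\<close> and the weak type estimate applies to the mass there, which
  convexity makes smaller than the bound \<open>2 h\<close> by the factor \<open>2^N\<close>.\<close>

lemma level_density:
  assumes fm [measurable]: "f \<in> borel_measurable lebesgue" and f0: "\<And>y. 0 \<le> f y" and t: "0 < t" and \<alpha>: "0 < \<alpha>" "\<alpha> < 1"
    and z: "z \<notin> level \<alpha> k f t" and h: "0 < h" and N: "1 \<le> N"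
  shows "emeasure lebesgue (level \<alpha> k f (2 ^ N * t) \<inter> {z<..<z + h}) \<le> ennreal (20 * h / 2 ^ N)"
proof -
  define P where "P = (2::real) ^ N"
  have P: "2 \<le> P" unfolding P_def using N power_increasing[of 1 N "2::real"] by simp
  let ?g = "\<lambda>y. ennreal (LlogL k (f y * ((2 * h) powr \<alpha> / (P * t)))) * indicator {z<..<z + 2 * h} y"
  have scale: "orlicz_mass k f (s / P) A \<le> ennreal (1 / P) * orlicz_mass k f s A" if "0 \<le> s" "A \<in> sets lebesgue" for s A
  proof -
    have "ennreal P * orlicz_mass k f (s / P) A \<le> orlicz_mass k f (P * (s / P)) A"
      by (rule orlicz_mass_scale) (use that P f0 in auto)
    then have "ennreal (1 / P) * (ennreal P * orlicz_mass k f (s / P) A) \<le> ennreal (1 / P) * orlicz_mass k f (P * (s / P)) A"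
      by (rule mult_left_mono) simp
    moreover have "ennreal (1 / P) * (ennreal P * orlicz_mass k f (s / P) A) = orlicz_mass k f (s / P) A"
      using P by (simp add: mult.assoc[symmetric] ennreal_mult[symmetric])
    ultimately show ?thesis using P by simp
  qed
  have "emeasure lebesgue (level \<alpha> k f (P * t) \<inter> {z<..<z + h}) \<le> 10 * (\<integral>\<^sup>+y. ?g y \<partial>lebesgue)"
  proof (rule vitali_weak_type[where B = h])
    show "?g \<in> borel_measurable lebesgue" by (intro borel_measurable_times_ennreal borel_measurable_indicator) auto
    have "open (level \<alpha> k f (P * t) \<inter> {z<..<z + h})"
      using t P f0 \<alpha> by (intro open_Int open_level fm) auto
    then show "level \<alpha> k f (P * t) \<inter> {z<..<z + h} \<in> sets lebesgue" by (simp add: borel_open)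
    fix x assume x: "x \<in> level \<alpha> k f (P * t) \<inter> {z<..<z + h}"
    then obtain r where r: "0 < r" and lt: "ennreal r < orlicz_mass k f (r powr \<alpha> / (P * t)) {x<..<x + r}" by (auto simp: level_def)
    have zx: "z < x" "x < z + h" using x by auto
    have rx: "r < x - z"
    proof (rule ccontr)
      assume "\<not> r < x - z"
      then have r2: "x + r - z \<le> 2 * r" by linarith
      have pos: "0 < x + r - z" using r zx by simp
      have "orlicz_mass k f (r powr \<alpha> / (P * t)) {x<..<x + r} \<le> orlicz_mass k f ((x + r - z) powr \<alpha> / (P * t)) {z<..<z + (x + r - z)}"
        using f0 t P r zx \<alpha> by (intro orlicz_mass_mono divide_right_mono powr_mono2) auto
      also have "\<dots> = orlicz_mass k f (((x + r - z) powr \<alpha> / t) / P) {z<..<z + (x + r - z)}" by (simp add: mult.commute)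
      also have "\<dots> \<le> ennreal (1 / P) * orlicz_mass k f ((x + r - z) powr \<alpha> / t) {z<..<z + (x + r - z)}"
        by (rule scale) (use t in auto)
      also have "\<dots> \<le> ennreal (1 / P) * ennreal (x + r - z)"
        by (intro mult_left_mono good_point_mass_le[OF z pos]) auto
      also have "\<dots> = ennreal ((x + r - z) / P)" using P pos by (simp flip: ennreal_mult)
      also have "\<dots> \<le> ennreal r"
      proof (rule ennreal_leI)
        have "x + r - z \<le> P * r" using r2 P r mult_right_mono[of 2 P r] by linarith
        then show "(x + r - z) / P \<le> r" using P by (simp add: field_simps)
      qed
      finally show False using lt by simp
    qed
    have "ennreal r \<le> orlicz_mass k f ((2 * h) powr \<alpha> / (P * t)) {x<..<x + r}"
      using lt f0 t P r zx rx \<alpha>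
      by (intro order_trans[OF less_imp_le[OF lt]] orlicz_mass_mono divide_right_mono powr_mono2) auto
    also have "\<dots> \<le> (\<integral>\<^sup>+y\<in>{x - r<..<x + r}. ?g y \<partial>lebesgue)"
      unfolding orlicz_mass_def
      by (rule nn_integral_mono) (use zx rx r in \<open>auto simp: indicator_def\<close>)
    finally show "\<exists>r>0. r \<le> h \<and> ennreal r \<le> (\<integral>\<^sup>+y\<in>{x - r<..<x + r}. ?g y \<partial>lebesgue)"
      using r rx zx by (intro exI[of _ r]) auto
  qed
  also have "(\<integral>\<^sup>+y. ?g y \<partial>lebesgue) = orlicz_mass k f (((2 * h) powr \<alpha> / t) / P) {z<..<z + 2 * h}"
    by (simp add: orlicz_mass_def mult.commute)
  also have "\<dots> \<le> ennreal (1 / P) * orlicz_mass k f ((2 * h) powr \<alpha> / t) {z<..<z + 2 * h}"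
    by (rule scale) (use t in auto)
  also have "\<dots> \<le> ennreal (1 / P) * ennreal (2 * h)"
    by (intro mult_left_mono good_point_mass_le[OF z]) (use h in auto)
  also have "10 * (ennreal (1 / P) * ennreal (2 * h)) = ennreal (20 * h / P)"
  proof -
    have "ennreal (1 / P) * ennreal (2 * h) = ennreal (1 / P * (2 * h))" using P h by (intro ennreal_mult[symmetric]) auto
    moreover have "10 * ennreal (1 / P * (2 * h)) = ennreal (10 * (1 / P * (2 * h)))" using P h by (subst ennreal_mult) auto
    ultimately show ?thesis by simp
  qed
  finally show ?thesis by (simp add: P_def mult_left_mono)
qed

section \<open>Tails to the left of a good point\<close>

text \<open>Intervals ending at distance at least \<open>\<rho>\<close> to the right of \<open>x\<close> have tails \<open>(l / \<rho>)^q\<close> in terms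
  of their lengths \<open>l\<close>. As \<open>q > 1\<close> and the total length is at most \<open>S\<close>, the sum is largest for a
  single interval of length \<open>S\<close>.\<close>

lemma tails_group_le:
  assumes \<V>: "interval_family \<V>" and q: "1 < q" and \<rho>: "0 < \<rho>" and S: "0 < S"
    and far: "\<And>U. U \<in> \<V> \<Longrightarrow> \<rho> \<le> snd U - x"
    and sub: "\<And>U. U \<in> \<V> \<Longrightarrow> {fst U<..<snd U} \<subseteq> E" and E: "E \<in> sets lebesgue" "emeasure lebesgue E \<le> ennreal S"
  shows "tails q \<V> x \<le> ennreal ((S / \<rho>) powr q)"
proof -
  let ?I = "\<lambda>U. {fst U<..<snd U}"
  have cV: "countable \<V>" and dV: "disjoint_family_on ?I \<V>" and ltV: "\<And>U. U \<in> \<V> \<Longrightarrow> fst U < snd U"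
    using \<V> by (auto simp: interval_family_def)
  have single: "ennreal (tail q (fst U) (snd U) x) \<le> ennreal ((1 / \<rho>) powr q * S powr (q - 1)) * emeasure lebesgue (?I U)" if U: "U \<in> \<V>" for U
  proof -
    define l where "l = snd U - fst U"
    have l: "0 < l" using ltV[OF U] by (simp add: l_def)
    have el: "emeasure lebesgue (?I U) = ennreal l" using l by (simp add: l_def)
    have "ennreal l \<le> ennreal S"
      unfolding el[symmetric] using emeasure_mono[OF sub[OF U] E(1)] E(2) by (rule order_trans)
    then have lS: "l \<le> S" using S by simp
    have "x < snd U" using far[OF U] \<rho> by simp
    then have "tail q (fst U) (snd U) x \<le> (l / (snd U - x)) powr q"
      using l q by (auto simp: tail_def l_def intro!: powr_mono2)
    also have "\<dots> \<le> (l / \<rho>) powr q"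
      using l q \<rho> far[OF U] by (intro powr_mono2 divide_left_mono mult_pos_pos) auto
    also have "\<dots> = (1 / \<rho>) powr q * (l powr (q - 1) * l powr 1)"
    proof -
      have "l powr (q - 1) * l powr 1 = l powr q" by (simp only: powr_add[symmetric]) simp
      then show ?thesis using l \<rho> by (simp add: powr_divide)
    qed
    also have "\<dots> \<le> (1 / \<rho>) powr q * (S powr (q - 1) * l powr 1)"
      using l q lS by (intro mult_left_mono mult_right_mono powr_mono2) auto
    also have "\<dots> = (1 / \<rho>) powr q * S powr (q - 1) * l" using l by simp
    finally have "ennreal (tail q (fst U) (snd U) x) \<le> ennreal ((1 / \<rho>) powr q * S powr (q - 1) * l)" by (rule ennreal_leI)
    also have "\<dots> = ennreal ((1 / \<rho>) powr q * S powr (q - 1)) * ennreal l" using l by (intro ennreal_mult) auto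
    finally show ?thesis by (simp only: el)
  qed
  have "tails q \<V> x \<le> (\<integral>\<^sup>+U. ennreal ((1 / \<rho>) powr q * S powr (q - 1)) * emeasure lebesgue (?I U) \<partial>count_space \<V>)"
    unfolding tails_def by (rule nn_integral_mono) (use single in auto)
  also have "\<dots> = ennreal ((1 / \<rho>) powr q * S powr (q - 1)) * (\<integral>\<^sup>+U. emeasure lebesgue (?I U) \<partial>count_space \<V>)"
    by (rule nn_integral_cmult) simp
  also have "(\<integral>\<^sup>+U. emeasure lebesgue (?I U) \<partial>count_space \<V>) = (\<integral>\<^sup>+U. (\<integral>\<^sup>+x\<in>?I U. 1 \<partial>lebesgue) \<partial>count_space \<V>)"
    by (rule nn_integral_cong) simp
  also have "\<dots> \<le> (\<integral>\<^sup>+x\<in>E. 1 \<partial>lebesgue)"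
    by (rule nn_integral_disjoint_le[OF cV _ dV]) (use sub in auto)
  also have "\<dots> \<le> ennreal S" using E by simp
  also have "ennreal ((1 / \<rho>) powr q * S powr (q - 1)) * ennreal S = ennreal ((1 / \<rho>) powr q * S powr (q - 1) * S)"
    using S by (intro ennreal_mult[symmetric]) auto
  also have "(1 / \<rho>) powr q * S powr (q - 1) * S = (S / \<rho>) powr q"
  proof -
    have "S powr (q - 1) * S = S powr q" using S by (metis add.commute diff_add_cancel powr_add powr_one less_imp_le)
    then show ?thesis using S \<rho> by (simp add: powr_divide)
  qed
  finally show ?thesis by (simp add: mult_left_mono)
qed

lemma tails_le_sum_groups:
  assumes "finite J" and "\<And>U. U \<in> \<U> \<Longrightarrow> \<exists>j\<in>J. U \<in> \<V> j"
  shows "tails q \<U> x \<le> (\<Sum>j\<in>J. tails q (\<V> j) x)"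
proof -
  let ?t = "\<lambda>U. ennreal (tail q (fst U) (snd U) x)"
  have "tails q \<U> x \<le> (\<integral>\<^sup>+U. (\<Sum>j\<in>J. ?t U * indicator (\<V> j) U) \<partial>count_space UNIV)"
    unfolding tails_eq_UNIV
  proof (rule nn_integral_mono)
    fix U
    show "?t U * indicator \<U> U \<le> (\<Sum>j\<in>J. ?t U * indicator (\<V> j) U)"
    proof (cases "U \<in> \<U>")
      case True
      then obtain j where j: "j \<in> J" "U \<in> \<V> j" using assms(2) by blast
      then have "?t U * indicator \<U> U = ?t U * indicator (\<V> j) U" using True by simp
      also have "\<dots> \<le> (\<Sum>j\<in>J. ?t U * indicator (\<V> j) U)"
        by (rule member_le_sum[OF j(1)]) (use assms in auto)
      finally show ?thesis .
    qed simp
  qed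
  also have "\<dots> = (\<Sum>j\<in>J. tails q (\<V> j) x)"
    unfolding tails_eq_UNIV by (rule nn_integral_sum) simp
  finally show ?thesis .
qed

lemma tail_double_le:
  assumes "a < c" "0 < q" shows "tail q (a - (c - a)) c x \<le> 2 powr q * tail q a c x"
proof (cases "x < c")
  case True
  define r where "r = (c - a) / (c - x)"
  have r: "0 < r" using assms True by (simp add: r_def)
  have "(c - (a - (c - a))) / (c - x) = 2 * r" by (simp add: r_def algebra_simps add_divide_distrib diff_divide_distrib)
  then have "tail q (a - (c - a)) c x = min 1 (2 * r) powr q" using True by (simp add: tail_def)
  also have "\<dots> \<le> (2 * min 1 r) powr q" using r assms by (intro powr_mono2) auto
  also have "\<dots> = 2 powr q * tail q a c x" using r True by (simp add: powr_mult tail_def r_def)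
  finally show ?thesis .
qed (simp add: tail_def)

lemma summable_linear_geometric:
  assumes "0 < (\<rho>::real)" "\<rho> < 1" shows "summable (\<lambda>l. (real l + 2) * \<rho> ^ l)"
proof -
  have "summable (\<lambda>l. real (Suc l) * \<rho> ^ l)"
    using geometric_deriv_sums[of \<rho>] assms by (auto simp: sums_iff)
  moreover have "summable (\<lambda>l. \<rho> ^ l)" using assms by (intro summable_geometric) auto
  ultimately have "summable (\<lambda>l. real (Suc l) * \<rho> ^ l + \<rho> ^ l)" by (rule summable_add)
  then show ?thesis by (simp add: algebra_simps)
qed

text \<open>The intervals fill at most the proportion \<open>\<kappa>\<close> of every interval \<open>(a, a + h)\<close>. At a point \<open>x\<close>
  farther from \<open>a\<close> than \<open>L = c - a\<close>, all of them are at comparable distance, and their sum is at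
  most \<open>(2 \<kappa>)^q\<close> times the tail of \<open>(a, c)\<close>. If the distance \<open>r\<close> is about \<open>L / 2^l\<close>, they are
  grouped by their distance \<open>2^j r\<close> from \<open>x\<close>; each of the \<open>l + 2\<close> groups contributes \<open>(2 \<kappa>)^q\<close>.
  The points at distance at most \<open>L / 2^l\<close> from \<open>a\<close> form a set \<open>E l\<close> of small density in the
  interval \<open>(a - L, c)\<close>, whose weight decays like \<open>2^(-l e)\<close> and so outweighs the factor
  \<open>l + 2\<close>.\<close>

lemma tails_left_of_good_point:
  assumes sW: "sets W = sets lebesgue" and nW: "\<And>x. emeasure W {x} = 0"
    and wb: "whitney_bound W q e D" and q: "1 < q" and e: "0 < e" and D: "0 < D"
    and Sl: "Sl = (\<Sum>l. (real l + 2) * (1 / 2 powr e) ^ l)"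
    and ac: "a < c" and \<U>: "interval_family \<U>" and sub: "\<And>U. U \<in> \<U> \<Longrightarrow> a \<le> fst U \<and> snd U \<le> c"
    and O: "\<Omega> \<in> sets lebesgue" "\<And>U. U \<in> \<U> \<Longrightarrow> {fst U<..<snd U} \<subseteq> \<Omega>"
    and \<kappa>: "0 < \<kappa>" and dens: "\<And>h. 0 < h \<Longrightarrow> emeasure lebesgue (\<Omega> \<inter> {a<..<a + h}) \<le> ennreal (\<kappa> * h)"
  shows "(\<integral>\<^sup>+x\<in>{..a}. tails q \<U> x \<partial>W) \<le> ennreal ((2 * \<kappa>) powr q * (1 + D * Sl * 2 powr q)) * (\<integral>\<^sup>+x. ennreal (tail q a c x) \<partial>W)"
proof -
  define L where "L = c - a"
  have L: "0 < L" using ac by (simp add: L_def)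
  let ?T = "\<integral>\<^sup>+x. ennreal (tail q a c x) \<partial>W"
  define B where "B = (2 * \<kappa>) powr q"
  have B: "0 < B" using \<kappa> by (simp add: B_def)
  have grp: "tails q \<V> x \<le> ennreal ((\<kappa> * h / \<rho>) powr q)"
    if "\<V> \<subseteq> \<U>" "0 < h" "0 < \<rho>" "\<And>U. U \<in> \<V> \<Longrightarrow> \<rho> \<le> snd U - x" "\<And>U. U \<in> \<V> \<Longrightarrow> snd U \<le> a + h" for \<V> h \<rho> x
  proof (rule tails_group_le[OF interval_family_subset[OF \<U> that(1)] q that(3) _ that(4)])
    show "0 < \<kappa> * h" using \<kappa> that by simp
    show "\<Omega> \<inter> {a<..<a + h} \<in> sets lebesgue" using O by auto
    show "emeasure lebesgue (\<Omega> \<inter> {a<..<a + h}) \<le> ennreal (\<kappa> * h)" by (rule dens) fact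
    fix U assume U: "U \<in> \<V>"
    then have "a \<le> fst U" using sub that(1) by blast
    then show "{fst U<..<snd U} \<subseteq> \<Omega> \<inter> {a<..<a + h}" using O(2)[of U] that(1) that(5)[OF U] U by fastforce
  qed
  have gt: "a < snd U" if "U \<in> \<U>" for U
    using sub[OF that] \<U> that by (auto simp: interval_family_def intro: le_less_trans)
  have far: "tails q \<U> x \<le> ennreal B * ennreal (tail q a c x)" if x: "x \<le> a - L" for x
  proof -
    have pos: "0 < c - x" using x L by (simp add: L_def)
    have "tails q \<U> x \<le> ennreal ((\<kappa> * L / ((c - x) / 2)) powr q)"
    proof (rule grp)
      fix U assume U: "U \<in> \<U>"
      show "(c - x) / 2 \<le> snd U - x" using gt[OF U] x by (simp add: L_def field_simps)
      show "snd U \<le> a + L" using sub[OF U] by (simp add: L_def)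
    qed (use pos L in auto)
    also have "(\<kappa> * L / ((c - x) / 2)) powr q = B * (L / (c - x)) powr q"
      using \<kappa> L pos unfolding B_def by (subst powr_mult[symmetric]) (auto simp: field_simps)
    also have "(L / (c - x)) powr q = tail q a c x"
      using x L by (simp add: tail_def L_def min_def)
    finally show ?thesis using B by (simp add: ennreal_mult)
  qed
  define E where "E l = {x \<in> {a - L<..<a}. a - x \<le> L / 2 ^ l}" for l :: nat
  have Eeq: "E l = {a - L<..<a} \<inter> {a - L / 2 ^ l..}" for l by (auto simp: E_def)
  have E: "E l \<in> sets lebesgue" for l unfolding Eeq by simp
  have near: "tails q \<U> x \<le> (\<Sum>l. ennreal ((real l + 2) * B) * indicator (E l) x)" if x: "a - L < x" "x < a" for x
  proof -
    define r where "r = a - x"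
    have r: "0 < r" "r < L" using x by (auto simp: r_def)
    then have "1 \<le> L / r" by simp
    then obtain l where l: "2 ^ l \<le> L / r" "L / r < 2 ^ Suc l" using dyadic_scale by blast
    then have l': "2 ^ l * r \<le> L" "L < 2 ^ Suc l * r" using r by (auto simp: field_simps)
    have xE: "x \<in> E l" using l'(1) x by (simp add: E_def r_def field_simps)
    define V where "V j = {U \<in> \<U>. 2 ^ j * r \<le> snd U - x \<and> snd U - x < 2 ^ Suc j * r}" for j :: nat
    have "tails q \<U> x \<le> (\<Sum>j\<in>{..<l + 2}. tails q (V j) x)"
    proof (rule tails_le_sum_groups)
      fix U assume U: "U \<in> \<U>"
      have "r \<le> snd U - x" using gt[OF U] by (simp add: r_def)
      then have "1 \<le> (snd U - x) / r" using r by simp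
      then obtain j where j: "2 ^ j \<le> (snd U - x) / r" "(snd U - x) / r < 2 ^ Suc j" using dyadic_scale by blast
      then have j': "2 ^ j * r \<le> snd U - x" "snd U - x < 2 ^ Suc j * r" using r by (auto simp: field_simps)
      have "snd U - x \<le> L + r" using sub[OF U] by (simp add: L_def r_def)
      also have "\<dots> < 2 ^ Suc l * r + 2 ^ Suc l * r"
        using l'(2) r mult_right_mono[of 1 "2 ^ Suc l" r] one_le_power[of "2::real" "Suc l"] by (intro add_less_le_mono) auto
      also have "\<dots> = 2 ^ (l + 2) * r" by simp
      finally have "2 ^ j * r < 2 ^ (l + 2) * r" using j'(1) by linarith
      then have "(2::real) ^ j < 2 ^ (l + 2)" using r by simp
      then have "j < l + 2" by (subst (asm) power_strict_increasing_iff) auto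
      then show "\<exists>j\<in>{..<l + 2}. U \<in> V j" using j' U by (auto simp: V_def)
    qed simp
    also have "\<dots> \<le> (\<Sum>j\<in>{..<l + 2}. ennreal B)"
    proof (rule sum_mono)
      fix j
      have "tails q (V j) x \<le> ennreal ((\<kappa> * (2 ^ Suc j * r) / (2 ^ j * r)) powr q)"
      proof (rule grp)
        fix U assume U: "U \<in> V j"
        then show "2 ^ j * r \<le> snd U - x" by (simp add: V_def)
        have "snd U - x < 2 ^ Suc j * r" using U by (simp add: V_def)
        then show "snd U \<le> a + 2 ^ Suc j * r" using x by linarith
      qed (use r in \<open>auto simp: V_def\<close>)
      also have "\<kappa> * (2 ^ Suc j * r) / (2 ^ j * r) = 2 * \<kappa>" using r by simp
      finally show "tails q (V j) x \<le> ennreal B" by (simp add: B_def)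
    qed
    also have "\<dots> = ennreal ((real l + 2) * B)"
      using B by (subst sum_ennreal) (auto simp: algebra_simps)
    also have "\<dots> = (\<Sum>l\<in>{l}. ennreal ((real l + 2) * B) * indicator (E l) x)" using xE by simp
    also have "\<dots> \<le> (\<Sum>l. ennreal ((real l + 2) * B) * indicator (E l) x)" by (rule sum_le_suminf) auto
    finally show ?thesis .
  qed
  have WE: "emeasure W (E l) \<le> ennreal (D * (1 / 2 ^ l) powr e) * (\<integral>\<^sup>+x. ennreal (tail q (a - L) c x) \<partial>W)" for l
  proof (rule wb[unfolded whitney_bound_def, rule_format], intro conjI allI E)
    show "a - L < c" "0 \<le> (1::real) / 2 ^ l" using L ac by auto
    show "E l \<subseteq> {a - L<..<c}" using ac by (auto simp: E_def)
    fix j :: nat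
    \<comment> \<open>\<open>E l\<close> is contained in the first Whitney interval \<open>(a - L, a)\<close> of \<open>(a - L, c)\<close>.\<close>
    have eq: "c - (a - L) = 2 * L" by (simp add: L_def)
    show "emeasure lebesgue (E l \<inter> {c - (c - (a - L)) / 2 ^ j<..<c - (c - (a - L)) / 2 ^ Suc j})
       \<le> ennreal (1 / 2 ^ l * ((c - (a - L)) / 2 ^ Suc j))"
    proof (cases "j = 0")
      case True
      have "emeasure lebesgue (E l \<inter> {c - (c - (a - L)) / 2 ^ j<..<c - (c - (a - L)) / 2 ^ Suc j}) \<le> emeasure lebesgue {a - L / 2 ^ l..a}"
        by (rule emeasure_mono) (auto simp: E_def)
      also have "\<dots> = ennreal (L / 2 ^ l)" using L by simp
      finally show ?thesis unfolding eq True by simp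
    next
      case False
      have "2 * L / 2 ^ j \<le> L"
      proof -
        have "(2::real) ^ 1 \<le> 2 ^ j" using False by (intro power_increasing) auto
        then show ?thesis using L mult_right_mono[of 2 "2 ^ j" L] by (simp add: field_simps)
      qed
      then have "E l \<inter> {c - (c - (a - L)) / 2 ^ j<..<c - (c - (a - L)) / 2 ^ Suc j} = {}"
        unfolding eq by (auto simp: E_def L_def)
      then show ?thesis by simp
    qed
  qed
  have tmW: "(\<lambda>x. ennreal (tail q a c x)) \<in> borel_measurable W" for a c
    unfolding measurable_cong_sets[OF sW refl] by measurable
  have T2: "(\<integral>\<^sup>+x. ennreal (tail q (a - L) c x) \<partial>W) \<le> ennreal (2 powr q) * ?T"
  proof -
    have "(\<integral>\<^sup>+x. ennreal (tail q (a - L) c x) \<partial>W) \<le> (\<integral>\<^sup>+x. ennreal (2 powr q) * ennreal (tail q a c x) \<partial>W)"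
      using tail_double_le[OF ac, of q] q unfolding L_def
      by (intro nn_integral_mono) (auto simp flip: ennreal_mult intro!: ennreal_leI)
    also have "\<dots> = ennreal (2 powr q) * ?T" by (rule nn_integral_cmult) (rule tmW)
    finally show ?thesis .
  qed
  have \<rho>: "0 < 1 / 2 powr e" "1 / 2 powr e < 1" using e by auto
  have sm: "summable (\<lambda>l. (real l + 2) * (1 / 2 powr e) ^ l)" by (rule summable_linear_geometric[OF \<rho>])
  have EW: "E l \<in> sets W" for l using E sW by simp
  have "(\<integral>\<^sup>+x\<in>{..a}. tails q \<U> x \<partial>W) \<le> (\<integral>\<^sup>+x. ennreal B * ennreal (tail q a c x) + (\<Sum>l. ennreal ((real l + 2) * B) * indicator (E l) x) \<partial>W)"
  proof (rule nn_integral_mono_AE)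
    have "AE x in W. x \<noteq> a"
      using nW[of a] by (intro AE_I[where N = "{a}"]) (auto simp: sW)
    then show "AE x in W. tails q \<U> x * indicator {..a} x \<le> ennreal B * ennreal (tail q a c x) + (\<Sum>l. ennreal ((real l + 2) * B) * indicator (E l) x)"
    proof eventually_elim
      case (elim x)
      consider "x \<le> a - L" | "a - L < x" "x < a" | "a < x" using elim by linarith
      then show ?case
      proof cases
        case 1 then show ?thesis using far[OF 1] L by (auto simp: indicator_def intro: add_increasing2)
      next
        case 2 then show ?thesis using near[OF 2] by (auto simp: indicator_def intro: add_increasing)
      qed simp
    qed
  qed
  also have "\<dots> = (\<integral>\<^sup>+x. ennreal B * ennreal (tail q a c x) \<partial>W) + (\<integral>\<^sup>+x. (\<Sum>l. ennreal ((real l + 2) * B) * indicator (E l) x) \<partial>W)"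
    by (rule nn_integral_add)
      (use EW tmW in \<open>auto intro!: borel_measurable_suminf_order borel_measurable_times_ennreal borel_measurable_indicator\<close>)
  also have "(\<integral>\<^sup>+x. ennreal B * ennreal (tail q a c x) \<partial>W) = ennreal B * ?T" by (rule nn_integral_cmult) (rule tmW)
  also have "(\<integral>\<^sup>+x. (\<Sum>l. ennreal ((real l + 2) * B) * indicator (E l) x) \<partial>W) = (\<Sum>l. ennreal ((real l + 2) * B) * emeasure W (E l))"
    using EW by (subst nn_integral_suminf) (auto simp: nn_integral_cmult_indicator)
  also have "\<dots> \<le> (\<Sum>l. ennreal (B * D * 2 powr q * ((real l + 2) * (1 / 2 powr e) ^ l)) * ?T)"
  proof (rule suminf_le)
    fix l
    have "(1 / 2 ^ l) powr e = (1 / 2 powr e) ^ l"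
    proof -
      have "(1 / 2 ^ l) powr e = 1 / ((2 powr real l) powr e)" by (simp add: powr_divide powr_realpow)
      also have "(2 powr real l) powr e = (2 powr e) powr real l" by (simp only: powr_powr mult.commute)
      also have "\<dots> = (2 powr e) ^ l" by (simp add: powr_realpow)
      finally show ?thesis by (simp add: power_one_over)
    qed
    then have "emeasure W (E l) \<le> ennreal (D * (1 / 2 powr e) ^ l) * (\<integral>\<^sup>+x. ennreal (tail q (a - L) c x) \<partial>W)"
      using WE[of l] by (simp only:)
    also have "\<dots> \<le> ennreal (D * (1 / 2 powr e) ^ l) * (ennreal (2 powr q) * ?T)"
      by (intro mult_left_mono T2) simp
    finally have "emeasure W (E l) \<le> ennreal (D * (1 / 2 powr e) ^ l) * (ennreal (2 powr q) * ?T)" .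
    then have "ennreal ((real l + 2) * B) * emeasure W (E l) \<le> ennreal ((real l + 2) * B) * (ennreal (D * (1 / 2 powr e) ^ l) * (ennreal (2 powr q) * ?T))"
      by (rule mult_left_mono) simp
    also have "\<dots> = (ennreal ((real l + 2) * B) * ennreal (D * (1 / 2 powr e) ^ l) * ennreal (2 powr q)) * ?T" by (simp only: mult.assoc)
    also have "ennreal ((real l + 2) * B) * ennreal (D * (1 / 2 powr e) ^ l) * ennreal (2 powr q)
      = ennreal ((real l + 2) * B * (D * (1 / 2 powr e) ^ l) * 2 powr q)"
      using B D by (subst ennreal_mult; simp)+
    also have "(real l + 2) * B * (D * (1 / 2 powr e) ^ l) * 2 powr q = B * D * 2 powr q * ((real l + 2) * (1 / 2 powr e) ^ l)" by (simp only: mult_ac)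
    finally show "ennreal ((real l + 2) * B) * emeasure W (E l) \<le> ennreal (B * D * 2 powr q * ((real l + 2) * (1 / 2 powr e) ^ l)) * ?T" .
  qed auto
  also have "\<dots> = (\<Sum>l. ennreal (B * D * 2 powr q * ((real l + 2) * (1 / 2 powr e) ^ l))) * ?T" by (rule ennreal_suminf_multc)
  also have "(\<Sum>l. ennreal (B * D * 2 powr q * ((real l + 2) * (1 / 2 powr e) ^ l))) = ennreal (B * D * 2 powr q * Sl)"
  proof (rule suminf_ennreal_eq)
    show "(\<lambda>l. B * D * 2 powr q * ((real l + 2) * (1 / 2 powr e) ^ l)) sums (B * D * 2 powr q * Sl)"
      unfolding Sl by (intro sums_mult summable_sums sm)
  qed (use B D in auto)
  also have "ennreal B * ?T + ennreal (B * D * 2 powr q * Sl) * ?T = (ennreal B + ennreal (B * D * 2 powr q * Sl)) * ?T"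
    by (rule distrib_right[symmetric])
  also have "ennreal B + ennreal (B * D * 2 powr q * Sl) = ennreal (B * (1 + D * Sl * 2 powr q))"
  proof -
    have "0 \<le> Sl" unfolding Sl by (rule suminf_nonneg[OF sm]) auto
    then show ?thesis using B D by (subst ennreal_plus[symmetric]) (auto simp: algebra_simps)
  qed
  finally show ?thesis by (simp add: B_def add_left_mono)
qed

lemma measurable_lebesgue_sets: "sets W = sets lebesgue \<Longrightarrow> f \<in> borel_measurable lebesgue \<Longrightarrow> f \<in> borel_measurable W"
  by (subst measurable_cong_sets[of W lebesgue borel borel]) auto

text \<open>One step from level \<open>t\<close> to level \<open>2^N t\<close> below an interval \<open>(a, c)\<close> whose left endpoint is
  good for \<open>t\<close>. Inside \<open>(a, c)\<close> the bound is \<open>weighted_tails_bound\<close>. On the left the density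
  \<open>20 / 2^N\<close> of \<open>level_density\<close> gives the factor \<open>(40 / 2^N)^q\<close>. This beats \<open>2^(-N p)\<close> for large
  \<open>N\<close> because \<open>p < q\<close>; the factor \<open>1/2\<close> in front allows absorption. \<open>N\<close> and \<open>K\<close> depend on the
  weight and the exponents only.\<close>

lemma good_interval_step:
  assumes sW: "sets W = sets lebesgue" and nW: "\<And>x. emeasure W {x} = 0"
    and wb: "whitney_bound W q e D" and q: "1 < q" and e: "0 < e" and D: "0 < D" and p: "p < q"
  shows "\<exists>N::nat. 1 \<le> N \<and> (\<exists>K>0. \<forall>\<alpha> k f t a c \<U>. 0 < \<alpha> \<longrightarrow> \<alpha> < 1 \<longrightarrow> f \<in> borel_measurable lebesgue \<longrightarrow> (\<forall>y. 0 \<le> f y) \<longrightarrow>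
     0 < t \<longrightarrow> a < c \<longrightarrow> a \<notin> level \<alpha> k f t \<longrightarrow> interval_family \<U> \<longrightarrow>
     (\<forall>U\<in>\<U>. a \<le> fst U \<and> snd U \<le> c \<and> {fst U<..<snd U} \<subseteq> level \<alpha> k f (2 ^ N * t)) \<longrightarrow>
     (\<integral>\<^sup>+x. tails q \<U> x \<partial>W) \<le> ennreal K * emeasure W {a<..<c} + ennreal (1 / (2 * (2 powr p) ^ N)) * (\<integral>\<^sup>+x. ennreal (tail q a c x) \<partial>W))"
proof -
  define Sl where "Sl = (\<Sum>l. (real l + 2) * (1 / 2 powr e) ^ l)"
  have "0 \<le> Sl" unfolding Sl_def by (rule suminf_nonneg[OF summable_linear_geometric]) (use e in auto)
  define C1 where "C1 = 40 powr q * (1 + D * Sl * 2 powr q)"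
  have C1: "0 < C1" using \<open>0 \<le> Sl\<close> D by (simp add: C1_def add_pos_nonneg)
  define r where "r = 2 powr p / 2 powr q"
  have r: "0 < r" "r < 1" using p by (auto simp: r_def)
  obtain n where n: "r ^ n < 1 / (4 * C1)" using real_arch_pow_inv[of "1 / (4 * C1)" r] r C1 by auto
  define N where "N = Suc n"
  have "r ^ N \<le> r ^ n" using r by (simp add: N_def mult_left_le_one_le)
  then have N: "r ^ N < 1 / (4 * C1)" using n by simp
  \<comment> \<open>Half of the allowed coefficient for each of the two regions.\<close>
  define \<eta> where "\<eta> = 1 / (4 * (2 powr p) ^ N)"
  have \<eta>: "0 < \<eta>" by (simp add: \<eta>_def)
  obtain K where K: "K > 0" and Kb: "\<forall>a c \<U>. a < c \<longrightarrow> interval_family \<U> \<longrightarrow> (\<forall>U\<in>\<U>. a \<le> fst U \<and> snd U \<le> c) \<longrightarrow>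
     (\<integral>\<^sup>+x\<in>{a<..<c}. tails q \<U> x \<partial>W) \<le> ennreal K * emeasure W {a<..<c} + ennreal \<eta> * (\<integral>\<^sup>+x. ennreal (tail q a c x) \<partial>W)"
    using weighted_tails_bound[OF sW wb q e D \<eta>] by (elim exE conjE) (rule that)
  show ?thesis
  proof (intro exI[of _ N] conjI exI[of _ K] allI impI K)
    show "1 \<le> N" by (simp add: N_def)
    fix \<alpha> k f t a c \<U>
    assume \<alpha>: "0 < \<alpha>" "\<alpha> < 1" and fm: "f \<in> borel_measurable lebesgue" and f0: "\<forall>y. (0::real) \<le> f y" and t: "0 < t"
      and ac: "(a::real) < c" and a: "a \<notin> level \<alpha> k f t" and \<U>: "interval_family \<U>"
      and sub: "\<forall>U\<in>\<U>. a \<le> fst U \<and> snd U \<le> c \<and> {fst U<..<snd U} \<subseteq> level \<alpha> k f (2 ^ N * t)"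
    let ?T = "\<integral>\<^sup>+x. ennreal (tail q a c x) \<partial>W"
    define \<kappa> where "\<kappa> = 20 / (2::real) ^ N"
    have \<kappa>: "0 < \<kappa>" by (simp add: \<kappa>_def)
    have op: "open (level \<alpha> k f (2 ^ N * t))" using f0 t \<alpha> by (intro open_level fm) auto
    have left: "(\<integral>\<^sup>+x\<in>{..a}. tails q \<U> x \<partial>W) \<le> ennreal ((2 * \<kappa>) powr q * (1 + D * Sl * 2 powr q)) * ?T"
    proof (rule tails_left_of_good_point[OF sW nW wb q e D Sl_def ac \<U>])
      show "level \<alpha> k f (2 ^ N * t) \<in> sets lebesgue" using op by (simp add: borel_open)
      show "emeasure lebesgue (level \<alpha> k f (2 ^ N * t) \<inter> {a<..<a + h}) \<le> ennreal (\<kappa> * h)" if "0 < h" for h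
        using level_density[OF fm _ t \<alpha> a that, of N] f0 by (simp add: \<kappa>_def N_def mult.commute)
    qed (use sub \<kappa> in auto)
    have C: "(2 * \<kappa>) powr q * (1 + D * Sl * 2 powr q) \<le> \<eta>"
    proof -
      have "((2::real) ^ N) powr q = (2 powr q) ^ N"
        by (rule two_power_powr)
      then have "(2 * \<kappa>) powr q = 40 powr q / (2 powr q) ^ N" by (simp add: \<kappa>_def powr_divide)
      then have "(2 * \<kappa>) powr q * (1 + D * Sl * 2 powr q) = C1 * r ^ N / (2 powr p) ^ N"
        by (simp add: C1_def r_def power_divide)
      also have "\<dots> \<le> 1 / 4 / (2 powr p) ^ N"
        using N C1 by (intro divide_right_mono) (auto simp: field_simps)
      finally show ?thesis by (simp add: \<eta>_def)
    qed
    have tm: "tails q \<U> \<in> borel_measurable W" by (rule measurable_lebesgue_sets[OF sW tails_measurable[OF \<U>]])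
    have "(\<integral>\<^sup>+x. tails q \<U> x \<partial>W) = (\<integral>\<^sup>+x. tails q \<U> x * indicator {..a} x + tails q \<U> x * indicator {a<..<c} x \<partial>W)"
    proof (rule nn_integral_cong)
      fix x
      have "tails q \<U> x = 0" if "c \<le> x"
      proof -
        have "tail q (fst U) (snd U) x = 0" if "U \<in> \<U>" for U
        proof -
          have "snd U \<le> x" using sub that \<open>c \<le> x\<close> by fastforce
          then show ?thesis by (simp add: tail_def)
        qed
        then show ?thesis unfolding tails_def by (subst nn_integral_0_iff_AE) (auto simp: AE_count_space)
      qed
      then show "tails q \<U> x = tails q \<U> x * indicator {..a} x + tails q \<U> x * indicator {a<..<c} x"
        using ac by (auto simp: indicator_def)
    qed
    also have "\<dots> = (\<integral>\<^sup>+x\<in>{..a}. tails q \<U> x \<partial>W) + (\<integral>\<^sup>+x\<in>{a<..<c}. tails q \<U> x \<partial>W)"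
    proof (rule nn_integral_add)
      show "(\<lambda>x. tails q \<U> x * indicator {..a} x) \<in> borel_measurable W"
        by (rule borel_measurable_times_ennreal[OF tm borel_measurable_indicator]) (simp add: sW)
      show "(\<lambda>x. tails q \<U> x * indicator {a<..<c} x) \<in> borel_measurable W"
        by (rule borel_measurable_times_ennreal[OF tm borel_measurable_indicator]) (simp add: sW)
    qed
    also have "\<dots> \<le> ennreal \<eta> * ?T + (ennreal K * emeasure W {a<..<c} + ennreal \<eta> * ?T)"
    proof (rule add_mono)
      show "(\<integral>\<^sup>+x\<in>{..a}. tails q \<U> x \<partial>W) \<le> ennreal \<eta> * ?T"
        by (rule order_trans[OF left]) (intro mult_right_mono ennreal_leI C, simp)
      show "(\<integral>\<^sup>+x\<in>{a<..<c}. tails q \<U> x \<partial>W) \<le> ennreal K * emeasure W {a<..<c} + ennreal \<eta> * ?T"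
        by (rule Kb[rule_format, OF ac \<U>]) (use sub in auto)
    qed
    also have "\<dots> = ennreal K * emeasure W {a<..<c} + (ennreal \<eta> + ennreal \<eta>) * ?T"
      by (simp add: distrib_right add_ac)
    also have "ennreal \<eta> + ennreal \<eta> = ennreal (1 / (2 * (2 powr p) ^ N))"
      using \<eta> by (subst ennreal_plus[symmetric]) (auto simp: \<eta>_def)
    finally show "(\<integral>\<^sup>+x. tails q \<U> x \<partial>W) \<le> ennreal K * emeasure W {a<..<c} + ennreal (1 / (2 * (2 powr p) ^ N)) * ?T" .
  qed
qed

text \<open>Every interval of \<open>\<U>\<close> has a parent \<open>V\<close> with \<open>U \<in> F V\<close>, so the sum over the parents counts it
  at least once.\<close>

lemma tails_le_nn_integral_parents:
  assumes c: "countable \<P>" "countable \<U>" and ex: "\<And>U. U \<in> \<U> \<Longrightarrow> \<exists>V\<in>\<P>. U \<in> F V" and F: "\<And>V. F V \<subseteq> \<U>"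
  shows "tails q \<U> x \<le> (\<integral>\<^sup>+V. tails q (F V) x \<partial>count_space \<P>)"
proof -
  let ?t = "\<lambda>U. ennreal (tail q (fst U) (snd U) x)"
  have tF: "tails q (F V) x = (\<integral>\<^sup>+U. ?t U * indicator (F V) U \<partial>count_space \<U>)" for V
  proof -
    have "(\<integral>\<^sup>+U. ?t U * indicator (F V) U \<partial>count_space \<U>) = (\<integral>\<^sup>+U. ?t U * indicator (F V) U * indicator \<U> U \<partial>count_space UNIV)"
      by (rule nn_integral_count_space_indicator) simp
    also have "\<dots> = tails q (F V) x"
      unfolding tails_eq_UNIV by (rule nn_integral_cong) (use F[of V] in \<open>auto simp: indicator_def\<close>)
    finally show ?thesis by simp
  qed
  have "tails q \<U> x \<le> (\<integral>\<^sup>+U. (\<integral>\<^sup>+V. ?t U * indicator (F V) U \<partial>count_space \<P>) \<partial>count_space \<U>)"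
    unfolding tails_def
  proof (rule nn_integral_mono)
    fix U assume "U \<in> space (count_space \<U>)"
    then have "U \<in> \<U>" by simp
    from ex[OF this] obtain V where V: "V \<in> \<P>" "U \<in> F V" by blast
    have "?t U = (\<integral>\<^sup>+V'. ?t U * indicator {V} V' \<partial>count_space \<P>)"
      using V by (subst nn_integral_cmult_indicator) (auto simp: emeasure_count_space)
    also have "\<dots> \<le> (\<integral>\<^sup>+V. ?t U * indicator (F V) U \<partial>count_space \<P>)"
      by (rule nn_integral_mono) (use V in \<open>auto simp: indicator_def\<close>)
    finally show "?t U \<le> (\<integral>\<^sup>+V. ?t U * indicator (F V) U \<partial>count_space \<P>)" .
  qed
  also have "\<dots> = (\<integral>\<^sup>+V. (\<integral>\<^sup>+U. ?t U * indicator (F V) U \<partial>count_space \<U>) \<partial>count_space \<P>)"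
    by (rule nn_integral_count_space_nn_integral) (use c in auto)
  also have "\<dots> = (\<integral>\<^sup>+V. tails q (F V) x \<partial>count_space \<P>)" by (simp add: tF)
  finally show ?thesis .
qed

section \<open>Level sets of a bounded function of compact support\<close>

locale truncated =
  fixes \<alpha> R F :: real and k :: nat and f :: "real \<Rightarrow> real"
  assumes \<alpha>: "0 < \<alpha>" "\<alpha> < 1" and fm [measurable]: "f \<in> borel_measurable lebesgue" and f0: "\<And>y. 0 \<le> f y"
    and fF: "\<And>y. f y \<le> F" and supp: "\<And>y. R < \<bar>y\<bar> \<Longrightarrow> f y = 0" and R: "0 < R" and F: "0 < F"
begin

abbreviation "lev \<equiv> level \<alpha> k f"
abbreviation "mass \<equiv> orlicz_mass k f"

lemma open_lev: "0 < t \<Longrightarrow> open (lev t)"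
  by (rule open_level[OF fm f0]) (use \<alpha> in auto)

lemma lev_measurable: "0 < t \<Longrightarrow> lev t \<in> sets lebesgue"
  using open_lev by (simp add: borel_open)

lemma mass_outside:
  assumes "\<And>y. y \<in> A \<Longrightarrow> R < \<bar>y\<bar>"
  shows "mass s A = 0"
proof -
  have "mass s A = (\<integral>\<^sup>+(y::real). 0 \<partial>lebesgue)"
    unfolding orlicz_mass_def by (rule nn_integral_cong) (use assms in \<open>auto simp: indicator_def supp\<close>)
  then show ?thesis by simp
qed

lemma lev_less_R: "x \<in> lev t \<Longrightarrow> x < R"
proof (rule ccontr)
  assume x: "x \<in> lev t" "\<not> x < R"
  then obtain h where h: "0 < h" "ennreal h < mass (h powr \<alpha> / t) {x<..<x + h}" by (auto simp: level_def)
  have "mass (h powr \<alpha> / t) {x<..<x + h} = 0" by (rule mass_outside) (use x R in auto)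
  then show False using h by simp
qed

lemma lev_antimono: "0 < t \<Longrightarrow> t \<le> t' \<Longrightarrow> lev t' \<subseteq> lev t"
  by (rule level_antimono) (use f0 in auto)

text \<open>The modular of a bounded function supported in \<open>[-R, R]\<close> with scaling \<open>h powr \<alpha> / t\<close> grows at
  most like \<open>h powr (\<alpha> * \<gamma>)\<close> for any \<open>\<gamma> > 1\<close>. As \<open>\<alpha> < 1\<close>, one can choose \<open>\<gamma>\<close> with \<open>\<alpha> * \<gamma> < 1\<close>,
  and then the modular cannot exceed a large \<open>h\<close>.\<close>

lemma witness_bounded:
  assumes t: "0 < t"
  obtains H where "0 < H" "\<And>x h. 0 < h \<Longrightarrow> ennreal h < mass (h powr \<alpha> / t) {x<..<x + h} \<Longrightarrow> h \<le> H"
proof -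
  define \<gamma> where "\<gamma> = (1 + 1 / \<alpha>) / 2"
  have \<gamma>: "1 < \<gamma>" using \<alpha> by (simp add: \<gamma>_def field_simps)
  define \<delta> where "\<delta> = \<alpha> * \<gamma>"
  have \<delta>: "0 < \<delta>" "\<delta> < 1"
  proof -
    show "0 < \<delta>" unfolding \<delta>_def using \<alpha> \<gamma> by (intro mult_pos_pos) auto
    have "\<delta> = (\<alpha> + 1) / 2" using \<alpha> by (simp add: \<delta>_def \<gamma>_def field_simps)
    then show "\<delta> < 1" using \<alpha> by simp
  qed
  obtain C where C: "0 < C" "\<And>u. 1 \<le> u \<Longrightarrow> LlogL k u \<le> C * u powr \<gamma>" using LlogL_growth[OF \<gamma>] by metis
  have growth: "LlogL k u \<le> 1 + C * u powr \<gamma>" if "0 \<le> u" for u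
  proof (cases "1 \<le> u")
    case True then show ?thesis using C(2)[OF True] by simp
  next
    case False
    then have "LlogL k u \<le> 1" using that by (simp add: LlogL_le_1)
    then show ?thesis using C(1) by (simp add: add_increasing2)
  qed
  define K where "K = 2 * R * C * (F / t) powr \<gamma>"
  have K: "0 < K" using R C F t by (simp add: K_def)
  define H where "H = Max {1, 4 * R, (2 * K) powr (1 / (1 - \<delta>))}"
  show thesis
  proof (rule that[of H])
    show "0 < H" unfolding H_def by (subst Max_gr_iff) auto
    fix x h :: real assume h: "0 < h" and lt: "ennreal h < mass (h powr \<alpha> / t) {x<..<x + h}"
    show "h \<le> H"
    proof (rule ccontr)
      assume "\<not> h \<le> H"
      then have hH: "1 < h" "4 * R < h" "(2 * K) powr (1 / (1 - \<delta>)) < h" by (auto simp: H_def)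
      have "mass (h powr \<alpha> / t) {x<..<x + h} \<le> (\<integral>\<^sup>+y. ennreal (1 + C * (F * (h powr \<alpha> / t)) powr \<gamma>) * indicator {-R..R} y \<partial>lebesgue)"
        unfolding orlicz_mass_def
      proof (rule nn_integral_mono)
        fix y
        show "ennreal (LlogL k (f y * (h powr \<alpha> / t))) * indicator {x<..<x + h} y \<le> ennreal (1 + C * (F * (h powr \<alpha> / t)) powr \<gamma>) * indicator {-R..R} y"
        proof (cases "R < \<bar>y\<bar>")
          case True then show ?thesis by (simp add: supp)
        next
          case False
          have "LlogL k (f y * (h powr \<alpha> / t)) \<le> LlogL k (F * (h powr \<alpha> / t))"
            using f0 fF t by (intro LlogL_mono mult_right_mono) auto
          also have "\<dots> \<le> 1 + C * (F * (h powr \<alpha> / t)) powr \<gamma>" using F t by (intro growth) auto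
          finally show ?thesis using False by (auto simp: indicator_def intro!: ennreal_leI)
        qed
      qed
      also have "\<dots> = ennreal ((1 + C * (F * (h powr \<alpha> / t)) powr \<gamma>) * (2 * R))"
      proof -
        have "0 \<le> 1 + C * (F * (h powr \<alpha> / t)) powr \<gamma>" using C(1) by (intro add_nonneg_nonneg mult_nonneg_nonneg) auto
        moreover have "emeasure lebesgue {-R..R} = ennreal (2 * R)" using R by simp
        ultimately show ?thesis
          using R by (subst nn_integral_cmult_indicator, simp) (simp only: ennreal_mult[symmetric] mult_nonneg_nonneg zero_le_numeral less_imp_le)
      qed
      also have "(1 + C * (F * (h powr \<alpha> / t)) powr \<gamma>) * (2 * R) = 2 * R + K * h powr \<delta>"
      proof -
        have "(F * (h powr \<alpha> / t)) powr \<gamma> = ((F / t) * h powr \<alpha>) powr \<gamma>" by (simp add: mult.commute)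
        also have "\<dots> = (F / t) powr \<gamma> * (h powr \<alpha>) powr \<gamma>" by (rule powr_mult)
        also have "(h powr \<alpha>) powr \<gamma> = h powr \<delta>" by (simp only: powr_powr \<delta>_def)
        finally show ?thesis by (simp add: K_def algebra_simps)
      qed
      finally have "ennreal h < ennreal (2 * R + K * h powr \<delta>)" using lt by (rule less_le_trans[rotated])
      then have 1: "h < 2 * R + K * h powr \<delta>" using h by (simp add: ennreal_less_iff)
      have "2 * K = ((2 * K) powr (1 / (1 - \<delta>))) powr (1 - \<delta>)" using K \<delta> by (simp add: powr_powr)
      also have "\<dots> \<le> h powr (1 - \<delta>)" using hH \<delta> by (intro powr_mono2) auto
      finally have "2 * K * h powr \<delta> \<le> h powr (1 - \<delta>) * h powr \<delta>" by (rule mult_right_mono) simp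
      also have "\<dots> = h" using h by (simp flip: powr_add)
      finally show False using 1 hH by linarith
    qed
  qed
qed

lemma bdd_lev: assumes "0 < t" shows "bdd_above (lev t)" "bdd_below (lev t)"
proof -
  show "bdd_above (lev t)" by (rule bdd_aboveI[of _ R]) (use lev_less_R in \<open>auto intro: less_imp_le\<close>)
  obtain H where H: "0 < H" "\<And>x h. 0 < h \<Longrightarrow> ennreal h < mass (h powr \<alpha> / t) {x<..<x + h} \<Longrightarrow> h \<le> H"
    using witness_bounded[OF assms] by blast
  show "bdd_below (lev t)"
  proof (rule bdd_belowI[of _ "- R - H"])
    fix x assume "x \<in> lev t"
    then obtain h where h: "0 < h" "ennreal h < mass (h powr \<alpha> / t) {x<..<x + h}" by (auto simp: level_def)
    show "- R - H \<le> x"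
    proof (rule ccontr)
      assume "\<not> - R - H \<le> x"
      then have "x + h < - R" using H(2)[OF h] by linarith
      then have "mass (h powr \<alpha> / t) {x<..<x + h} = 0" by (intro mass_outside) auto
      then show False using h by simp
    qed
  qed
qed

lemma lev_eventually_empty: obtains t0 where "0 < t0" "\<And>t. t0 \<le> t \<Longrightarrow> lev t = {}"
proof -
  obtain H where H: "0 < H" "\<And>x h. 0 < h \<Longrightarrow> ennreal h < mass (h powr \<alpha> / 1) {x<..<x + h} \<Longrightarrow> h \<le> H"
    using witness_bounded[of 1] by auto
  define t0 where "t0 = max 1 (F * H powr \<alpha>)"
  show thesis
  proof (rule that[of t0])
    show "0 < t0" by (simp add: t0_def)
    fix t assume t: "t0 \<le> t"
    then have t1: "1 \<le> t" "F * H powr \<alpha> \<le> t" by (auto simp: t0_def)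
    show "lev t = {}"
    proof (rule ccontr)
      assume "lev t \<noteq> {}"
      then obtain x h where h: "0 < h" and lt: "ennreal h < mass (h powr \<alpha> / t) {x<..<x + h}" by (auto simp: level_def)
      have "mass (h powr \<alpha> / t) {x<..<x + h} \<le> mass (h powr \<alpha> / 1) {x<..<x + h}"
        by (rule orlicz_mass_mono) (use f0 t1 in \<open>auto simp: divide_le_eq mult_le_cancel_left1\<close>)
      with lt have "h \<le> H" by (intro H(2)[OF h]) (rule less_le_trans)
      then have hp: "h powr \<alpha> \<le> H powr \<alpha>" using h \<alpha> by (intro powr_mono2) auto
      have "mass (h powr \<alpha> / t) {x<..<x + h} \<le> (\<integral>\<^sup>+y. 1 * indicator {x<..<x + h} y \<partial>lebesgue)"
        unfolding orlicz_mass_def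
      proof (rule nn_integral_mono)
        fix y
        have "f y * h powr \<alpha> \<le> F * H powr \<alpha>" using f0 fF hp F by (intro mult_mono) auto
        then have "f y * (h powr \<alpha> / t) \<le> 1" using t1 by (simp add: divide_le_eq)
        moreover have "0 \<le> f y * (h powr \<alpha> / t)" using f0 t1 by auto
        ultimately have "LlogL k (f y * (h powr \<alpha> / t)) \<le> 1" by (simp add: LlogL_le_1)
        then show "ennreal (LlogL k (f y * (h powr \<alpha> / t))) * indicator {x<..<x + h} y \<le> 1 * indicator {x<..<x + h} y"
          by (auto simp: indicator_def)
      qed
      also have "\<dots> = ennreal h" using h by simp
      finally show False using lt by simp
    qed
  qed
qed

text \<open>Extending a witness to the left by \<open>y - x\<close> keeps it a witness if the level is lowered
  accordingly. So the maximal function decays to the left at most like the power \<open>1 - \<alpha>\<close> of the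
  ratio of the lengths.\<close>

lemma lev_shift_left:
  assumes t: "0 < t" and h: "0 < h" "ennreal h < mass (h powr \<alpha> / t) {y<..<y + h}" and xy: "x \<le> y"
  shows "x \<in> lev (t * (h / (h + (y - x))) powr (1 - \<alpha>))"
proof -
  define h' where "h' = h + (y - x)"
  define l where "l = h' / h"
  have h': "h \<le> h'" "0 < h'" using h xy by (auto simp: h'_def)
  have l: "1 \<le> l" using h h' by (simp add: l_def)
  define \<tau> where "\<tau> = t * (h / h') powr (1 - \<alpha>)"
  \<comment> \<open>The new level is chosen so that the scaling parameter grows exactly by the factor \<open>l\<close> by
    which the interval grows.\<close>
  have eq: "h' powr \<alpha> / \<tau> = l * (h powr \<alpha> / t)"
  proof -
    have "h' powr \<alpha> * h' powr (1 - \<alpha>) = h'" "h powr \<alpha> * h powr (1 - \<alpha>) = h" using h h' by (simp_all flip: powr_add)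
    moreover have "(h / h') powr (1 - \<alpha>) = h powr (1 - \<alpha>) / h' powr (1 - \<alpha>)" using h h' by (simp add: powr_divide)
    moreover have "u / (t * (y / v)) = (u * v) / (z * y) * (z / t)" if "0 < u" "0 < v" "0 < z" "0 < y" for u v z y :: real
      using that t by (simp add: field_simps)
    from this[of "h' powr \<alpha>" "h' powr (1 - \<alpha>)" "h powr \<alpha>" "h powr (1 - \<alpha>)"]
    have "h' powr \<alpha> / (t * (h powr (1 - \<alpha>) / h' powr (1 - \<alpha>))) =
      (h' powr \<alpha> * h' powr (1 - \<alpha>)) / (h powr \<alpha> * h powr (1 - \<alpha>)) * (h powr \<alpha> / t)" using h h' by simp
    ultimately show ?thesis unfolding \<tau>_def l_def by (simp only:)
  qed
  have "ennreal h' = ennreal l * ennreal h" using h l by (simp add: l_def flip: ennreal_mult)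
  also have "\<dots> < ennreal l * mass (h powr \<alpha> / t) {y<..<y + h}"
    using h l by (intro ennreal_mult_strict_left_mono) (auto simp: )
  also have "\<dots> \<le> mass (l * (h powr \<alpha> / t)) {y<..<y + h}"
    by (rule orlicz_mass_scale) (use f0 t l in auto)
  also have "\<dots> \<le> mass (h' powr \<alpha> / \<tau>) {x<..<x + h'}"
    unfolding eq by (rule orlicz_mass_mono) (use f0 t l xy in \<open>auto simp: h'_def\<close>)
  finally show ?thesis using h' unfolding level_def \<tau>_def h'_def by blast
qed

text \<open>Left of the support, moving the starting point to the right loses no mass.\<close>

lemma lev_left:
  assumes "0 < t" "y \<in> lev t" "y \<le> x" "x < - R"
  shows "x \<in> lev t"
proof -
  obtain h where h: "0 < h" "ennreal h < mass (h powr \<alpha> / t) {y<..<y + h}" using assms by (auto simp: level_def)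
  note h(2)
  also have "mass (h powr \<alpha> / t) {y<..<y + h} \<le> mass (h powr \<alpha> / t) {x<..<x + h}"
    unfolding orlicz_mass_def
  proof (rule nn_integral_mono)
    fix z
    show "ennreal (LlogL k (f z * (h powr \<alpha> / t))) * indicator {y<..<y + h} z \<le> ennreal (LlogL k (f z * (h powr \<alpha> / t))) * indicator {x<..<x + h} z"
    proof (cases "z \<le> x")
      case True then show ?thesis using assms by (simp add: supp)
    next
      case False then show ?thesis using assms by (auto simp: indicator_def)
    qed
  qed
  finally show ?thesis using h(1) unfolding level_def by blast
qed

text \<open>As \<open>t\<close> tends to \<open>0\<close> the level sets exhaust the half-line left of the support, since \<open>f\<close> does
  not vanish and the Young function is at least linear.\<close>

lemma lev_reaches_far_left:
  assumes pos: "0 < (\<integral>\<^sup>+y. ennreal (f y) \<partial>lebesgue)" and B: "R \<le> B"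
  obtains \<tau> where "0 < \<tau>" "\<And>t. 0 < t \<Longrightarrow> t \<le> \<tau> \<Longrightarrow> - B \<in> lev t"
proof -
  obtain m where m: "0 < m" "ennreal m \<le> (\<integral>\<^sup>+y. ennreal (f y) \<partial>lebesgue)"
  proof (cases "(\<integral>\<^sup>+y. ennreal (f y) \<partial>lebesgue) = top")
    case True then show ?thesis by (intro that[of 1]) auto
  next
    case False
    then obtain r where "(\<integral>\<^sup>+y. ennreal (f y) \<partial>lebesgue) = ennreal r" by (cases "\<integral>\<^sup>+y. ennreal (f y) \<partial>lebesgue") auto
    then show ?thesis using pos by (intro that[of r]) auto
  qed
  define h where "h = B + R + 1"
  have h: "0 < h" using B R by (simp add: h_def)
  define \<tau> where "\<tau> = m * h powr \<alpha> / (2 * h)"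
  have \<tau>: "0 < \<tau>" using m h by (simp add: \<tau>_def)
  show thesis
  proof (rule that[OF \<tau>])
    fix t assume t: "0 < t" "t \<le> \<tau>"
    have "ennreal h < ennreal (m * (h powr \<alpha> / t))"
    proof (rule ennreal_lessI)
      show "0 < m * (h powr \<alpha> / t)" using m h t by simp
      have "h * t \<le> h * \<tau>" using t h by simp
      also have "\<dots> < m * h powr \<alpha>" using m h by (simp add: \<tau>_def)
      finally show "h < m * (h powr \<alpha> / t)" using t by (simp add: field_simps)
    qed
    also have "\<dots> = ennreal m * ennreal (h powr \<alpha> / t)" using m t by (intro ennreal_mult) auto
    also have "\<dots> \<le> (\<integral>\<^sup>+y. ennreal (f y) \<partial>lebesgue) * ennreal (h powr \<alpha> / t)" using m by (intro mult_right_mono) auto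
    also have "\<dots> = (\<integral>\<^sup>+y. ennreal (f y) * ennreal (h powr \<alpha> / t) \<partial>lebesgue)"
      by (rule nn_integral_multc[symmetric]) measurable
    also have "\<dots> \<le> (\<integral>\<^sup>+y\<in>{-B-1<..<-B-1 + (h + 1)}. ennreal (LlogL k (f y * (h powr \<alpha> / t))) \<partial>lebesgue)"
    proof (rule nn_integral_mono)
      fix y
      show "ennreal (f y) * ennreal (h powr \<alpha> / t) \<le> ennreal (LlogL k (f y * (h powr \<alpha> / t))) * indicator {-B-1<..<-B-1 + (h + 1)} y"
      proof (cases "R < \<bar>y\<bar>")
        case True then show ?thesis by (simp add: supp)
      next
        case False
        then have "y \<in> {-B-1<..<-B-1 + (h + 1)}" using B by (auto simp: h_def)
        moreover have "f y * (h powr \<alpha> / t) \<le> LlogL k (f y * (h powr \<alpha> / t))" using f0 t by (intro LlogL_ge) auto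
        ultimately show ?thesis using f0[of y] t by (simp add: ennreal_leI flip: ennreal_mult)
      qed
    qed
    \<comment> \<open>The interval was extended by one unit to the left so as to contain \<open>[-R, R]\<close> also for
      \<open>B = R\<close>; this adds no mass.\<close>
    also have "\<dots> = (\<integral>\<^sup>+y\<in>{-B<..<-B + h}. ennreal (LlogL k (f y * (h powr \<alpha> / t))) \<partial>lebesgue)"
    proof (rule nn_integral_cong_AE)
      have "AE y in lebesgue. y \<noteq> - B" by (auto intro!: AE_completion AE_lborel_singleton)
      then show "AE y in lebesgue. ennreal (LlogL k (f y * (h powr \<alpha> / t))) * indicator {-B-1<..<-B-1 + (h + 1)} y
          = ennreal (LlogL k (f y * (h powr \<alpha> / t))) * indicator {-B<..<-B + h} y"
      proof eventually_elim
        case (elim y)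
        show ?case
        proof (cases "R < \<bar>y\<bar>")
          case True then show ?thesis by (simp add: supp)
        next
          case False then show ?thesis using elim B by (auto simp: indicator_def)
        qed
      qed
    qed
    finally show "- B \<in> lev t" using h unfolding level_def orlicz_mass_def by blast
  qed
qed

end

section \<open>Summation over the levels\<close>

text \<open>One half of the homogeneity of the integral, for functions that need not be measurable. The
  \<open>p\<close>-th power of the maximal function is such a function here.\<close>

lemma nn_integral_cmult_le:
  fixes g :: "'a \<Rightarrow> ennreal"
  assumes c: "0 < c"
  shows "(\<integral>\<^sup>+x. ennreal c * g x \<partial>M) \<le> ennreal c * (\<integral>\<^sup>+x. g x \<partial>M)"
  unfolding nn_integral_def[of M "\<lambda>x. ennreal c * g x"]
proof (rule SUP_least)
  fix s assume "s \<in> {s. simple_function M s \<and> s \<le> (\<lambda>x. ennreal c * g x)}"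
  then have s: "simple_function M s" and le: "\<And>x. s x \<le> ennreal c * g x" by (auto simp: le_fun_def)
  have one: "ennreal c * ennreal (1 / c) = 1" using c by (simp flip: ennreal_mult)
  have sm: "s \<in> borel_measurable M" by (rule borel_measurable_simple_function[OF s])
  have "integral\<^sup>S M s = (\<integral>\<^sup>+x. s x \<partial>M)" using s by (rule nn_integral_eq_simple_integral[symmetric])
  also have "\<dots> = ennreal c * (ennreal (1 / c) * (\<integral>\<^sup>+x. s x \<partial>M))" by (simp add: one mult.assoc[symmetric])
  also have "ennreal (1 / c) * (\<integral>\<^sup>+x. s x \<partial>M) = (\<integral>\<^sup>+x. ennreal (1 / c) * s x \<partial>M)"
    by (rule nn_integral_cmult[symmetric]) (rule sm)
  also have "\<dots> \<le> (\<integral>\<^sup>+x. g x \<partial>M)"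
  proof (rule nn_integral_mono)
    fix x
    have "ennreal (1 / c) * s x \<le> ennreal (1 / c) * (ennreal c * g x)" by (intro mult_left_mono le) simp
    also have "\<dots> = g x" using one by (simp add: mult.assoc[symmetric] mult.commute[of "ennreal (1 / c)"])
    finally show "ennreal (1 / c) * s x \<le> g x" .
  qed
  finally show "integral\<^sup>S M s \<le> ennreal c * (\<integral>\<^sup>+x. g x \<partial>M)" by (simp add: mult_left_mono)
qed

lemma le_two_power_mult: "0 \<le> (t::real) \<Longrightarrow> t \<le> 2 ^ n * t"
  using mult_right_mono[of 1 "2 ^ n" t] one_le_power[of "2::real" n] by simp

lemma geometric_powr_sum_le:
  fixes t p :: real
  assumes "0 < t" "0 < p"
  shows "(\<Sum>n\<le>m. (2 ^ n * t) powr p) \<le> (2 ^ m * t) powr p / (1 - 1 / 2 powr p)"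
proof -
  define \<rho> where "\<rho> = 1 / (2::real) powr p"
  have \<rho>: "0 < \<rho>" "\<rho> < 1" using assms by (auto simp: \<rho>_def)
  have "(\<Sum>n\<le>m. (2 ^ n * t) powr p) \<le> (2 ^ m * t) powr p / (1 - \<rho>)"
  proof (induction m)
    case 0
    have "t powr p * (1 - \<rho>) \<le> t powr p" using \<rho> by (intro mult_left_le) auto
    then show ?case using \<rho> by (simp add: pos_le_divide_eq)
  next
    case (Suc m)
    define X where "X = (2 ^ Suc m * t) powr p"
    have "X = 2 powr p * (2 ^ m * t) powr p" unfolding X_def by (simp only: power_Suc mult.assoc powr_mult)
    then have Xm: "(2 ^ m * t) powr p = \<rho> * X" by (simp add: \<rho>_def)
    have "(\<Sum>n\<le>Suc m. (2 ^ n * t) powr p) \<le> \<rho> * X / (1 - \<rho>) + X"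
      using Suc.IH unfolding Xm by (simp add: X_def)
    also have "\<dots> = X / (1 - \<rho>)" using \<rho> by (simp add: divide_simps) (simp add: algebra_simps)
    finally show ?case by (simp add: X_def)
  qed
  then show ?thesis by (simp add: \<rho>_def)
qed

lemma ennreal_absorb_half:
  fixes x a :: ennreal
  assumes "x \<le> a + ennreal (1/2) * x" "x < top"
  shows "x \<le> 2 * a"
proof (cases "a = top")
  case True then show ?thesis by (simp add: ennreal_mult_top)
next
  case False
  then obtain r s where r: "x = ennreal r" "0 \<le> r" and s: "a = ennreal s" "0 \<le> s"
    using assms(2) by (cases x; cases a) auto
  have "ennreal s + ennreal (1/2) * ennreal r = ennreal (s + 1/2 * r)"
  proof -
    have "ennreal (1/2) * ennreal r = ennreal (1/2 * r)" by (rule ennreal_mult[symmetric]) (use r in auto)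
    moreover have "ennreal s + ennreal (1/2 * r) = ennreal (s + 1/2 * r)" by (rule ennreal_plus[symmetric]) (use r s in auto)
    ultimately show ?thesis by (simp only:)
  qed
  then have "ennreal r \<le> ennreal (s + 1/2 * r)"
    using assms(1) unfolding r(1) s(1) by (simp only:)
  then have "r \<le> 2 * s" using r(2) s(2) by (subst (asm) ennreal_le_iff) auto
  then show ?thesis using s r by (simp add: ennreal_leI flip: ennreal_mult ennreal_numeral)
qed

lemma sum_lessThan_add: "(\<Sum>n<N + (I::nat). x n) = (\<Sum>n<N. x n) + (\<Sum>m<I. (x (N + m) :: ennreal))"
  by (induction I) (auto simp: add.assoc)

text \<open>The weight as a measure \<open>W\<close>, with the constants extracted from the weight condition.\<close>

locale one_sided_weight =
  fixes W :: "real measure" and q e D p :: real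
  assumes sW: "sets W = sets lebesgue" and nW: "\<And>x. emeasure W {x} = 0"
    and wb: "whitney_bound W q e D" and q: "1 < q" and e: "0 < e" and D: "0 < D" and p: "0 < p" "p < q"
    and finW: "\<And>r. emeasure W {-r..r} < top"
begin

abbreviation "tail_weight a c \<equiv> \<integral>\<^sup>+x. ennreal (tail q a c x) \<partial>W"

text \<open>The conclusion of \<open>good_interval_step\<close> for fixed constants. It is uniform in \<open>f\<close> and \<open>t\<close>,
  which makes the final constant independent of \<open>f\<close>.\<close>

definition step_const :: "nat \<Rightarrow> real \<Rightarrow> bool" where
  "step_const N K \<longleftrightarrow> (\<forall>\<alpha> k f t a c \<U>. 0 < \<alpha> \<longrightarrow> \<alpha> < 1 \<longrightarrow> f \<in> borel_measurable lebesgue \<longrightarrow> (\<forall>y. 0 \<le> f y) \<longrightarrow>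
     0 < t \<longrightarrow> a < c \<longrightarrow> a \<notin> level \<alpha> k f t \<longrightarrow> interval_family \<U> \<longrightarrow>
     (\<forall>U\<in>\<U>. a \<le> fst U \<and> snd U \<le> c \<and> {fst U<..<snd U} \<subseteq> level \<alpha> k f (2 ^ N * t)) \<longrightarrow>
     (\<integral>\<^sup>+x. tails q \<U> x \<partial>W) \<le> ennreal K * emeasure W {a<..<c} + ennreal (1 / (2 * (2 powr p) ^ N)) * tail_weight a c)"

lemma step_const_exists: "\<exists>N K. 1 \<le> N \<and> 0 < K \<and> step_const N K"
  using good_interval_step[OF sW nW wb q e D p(2)] unfolding step_const_def by (elim exE conjE) (intro exI conjI)

lemma tail_measurable_W: "(\<lambda>x. ennreal (tail q a c x)) \<in> borel_measurable W"
  by (rule measurable_lebesgue_sets[OF sW]) measurable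

lemma emeasure_le_tail_weight: "emeasure W {a<..<c} \<le> tail_weight a c"
proof -
  have "emeasure W {a<..<c} = (\<integral>\<^sup>+x. indicator {a<..<c} x \<partial>W)"
    by (rule nn_integral_indicator[symmetric]) (simp add: sW)
  also have "\<dots> \<le> tail_weight a c"
    by (rule nn_integral_mono) (auto simp: indicator_def tail_inside)
  finally show ?thesis .
qed

end

text \<open>The function \<open>g\<close> stands for the \<open>p\<close>-th power of the maximal function. All that the proof uses
  of it is that it is at least \<open>t^p\<close> on the level set for \<open>t\<close>, and that its integral is finite,
  as it may be assumed to be.\<close>

locale weighted_truncated = one_sided_weight W q e D p + truncated \<alpha> R F k f
  for W q e D p \<alpha> R F k f +
  fixes g :: "real \<Rightarrow> ennreal"
  assumes dom: "\<And>t x. 0 < t \<Longrightarrow> x \<in> lev t \<Longrightarrow> ennreal (t powr p) \<le> g x"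
    and nonzero: "0 < (\<integral>\<^sup>+y. ennreal (f y) \<partial>lebesgue)"
    and fing: "(\<integral>\<^sup>+x. g x \<partial>W) < top"
begin

abbreviation "G \<equiv> \<integral>\<^sup>+x. g x \<partial>W"

text \<open>The levels containing a given \<open>x\<close> form a geometric progression whose last term is at most
  \<open>g x\<close>.\<close>

lemma lev_weight_sum:
  assumes t: "0 < t"
  shows "(\<Sum>n<I. ennreal ((2 ^ n * t) powr p) * emeasure W (lev (2 ^ n * t))) \<le> ennreal (1 / (1 - 1 / 2 powr p)) * G"
proof -
  let ?C = "1 / (1 - 1 / (2::real) powr p)"
  have C: "0 < ?C" using p by simp
  have m: "lev (2 ^ n * t) \<in> sets W" for n using lev_measurable t sW by simp
  have "(\<Sum>n<I. ennreal ((2 ^ n * t) powr p) * emeasure W (lev (2 ^ n * t)))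
      = (\<Sum>n<I. \<integral>\<^sup>+x. ennreal ((2 ^ n * t) powr p) * indicator (lev (2 ^ n * t)) x \<partial>W)"
    by (rule sum.cong[OF refl]) (simp add: nn_integral_cmult_indicator m)
  also have "\<dots> = (\<integral>\<^sup>+x. (\<Sum>n<I. ennreal ((2 ^ n * t) powr p) * indicator (lev (2 ^ n * t)) x) \<partial>W)"
    by (rule nn_integral_sum[symmetric]) (intro borel_measurable_times_ennreal borel_measurable_indicator m borel_measurable_const)
  also have "\<dots> \<le> (\<integral>\<^sup>+x. ennreal ?C * g x \<partial>W)"
  proof (rule nn_integral_mono)
    fix x
    define J where "J = {n. n < I \<and> x \<in> lev (2 ^ n * t)}"
    have fJ: "finite J" by (simp add: J_def)
    have "(\<Sum>n<I. ennreal ((2 ^ n * t) powr p) * indicator (lev (2 ^ n * t)) x) = (\<Sum>n\<in>J. ennreal ((2 ^ n * t) powr p))"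
      by (rule sum.mono_neutral_cong_right) (auto simp: J_def indicator_def)
    also have "\<dots> \<le> ennreal ?C * g x"
    proof (cases "J = {}")
      case False
      define m where "m = Max J"
      have mJ: "m \<in> J" unfolding m_def using fJ False by (rule Max_in)
      have "(\<Sum>n\<in>J. ennreal ((2 ^ n * t) powr p)) \<le> (\<Sum>n\<le>m. ennreal ((2 ^ n * t) powr p))"
        by (rule sum_mono2) (use fJ in \<open>auto simp: m_def\<close>)
      also have "\<dots> = ennreal (\<Sum>n\<le>m. (2 ^ n * t) powr p)" by (rule sum_ennreal) auto
      also have "\<dots> \<le> ennreal (?C * (2 ^ m * t) powr p)"
        using geometric_powr_sum_le[OF t p(1), of m] by (intro ennreal_leI) simp
      also have "\<dots> = ennreal ?C * ennreal ((2 ^ m * t) powr p)" using C by (intro ennreal_mult) auto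
      also have "\<dots> \<le> ennreal ?C * g x" by (intro mult_left_mono dom) (use t mJ in \<open>auto simp: J_def\<close>)
      finally show ?thesis .
    qed simp
    finally show "(\<Sum>n<I. ennreal ((2 ^ n * t) powr p) * indicator (lev (2 ^ n * t)) x) \<le> ennreal ?C * g x" .
  qed
  also have "\<dots> \<le> ennreal ?C * G" by (rule nn_integral_cmult_le[OF C])
  finally show ?thesis .
qed

text \<open>The tail of the hull \<open>(A, R)\<close> of a level set that reaches far to the left of the support.
  Between \<open>A\<close> and \<open>- R\<close> every point is in the level set by \<open>lev_left\<close>. For \<open>x \<le> A\<close>, a witness
  for a point close to \<open>A\<close> extends to \<open>x\<close> by \<open>lev_shift_left\<close>, which bounds \<open>g x\<close> from below by
  \<open>t^p\<close> times the power \<open>(1 - \<alpha>) p\<close> of the ratio of the lengths. The tail decays faster, with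
  exponent \<open>q > p\<close>.\<close>

lemma hull_tail_pointwise:
  assumes t: "0 < t" and A: "A = Inf (lev t)" "A \<le> - 3 * R - 2" and ne: "lev t \<noteq> {}"
  shows "ennreal (t powr p) * ennreal (tail q A R x) \<le> ennreal (2 powr p) * g x + ennreal (t powr p) * indicator {-R..R} x"
proof -
  have le1: "tail q A R x \<le> 1" using A R q by (intro tail_le_1) auto
  consider "R \<le> x" | "- R \<le> x" "x < R" | "x < - R" "A < x" | "x \<le> A" using A R by linarith
  then show ?thesis
  proof cases
    case 1 then show ?thesis by (simp add: tail_def)
  next
    case 2
    have "ennreal (t powr p) * ennreal (tail q A R x) \<le> ennreal (t powr p) * 1"
      using le1 by (intro mult_left_mono) (auto simp: ennreal_le_1)
    also have "\<dots> = ennreal (t powr p) * indicator {-R..R} x" using 2 by simp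
    finally show ?thesis by (simp add: add_increasing)
  next
    case 3
    obtain y where y: "y \<in> lev t" "y < x" using 3(2) A(1) ne cInf_lessD by blast
    have "x \<in> lev t" by (rule lev_left[OF t y(1)]) (use y 3 in auto)
    then have gx: "ennreal (t powr p) \<le> g x" by (rule dom[OF t])
    have "ennreal (t powr p) * ennreal (tail q A R x) \<le> g x * 1"
      using le1 gx by (intro mult_mono) (auto simp: ennreal_le_1)
    also have "\<dots> \<le> ennreal (2 powr p) * g x"
    proof -
      have "(1::real) \<le> 2 powr p" using p by (simp add: ge_one_powr_ge_zero)
      then have "1 * g x \<le> ennreal (2 powr p) * g x" by (intro mult_right_mono) auto
      then show ?thesis by simp
    qed
    finally show ?thesis by (simp add: add_increasing2)
  next
    case 4
    \<comment> \<open>A point of the level set within distance \<open>1\<close> of its infimum; the assumption on \<open>A\<close> makes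
      this distance small compared with the distance from \<open>A\<close> to the support.\<close>
    have "Inf (lev t) < A + 1" using A by simp
    then obtain y where y: "y \<in> lev t" "y < A + 1" using ne cInf_lessD by blast
    have "A \<le> y" unfolding A(1) by (rule cInf_lower[OF y(1) bdd_lev(2)[OF t]])
    obtain h where h: "0 < h" and lt: "ennreal h < mass (h powr \<alpha> / t) {y<..<y + h}" using y(1) by (auto simp: level_def)
    have hR: "- R - y \<le> h"
    proof (rule ccontr)
      assume "\<not> - R - y \<le> h"
      then have "mass (h powr \<alpha> / t) {y<..<y + h} = 0" by (intro mass_outside) auto
      then show False using lt by simp
    qed
    define h' where "h' = h + (y - x)"
    have xy: "x \<le> y" using 4 \<open>A \<le> y\<close> by simp
    have h': "0 < h'" "h \<le> h'" using h xy by (auto simp: h'_def)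
    define s where "s = h / h'"
    have s: "0 < s" "s \<le> 1" using h h' by (auto simp: s_def)
    have xl: "x \<in> lev (t * s powr (1 - \<alpha>))"
      unfolding s_def h'_def by (rule lev_shift_left[OF t h lt xy])
    have pos: "0 < t * s powr (1 - \<alpha>)" using t s by simp
    have gx: "ennreal ((t * s powr (1 - \<alpha>)) powr p) \<le> g x" by (rule dom[OF pos xl])
    define \<rho> where "\<rho> = (R - A) / (R - x)"
    have Rx: "0 < R - x" "0 < R - A" using 4 A R by auto
    have \<rho>: "0 < \<rho>" "\<rho> \<le> 1" using Rx 4 by (auto simp: \<rho>_def)
    \<comment> \<open>A witness for \<open>y\<close> must reach the support, so \<open>h\<close> is comparable with \<open>R - A\<close>.\<close>
    have "\<rho> \<le> 2 * s"
    proof -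
      have b: "0 < - R - y" using y A R by linarith
      have 1: "R - A \<le> 2 * (- R - y)" using y(2) A(2) by (simp add: algebra_simps)
      have 2: "(- R - y) * h' \<le> h * (- R - x)"
      proof -
        have "(- R - y) * (y - x) \<le> h * (y - x)" using hR xy by (intro mult_right_mono) auto
        then show ?thesis unfolding h'_def by (simp add: algebra_simps)
      qed
      have "(R - A) * h' \<le> 2 * (- R - y) * h'" using 1 h' by (intro mult_right_mono) auto
      also have "\<dots> \<le> 2 * (h * (- R - x))" unfolding mult.assoc by (rule mult_left_mono[OF 2]) simp
      also have "\<dots> \<le> 2 * (h * (R - x))" using h R by simp
      finally have "(R - A) * h' \<le> 2 * h * (R - x)" by simp
      then show ?thesis unfolding \<rho>_def s_def using Rx h' by (simp add: divide_simps mult.commute)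
    qed
    have "tail q A R x = \<rho> powr q" using 4 Rx \<rho> by (simp add: tail_def \<rho>_def[symmetric] min_def)
    also have "\<dots> \<le> \<rho> powr ((1 - \<alpha>) * p)"
    proof (rule powr_mono')
      have "(1 - \<alpha>) * p \<le> 1 * p" using \<alpha> p by (intro mult_right_mono) auto
      then show "(1 - \<alpha>) * p \<le> q" using p by linarith
    qed (use \<rho> in auto)
    also have "\<dots> \<le> (2 * s) powr ((1 - \<alpha>) * p)" using \<rho> \<open>\<rho> \<le> 2 * s\<close> \<alpha> p by (intro powr_mono2) auto
    also have "\<dots> = 2 powr ((1 - \<alpha>) * p) * (s powr (1 - \<alpha>)) powr p" by (simp add: powr_mult powr_powr)
    also have "\<dots> \<le> 2 powr p * (s powr (1 - \<alpha>)) powr p"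
    proof (intro mult_right_mono powr_mono)
      have "(1 - \<alpha>) * p \<le> 1 * p" using \<alpha> p by (intro mult_right_mono) auto
      then show "(1 - \<alpha>) * p \<le> p" by linarith
    qed auto
    finally have "t powr p * tail q A R x \<le> t powr p * (2 powr p * (s powr (1 - \<alpha>)) powr p)" by (rule mult_left_mono) simp
    also have "\<dots> = 2 powr p * (t * s powr (1 - \<alpha>)) powr p" by (simp add: powr_mult)
    finally have "ennreal (t powr p * tail q A R x) \<le> ennreal (2 powr p * (t * s powr (1 - \<alpha>)) powr p)" by (rule ennreal_leI)
    also have "\<dots> = ennreal (2 powr p) * ennreal ((t * s powr (1 - \<alpha>)) powr p)" by (intro ennreal_mult) auto
    also have "\<dots> \<le> ennreal (2 powr p) * g x" by (intro mult_left_mono gx) simp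
    finally have "ennreal (t powr p) * ennreal (tail q A R x) \<le> ennreal (2 powr p) * g x"
      by (simp add: ennreal_mult)
    then show ?thesis by (simp add: add_increasing2)
  qed
qed

lemma hull_tail_integral:
  assumes t: "0 < t" and A: "A = Inf (lev t)" "A \<le> - 3 * R - 2" and ne: "lev t \<noteq> {}"
  shows "ennreal (t powr p) * tail_weight A R \<le> ennreal (2 powr p) * G + ennreal (t powr p) * emeasure W {-R..R}"
proof -
  have i: "{-R..R} \<in> sets W" by (simp add: sW)
  have c: "0 < 1 / (2::real) powr p" by simp
  let ?h = "\<lambda>x. ennreal (t powr p) * indicator {-R..R} x"
  have hm: "?h \<in> borel_measurable W" by (intro borel_measurable_times_ennreal borel_measurable_indicator i borel_measurable_const)
  have "ennreal (t powr p) * tail_weight A R = (\<integral>\<^sup>+x. ennreal (t powr p) * ennreal (tail q A R x) \<partial>W)"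
    by (rule nn_integral_cmult[symmetric]) (rule tail_measurable_W)
  also have "\<dots> \<le> (\<integral>\<^sup>+x. ennreal (t powr p) * ennreal (tail q A R x) * indicator (- {-R..R}) x \<partial>W)
      + (\<integral>\<^sup>+x. ?h x \<partial>W)"
  proof (subst nn_integral_add[symmetric])
    show "(\<lambda>x. ennreal (t powr p) * ennreal (tail q A R x) * indicator (- {-R..R}) x) \<in> borel_measurable W"
      by (intro borel_measurable_times_ennreal borel_measurable_indicator borel_measurable_const tail_measurable_W) (simp add: sW)
    show "?h \<in> borel_measurable W" by (rule hm)
    show "(\<integral>\<^sup>+x. ennreal (t powr p) * ennreal (tail q A R x) \<partial>W) \<le> (\<integral>\<^sup>+x. ennreal (t powr p) * ennreal (tail q A R x) * indicator (- {-R..R}) x + ?h x \<partial>W)"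
    proof (rule nn_integral_mono)
      fix x
      have "tail q A R x \<le> 1" using A R q by (intro tail_le_1) auto
      then have "ennreal (t powr p) * ennreal (tail q A R x) \<le> ennreal (t powr p) * 1"
        by (intro mult_left_mono) (auto simp: ennreal_le_1)
      then show "ennreal (t powr p) * ennreal (tail q A R x) \<le> ennreal (t powr p) * ennreal (tail q A R x) * indicator (- {-R..R}) x + ?h x"
        by (cases "x \<in> {-R..R}") auto
    qed
  qed
  also have "(\<integral>\<^sup>+x. ennreal (t powr p) * ennreal (tail q A R x) * indicator (- {-R..R}) x \<partial>W) \<le> (\<integral>\<^sup>+x. ennreal (2 powr p) * g x \<partial>W)"
  proof (rule nn_integral_mono)
    fix x
    show "ennreal (t powr p) * ennreal (tail q A R x) * indicator (- {-R..R}) x \<le> ennreal (2 powr p) * g x"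
      using hull_tail_pointwise[OF assms, of x] by (cases "x \<in> {-R..R}") auto
  qed
  also have "\<dots> \<le> ennreal (2 powr p) * G" by (rule nn_integral_cmult_le) simp
  also have "(\<integral>\<^sup>+x. ?h x \<partial>W) = ennreal (t powr p) * emeasure W {-R..R}" by (rule nn_integral_cmult_indicator[OF i])
  finally show ?thesis by (simp add: add_right_mono)
qed

definition tail_sum :: "real \<Rightarrow> ennreal" where
  "tail_sum t = (\<integral>\<^sup>+x. tails q (comps (lev t)) x \<partial>W)"

text \<open>For the lowest levels the hull of a lower level set plays the role of the parent component;
  its left endpoint is good because the level sets are open.\<close>

lemma tail_sum_hull_step:
  assumes st: "step_const N K" and K: "0 < K" and t: "0 < t" and s: "0 < s" "s \<le> t"
    and A: "A = Inf (lev s)" "A \<le> - 3 * R - 2" and ne: "lev s \<noteq> {}"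
  shows "tail_sum (2 ^ N * t) \<le> ennreal (K + 1) * tail_weight A R"
proof -
  have "A \<notin> lev s"
  proof
    assume "A \<in> lev s"
    then obtain d where d: "d > 0" "\<forall>y. dist y A < d \<longrightarrow> y \<in> lev s" using open_lev[OF s(1)] by (auto simp: open_dist)
    then have "A - d / 2 \<in> lev s" by (auto simp: dist_real_def)
    then have "A \<le> A - d / 2" unfolding A(1) by (rule cInf_lower[OF _ bdd_lev(2)[OF s(1)]])
    then show False using d by simp
  qed
  then have At: "A \<notin> lev t" using lev_antimono[OF s] by blast
  have sub: "lev (2 ^ N * t) \<subseteq> lev s"
  proof -
    have "t \<le> 2 ^ N * t" using t by (intro le_two_power_mult) simp
    then show ?thesis by (intro lev_antimono[OF s(1)] order_trans[OF s(2)])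
  qed
  have "tail_sum (2 ^ N * t) \<le> ennreal K * emeasure W {A<..<R} + ennreal (1 / (2 * (2 powr p) ^ N)) * tail_weight A R"
    unfolding tail_sum_def
  proof (rule st[unfolded step_const_def, rule_format, OF \<alpha> fm f0 t _ At interval_family_comps])
    show "A < R" using A R by simp
    fix U assume U: "U \<in> comps (lev (2 ^ N * t))"
    then have lt: "fst U < snd U" and IU: "{fst U<..<snd U} \<subseteq> lev (2 ^ N * t)" by (auto simp: comps_def)
    have in1: "A \<le> x" "x < R" if "x \<in> {fst U<..<snd U}" for x
    proof -
      have "x \<in> lev s" using that IU sub by blast
      then show "A \<le> x" "x < R" using cInf_lower[OF _ bdd_lev(2)[OF s(1)]] lev_less_R A(1) by auto
    qed
    have "A \<le> fst U"
    proof (rule ccontr)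
      assume "\<not> A \<le> fst U"
      then have "min A (snd U) > fst U" using lt by simp
      then obtain z where "fst U < z" "z < min A (snd U)" using dense by blast
      then show False using in1[of z] by auto
    qed
    moreover have "snd U \<le> R"
    proof (rule ccontr)
      assume "\<not> snd U \<le> R"
      then have "max R (fst U) < snd U" using lt by simp
      then obtain z where "max R (fst U) < z" "z < snd U" using dense by blast
      then show False using in1[of z] by auto
    qed
    ultimately show "A \<le> fst U \<and> snd U \<le> R \<and> {fst U<..<snd U} \<subseteq> lev (2 ^ N * t)" using IU by blast
  qed
  also have "\<dots> \<le> ennreal K * tail_weight A R + ennreal 1 * tail_weight A R"
  proof (intro add_mono mult_left_mono mult_right_mono emeasure_le_tail_weight ennreal_leI)
    have "1 \<le> (2 powr p) ^ N" using p by (simp add: one_le_power ge_one_powr_ge_zero)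
    then show "1 / (2 * (2 powr p) ^ N) \<le> 1" by (simp add: divide_simps)
  qed auto
  also have "\<dots> = ennreal (K + 1) * tail_weight A R" using K by (simp add: ennreal_plus distrib_right)
  finally show ?thesis .
qed

text \<open>Every component at level \<open>2^N t\<close> lies in a component at level \<open>t\<close>, whose left endpoint is
  good. Summing the one-step estimate over these parents gives back \<open>tail_sum t\<close> with a small
  coefficient.\<close>

lemma tail_sum_recursion:
  assumes st: "step_const N K" and K: "0 < K" and t: "0 < t"
  shows "tail_sum (2 ^ N * t) \<le> ennreal K * emeasure W (lev t) + ennreal (1 / (2 * (2 powr p) ^ N)) * tail_sum t"
proof -
  let ?U = "comps (lev (2 ^ N * t))" and ?P = "comps (lev t)" and ?c = "ennreal (1 / (2 * (2 powr p) ^ N))"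
  define Fm where "Fm V = {U \<in> ?U. fst V \<le> fst U \<and> snd U \<le> snd V}" for V
  have fU: "interval_family ?U" and fP: "interval_family ?P" by (rule interval_family_comps)+
  have cU: "countable ?U" and cP: "countable ?P" using fU fP by (auto simp: interval_family_def)
  have sub: "lev (2 ^ N * t) \<subseteq> lev t"
    using t by (intro lev_antimono le_two_power_mult) auto
  have "tail_sum (2 ^ N * t) \<le> (\<integral>\<^sup>+x. (\<integral>\<^sup>+V. tails q (Fm V) x \<partial>count_space ?P) \<partial>W)"
    unfolding tail_sum_def
  proof (intro nn_integral_mono tails_le_nn_integral_parents[OF cP cU])
    show "Fm V \<subseteq> ?U" for V by (auto simp: Fm_def)
    fix U assume U: "U \<in> ?U"
    then have lt: "fst U < snd U" and IU: "{fst U<..<snd U} \<subseteq> lev (2 ^ N * t)" by (auto simp: comps_def)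
    obtain x where x: "x \<in> {fst U<..<snd U}" using dense[OF lt] by auto
    then have "x \<in> lev t" using IU sub by blast
    then obtain V where V: "V \<in> ?P" "x \<in> {fst V<..<snd V}"
      using comps_cover[OF open_lev[OF t] bdd_lev[OF t]] by blast
    have "fst V \<le> fst U \<and> snd U \<le> snd V" by (rule comps_nested[OF U V(1) sub x V(2)])
    then show "\<exists>V\<in>?P. U \<in> Fm V" using U V(1) by (auto simp: Fm_def)
  qed
  also have "\<dots> = (\<integral>\<^sup>+V. (\<integral>\<^sup>+x. tails q (Fm V) x \<partial>W) \<partial>count_space ?P)"
  proof (rule nn_integral_count_space_nn_integral[OF cP])
    fix V
    have "interval_family (Fm V)" by (rule interval_family_subset[OF fU]) (auto simp: Fm_def)
    then show "(\<lambda>x. tails q (Fm V) x) \<in> borel_measurable W" by (intro measurable_lebesgue_sets[OF sW] tails_measurable)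
  qed
  also have "\<dots> \<le> (\<integral>\<^sup>+V. ennreal K * emeasure W {fst V<..<snd V} + ?c * tail_weight (fst V) (snd V) \<partial>count_space ?P)"
  proof (rule nn_integral_mono)
    fix V assume "V \<in> space (count_space ?P)"
    then have V: "fst V < snd V" "fst V \<notin> lev t" by (auto simp: comps_def)
    show "(\<integral>\<^sup>+x. tails q (Fm V) x \<partial>W) \<le> ennreal K * emeasure W {fst V<..<snd V} + ?c * tail_weight (fst V) (snd V)"
    proof (rule st[unfolded step_const_def, rule_format, OF \<alpha> fm f0 t V])
      show "interval_family (Fm V)" by (rule interval_family_subset[OF fU]) (auto simp: Fm_def)
    qed (auto simp: Fm_def comps_def)
  qed
  also have "\<dots> = ennreal K * (\<integral>\<^sup>+V. emeasure W {fst V<..<snd V} \<partial>count_space ?P) + ?c * (\<integral>\<^sup>+V. tail_weight (fst V) (snd V) \<partial>count_space ?P)"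
    by (simp add: nn_integral_add nn_integral_cmult)
  also have "(\<integral>\<^sup>+V. emeasure W {fst V<..<snd V} \<partial>count_space ?P) \<le> emeasure W (lev t)"
  proof -
    have i: "{a<..<c} \<in> sets W" for a c :: real by (simp add: sW)
    have "(\<integral>\<^sup>+V. emeasure W {fst V<..<snd V} \<partial>count_space ?P) = (\<integral>\<^sup>+V. (\<integral>\<^sup>+x\<in>{fst V<..<snd V}. 1 \<partial>W) \<partial>count_space ?P)"
      by (rule nn_integral_cong) (simp add: i)
    also have "\<dots> \<le> (\<integral>\<^sup>+x\<in>lev t. 1 \<partial>W)"
      by (rule nn_integral_disjoint_le[OF cP]) (use fP i in \<open>auto simp: interval_family_def comps_def\<close>)
    also have "\<dots> = emeasure W (lev t)" using lev_measurable[OF t] by (simp add: sW)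
    finally show ?thesis .
  qed
  also have "(\<integral>\<^sup>+V. tail_weight (fst V) (snd V) \<partial>count_space ?P) = tail_sum t"
    using nn_integral_tails[OF fP sW, of "\<lambda>x. 1" q] unfolding tail_sum_def by simp
  finally show ?thesis by (simp add: mult_left_mono add_right_mono)
qed

definition sum_const :: "nat \<Rightarrow> real \<Rightarrow> real" where
  "sum_const N K = 2 * (real N * (K + 1) * (4 ^ N) powr p * 2 powr p + K * (2 powr p) ^ N / (1 - 1 / 2 powr p))"

text \<open>With \<open>x n = (2^n t)^p\<close> times the sum of the tails at level \<open>2^n t\<close>, the recursion reads
  \<open>x (N + m) \<le> C y m + x m / 2\<close>, where the terms \<open>y m\<close> have a bounded sum by \<open>lev_weight_sum\<close>.
  The first \<open>N\<close> terms are bounded through the hull at level \<open>t / 2^N\<close>. The finite sum of the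
  \<open>x n\<close> can then be absorbed, once its terms are known to be finite.\<close>

lemma tail_sum_bound:
  assumes st: "step_const N K" and N: "1 \<le> N" and K: "0 < K" and t: "0 < t"
    and A: "Inf (lev (t / 2 ^ N)) \<le> - 3 * R - 2" and ne: "lev (t / 2 ^ N) \<noteq> {}"
  shows "(\<Sum>n<I. ennreal ((2 ^ n * t) powr p) * tail_sum (2 ^ n * t)) \<le> ennreal (sum_const N K) * (G + ennreal (t powr p) * emeasure W {-R..R})"
proof -
  define s where "s = t / 2 ^ N"
  have s: "0 < s" using t by (simp add: s_def)
  define A where "A = Inf (lev s)"
  let ?B = "G + ennreal (t powr p) * emeasure W {-R..R}"
  have Bfin: "?B < top" using fing finW[of R] by (simp add: ennreal_mult_less_top)
  define x where "x n = ennreal ((2 ^ n * t) powr p) * tail_sum (2 ^ n * t)" for n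
  define y where "y n = ennreal ((2 ^ n * t) powr p) * emeasure W (lev (2 ^ n * t))" for n
  let ?b = "(K + 1) * (4 ^ N) powr p * 2 powr p"
  have st2: "s powr p \<le> t powr p" using t p by (intro powr_mono2) (auto simp: s_def divide_le_eq one_le_power)
  have hull: "ennreal (s powr p) * tail_weight A R \<le> ennreal (2 powr p) * ?B"
  proof -
    have "ennreal (s powr p) * tail_weight A R \<le> ennreal (2 powr p) * G + ennreal (s powr p) * emeasure W {-R..R}"
      by (rule hull_tail_integral[OF s A_def]) (use assms in \<open>auto simp: A_def s_def\<close>)
    also have "\<dots> \<le> ennreal (2 powr p) * G + ennreal (2 powr p) * (ennreal (t powr p) * emeasure W {-R..R})"
    proof (rule add_left_mono)
      have "ennreal (s powr p) * emeasure W {-R..R} \<le> ennreal (t powr p) * emeasure W {-R..R}"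
        by (intro mult_right_mono ennreal_leI st2) simp
      also have "\<dots> = 1 * (ennreal (t powr p) * emeasure W {-R..R})" by simp
      also have "\<dots> \<le> ennreal (2 powr p) * (ennreal (t powr p) * emeasure W {-R..R})"
        by (rule mult_right_mono) (use p in \<open>auto simp: ge_one_powr_ge_zero\<close>)
      finally show "ennreal (s powr p) * emeasure W {-R..R} \<le> ennreal (2 powr p) * (ennreal (t powr p) * emeasure W {-R..R})" .
    qed
    also have "\<dots> = ennreal (2 powr p) * ?B" by (simp add: distrib_left)
    finally show ?thesis .
  qed
  have bottom: "x n \<le> ennreal ?b * ?B" if n: "n < N" for n
  proof -
    have "tail_sum (2 ^ n * t) = tail_sum (2 ^ N * (2 ^ n * s))" by (simp add: s_def)
    also have "\<dots> \<le> ennreal (K + 1) * tail_weight A R"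
    proof (rule tail_sum_hull_step[OF st K _ s _ A_def])
      show "0 < 2 ^ n * s" "s \<le> 2 ^ n * s" using s by (auto intro: le_two_power_mult)
    qed (use assms in \<open>auto simp: A_def s_def\<close>)
    finally have "x n \<le> ennreal ((2 ^ n * t) powr p) * (ennreal (K + 1) * tail_weight A R)"
      unfolding x_def by (rule mult_left_mono) simp
    also have "\<dots> \<le> ennreal ((4 ^ N) powr p * s powr p) * (ennreal (K + 1) * tail_weight A R)"
    proof (intro mult_right_mono ennreal_leI)
      have "2 ^ n * t \<le> 2 ^ N * t" using n t by (intro mult_right_mono power_increasing) auto
      also have "\<dots> = 2 ^ N * 2 ^ N * s" by (simp add: s_def)
      also have "2 ^ N * 2 ^ N = (4::real) ^ N" by (simp flip: power_mult_distrib)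
      finally have "(2 ^ n * t) powr p \<le> (4 ^ N * s) powr p" using t p by (intro powr_mono2) auto
      then show "(2 ^ n * t) powr p \<le> (4 ^ N) powr p * s powr p" by (simp add: powr_mult)
    qed simp
    also have "\<dots> = ennreal ((K + 1) * (4 ^ N) powr p) * (ennreal (s powr p) * tail_weight A R)"
      using K by (simp add: ennreal_mult mult_ac)
    also have "\<dots> \<le> ennreal ((K + 1) * (4 ^ N) powr p) * (ennreal (2 powr p) * ?B)"
      by (intro mult_left_mono hull) simp
    also have "\<dots> = ennreal ?b * ?B" using K by (subst ennreal_mult[of _ "2 powr p"]) (auto simp: mult.assoc)
    finally show ?thesis .
  qed
  have rec: "x (N + m) \<le> ennreal (K * (2 powr p) ^ N) * y m + ennreal (1/2) * x m" for m
  proof -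
    have pw: "(2 ^ (N + m) * t) powr p = (2 powr p) ^ N * (2 ^ m * t) powr p"
    proof -
      have "(2 ^ (N + m) * t) powr p = (2 ^ N) powr p * (2 ^ m * t) powr p" by (simp only: power_add mult.assoc powr_mult)
      also have "((2::real) ^ N) powr p = (2 powr p) ^ N"
        by (rule two_power_powr)
      finally show ?thesis .
    qed
    have "tail_sum (2 ^ (N + m) * t) = tail_sum (2 ^ N * (2 ^ m * t))" by (simp add: power_add mult.assoc)
    also have "\<dots> \<le> ennreal K * emeasure W (lev (2 ^ m * t)) + ennreal (1 / (2 * (2 powr p) ^ N)) * tail_sum (2 ^ m * t)"
      by (rule tail_sum_recursion[OF st K]) (use t in simp)
    finally have "x (N + m) \<le> ennreal ((2 powr p) ^ N * (2 ^ m * t) powr p) *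
       (ennreal K * emeasure W (lev (2 ^ m * t)) + ennreal (1 / (2 * (2 powr p) ^ N)) * tail_sum (2 ^ m * t))"
      unfolding x_def pw by (rule mult_left_mono) simp
    also have "\<dots> = ennreal ((2 powr p) ^ N) * ennreal ((2 ^ m * t) powr p) * (ennreal K * emeasure W (lev (2 ^ m * t)))
       + ennreal ((2 powr p) ^ N) * ennreal ((2 ^ m * t) powr p) * (ennreal (1 / (2 * (2 powr p) ^ N)) * tail_sum (2 ^ m * t))"
      by (subst ennreal_mult) (auto simp: distrib_left)
    also have "ennreal ((2 powr p) ^ N) * ennreal ((2 ^ m * t) powr p) * (ennreal K * emeasure W (lev (2 ^ m * t)))
       = (ennreal K * ennreal ((2 powr p) ^ N)) * y m"
      unfolding y_def by (simp only: mult_ac)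
    also have "ennreal K * ennreal ((2 powr p) ^ N) = ennreal (K * (2 powr p) ^ N)"
      using K by (intro ennreal_mult[symmetric]) auto
    also have "ennreal ((2 powr p) ^ N) * ennreal ((2 ^ m * t) powr p) * (ennreal (1 / (2 * (2 powr p) ^ N)) * tail_sum (2 ^ m * t))
      = (ennreal ((2 powr p) ^ N) * ennreal (1 / (2 * (2 powr p) ^ N))) * x m"
      unfolding x_def by (simp only: mult_ac)
    also have "ennreal ((2 powr p) ^ N) * ennreal (1 / (2 * (2 powr p) ^ N)) = ennreal (1/2)"
      by (subst ennreal_mult[symmetric]) auto
    finally show ?thesis .
  qed
  have C1: "0 < 1 - 1 / (2::real) powr p" using p by simp
  have yb: "(\<Sum>n<I. y n) \<le> ennreal (1 / (1 - 1 / 2 powr p)) * G" for I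
    unfolding y_def by (rule lev_weight_sum[OF t])
  have yfin: "y m < top" for m
  proof -
    have "y m \<le> (\<Sum>n<Suc m. y n)" by (rule member_le_sum) auto
    also have "\<dots> \<le> ennreal (1 / (1 - 1 / 2 powr p)) * G" by (rule yb)
    also have "\<dots> < top" using fing by (simp add: ennreal_mult_less_top)
    finally show ?thesis .
  qed
  \<comment> \<open>Finiteness, needed for the absorption, comes by induction from the recursion itself.\<close>
  have xfin: "x n < top" for n
  proof (induction n rule: less_induct)
    case (less n)
    show ?case
    proof (cases "n < N")
      case True
      have "x n \<le> ennreal ?b * ?B" by (rule bottom[OF True])
      also have "\<dots> < top" using Bfin by (simp only: ennreal_mult_less_top) simp
      finally show ?thesis .
    next
      case False
      then obtain m where m: "n = N + m" using le_Suc_ex not_less by blast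
      show ?thesis
      proof -
        have "x m < top" using m N by (intro less.IH) auto
        then have "ennreal (K * (2 powr p) ^ N) * y m + ennreal (1/2) * x m < top"
          using yfin[of m] by (simp only: ennreal_add_less_top ennreal_mult_less_top ennreal_less_top simp_thms)
        then show ?thesis using rec[of m] m by (auto intro: le_less_trans)
      qed
    qed
  qed
  let ?X = "\<Sum>n<I. x n"
  have "?X \<le> (\<Sum>n<N + I. x n)" by (rule sum_mono2) auto
  also have "\<dots> = (\<Sum>n<N. x n) + (\<Sum>m<I. x (N + m))" by (rule sum_lessThan_add)
  also have "\<dots> \<le> (\<Sum>n<N. ennreal ?b * ?B) + (\<Sum>m<I. ennreal (K * (2 powr p) ^ N) * y m + ennreal (1/2) * x m)"
    by (intro add_mono sum_mono bottom rec) auto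
  also have "\<dots> = (of_nat N * (ennreal ?b * ?B) + ennreal (K * (2 powr p) ^ N) * (\<Sum>m<I. y m)) + ennreal (1/2) * ?X"
    by (simp add: sum.distrib sum_distrib_left add.assoc)
  also have "\<dots> \<le> (of_nat N * (ennreal ?b * ?B) + ennreal (K * (2 powr p) ^ N) * (ennreal (1 / (1 - 1 / 2 powr p)) * ?B)) + ennreal (1/2) * ?X"
    by (intro add_right_mono add_left_mono mult_left_mono order_trans[OF yb]) auto
  finally have "?X \<le> 2 * (of_nat N * (ennreal ?b * ?B) + ennreal (K * (2 powr p) ^ N) * (ennreal (1 / (1 - 1 / 2 powr p)) * ?B))"
    by (rule ennreal_absorb_half) (use xfin in \<open>simp add: ennreal_sum_less_top\<close>)
  also have "\<dots> = ennreal (sum_const N K) * ?B"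
  proof -
    define c1 where "c1 = ?b"
    define c2 where "c2 = K * (2 powr p) ^ N"
    define c3 where "c3 = 1 / (1 - 1 / 2 powr p)"
    have c: "0 \<le> c1" "0 \<le> c2" "0 \<le> c3" using K C1 by (auto simp: c1_def c2_def c3_def)
    have "2 * (of_nat N * (ennreal c1 * ?B) + ennreal c2 * (ennreal c3 * ?B)) = (ennreal 2 * (ennreal (real N) * ennreal c1 + ennreal c2 * ennreal c3)) * ?B"
      by (simp only: distrib_left distrib_right mult.assoc add_ac ennreal_of_nat_eq_real_of_nat ennreal_numeral)
    also have "ennreal 2 * (ennreal (real N) * ennreal c1 + ennreal c2 * ennreal c3) = ennreal (2 * (real N * c1 + c2 * c3))"
      using c by (simp only: ennreal_mult[symmetric] ennreal_plus[symmetric] mult_nonneg_nonneg add_nonneg_nonneg of_nat_0_le_iff zero_le_numeral)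
    also have "2 * (real N * c1 + c2 * c3) = sum_const N K" by (simp add: c1_def c2_def c3_def sum_const_def mult.assoc)
    finally show ?thesis by (simp only: c1_def c2_def c3_def)
  qed
  finally show ?thesis by (simp only: x_def)
qed

end

section \<open>The local estimate on a Whitney interval\<close>

lemma exp_20_le: "exp (1/20) \<le> (2::real)"
proof -
  have "exp (1/20) \<le> exp (1/5 :: real)" by simp
  also note exp_rational_bounds(1)
  finally show ?thesis by simp
qed

lemma sum_indicator_overlap_le_3:
  fixes u \<delta> y :: real
  assumes "0 < \<delta>" "finite G"
  shows "(\<Sum>g\<in>G. indicator {u + real g * \<delta><..<u + (real g + 3) * \<delta>} y) \<le> (3::ennreal)"
proof -
  define H where "H = {g\<in>G. y \<in> {u + real g * \<delta><..<u + (real g + 3) * \<delta>}}"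
  have "(\<Sum>g\<in>G. indicator {u + real g * \<delta><..<u + (real g + 3) * \<delta>} y) = (\<Sum>g\<in>H. (1::ennreal))"
    using assms by (intro sum.mono_neutral_cong_right) (auto simp: H_def indicator_def)
  also have "\<dots> = of_nat (card H)" by simp
  also have "card H \<le> 3"
  proof (cases "H = {}")
    case False
    have fH: "finite H" using assms by (simp add: H_def)
    define g0 where "g0 = Min H"
    have g0: "g0 \<in> H" unfolding g0_def by (rule Min_in[OF fH False])
    have "H \<subseteq> {g0..<g0 + 3}"
    proof
      fix g assume g: "g \<in> H"
      have "g0 \<le> g" unfolding g0_def by (rule Min_le[OF fH g])
      moreover have "real g * \<delta> < (real g0 + 3) * \<delta>" using g g0 by (auto simp: H_def)
      then have "real g < real g0 + 3" using assms by simp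
      ultimately show "g \<in> {g0..<g0 + 3}" by auto
    qed
    then have "card H \<le> card {g0..<g0 + 3}" by (rule card_mono[rotated]) simp
    then show ?thesis by simp
  qed simp
  then have "of_nat (card H) \<le> (of_nat 3 :: ennreal)" by (rule of_nat_mono)
  finally show ?thesis by simp
qed

locale truncated_bmo = truncated \<alpha> R F k f for \<alpha> R F k f +
  fixes b :: "real \<Rightarrow> real" and B :: real
  assumes locb: "loc_integrable b" and bmo: "bmo_norm b \<le> ennreal B" and B: "0 < B"
begin

text \<open>The additional \<open>1\<close> lets the difference of two values of \<open>b\<close> be bounded by a product instead of
  a sum (\<open>osc_le_dev\<close>); the factors in \<open>x\<close> and in \<open>y\<close> then separate in the kernel.\<close>

definition dev :: "real \<Rightarrow> real \<Rightarrow> real \<Rightarrow> real" where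
  "dev a c y = 1 + \<bar>b y - average b a c\<bar> / B"

lemma bm [measurable]: "b \<in> borel_measurable lebesgue" by (rule loc_integrable_measurable[OF locb])

lemma dev_measurable [measurable]: "dev a c \<in> borel_measurable lebesgue"
  unfolding dev_def[abs_def] by measurable

lemma dev_ge_1: "1 \<le> dev a c y" using B by (simp add: dev_def)

lemma osc_le_dev: "\<bar>b x - b y\<bar> \<le> B * (dev a c x * dev a c y)"
proof -
  define X where "X = \<bar>b x - average b a c\<bar> / B"
  define Y where "Y = \<bar>b y - average b a c\<bar> / B"
  have XY: "0 \<le> X" "0 \<le> Y" using B by (auto simp: X_def Y_def)
  have eX: "\<bar>b x - average b a c\<bar> = B * X" "\<bar>b y - average b a c\<bar> = B * Y" using B by (auto simp: X_def Y_def)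
  have "\<bar>b x - b y\<bar> \<le> B * X + B * Y" using eX by linarith
  also have "\<dots> = B * (X + Y)" by (simp add: algebra_simps)
  also have "\<dots> \<le> B * ((1 + X) * (1 + Y))" using XY B by (intro mult_left_mono) (auto simp: algebra_simps)
  finally show ?thesis by (simp add: dev_def X_def Y_def)
qed

lemma exp_dev_integral:
  assumes "a < c" "S \<subseteq> {a<..<c}"
  shows "(\<integral>\<^sup>+y\<in>S. ennreal (exp (dev a c y / 20)) \<partial>lebesgue) \<le> ennreal (6 * (c - a))"
proof -
  have m: "(\<lambda>y. ennreal (exp (\<bar>b y - average b a c\<bar> / (20 * B))) * indicator {a<..<c} y) \<in> borel_measurable lebesgue"
    by (intro borel_measurable_times_ennreal borel_measurable_indicator) auto
  have "(\<integral>\<^sup>+y\<in>S. ennreal (exp (dev a c y / 20)) \<partial>lebesgue)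
     \<le> (\<integral>\<^sup>+y. ennreal 2 * (ennreal (exp (\<bar>b y - average b a c\<bar> / (20 * B))) * indicator {a<..<c} y) \<partial>lebesgue)"
  proof (rule nn_integral_mono)
    fix y
    have "dev a c y / 20 = 1/20 + \<bar>b y - average b a c\<bar> / (20 * B)" using B by (simp add: dev_def field_simps)
    then have "exp (dev a c y / 20) = exp (1/20 + \<bar>b y - average b a c\<bar> / (20 * B))" by (simp only:)
    also have "\<dots> = exp (1/20) * exp (\<bar>b y - average b a c\<bar> / (20 * B))" by (rule exp_add)
    also have "\<dots> \<le> 2 * exp (\<bar>b y - average b a c\<bar> / (20 * B))" by (rule mult_right_mono[OF exp_20_le]) simp
    finally have "ennreal (exp (dev a c y / 20)) \<le> ennreal (2 * exp (\<bar>b y - average b a c\<bar> / (20 * B)))" by (rule ennreal_leI)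
    also have "\<dots> = ennreal 2 * ennreal (exp (\<bar>b y - average b a c\<bar> / (20 * B)))" by (rule ennreal_mult) auto
    finally have "ennreal (exp (dev a c y / 20)) \<le> ennreal 2 * ennreal (exp (\<bar>b y - average b a c\<bar> / (20 * B)))" .
    then show "ennreal (exp (dev a c y / 20)) * indicator S y \<le> ennreal 2 * (ennreal (exp (\<bar>b y - average b a c\<bar> / (20 * B))) * indicator {a<..<c} y)"
      using assms(2) by (auto simp: indicator_def)
  qed
  also have "\<dots> = ennreal 2 * (\<integral>\<^sup>+y\<in>{a<..<c}. ennreal (exp (\<bar>b y - average b a c\<bar> / (20 * B))) \<partial>lebesgue)"
    by (rule nn_integral_cmult) (rule m)
  also have "\<dots> \<le> ennreal 2 * ennreal (3 * (c - a))"
    by (intro mult_left_mono john_nirenberg[OF locb bmo B assms(1)]) simp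
  also have "\<dots> = ennreal (6 * (c - a))" using assms by (subst ennreal_mult[symmetric]) auto
  finally show ?thesis .
qed

lemma dev_moment:
  assumes "a < c"
  shows "(\<integral>\<^sup>+y\<in>{a<..<c}. ennreal (dev a c y ^ n) \<partial>lebesgue) \<le> ennreal (20 ^ n * fact n * 6 * (c - a))"
proof -
  have m: "(\<lambda>y. ennreal (exp (dev a c y / 20)) * indicator {a<..<c} y) \<in> borel_measurable lebesgue"
    by (intro borel_measurable_times_ennreal borel_measurable_indicator) auto
  have "(\<integral>\<^sup>+y\<in>{a<..<c}. ennreal (dev a c y ^ n) \<partial>lebesgue)
     \<le> (\<integral>\<^sup>+y. ennreal (20 ^ n * fact n) * (ennreal (exp (dev a c y / 20)) * indicator {a<..<c} y) \<partial>lebesgue)"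
  proof (rule nn_integral_mono)
    fix y
    have "0 \<le> dev a c y / 20" using dev_ge_1[of a c y] by simp
    from power_le_fact_exp[OF this, of n] have "20 ^ n * (dev a c y / 20) ^ n \<le> 20 ^ n * (fact n * exp (dev a c y / 20))"
      by (rule mult_left_mono) simp
    then have "dev a c y ^ n \<le> 20 ^ n * fact n * exp (dev a c y / 20)" by (simp add: power_divide mult.assoc)
    then have "ennreal (dev a c y ^ n) \<le> ennreal (20 ^ n * fact n) * ennreal (exp (dev a c y / 20))"
      by (simp add: ennreal_leI flip: ennreal_mult)
    then show "ennreal (dev a c y ^ n) * indicator {a<..<c} y \<le> ennreal (20 ^ n * fact n) * (ennreal (exp (dev a c y / 20)) * indicator {a<..<c} y)"
      by (auto simp: indicator_def)
  qed
  also have "\<dots> = ennreal (20 ^ n * fact n) * (\<integral>\<^sup>+y\<in>{a<..<c}. ennreal (exp (dev a c y / 20)) \<partial>lebesgue)"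
    by (rule nn_integral_cmult) (rule m)
  also have "\<dots> \<le> ennreal (20 ^ n * fact n) * ennreal (6 * (c - a))"
    by (intro mult_left_mono exp_dev_integral assms) auto
  also have "\<dots> = ennreal (20 ^ n * fact n * 6 * (c - a))" using assms by (subst ennreal_mult[symmetric]) (auto simp: mult.assoc)
  finally show ?thesis .
qed

text \<open>John-Nirenberg against the modular: Young's inequality splits \<open>dev^k f\<close> into the modular of
  \<open>f\<close> and an exponential of \<open>dev\<close>, which is integrable.\<close>

lemma dev_weighted_mass:
  assumes ac: "a < c" and S: "S \<in> sets lebesgue" "S \<subseteq> {a<..<c}" and s: "0 < s"
  shows "(\<integral>\<^sup>+y\<in>S. ennreal (dev a c y ^ k * f y) \<partial>lebesgue) \<le> ennreal (40 ^ k / s) * (mass s S + ennreal (6 * fact k * (c - a)))"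
proof -
  have mm: "(\<lambda>y. ennreal (LlogL k (f y * s)) * indicator S y) \<in> borel_measurable lebesgue"
    by (intro borel_measurable_times_ennreal borel_measurable_indicator S) auto
  have me: "(\<lambda>y. ennreal (exp (dev a c y / 20)) * indicator S y) \<in> borel_measurable lebesgue"
    by (intro borel_measurable_times_ennreal borel_measurable_indicator S) auto
  have me': "(\<lambda>y. ennreal (fact k) * (ennreal (exp (dev a c y / 20)) * indicator S y)) \<in> borel_measurable lebesgue"
    by (intro borel_measurable_times_ennreal me) auto
  have "(\<integral>\<^sup>+y\<in>S. ennreal (dev a c y ^ k * f y) \<partial>lebesgue)
    \<le> (\<integral>\<^sup>+y. ennreal (40 ^ k / s) * (ennreal (LlogL k (f y * s)) * indicator S y + ennreal (fact k) * (ennreal (exp (dev a c y / 20)) * indicator S y)) \<partial>lebesgue)"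
  proof (rule nn_integral_mono)
    fix y
    define v where "v = dev a c y / 20"
    have v: "0 \<le> v" using dev_ge_1[of a c y] by (simp add: v_def)
    have u: "0 \<le> f y * s" using f0 s by simp
    have "dev a c y ^ k * f y = (20 ^ k / s) * ((f y * s) * v ^ k)"
      using s by (simp add: v_def power_divide)
    also have "\<dots> \<le> (20 ^ k / s) * (2 ^ k * LlogL k (f y * s) + 2 ^ k * fact k * exp v)"
      using s by (intro mult_left_mono LlogL_young u v) auto
    also have "\<dots> = (20 ^ k * 2 ^ k / s) * (LlogL k (f y * s) + fact k * exp v)" by (simp add: algebra_simps add_divide_distrib)
    also have "(20::real) ^ k * 2 ^ k = 40 ^ k" by (simp flip: power_mult_distrib)
    finally have "ennreal (dev a c y ^ k * f y) \<le> ennreal ((40 ^ k / s) * (LlogL k (f y * s) + fact k * exp v))" by (rule ennreal_leI)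
    also have "\<dots> = ennreal (40 ^ k / s) * (ennreal (LlogL k (f y * s)) + ennreal (fact k) * ennreal (exp v))"
      using s u by (simp only: ennreal_mult ennreal_plus LlogL_nonneg mult_nonneg_nonneg divide_nonneg_pos zero_le_power exp_ge_zero fact_ge_zero zero_le_numeral add_nonneg_nonneg)
    finally show "ennreal (dev a c y ^ k * f y) * indicator S y \<le> ennreal (40 ^ k / s) * (ennreal (LlogL k (f y * s)) * indicator S y + ennreal (fact k) * (ennreal (exp (dev a c y / 20)) * indicator S y))"
      by (cases "y \<in> S") (auto simp: v_def)
  qed
  also have "\<dots> = ennreal (40 ^ k / s) * (mass s S + ennreal (fact k) * (\<integral>\<^sup>+y\<in>S. ennreal (exp (dev a c y / 20)) \<partial>lebesgue))"
    unfolding orlicz_mass_def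
    by (subst nn_integral_cmult, intro borel_measurable_add mm me', subst nn_integral_add[OF mm me'], subst nn_integral_cmult[OF me]) (rule refl)
  also have "\<dots> \<le> ennreal (40 ^ k / s) * (mass s S + ennreal (fact k) * ennreal (6 * (c - a)))"
    by (intro mult_left_mono add_left_mono exp_dev_integral ac S) auto
  also have "ennreal (fact k) * ennreal (6 * (c - a)) = ennreal (6 * fact k * (c - a))"
    using ac by (subst ennreal_mult[symmetric]) (auto simp: mult_ac)
  finally show ?thesis .
qed

definition near_const :: real where "near_const = 40 ^ k * (2 + 18 * fact k)"
definition grid_const :: real where "grid_const = 40 ^ k * (6 + 18 * fact k)"
definition moment_const :: "nat \<Rightarrow> real" where "moment_const m = 18 * 20 ^ (k * m) * fact (k * m)"

lemma local_consts_pos: "0 < near_const" "0 < grid_const" "0 < moment_const m" by (auto simp: near_const_def grid_const_def moment_const_def add_pos_pos)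

text \<open>At scale \<open>\<delta>\<close> next to a good point \<open>z\<close> the kernel \<open>(y - x)^(\<alpha> - 1)\<close>, which is about
  \<open>\<delta>^(\<alpha> - 1)\<close>, against the mass of \<open>f\<close>, which is about \<open>\<tau> \<delta>^(1 - \<alpha>)\<close>, gives \<open>\<tau>\<close>.\<close>

lemma near_mass_le:
  assumes \<tau>: "0 < \<tau>" and z: "z \<notin> lev \<tau>" and \<delta>: "0 < \<delta>" and S: "S \<in> sets lebesgue" "S \<subseteq> {a<..<a + 3 * \<delta>}" "S \<subseteq> {z<..<z + 2 * \<delta>}"
  shows "ennreal (\<delta> powr (\<alpha> - 1)) * (\<integral>\<^sup>+y\<in>S. ennreal (dev a (a + 3 * \<delta>) y ^ k * f y) \<partial>lebesgue) \<le> ennreal (near_const * \<tau>)"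
proof -
  define s where "s = (2 * \<delta>) powr \<alpha> / \<tau>"
  have s: "0 < s" using \<delta> \<tau> by (simp add: s_def)
  have "(\<integral>\<^sup>+y\<in>S. ennreal (dev a (a + 3 * \<delta>) y ^ k * f y) \<partial>lebesgue) \<le> ennreal (40 ^ k / s) * (mass s S + ennreal (6 * fact k * (a + 3 * \<delta> - a)))"
    by (rule dev_weighted_mass) (use \<delta> S s in auto)
  also have "\<dots> \<le> ennreal (40 ^ k / s) * (ennreal (2 * \<delta>) + ennreal (6 * fact k * (a + 3 * \<delta> - a)))"
  proof (intro mult_left_mono add_right_mono)
    have "mass s S \<le> mass s {z<..<z + 2 * \<delta>}" by (rule orlicz_mass_mono) (use f0 s S in auto)
    also have "\<dots> \<le> ennreal (2 * \<delta>)" unfolding s_def by (rule good_point_mass_le[OF z]) (use \<delta> in simp)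
    finally show "mass s S \<le> ennreal (2 * \<delta>)" .
  qed simp
  also have "\<dots> = ennreal (40 ^ k / s * ((2 + 18 * fact k) * \<delta>))"
  proof -
    have "ennreal (2 * \<delta>) + ennreal (6 * fact k * (a + 3 * \<delta> - a)) = ennreal ((2 + 18 * fact k) * \<delta>)"
      using \<delta> by (subst ennreal_plus[symmetric]) (auto simp: algebra_simps)
    then show ?thesis using s \<delta> by (subst ennreal_mult) (auto intro: add_nonneg_nonneg)
  qed
  finally have "ennreal (\<delta> powr (\<alpha> - 1)) * (\<integral>\<^sup>+y\<in>S. ennreal (dev a (a + 3 * \<delta>) y ^ k * f y) \<partial>lebesgue)
     \<le> ennreal (\<delta> powr (\<alpha> - 1)) * ennreal (40 ^ k / s * ((2 + 18 * fact k) * \<delta>))" by (rule mult_left_mono) simp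
  also have "\<dots> = ennreal (\<delta> powr (\<alpha> - 1) * (40 ^ k / s * ((2 + 18 * fact k) * \<delta>)))"
    using s \<delta> by (intro ennreal_mult[symmetric]) (auto intro!: mult_nonneg_nonneg add_nonneg_nonneg)
  also have "\<dots> \<le> ennreal (near_const * \<tau>)"
  proof (rule ennreal_leI)
    have d: "\<delta> powr (\<alpha> - 1) * \<delta> = \<delta> powr \<alpha>" using \<delta> powr_add[of \<delta> "\<alpha> - 1" 1] by simp
    have "\<delta> powr (\<alpha> - 1) * (40 ^ k / s * ((2 + 18 * fact k) * \<delta>)) = near_const * (\<delta> powr (\<alpha> - 1) * \<delta>) / s"
      by (simp add: near_const_def)
    also have "\<dots> = near_const * (\<delta> powr \<alpha> / ((2 * \<delta>) powr \<alpha>)) * \<tau>" unfolding d s_def by simp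
    also have "\<dots> \<le> near_const * 1 * \<tau>"
    proof (intro mult_right_mono mult_left_mono)
      have "\<delta> powr \<alpha> \<le> (2 * \<delta>) powr \<alpha>" using \<delta> \<alpha> by (intro powr_mono2) auto
      then show "\<delta> powr \<alpha> / (2 * \<delta>) powr \<alpha> \<le> 1" using \<delta> by simp
    qed (use local_consts_pos \<tau> in auto)
    finally show "\<delta> powr (\<alpha> - 1) * (40 ^ k / s * ((2 + 18 * fact k) * \<delta>)) \<le> near_const * \<tau>" by simp
  qed
  finally show ?thesis .
qed

text \<open>The interval of length \<open>L\<close> is divided into \<open>2^n\<close> cells of length \<open>\<delta>\<close>, and every cell is
  enlarged to an interval of length \<open>3 \<delta>\<close> that contains what its points see at distance between
  \<open>\<delta>\<close> and \<open>2 \<delta>\<close>. Summed over the cells, the masses add up with overlap at most \<open>3\<close> to the mass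
  at scale \<open>L\<close>, so that the average over the cells of the quantity in \<open>near_mass_le\<close> is smaller
  than \<open>\<tau>\<close> by the factor \<open>2^(-n \<alpha>)\<close>.\<close>

lemma grid_mass_sum_le:
  assumes \<tau>: "0 < \<tau>" and z: "z \<notin> lev \<tau>" and L: "0 < L" and S: "S \<in> sets lebesgue" "S \<subseteq> {z<..<z + 2 * L}"
    and \<delta>: "\<delta> = L / 2 ^ n"
  shows "(\<Sum>g<2 ^ n. ennreal \<delta> * (ennreal (\<delta> powr (\<alpha> - 1)) *
      (\<integral>\<^sup>+y\<in>({u + real g * \<delta><..<u + (real g + 3) * \<delta>} \<inter> S). ennreal (dev (u + real g * \<delta>) (u + (real g + 3) * \<delta>) y ^ k * f y) \<partial>lebesgue)))
    \<le> ennreal (grid_const * (1 / 2 powr \<alpha>) ^ n * \<tau> * L)"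
proof -
  define s where "s = (2 * L) powr \<alpha> / \<tau>"
  have s: "0 < s" using L \<tau> by (simp add: s_def)
  have d: "0 < \<delta>" using L \<delta> by simp
  let ?J = "\<lambda>g::nat. {u + real g * \<delta><..<u + (real g + 3) * \<delta>}"
  let ?Q = "\<lambda>g. \<integral>\<^sup>+y\<in>(?J g \<inter> S). ennreal (dev (u + real g * \<delta>) (u + (real g + 3) * \<delta>) y ^ k * f y) \<partial>lebesgue"
  have JS: "?J g \<inter> S \<in> sets lebesgue" for g using S by auto
  have Q: "?Q g \<le> ennreal (40 ^ k / s) * (mass s (?J g \<inter> S) + ennreal (18 * fact k * \<delta>))" for g
  proof -
    have "?Q g \<le> ennreal (40 ^ k / s) * (mass s (?J g \<inter> S) + ennreal (6 * fact k * (u + (real g + 3) * \<delta> - (u + real g * \<delta>))))"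
      by (rule dev_weighted_mass) (use d JS s in auto)
    also have "6 * fact k * (u + (real g + 3) * \<delta> - (u + real g * \<delta>)) = 18 * fact k * \<delta>" by (simp add: algebra_simps)
    finally show ?thesis .
  qed
  have overlap: "(\<Sum>g<2 ^ n. mass s (?J g \<inter> S)) \<le> ennreal (6 * L)"
  proof -
    have mm: "(\<lambda>y. ennreal (LlogL k (f y * s)) * indicator A y) \<in> borel_measurable lebesgue" if "A \<in> sets lebesgue" for A
      by (intro borel_measurable_times_ennreal borel_measurable_indicator that) auto
    have "(\<Sum>g<2 ^ n. mass s (?J g \<inter> S)) = (\<integral>\<^sup>+y. (\<Sum>g<2 ^ n. ennreal (LlogL k (f y * s)) * indicator (?J g \<inter> S) y) \<partial>lebesgue)"
      unfolding orlicz_mass_def by (rule nn_integral_sum[symmetric]) (rule mm[OF JS])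
    also have "\<dots> \<le> (\<integral>\<^sup>+y. 3 * (ennreal (LlogL k (f y * s)) * indicator S y) \<partial>lebesgue)"
    proof (rule nn_integral_mono)
      fix y
      have "(\<Sum>g<2 ^ n. ennreal (LlogL k (f y * s)) * indicator (?J g \<inter> S) y)
        = (ennreal (LlogL k (f y * s)) * indicator S y) * (\<Sum>g<2 ^ n. indicator (?J g) y)"
        unfolding sum_distrib_left by (rule sum.cong) (auto simp: indicator_def)
      also have "\<dots> \<le> (ennreal (LlogL k (f y * s)) * indicator S y) * 3"
        by (intro mult_left_mono sum_indicator_overlap_le_3 d) auto
      finally show "(\<Sum>g<2 ^ n. ennreal (LlogL k (f y * s)) * indicator (?J g \<inter> S) y) \<le> 3 * (ennreal (LlogL k (f y * s)) * indicator S y)"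
        by (simp only: mult.commute)
    qed
    also have "\<dots> = 3 * mass s S" unfolding orlicz_mass_def by (rule nn_integral_cmult) (rule mm[OF S(1)])
    also have "\<dots> \<le> 3 * mass s {z<..<z + 2 * L}"
      by (intro mult_left_mono orlicz_mass_mono) (use f0 s S in auto)
    also have "\<dots> \<le> 3 * ennreal (2 * L)"
      unfolding s_def by (intro mult_left_mono good_point_mass_le[OF z]) (use L in auto)
    also have "\<dots> = ennreal (6 * L)" using L ennreal_mult[of 3 "2 * L"] by simp
    finally show ?thesis .
  qed
  have "(\<Sum>g<2 ^ n. ennreal \<delta> * (ennreal (\<delta> powr (\<alpha> - 1)) * ?Q g))
     \<le> (\<Sum>g<2 ^ n. ennreal \<delta> * (ennreal (\<delta> powr (\<alpha> - 1)) * (ennreal (40 ^ k / s) * (mass s (?J g \<inter> S) + ennreal (18 * fact k * \<delta>)))))"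
    by (intro sum_mono mult_left_mono Q) auto
  also have "\<dots> = ennreal \<delta> * (ennreal (\<delta> powr (\<alpha> - 1)) * (ennreal (40 ^ k / s) * ((\<Sum>g<2 ^ n. mass s (?J g \<inter> S)) + (\<Sum>g<(2::nat) ^ n. ennreal (18 * fact k * \<delta>)))))"
    by (simp only: sum_distrib_left[symmetric] sum.distrib)
  also have "\<dots> \<le> ennreal \<delta> * (ennreal (\<delta> powr (\<alpha> - 1)) * (ennreal (40 ^ k / s) * (ennreal (6 * L) + ennreal (18 * fact k * L))))"
  proof (intro mult_left_mono add_mono overlap)
    have "(\<Sum>g<(2::nat) ^ n. ennreal (18 * fact k * \<delta>)) = ennreal (\<Sum>g<(2::nat) ^ n. 18 * fact k * \<delta>)"
      using d by (intro sum_ennreal) auto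
    also have "(\<Sum>g<(2::nat) ^ n. 18 * fact k * \<delta>) = 18 * fact k * L" by (simp add: \<delta>)
    finally show "(\<Sum>g<(2::nat) ^ n. ennreal (18 * fact k * \<delta>)) \<le> ennreal (18 * fact k * L)" by simp
  qed auto
  also have "\<dots> = ennreal (\<delta> * (\<delta> powr (\<alpha> - 1) * (40 ^ k / s * (6 * L + 18 * fact k * L))))"
    using d s L by (simp only: ennreal_mult ennreal_plus mult_nonneg_nonneg add_nonneg_nonneg less_imp_le divide_nonneg_pos zero_le_power zero_le_numeral fact_ge_zero powr_ge_zero)
  also have "\<dots> \<le> ennreal (grid_const * (1 / 2 powr \<alpha>) ^ n * \<tau> * L)"
  proof (rule ennreal_leI)
    have dd: "\<delta> * \<delta> powr (\<alpha> - 1) = \<delta> powr \<alpha>" using d powr_add[of \<delta> 1 "\<alpha> - 1"] by simp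
    have "\<delta> powr \<alpha> = L powr \<alpha> / (2 ^ n) powr \<alpha>" unfolding \<delta> using L by (simp add: powr_divide)
    also have "((2::real) ^ n) powr \<alpha> = (2 powr \<alpha>) ^ n"
      by (rule two_power_powr)
    finally have dL: "\<delta> powr \<alpha> = L powr \<alpha> * (1 / 2 powr \<alpha>) ^ n" by (simp add: power_divide)
    have "\<delta> * (\<delta> powr (\<alpha> - 1) * (40 ^ k / s * (6 * L + 18 * fact k * L))) = (\<delta> * \<delta> powr (\<alpha> - 1)) * (grid_const * L / s)"
      by (simp add: grid_const_def algebra_simps add_divide_distrib)
    also have "\<dots> = grid_const * (1 / 2 powr \<alpha>) ^ n * \<tau> * L * (L powr \<alpha> / (2 * L) powr \<alpha>)"
      unfolding dd dL s_def by simp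
    also have "\<dots> \<le> grid_const * (1 / 2 powr \<alpha>) ^ n * \<tau> * L * 1"
    proof (intro mult_left_mono)
      have "L powr \<alpha> \<le> (2 * L) powr \<alpha>" using L \<alpha> by (intro powr_mono2) auto
      then show "L powr \<alpha> / (2 * L) powr \<alpha> \<le> 1" using L by simp
    qed (use local_consts_pos \<tau> L in auto)
    finally show "\<delta> * (\<delta> powr (\<alpha> - 1) * (40 ^ k / s * (6 * L + 18 * fact k * L))) \<le> grid_const * (1 / 2 powr \<alpha>) ^ n * \<tau> * L" by simp
  qed
  finally show ?thesis .
qed

text \<open>Chebyshev's inequality with the moment of order \<open>m\<close>. Of the \<open>m\<close> factors \<open>r\<close>, all but one are
  replaced by their uniform bound; the remaining one is kept because its sum over the cells
  carries the gain of \<open>grid_mass_sum_le\<close>.\<close>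

lemma dev_markov:
  assumes \<delta>: "0 < \<delta>" and m: "1 \<le> m" and \<mu>: "0 < \<mu>" and r: "0 \<le> r" "r \<le> near_const * \<tau>"
  shows "emeasure lebesgue {x \<in> {a<..<a + 3 * \<delta>}. \<mu> < dev a (a + 3 * \<delta>) x ^ k * r}
     \<le> ennreal (moment_const m * (near_const * \<tau>) ^ (m - 1) / \<mu> ^ m) * (ennreal \<delta> * ennreal r)"
proof -
  let ?d = "dev a (a + 3 * \<delta>)"
  let ?E = "{x \<in> {a<..<a + 3 * \<delta>}. \<mu> < ?d x ^ k * r}"
  have mm: "(\<lambda>x. ennreal (?d x ^ (k * m)) * indicator {a<..<a + 3 * \<delta>} x) \<in> borel_measurable lebesgue"
    by (intro borel_measurable_times_ennreal borel_measurable_indicator) auto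
  have E: "?E \<in> sets lebesgue"
  proof -
    have "(\<lambda>x. ?d x ^ k * r) \<in> borel_measurable lebesgue" by measurable
    then have X: "(\<lambda>x. ?d x ^ k * r) -` {\<mu><..} \<inter> space lebesgue \<in> sets lebesgue" by (rule measurable_sets) simp
    have eq: "?E = {a<..<a + 3 * \<delta>} \<inter> ((\<lambda>x. ?d x ^ k * r) -` {\<mu><..} \<inter> space lebesgue)" by auto
    show ?thesis unfolding eq by (rule sets.Int[OF _ X]) simp
  qed
  have rm: "r ^ m \<le> (near_const * \<tau>) ^ (m - 1) * r"
  proof -
    obtain j where j: "m = Suc j" using m by (cases m) auto
    have "r ^ j * r \<le> (near_const * \<tau>) ^ j * r" using r by (intro mult_right_mono power_mono) auto
    then show ?thesis by (simp add: j mult.commute)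
  qed
  have Ct: "0 \<le> near_const * \<tau>" using r by linarith
  have "emeasure lebesgue ?E = (\<integral>\<^sup>+x. indicator ?E x \<partial>lebesgue)" by (rule nn_integral_indicator[OF E, symmetric])
  also have "\<dots> \<le> (\<integral>\<^sup>+x. ennreal ((r / \<mu>) ^ m) * (ennreal (?d x ^ (k * m)) * indicator {a<..<a + 3 * \<delta>} x) \<partial>lebesgue)"
  proof (rule nn_integral_mono)
    fix x
    show "(indicator ?E x :: ennreal) \<le> ennreal ((r / \<mu>) ^ m) * (ennreal (?d x ^ (k * m)) * indicator {a<..<a + 3 * \<delta>} x)"
    proof (cases "x \<in> ?E")
      case True
      then have "1 \<le> ?d x ^ k * r / \<mu>" using \<mu> by simp
      then have "1 \<le> (?d x ^ k * r / \<mu>) ^ m" by (rule one_le_power)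
      also have "(?d x ^ k * r / \<mu>) ^ m = (r / \<mu>) ^ m * ?d x ^ (k * m)" by (simp add: power_mult_distrib power_divide power_mult)
      finally have "ennreal 1 \<le> ennreal ((r / \<mu>) ^ m * ?d x ^ (k * m))" by (rule ennreal_leI)
      also have "\<dots> = ennreal ((r / \<mu>) ^ m) * ennreal (?d x ^ (k * m))"
        using r \<mu> dev_ge_1[of a "a + 3 * \<delta>" x] by (intro ennreal_mult) auto
      finally show ?thesis using True by simp
    qed simp
  qed
  also have "\<dots> = ennreal ((r / \<mu>) ^ m) * (\<integral>\<^sup>+x\<in>{a<..<a + 3 * \<delta>}. ennreal (?d x ^ (k * m)) \<partial>lebesgue)"
    by (rule nn_integral_cmult) (rule mm)
  also have "\<dots> \<le> ennreal ((r / \<mu>) ^ m) * ennreal (20 ^ (k * m) * fact (k * m) * 6 * (a + 3 * \<delta> - a))"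
    by (intro mult_left_mono dev_moment) (use \<delta> in auto)
  also have "\<dots> = ennreal ((r / \<mu>) ^ m * (moment_const m * \<delta>))"
    using r \<mu> \<delta> by (subst ennreal_mult[symmetric]) (auto simp: moment_const_def mult_ac)
  also have "\<dots> \<le> ennreal (moment_const m * (near_const * \<tau>) ^ (m - 1) / \<mu> ^ m * (\<delta> * r))"
  proof (rule ennreal_leI)
    have "(r / \<mu>) ^ m * (moment_const m * \<delta>) = r ^ m * (moment_const m * \<delta> / \<mu> ^ m)" by (simp add: power_divide)
    also have "\<dots> \<le> ((near_const * \<tau>) ^ (m - 1) * r) * (moment_const m * \<delta> / \<mu> ^ m)"
      using local_consts_pos(3)[of m] \<delta> \<mu> by (intro mult_right_mono rm) auto
    finally show "(r / \<mu>) ^ m * (moment_const m * \<delta>) \<le> moment_const m * (near_const * \<tau>) ^ (m - 1) / \<mu> ^ m * (\<delta> * r)" by (simp add: mult_ac)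
  qed
  also have "\<dots> = ennreal (moment_const m * (near_const * \<tau>) ^ (m - 1) / \<mu> ^ m) * ennreal (\<delta> * r)"
    using local_consts_pos(3)[of m] \<mu> Ct \<delta> r by (intro ennreal_mult) auto
  also have "ennreal (\<delta> * r) = ennreal \<delta> * ennreal r" using \<delta> r by (intro ennreal_mult) auto
  finally show ?thesis .
qed

definition local_const :: "nat \<Rightarrow> real" where
  "local_const m = moment_const m * near_const ^ (m - 1) * grid_const / ((1 - 1 / 2 powr (\<alpha> / (2 * real m))) ^ m * (1 - 1 / 2 powr (\<alpha> / 2)))"

text \<open>The integral is split over the dyadic annuli \<open>A n x\<close>, at distance \<open>\<delta> n = L / 2^n\<close> to \<open>2 \<delta> n\<close>
  from \<open>x\<close>. If \<open>x\<close> is in the cell \<open>g\<close>, the annulus contributes at most \<open>B^k dev(x)^k r n g\<close>,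
  where \<open>r n g\<close> is bounded by a multiple of \<open>\<tau>\<close> individually (\<open>near_mass_le\<close>) and has average
  \<open>2^(-n \<alpha>) \<tau>\<close> over the cells (\<open>grid_mass_sum_le\<close>). In terms of \<open>\<theta> < 1\<close>, the contribution of the
  annulus is allowed to be \<open>B^k\<close> times \<open>\<Lambda> \<tau> (1 - \<theta>) \<theta>^n\<close>; the exceptional set where
  \<open>dev(x)^k r n g\<close> exceeds this is estimated by \<open>dev_markov\<close>.\<close>

lemma local_estimate:
  assumes \<tau>: "0 < \<tau>" and m: "1 \<le> m" and uv: "u < v" and \<Lambda>: "0 < \<Lambda>"
    and c: "c = v + (v - u)"
  shows "\<exists>E\<in>sets lebesgue. {x \<in> {u<..<v}. ennreal (\<Lambda> * (B ^ k * \<tau>)) <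
       (\<integral>\<^sup>+y\<in>{next_good (lev \<tau>) x<..<c}. ennreal (\<bar>b x - b y\<bar> ^ k * (f y * (y - x) powr (\<alpha> - 1))) \<partial>lebesgue)} \<subseteq> E \<and>
     emeasure lebesgue E \<le> ennreal (local_const m / \<Lambda> ^ m * (v - u))"
proof -
  define L where "L = v - u"
  have L: "0 < L" using uv by (simp add: L_def)
  let ?z = "next_good (lev \<tau>)"
  have good: "?z x \<notin> lev \<tau>" "x \<le> ?z x" for x
    using next_good(1,2)[OF open_lev[OF \<tau>] bdd_lev(1)[OF \<tau>]] by auto
  have zmono: "?z x \<le> ?z y" if "x \<le> y" for x y
    using next_good_mono[OF open_lev[OF \<tau>] bdd_lev(1)[OF \<tau>]] that by (auto simp: mono_def)
  define s where "s = ?z u"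
  have su: "u \<le> s" using good(2)[of u] by (simp add: s_def)
  \<comment> \<open>Half of the gain \<open>2^(-n \<alpha>)\<close> is spent on the thresholds, as \<open>\<theta>^n\<close> to the power \<open>m\<close>; the
    other half makes the measures of the exceptional sets summable in \<open>n\<close>.\<close>
  define \<theta> where "\<theta> = 1 / 2 powr (\<alpha> / (2 * real m))"
  have \<theta>: "0 < \<theta>" "\<theta> < 1" using \<alpha> m by (auto simp: \<theta>_def)
  define \<rho> where "\<rho> = 1 / 2 powr (\<alpha> / 2)"
  have \<rho>: "0 < \<rho>" "\<rho> < 1" using \<alpha> by (auto simp: \<rho>_def)
  have \<theta>m: "\<theta> ^ m = \<rho>"
  proof -
    have "(2 powr (\<alpha> / (2 * real m))) ^ m = (2::real) powr (\<alpha> / 2)"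
      using m by (subst powr_realpow[symmetric]) (auto simp: powr_powr)
    then show ?thesis by (simp add: \<theta>_def \<rho>_def power_one_over)
  qed
  have \<rho>2: "1 / 2 powr \<alpha> = \<rho> * \<rho>" by (simp add: \<rho>_def powr_add[symmetric])
  define \<delta> where "\<delta> n = L / 2 ^ n" for n :: nat
  have \<delta>: "0 < \<delta> n" for n using L by (simp add: \<delta>_def)
  define a where "a n g = u + real g * \<delta> n" for n g :: nat
  define J where "J n g = {a n g<..<a n g + 3 * \<delta> n}" for n g
  define dv where "dv n g = dev (a n g) (a n g + 3 * \<delta> n)" for n g
  define Q where "Q n g = ennreal (\<delta> n powr (\<alpha> - 1)) * (\<integral>\<^sup>+y\<in>(J n g \<inter> {s<..<c}). ennreal (dv n g y ^ k * f y) \<partial>lebesgue)" for n g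
  \<comment> \<open>The minimum of the individual bound and the bound that sums well over the cells.\<close>
  define r where "r n g = enn2real (min (ennreal (near_const * \<tau>)) (Q n g))" for n g
  have er: "ennreal (r n g) = min (ennreal (near_const * \<tau>)) (Q n g)" for n g
    unfolding r_def by (rule ennreal_enn2real) (simp add: min_less_iff_disj)
  have r: "0 \<le> r n g" "r n g \<le> near_const * \<tau>" "ennreal (r n g) \<le> Q n g" for n g
  proof -
    show "0 \<le> r n g" by (simp add: r_def)
    have "ennreal (r n g) \<le> ennreal (near_const * \<tau>)" unfolding er by simp
    then show "r n g \<le> near_const * \<tau>" using local_consts_pos(1) \<tau> by (subst (asm) ennreal_le_iff) auto
    show "ennreal (r n g) \<le> Q n g" unfolding er by simp
  qed
  define \<mu> where "\<mu> n = \<Lambda> * \<tau> * (1 - \<theta>) * \<theta> ^ n" for n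
  have \<mu>: "0 < \<mu> n" for n using \<Lambda> \<tau> \<theta> by (simp add: \<mu>_def)
  define E where "E n g = {x \<in> J n g. \<mu> n < dv n g x ^ k * r n g}" for n g
  have Em: "E n g \<in> sets lebesgue" for n g
  proof -
    have "(\<lambda>x. dv n g x ^ k * r n g) \<in> borel_measurable lebesgue" unfolding dv_def by measurable
    then have X: "(\<lambda>x. dv n g x ^ k * r n g) -` {\<mu> n<..} \<inter> space lebesgue \<in> sets lebesgue" by (rule measurable_sets) simp
    have eq: "E n g = J n g \<inter> ((\<lambda>x. dv n g x ^ k * r n g) -` {\<mu> n<..} \<inter> space lebesgue)" by (auto simp: E_def)
    show ?thesis unfolding eq by (rule sets.Int[OF _ X]) (simp add: J_def)
  qed
  define A where "A n x = {?z x<..<c} \<inter> {x + \<delta> n..<x + 2 * \<delta> n}" for n x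
  let ?K = "\<lambda>x y. ennreal (\<bar>b x - b y\<bar> ^ k * (f y * (y - x) powr (\<alpha> - 1)))"
  have Km: "?K x \<in> borel_measurable lebesgue" for x
  proof -
    have "(\<lambda>y. (y - x) powr (\<alpha> - 1)) \<in> borel_measurable lebesgue" by (rule measurable_completion) measurable
    then show ?thesis by measurable
  qed
  have annulus: "(\<integral>\<^sup>+y\<in>A n x. ?K x y \<partial>lebesgue) \<le> ennreal (B ^ k * (dv n g x ^ k * r n g))"
    if x: "u < x" "a n g < x" "x \<le> a n g + \<delta> n" for n g x
  proof -
    have Asub: "A n x \<subseteq> J n g" "A n x \<subseteq> {?z x<..<?z x + 2 * \<delta> n}" "A n x \<subseteq> J n g \<inter> {s<..<c}"
    proof -
      show 1: "A n x \<subseteq> J n g" using x \<delta>[of n] by (auto simp: A_def J_def)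
      show "A n x \<subseteq> {?z x<..<?z x + 2 * \<delta> n}" using good(2)[of x] by (auto simp: A_def)
      have "s \<le> ?z x" unfolding s_def using x by (intro zmono) simp
      then show "A n x \<subseteq> J n g \<inter> {s<..<c}" using 1 by (auto simp: A_def)
    qed
    have Ames: "A n x \<in> sets lebesgue" by (simp add: A_def)
    let ?I = "\<integral>\<^sup>+y\<in>A n x. ennreal (dv n g y ^ k * f y) \<partial>lebesgue"
    have mI: "(\<lambda>y. ennreal (dv n g y ^ k * f y) * indicator (A n x) y) \<in> borel_measurable lebesgue"
      unfolding dv_def by (intro borel_measurable_times_ennreal borel_measurable_indicator Ames) measurable
    have d0: "0 \<le> dv n g y" for y using dev_ge_1[of "a n g" "a n g + 3 * \<delta> n" y] by (simp add: dv_def)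
    have "(\<integral>\<^sup>+y\<in>A n x. ?K x y \<partial>lebesgue) \<le> (\<integral>\<^sup>+y. ennreal (B ^ k * dv n g x ^ k * \<delta> n powr (\<alpha> - 1)) * (ennreal (dv n g y ^ k * f y) * indicator (A n x) y) \<partial>lebesgue)"
    proof (rule nn_integral_mono)
      fix y
      show "?K x y * indicator (A n x) y \<le> ennreal (B ^ k * dv n g x ^ k * \<delta> n powr (\<alpha> - 1)) * (ennreal (dv n g y ^ k * f y) * indicator (A n x) y)"
      proof (cases "y \<in> A n x")
        case True
        then have yx: "\<delta> n \<le> y - x" by (auto simp: A_def)
        have 1: "(y - x) powr (\<alpha> - 1) \<le> \<delta> n powr (\<alpha> - 1)"
          using yx \<delta>[of n] \<alpha> by (intro powr_mono2') auto
        have "\<bar>b x - b y\<bar> ^ k \<le> (B * (dv n g x * dv n g y)) ^ k"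
          unfolding dv_def by (intro power_mono osc_le_dev) simp
        then have "\<bar>b x - b y\<bar> ^ k * (f y * (y - x) powr (\<alpha> - 1)) \<le> (B * (dv n g x * dv n g y)) ^ k * (f y * \<delta> n powr (\<alpha> - 1))"
          using f0 1 by (intro mult_mono mult_left_mono mult_nonneg_nonneg) (auto intro!: zero_le_power mult_nonneg_nonneg d0 less_imp_le[OF B])
        also have "\<dots> = (B ^ k * dv n g x ^ k * \<delta> n powr (\<alpha> - 1)) * (dv n g y ^ k * f y)"
          by (simp add: power_mult_distrib mult_ac)
        finally have "?K x y \<le> ennreal ((B ^ k * dv n g x ^ k * \<delta> n powr (\<alpha> - 1)) * (dv n g y ^ k * f y))" by (rule ennreal_leI)
        also have "\<dots> = ennreal (B ^ k * dv n g x ^ k * \<delta> n powr (\<alpha> - 1)) * ennreal (dv n g y ^ k * f y)"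
          using d0 B f0 by (intro ennreal_mult) auto
        finally show ?thesis using True by simp
      qed simp
    qed
    also have "\<dots> = ennreal (B ^ k * dv n g x ^ k * \<delta> n powr (\<alpha> - 1)) * ?I" by (rule nn_integral_cmult) (rule mI)
    also have "\<dots> = ennreal (B ^ k * dv n g x ^ k) * (ennreal (\<delta> n powr (\<alpha> - 1)) * ?I)"
      using d0 B by (subst ennreal_mult) (auto simp: mult.assoc)
    also have "\<dots> \<le> ennreal (B ^ k * dv n g x ^ k) * ennreal (r n g)"
    proof (rule mult_left_mono)
      have "ennreal (\<delta> n powr (\<alpha> - 1)) * ?I \<le> ennreal (near_const * \<tau>)"
        unfolding dv_def by (rule near_mass_le[OF \<tau> good(1) \<delta> Ames]) (use Asub in \<open>auto simp: J_def\<close>)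
      moreover have "ennreal (\<delta> n powr (\<alpha> - 1)) * ?I \<le> Q n g"
        unfolding Q_def by (intro mult_left_mono nn_set_integral_set_mono Asub) simp
      ultimately show "ennreal (\<delta> n powr (\<alpha> - 1)) * ?I \<le> ennreal (r n g)" by (simp add: er)
    qed simp
    also have "\<dots> = ennreal (B ^ k * (dv n g x ^ k * r n g))"
      using d0 B r(1) by (subst ennreal_mult[symmetric]) (auto simp: mult.assoc)
    finally show ?thesis .
  qed
  define EE where "EE = (\<Union>n. \<Union>g<2 ^ n. E n g)"
  have Un: "(\<Union>g<2 ^ n. E n g) \<in> sets lebesgue" for n by (rule sets.finite_UN) (use Em in auto)
  have EEm: "EE \<in> sets lebesgue" unfolding EE_def by (rule sets.countable_UN) (use Un in blast)
  have sub: "{x \<in> {u<..<v}. ennreal (\<Lambda> * (B ^ k * \<tau>)) < (\<integral>\<^sup>+y\<in>{?z x<..<c}. ?K x y \<partial>lebesgue)} \<subseteq> EE"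
  proof
    fix x assume x: "x \<in> {x \<in> {u<..<v}. ennreal (\<Lambda> * (B ^ k * \<tau>)) < (\<integral>\<^sup>+y\<in>{?z x<..<c}. ?K x y \<partial>lebesgue)}"
    then have ux: "u < x" "x < v" by auto
    show "x \<in> EE"
    proof (rule ccontr)
      assume nEE: "x \<notin> EE"
      have an: "(\<integral>\<^sup>+y\<in>A n x. ?K x y \<partial>lebesgue) \<le> ennreal (B ^ k * \<Lambda> * \<tau> * (1 - \<theta>) * \<theta> ^ n)" for n
      proof -
        define g where "g = nat (\<lceil>(x - u) / \<delta> n\<rceil> - 1)"
        have pos: "0 < (x - u) / \<delta> n" using ux \<delta>[of n] by simp
        have le: "(x - u) / \<delta> n < 2 ^ n" using ux L by (simp add: \<delta>_def L_def divide_simps)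
        have c1: "1 \<le> \<lceil>(x - u) / \<delta> n\<rceil>" using pos by linarith
        have rg: "real g = real_of_int \<lceil>(x - u) / \<delta> n\<rceil> - 1" using c1 by (simp add: g_def)
        have g1: "real g < (x - u) / \<delta> n" "(x - u) / \<delta> n \<le> real g + 1" unfolding rg by linarith+
        have "real g < 2 ^ n" using g1 le by linarith
        then have gn: "g < 2 ^ n" by (metis of_nat_less_iff of_nat_numeral of_nat_power)
        have ax: "a n g < x" "x \<le> a n g + \<delta> n" using g1 \<delta>[of n] by (auto simp: a_def field_simps)
        have "x \<in> J n g" using ax \<delta>[of n] by (auto simp: J_def)
        moreover have "x \<notin> E n g" using nEE gn by (auto simp: EE_def)
        ultimately have "dv n g x ^ k * r n g \<le> \<mu> n" by (auto simp: E_def)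
        then have "B ^ k * (dv n g x ^ k * r n g) \<le> B ^ k * \<mu> n" using B by (intro mult_left_mono) auto
        then have "ennreal (B ^ k * (dv n g x ^ k * r n g)) \<le> ennreal (B ^ k * \<Lambda> * \<tau> * (1 - \<theta>) * \<theta> ^ n)"
          by (intro ennreal_leI) (simp add: \<mu>_def mult.assoc)
        with annulus[OF ux(1) ax] show ?thesis by (rule order_trans)
      qed
      have mA: "(\<lambda>y. ?K x y * indicator (A n x) y) \<in> borel_measurable lebesgue" for n
        by (intro borel_measurable_times_ennreal borel_measurable_indicator Km) (simp add: A_def)
      have "(\<integral>\<^sup>+y\<in>{?z x<..<c}. ?K x y \<partial>lebesgue) \<le> (\<integral>\<^sup>+y. (\<Sum>n. ?K x y * indicator (A n x) y) \<partial>lebesgue)"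
      proof (rule nn_integral_mono)
        fix y
        show "?K x y * indicator {?z x<..<c} y \<le> (\<Sum>n. ?K x y * indicator (A n x) y)"
        proof (cases "y \<in> {?z x<..<c}")
          case True
          then have xy: "x < y" "y - x < 2 * L" using good(2)[of x] ux by (auto simp: c L_def)
          then have "1 \<le> 2 * L / (y - x)" by simp
          then obtain n where n: "2 ^ n \<le> 2 * L / (y - x)" "2 * L / (y - x) < 2 ^ Suc n" using dyadic_scale by blast
          then have n': "2 ^ n * (y - x) \<le> 2 * L" "2 * L < 2 ^ Suc n * (y - x)" using xy by (auto simp: field_simps)
          \<comment> \<open>For this \<open>n\<close> the point \<open>y\<close> is in \<open>A n x\<close>, unless \<open>y = x + 2 \<delta> n\<close>, which is the
            left end of the next larger annulus.\<close>
          have "y \<noteq> x + 2 * \<delta> n \<Longrightarrow> y \<in> A n x"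
            using n' True by (auto simp: A_def \<delta>_def field_simps)
          moreover have "y = x + 2 * \<delta> n \<Longrightarrow> n \<noteq> 0 \<Longrightarrow> y \<in> A (n - 1) x"
            using True \<delta>[of n] by (cases n) (auto simp: A_def \<delta>_def field_simps)
          moreover have "y = x + 2 * \<delta> n \<Longrightarrow> n = 0 \<Longrightarrow> False" using xy by (simp add: \<delta>_def)
          ultimately obtain n where n: "y \<in> A n x" by blast
          have "?K x y * indicator {?z x<..<c} y = (\<Sum>n\<in>{n}. ?K x y * indicator (A n x) y)" using n True by simp
          also have "\<dots> \<le> (\<Sum>n. ?K x y * indicator (A n x) y)" by (rule sum_le_suminf) auto
          finally show ?thesis .
        qed simp
      qed
      also have "\<dots> = (\<Sum>n. \<integral>\<^sup>+y\<in>A n x. ?K x y \<partial>lebesgue)" by (rule nn_integral_suminf) (rule mA)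
      also have "\<dots> \<le> (\<Sum>n. ennreal (B ^ k * \<Lambda> * \<tau> * (1 - \<theta>) * \<theta> ^ n))" by (rule suminf_le) (use an in auto)
      also have "\<dots> = ennreal (B ^ k * \<Lambda> * \<tau> * (1 - \<theta>) * (1 / (1 - \<theta>)))"
      proof (rule suminf_ennreal_eq)
        show "(\<lambda>n. B ^ k * \<Lambda> * \<tau> * (1 - \<theta>) * \<theta> ^ n) sums (B ^ k * \<Lambda> * \<tau> * (1 - \<theta>) * (1 / (1 - \<theta>)))"
          by (intro sums_mult geometric_sums) (use \<theta> in auto)
      qed (use B \<Lambda> \<tau> \<theta> in auto)
      also have "B ^ k * \<Lambda> * \<tau> * (1 - \<theta>) * (1 / (1 - \<theta>)) = \<Lambda> * (B ^ k * \<tau>)" using \<theta> by (simp add: mult_ac)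
      finally show False using x by auto
    qed
  qed
  have "emeasure lebesgue EE \<le> ennreal (local_const m / \<Lambda> ^ m * (v - u))"
  proof -
    have level_n: "emeasure lebesgue (\<Union>g<2 ^ n. E n g) \<le> ennreal (moment_const m * near_const ^ (m - 1) * grid_const / (\<Lambda> ^ m * (1 - \<theta>) ^ m) * L * \<rho> ^ n)" for n
    proof -
      let ?c = "moment_const m * (near_const * \<tau>) ^ (m - 1) / \<mu> n ^ m"
      have c0: "0 \<le> ?c" using local_consts_pos(1) local_consts_pos(3)[of m] \<tau> \<mu>[of n] by auto
      have "emeasure lebesgue (\<Union>g<2 ^ n. E n g) \<le> (\<Sum>g<2 ^ n. emeasure lebesgue (E n g))"
        by (rule emeasure_subadditive_finite) (use Em in auto)
      also have "\<dots> \<le> (\<Sum>g<2 ^ n. ennreal ?c * (ennreal (\<delta> n) * Q n g))"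
      proof (rule sum_mono)
        fix g
        have "emeasure lebesgue (E n g) \<le> ennreal ?c * (ennreal (\<delta> n) * ennreal (r n g))"
          unfolding E_def J_def dv_def by (rule dev_markov[OF \<delta> m \<mu> r(1,2)])
        also have "\<dots> \<le> ennreal ?c * (ennreal (\<delta> n) * Q n g)" by (intro mult_left_mono r(3)) auto
        finally show "emeasure lebesgue (E n g) \<le> ennreal ?c * (ennreal (\<delta> n) * Q n g)" .
      qed
      also have "\<dots> = ennreal ?c * (\<Sum>g<2 ^ n. ennreal (\<delta> n) * Q n g)" by (simp only: sum_distrib_left)
      also have "(\<Sum>g<2 ^ n. ennreal (\<delta> n) * Q n g) \<le> ennreal (grid_const * (1 / 2 powr \<alpha>) ^ n * \<tau> * L)"
      proof -
        have sS: "{s<..<c} \<subseteq> {s<..<s + 2 * L}" using su by (auto simp: c L_def)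
        have e: "u + (real g + 3) * \<delta> n = a n g + 3 * \<delta> n" for g by (simp add: a_def algebra_simps)
        have eqa: "u + real g * \<delta> n = a n g" for g by (simp add: a_def)
        show ?thesis
          using grid_mass_sum_le[OF \<tau> good(1)[of u] L, of "{s<..<c}" "\<delta> n" n u] sS
          unfolding e eqa Q_def J_def dv_def s_def[symmetric] by (simp add: \<delta>_def)
      qed
      also have "ennreal ?c * ennreal (grid_const * (1 / 2 powr \<alpha>) ^ n * \<tau> * L) = ennreal (?c * (grid_const * (1 / 2 powr \<alpha>) ^ n * \<tau> * L))"
        using c0 local_consts_pos(2) \<tau> L by (intro ennreal_mult[symmetric]) auto
      also have "?c * (grid_const * (1 / 2 powr \<alpha>) ^ n * \<tau> * L) = moment_const m * near_const ^ (m - 1) * grid_const / (\<Lambda> ^ m * (1 - \<theta>) ^ m) * L * \<rho> ^ n"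
      proof -
        have t1: "\<tau> ^ (m - 1) * \<tau> = \<tau> ^ m" using m by (metis Suc_diff_1 less_eq_Suc_le mult.commute power_Suc One_nat_def)
        have t2: "\<mu> n ^ m = \<Lambda> ^ m * \<tau> ^ m * (1 - \<theta>) ^ m * \<rho> ^ n"
        proof -
          have "(\<theta> ^ n) ^ m = \<rho> ^ n" unfolding \<theta>m[symmetric] by (simp add: power_mult[symmetric] mult.commute)
          then show ?thesis by (simp add: \<mu>_def power_mult_distrib)
        qed
        have "?c * (grid_const * (1 / 2 powr \<alpha>) ^ n * \<tau> * L) = moment_const m * near_const ^ (m - 1) * grid_const * L * (\<tau> ^ (m - 1) * \<tau>) * (\<rho> ^ n * \<rho> ^ n) / \<mu> n ^ m"
          by (simp add: power_mult_distrib \<rho>2)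
        also have "\<dots> = moment_const m * near_const ^ (m - 1) * grid_const / (\<Lambda> ^ m * (1 - \<theta>) ^ m) * L * \<rho> ^ n"
          unfolding t1 t2 using \<tau> \<rho> \<Lambda> \<theta> by simp
        finally show ?thesis .
      qed
      finally show ?thesis by (simp add: mult_left_mono)
    qed
    have "emeasure lebesgue EE \<le> (\<Sum>n. emeasure lebesgue (\<Union>g<2 ^ n. E n g))"
      unfolding EE_def by (rule emeasure_subadditive_countably) (use Un in blast)
    also have "\<dots> \<le> (\<Sum>n. ennreal (moment_const m * near_const ^ (m - 1) * grid_const / (\<Lambda> ^ m * (1 - \<theta>) ^ m) * L * \<rho> ^ n))"
      by (rule suminf_le) (use level_n in auto)
    also have "\<dots> = ennreal (moment_const m * near_const ^ (m - 1) * grid_const / (\<Lambda> ^ m * (1 - \<theta>) ^ m) * L * (1 / (1 - \<rho>)))"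
    proof (rule suminf_ennreal_eq)
      show "(\<lambda>n. moment_const m * near_const ^ (m - 1) * grid_const / (\<Lambda> ^ m * (1 - \<theta>) ^ m) * L * \<rho> ^ n) sums
          (moment_const m * near_const ^ (m - 1) * grid_const / (\<Lambda> ^ m * (1 - \<theta>) ^ m) * L * (1 / (1 - \<rho>)))"
        by (intro sums_mult geometric_sums) (use \<rho> in auto)
    qed (use local_consts_pos(1,2) local_consts_pos(3)[of m] \<Lambda> \<theta> \<rho> L in auto)
    also have "moment_const m * near_const ^ (m - 1) * grid_const / (\<Lambda> ^ m * (1 - \<theta>) ^ m) * L * (1 / (1 - \<rho>)) = local_const m / \<Lambda> ^ m * (v - u)"
      by (simp add: local_const_def \<theta>_def \<rho>_def L_def)
    finally show ?thesis .
  qed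
  then show ?thesis using sub EEm by blast
qed

end

section \<open>Powers of extended nonnegative reals and measurability\<close>

lemma sigma_finite_lebesgue: "sigma_finite_measure (lebesgue :: real measure)"
proof
  show "\<exists>A. countable A \<and> A \<subseteq> sets (lebesgue :: real measure) \<and> \<Union> A = space lebesgue \<and> (\<forall>a\<in>A. emeasure lebesgue a \<noteq> \<infinity>)"
  proof (intro exI[of _ "range (\<lambda>n::nat. {- real n..real n})"] conjI)
    show "\<Union> (range (\<lambda>n::nat. {- real n..real n})) = space lebesgue"
    proof (intro equalityI subsetI)
      fix x :: real
      obtain n where "\<bar>x\<bar> \<le> real n" using real_arch_simple by blast
      then show "x \<in> \<Union> (range (\<lambda>n::nat. {- real n..real n}))" by (auto intro!: exI[of _ n])
    qed auto
  qed auto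
qed

lemma epowr_measurable [measurable]: "(\<lambda>x. x epowr p) \<in> borel_measurable borel"
  unfolding epowr_def[abs_def] by measurable

lemma epowr_inverse: "0 < p \<Longrightarrow> (x epowr p) epowr (1 / p) = x"
  by (cases x) (auto simp: epowr_def powr_powr)

lemma epowr_inverse': "0 < p \<Longrightarrow> (x epowr (1 / p)) epowr p = x"
  using epowr_inverse[of "1 / p" x] by simp

lemma SUP_epowr_le:
  assumes "0 < p" shows "(SUP i\<in>I. a i) epowr p \<le> (SUP i\<in>I. a i epowr p)"
proof -
  let ?M = "SUP i\<in>I. a i epowr p"
  have "(SUP i\<in>I. a i) \<le> ?M epowr (1 / p)"
  proof (rule SUP_least)
    fix i assume "i \<in> I"
    then have "a i epowr p \<le> ?M" by (rule SUP_upper)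
    then have "(a i epowr p) epowr (1 / p) \<le> ?M epowr (1 / p)" by (rule epowr_mono) (use assms in simp)
    then show "a i \<le> ?M epowr (1 / p)" by (simp add: epowr_inverse assms)
  qed
  then have "(SUP i\<in>I. a i) epowr p \<le> (?M epowr (1 / p)) epowr p" by (rule epowr_mono) (use assms in simp)
  then show ?thesis by (simp add: epowr_inverse' assms)
qed

lemma epowr_mult: "(x * y) epowr p = (x epowr p) * (y epowr p)" if "0 < p"
proof (cases "x = top \<or> y = top")
  case True
  then show ?thesis using that by (auto simp: epowr_def ennreal_mult_top ennreal_top_mult mult_eq_0_iff enn2real_eq_0_iff powr_eq_0_iff)
next
  case False
  then obtain r s where "x = ennreal r" "0 \<le> r" "y = ennreal s" "0 \<le> s" by (cases x; cases y) auto
  then show ?thesis by (simp add: epowr_ennreal powr_mult flip: ennreal_mult)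
qed

text \<open>The modulus of the kernel of the commutator, applied to a nonnegative \<open>f\<close>.\<close>

definition kern :: "real \<Rightarrow> nat \<Rightarrow> (real \<Rightarrow> real) \<Rightarrow> (real \<Rightarrow> real) \<Rightarrow> real \<Rightarrow> real \<Rightarrow> ennreal" where
  "kern \<alpha> k b f x y = ennreal (\<bar>b x - b y\<bar> ^ k * (f y * (y - x) powr (\<alpha> - 1)))"

lemma kern_pair_measurable:
  assumes b: "b \<in> borel_measurable lebesgue" and f: "f \<in> borel_measurable lebesgue"
  shows "(\<lambda>p. kern \<alpha> k b f (fst p) (snd p)) \<in> borel_measurable (lebesgue \<Otimes>\<^sub>M lebesgue)"
    "(\<lambda>p. fst p :: real) \<in> borel_measurable (lebesgue \<Otimes>\<^sub>M (lebesgue :: real measure))"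
    "(\<lambda>p. snd p :: real) \<in> borel_measurable ((lebesgue :: real measure) \<Otimes>\<^sub>M lebesgue)"
proof -
  have id: "(\<lambda>x::real. x) \<in> borel_measurable lebesgue" by (rule measurable_completion) simp
  show [measurable]: "(\<lambda>p. fst p :: real) \<in> borel_measurable (lebesgue \<Otimes>\<^sub>M (lebesgue :: real measure))"
    by (rule measurable_compose[OF measurable_fst id])
  show [measurable]: "(\<lambda>p. snd p :: real) \<in> borel_measurable ((lebesgue :: real measure) \<Otimes>\<^sub>M lebesgue)"
    by (rule measurable_compose[OF measurable_snd id])
  have [measurable]: "(\<lambda>p. b (fst p)) \<in> borel_measurable (lebesgue \<Otimes>\<^sub>M (lebesgue :: real measure))"
    by (rule measurable_compose[OF measurable_fst b])
  have [measurable]: "(\<lambda>p. b (snd p)) \<in> borel_measurable ((lebesgue :: real measure) \<Otimes>\<^sub>M lebesgue)"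
    by (rule measurable_compose[OF measurable_snd b])
  have [measurable]: "(\<lambda>p. f (snd p)) \<in> borel_measurable ((lebesgue :: real measure) \<Otimes>\<^sub>M lebesgue)"
    by (rule measurable_compose[OF measurable_snd f])
  show "(\<lambda>p. kern \<alpha> k b f (fst p) (snd p)) \<in> borel_measurable (lebesgue \<Otimes>\<^sub>M lebesgue)"
    unfolding kern_def by measurable
qed

lemma kern_integral_measurable:
  assumes b: "b \<in> borel_measurable lebesgue" and f: "f \<in> borel_measurable lebesgue"
    and z: "z \<in> borel_measurable borel" and c: "c \<in> borel_measurable borel"
  shows "(\<lambda>x. \<integral>\<^sup>+y\<in>{z x<..<c x}. kern \<alpha> k b f x y \<partial>lebesgue) \<in> borel_measurable lebesgue"
proof -
  note [measurable] = kern_pair_measurable[OF b f] z c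
  have "(\<lambda>p. kern \<alpha> k b f (fst p) (snd p) * (if z (fst p) < snd p \<and> snd p < c (fst p) then 1 else 0)) \<in> borel_measurable (lebesgue \<Otimes>\<^sub>M lebesgue)"
    by measurable
  then have "(\<lambda>(x, y). kern \<alpha> k b f x y * indicator {z x<..<c x} y) \<in> borel_measurable (lebesgue \<Otimes>\<^sub>M lebesgue)"
    by (rule measurable_cong[THEN iffD1, rotated]) (auto simp: indicator_def)
  then show ?thesis by (rule sigma_finite_measure.borel_measurable_nn_integral[OF sigma_finite_lebesgue])
qed

lemma kern_integral_measurable_full:
  assumes b: "b \<in> borel_measurable lebesgue" and f: "f \<in> borel_measurable lebesgue"
  shows "(\<lambda>x. \<integral>\<^sup>+y\<in>{x<..}. kern \<alpha> k b f x y \<partial>lebesgue) \<in> borel_measurable lebesgue"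
proof -
  note [measurable] = kern_pair_measurable[OF b f]
  have "(\<lambda>p. kern \<alpha> k b f (fst p) (snd p) * (if fst p < snd p then 1 else 0)) \<in> borel_measurable (lebesgue \<Otimes>\<^sub>M lebesgue)"
    by measurable
  then have "(\<lambda>(x, y). kern \<alpha> k b f x y * indicator {x<..} y) \<in> borel_measurable (lebesgue \<Otimes>\<^sub>M lebesgue)"
    by (rule measurable_cong[THEN iffD1, rotated]) (auto simp: indicator_def)
  then show ?thesis by (rule sigma_finite_measure.borel_measurable_nn_integral[OF sigma_finite_lebesgue])
qed

lemma kern_measurable_snd:
  assumes b: "b \<in> borel_measurable lebesgue" and f: "f \<in> borel_measurable lebesgue"
  shows "kern \<alpha> k b f x \<in> borel_measurable lebesgue"
proof -
  have "(\<lambda>y. (y - x) powr (\<alpha> - 1)) \<in> borel_measurable lebesgue" by (rule measurable_completion) measurable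
  then show ?thesis using b f unfolding kern_def[abs_def] by measurable
qed

text \<open>A substitute for Minkowski's inequality that works for all \<open>p > 0\<close>: weakening the weights
  \<open>2^l\<close> to \<open>4^l\<close> pays for replacing the sum by its largest term.\<close>

lemma layer_epowr_le:
  fixes \<gamma> :: "nat \<Rightarrow> real"
  assumes p: "0 < p" and \<gamma>: "\<And>l. 0 \<le> \<gamma> l"
  shows "(\<Sum>l. ennreal (2 ^ l * \<gamma> l)) epowr p \<le> ennreal (2 powr p) * (\<Sum>l. ennreal ((4 ^ l * \<gamma> l) powr p))"
proof (cases "(\<Sum>l. ennreal ((4 ^ l * \<gamma> l) powr p)) = top")
  case True then show ?thesis by (simp add: ennreal_mult_top)
next
  case False
  define Z where "Z = (\<Sum>l. ennreal ((4 ^ l * \<gamma> l) powr p))"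
  have "Z \<noteq> top" using False by (simp only: Z_def not_False_eq_True)
  then obtain \<zeta> where "Z = ennreal \<zeta>" "0 \<le> \<zeta>" by (cases Z) auto
  then have \<zeta>: "(\<Sum>l. ennreal ((4 ^ l * \<gamma> l) powr p)) = ennreal \<zeta>" "0 \<le> \<zeta>" by (simp_all only: Z_def)
  define r where "r = \<zeta> powr (1 / p)"
  have le: "2 ^ l * \<gamma> l \<le> r * (1/2) ^ l" for l
  proof -
    have "(\<Sum>i\<in>{l}. ennreal ((4 ^ i * \<gamma> i) powr p)) \<le> (\<Sum>l. ennreal ((4 ^ l * \<gamma> l) powr p))"
      by (rule sum_le_suminf) auto
    then have "(4 ^ l * \<gamma> l) powr p \<le> \<zeta>" using \<zeta> by simp
    then have "((4 ^ l * \<gamma> l) powr p) powr (1 / p) \<le> r" unfolding r_def using p by (intro powr_mono2) auto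
    then have "4 ^ l * \<gamma> l \<le> r" using p \<gamma>[of l] by (simp add: powr_powr)
    moreover have "(4::real) ^ l = 2 ^ l * 2 ^ l" by (simp flip: power_mult_distrib)
    ultimately show ?thesis by (simp add: power_one_over field_simps)
  qed
  have r0: "0 \<le> r" by (simp add: r_def)
  have "(\<Sum>l. ennreal (2 ^ l * \<gamma> l)) \<le> (\<Sum>l. ennreal (r * (1/2) ^ l))"
    by (rule suminf_le) (use le in \<open>auto intro!: ennreal_leI\<close>)
  also have "\<dots> = ennreal (2 * r)"
  proof (rule suminf_ennreal_eq)
    have "(\<lambda>l. r * (1/2) ^ l) sums (r * (1 / (1 - 1/2)))" by (intro sums_mult geometric_sums) simp
    then show "(\<lambda>l. r * (1/2) ^ l) sums (2 * r)" by (simp add: mult.commute)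
  qed (use r0 in auto)
  finally have "(\<Sum>l. ennreal (2 ^ l * \<gamma> l)) epowr p \<le> ennreal (2 * r) epowr p"
    by (rule epowr_mono) (use p in simp)
  also have "\<dots> = ennreal ((2 * r) powr p)" using r0 by (intro epowr_ennreal) simp
  also have "(2 * r) powr p = 2 powr p * \<zeta>" using p \<zeta> by (simp add: powr_mult r_def powr_powr)
  also have "ennreal (2 powr p * \<zeta>) = ennreal (2 powr p) * ennreal \<zeta>" using \<zeta> by (intro ennreal_mult) auto
  finally show ?thesis by (simp add: \<zeta>)
qed

text \<open>The sum is at most twice its largest term, so that the \<open>p\<close>-th power can be taken term by term.\<close>

lemma lacunary_sum_powr_le:
  fixes t p :: real
  assumes t: "0 < t" and p: "0 < p" and "finite J"
  shows "(\<Sum>n\<in>J. 2 ^ n * t) powr p \<le> 2 powr p * (\<Sum>n\<in>J. (2 ^ n * t) powr p)"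
proof (cases "J = {}")
  case False
  define M where "M = Max J"
  have M: "M \<in> J" unfolding M_def using assms False by (intro Max_in) auto
  have "(\<Sum>n\<in>J. 2 ^ n * t) \<le> (\<Sum>n\<le>M. 2 ^ n * t)"
    by (rule sum_mono2) (use assms in \<open>auto simp: M_def\<close>)
  also have "\<dots> = (2 ^ Suc M - 1) * t"
    by (simp only: sum_distrib_right[symmetric] lessThan_Suc_atMost[symmetric] geometric_sum) simp
  also have "\<dots> \<le> 2 * (2 ^ M * t)" using t by (simp add: algebra_simps)
  finally have "(\<Sum>n\<in>J. 2 ^ n * t) powr p \<le> (2 * (2 ^ M * t)) powr p"
    using t p by (intro powr_mono2 sum_nonneg) auto
  also have "\<dots> = 2 powr p * (2 ^ M * t) powr p" by (rule powr_mult)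
  also have "\<dots> \<le> 2 powr p * (\<Sum>n\<in>J. (2 ^ n * t) powr p)"
    by (intro mult_left_mono member_le_sum M) (use assms in auto)
  finally show ?thesis .
qed simp

lemma layer_decomposition:
  fixes y :: ennreal and \<mu> :: real
  assumes \<mu>: "0 < \<mu>"
  shows "y \<le> ennreal \<mu> * (\<Sum>l. ennreal (2 ^ l) * (if l = 0 \<or> ennreal (2 ^ (l - 1) * \<mu>) < y then 1 else 0))"
    (is "_ \<le> _ * (\<Sum>l. ?g l)")
proof (cases "y = top")
  case True
  have "(\<Sum>l. ennreal 1) \<le> (\<Sum>l. ?g l)"
  proof (rule suminf_le)
    fix l
    have "ennreal 1 \<le> ennreal (2 ^ l)" by (rule ennreal_leI) (simp add: one_le_power)
    then show "ennreal 1 \<le> ?g l" using True by simp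
  qed auto
  moreover have "(\<Sum>l::nat. ennreal 1) = top"
    using ennreal_layer_bound[of 0 1 top] by (simp add: top_unique)
  ultimately show ?thesis using \<mu> by (simp add: top_unique ennreal_mult_top)
next
  case False
  then obtain r where r: "y = ennreal r" "0 \<le> r" by (cases y) auto
  have "\<exists>l. y \<le> ennreal \<mu> * ?g l"
  proof (cases "r \<le> \<mu>")
    case True then show ?thesis using r by (intro exI[of _ 0]) (auto intro!: ennreal_leI)
  next
    case False
    then have "1 \<le> r / \<mu>" using \<mu> by simp
    then obtain l where l: "2 ^ l \<le> r / \<mu>" "r / \<mu> < 2 ^ Suc l" using dyadic_scale by blast
    then have l': "2 ^ l * \<mu> \<le> r" "r < 2 ^ Suc l * \<mu>" using \<mu> by (auto simp: field_simps)
    show ?thesis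
    proof (cases "2 ^ l * \<mu> = r")
      case True
      have "l \<noteq> 0" using True \<open>\<not> r \<le> \<mu>\<close> by (intro notI) simp
      then have "2 ^ (l - 1) * \<mu> < r" using \<mu> True by (cases l) auto
      then have "?g l = ennreal (2 ^ l)" using r \<mu> by (simp add: ennreal_less_iff)
      then show ?thesis using True \<mu> r by (intro exI[of _ l]) (simp add: mult.commute flip: ennreal_mult)
    next
      case False
      then have "2 ^ l * \<mu> < r" using l' by simp
      then have "?g (Suc l) = ennreal (2 ^ Suc l)" using r \<mu> by (simp add: ennreal_less_iff)
      then have "ennreal \<mu> * ?g (Suc l) = ennreal (\<mu> * 2 ^ Suc l)" using \<mu> by (simp only: ennreal_mult less_imp_le zero_le_power zero_le_numeral)
      moreover have "y \<le> ennreal (\<mu> * 2 ^ Suc l)" using l' r by (intro ord_eq_le_trans[OF r(1)] ennreal_leI) (simp add: mult.commute)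
      ultimately show ?thesis by (intro exI[of _ "Suc l"]) simp
    qed
  qed
  then obtain l where "y \<le> ennreal \<mu> * ?g l" by blast
  also have "?g l = sum ?g {l}" by simp
  also have "sum ?g {l} \<le> (\<Sum>l. ?g l)" by (rule sum_le_suminf) auto
  finally show ?thesis by (simp add: mult_left_mono)
qed

section \<open>The bound for bounded functions of compact support\<close>

locale commutator_setting = weighted_truncated W q e D p \<alpha> R F k f g + truncated_bmo \<alpha> R F k f b B
  for W q e D p \<alpha> R F k f g b B
begin

abbreviation "ker \<equiv> kern \<alpha> k b f"
abbreviation "nx t \<equiv> next_good (lev t)"

lemma nx: assumes "0 < t" shows "x \<le> nx t x" "nx t x \<notin> lev t" "x \<notin> lev t \<Longrightarrow> nx t x = x"
  using next_good(1,2)[OF open_lev[OF assms] bdd_lev(1)[OF assms]] next_good_outside[OF open_lev[OF assms] bdd_lev(1)[OF assms]] by auto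

lemma nx_antimono: "0 < t \<Longrightarrow> t \<le> t' \<Longrightarrow> nx t' x \<le> nx t x"
  by (rule next_good_antimono_set[OF open_lev bdd_lev(1) open_lev bdd_lev(1) lev_antimono]) auto

lemma nx_measurable: "0 < t \<Longrightarrow> nx t \<in> borel_measurable borel"
  by (intro borel_measurable_mono next_good_mono open_lev bdd_lev)

definition piece :: "real \<Rightarrow> real \<Rightarrow> ennreal" where
  "piece t x = (\<integral>\<^sup>+y\<in>{nx (2 * t) x<..<nx t x}. ker x y \<partial>lebesgue)"

lemma piece_measurable: "0 < t \<Longrightarrow> piece t \<in> borel_measurable lebesgue"
  unfolding piece_def[abs_def] by (intro kern_integral_measurable bm fm nx_measurable) auto

lemma piece_zero: "0 < t \<Longrightarrow> x \<notin> lev t \<Longrightarrow> piece t x = 0"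
proof -
  assume t: "0 < t" and x: "x \<notin> lev t"
  then have "x \<notin> lev (2 * t)" using lev_antimono[of t "2 * t"] by auto
  then have "nx (2 * t) x = x" "nx t x = x" using nx(3) t x by auto
  then show ?thesis by (simp add: piece_def)
qed

text \<open>The layers of the piece at level \<open>t\<close>, at heights \<open>2^(l - 1)\<close> times its natural size
  \<open>B^k (2 t)\<close>; layer \<open>0\<close> is the whole level set.\<close>

definition layer :: "real \<Rightarrow> nat \<Rightarrow> real set" where
  "layer t l = {x \<in> lev t. l = 0 \<or> ennreal (2 ^ (l - 1) * (B ^ k * (2 * t))) < piece t x}"

lemma layer_measurable: assumes "0 < t" shows "layer t l \<in> sets lebesgue"
proof -
  have "layer t l = lev t \<inter> (if l = 0 then UNIV else piece t -` {ennreal (2 ^ (l - 1) * (B ^ k * (2 * t)))<..} \<inter> space lebesgue)"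
    by (auto simp: layer_def)
  also have "\<dots> \<in> sets lebesgue"
    using lev_measurable[OF assms] measurable_sets[OF piece_measurable[OF assms], of "{ennreal (2 ^ (l - 1) * (B ^ k * (2 * t)))<..}"] by auto
  finally show ?thesis .
qed

definition decay_const :: "nat \<Rightarrow> real" where
  "decay_const m = max 1 (D * (local_const m * 2 ^ m) powr e)"

lemma local_const_pos: "1 \<le> m \<Longrightarrow> 0 < local_const m"
proof -
  assume m: "1 \<le> m"
  have "1 < (2::real) powr (\<alpha> / (2 * real m))" "1 < (2::real) powr (\<alpha> / 2)" using \<alpha> m by (auto intro!: gr_one_powr)
  then show ?thesis unfolding local_const_def using local_consts_pos(1,2) local_consts_pos(3)[of m]
    by (intro divide_pos_pos mult_pos_pos zero_less_power) auto
qed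

text \<open>The local estimate at level \<open>2 t\<close> bounds the density of the layer in every Whitney interval of
  every component of the level set for \<open>t\<close>; the weight condition then gives the decay in \<open>l\<close>,
  with a rate that \<open>m\<close> makes as fast as desired.\<close>

lemma layer_weight:
  assumes t: "0 < t" and m: "1 \<le> m"
  shows "emeasure W (layer t l) \<le> ennreal (decay_const m * ((1 / 2 ^ (m * l)) powr e)) * tail_sum t"
proof -
  let ?P = "comps (lev t)" and ?I = "\<lambda>U. {fst U<..<snd U}"
  have fP: "interval_family ?P" by (rule interval_family_comps)
  then have cP: "countable ?P" by (simp add: interval_family_def)
  have bW: "layer t l \<inter> ?I U \<in> sets W" for U using layer_measurable[OF t] by (auto simp: sW)
  have "emeasure W (layer t l) \<le> emeasure W (\<Union>U\<in>?P. layer t l \<inter> ?I U)"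
  proof (rule emeasure_mono)
    show "layer t l \<subseteq> (\<Union>U\<in>?P. layer t l \<inter> ?I U)"
    proof
      fix x assume x: "x \<in> layer t l"
      then have "x \<in> lev t" by (simp add: layer_def)
      then obtain U where "U \<in> ?P" "x \<in> ?I U" using comps_cover[OF open_lev[OF t] bdd_lev[OF t]] by blast
      then show "x \<in> (\<Union>U\<in>?P. layer t l \<inter> ?I U)" using x by blast
    qed
    show "(\<Union>U\<in>?P. layer t l \<inter> ?I U) \<in> sets W" using cP bW by (intro sets.countable_UN'') auto
  qed
  also have "\<dots> \<le> (\<integral>\<^sup>+U. emeasure W (layer t l \<inter> ?I U) \<partial>count_space ?P)"
    by (rule emeasure_UN_le_nn_integral[OF cP bW])
  also have "\<dots> \<le> (\<integral>\<^sup>+U. ennreal (decay_const m * ((1 / 2 ^ (m * l)) powr e)) * tail_weight (fst U) (snd U) \<partial>count_space ?P)"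
  proof (rule nn_integral_mono)
    fix U assume "U \<in> space (count_space ?P)"
    then have U: "U \<in> ?P" by simp
    define a where "a = fst U"
    define c where "c = snd U"
    have ac: "a < c" using U by (simp add: comps_def a_def c_def)
    have nxc: "nx t x = c" if "x \<in> {a<..<c}" for x
      unfolding c_def by (rule next_good_comps[OF open_lev[OF t] bdd_lev(1)[OF t] U]) (use that in \<open>simp add: a_def c_def\<close>)
    have "emeasure W (layer t l \<inter> {a<..<c}) \<le> ennreal (decay_const m * ((1 / 2 ^ (m * l)) powr e)) * tail_weight a c"
    proof (cases "l = 0")
      case True
      have "emeasure W (layer t l \<inter> {a<..<c}) \<le> emeasure W {a<..<c}" by (rule emeasure_mono) (auto simp: sW)
      also have "\<dots> \<le> tail_weight a c" by (rule emeasure_le_tail_weight)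
      also have "\<dots> = ennreal 1 * tail_weight a c" by simp
      also have "\<dots> \<le> ennreal (decay_const m * ((1 / 2 ^ (m * l)) powr e)) * tail_weight a c"
        by (intro mult_right_mono ennreal_leI) (auto simp: True decay_const_def)
      finally show ?thesis .
    next
      case False
      define \<eta> where "\<eta> = local_const m / (2 ^ (l - 1)) ^ m"
      have \<eta>: "0 < \<eta>" using local_const_pos[OF m] by (simp add: \<eta>_def)
      have "emeasure W (layer t l \<inter> {a<..<c}) \<le> ennreal (D * \<eta> powr e) * tail_weight a c"
      proof (rule wb[unfolded whitney_bound_def, rule_format], intro conjI allI ac)
        show "0 \<le> \<eta>" using \<eta> by simp
        show "layer t l \<inter> {a<..<c} \<in> sets lebesgue" using layer_measurable[OF t] by auto
        show "layer t l \<inter> {a<..<c} \<subseteq> {a<..<c}" by auto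
        fix j
        define u where "u = c - (c - a) / 2 ^ j"
        define v where "v = c - (c - a) / 2 ^ Suc j"
        have vu: "v - u = (c - a) / 2 ^ Suc j" by (simp add: u_def v_def field_simps)
        have "0 < v - u" unfolding vu using ac by simp
        then have uv: "u < v" by simp
        have cv: "c = v + (v - u)" unfolding vu by (simp add: v_def)
        have t2: "0 < 2 * t" "0 < (2::real) ^ (l - 1)" using t by auto
        from local_estimate[OF t2(1) m uv t2(2) cv] obtain E where E: "E \<in> sets lebesgue" and
          sub: "{x \<in> {u<..<v}. ennreal (2 ^ (l - 1) * (B ^ k * (2 * t))) <
              (\<integral>\<^sup>+y\<in>{nx (2 * t) x<..<c}. ennreal (\<bar>b x - b y\<bar> ^ k * (f y * (y - x) powr (\<alpha> - 1))) \<partial>lebesgue)} \<subseteq> E"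
          and eE: "emeasure lebesgue E \<le> ennreal (local_const m / (2 ^ (l - 1)) ^ m * (v - u))"
          by (elim bexE conjE) (rule that)
        have "layer t l \<inter> {a<..<c} \<inter> {u<..<v} \<subseteq> E"
        proof
          fix x assume x: "x \<in> layer t l \<inter> {a<..<c} \<inter> {u<..<v}"
          then have "nx t x = c" using nxc by blast
          moreover have "ennreal (2 ^ (l - 1) * (B ^ k * (2 * t))) < piece t x" using x False by (simp add: layer_def)
          ultimately show "x \<in> E" using sub x unfolding piece_def kern_def by auto
        qed
        then have "emeasure lebesgue (layer t l \<inter> {a<..<c} \<inter> {u<..<v}) \<le> emeasure lebesgue E" by (rule emeasure_mono[OF _ E])
        also note eE
        finally have "emeasure lebesgue (layer t l \<inter> {a<..<c} \<inter> {u<..<v}) \<le> ennreal (\<eta> * ((c - a) / 2 ^ Suc j))"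
          by (simp only: vu \<eta>_def)
        then show "emeasure lebesgue (layer t l \<inter> {a<..<c} \<inter> {c - (c - a) / 2 ^ j<..<c - (c - a) / 2 ^ Suc j}) \<le> ennreal (\<eta> * ((c - a) / 2 ^ Suc j))"
          by (simp only: u_def v_def)
      qed
      also have "\<dots> \<le> ennreal (decay_const m * ((1 / 2 ^ (m * l)) powr e)) * tail_weight a c"
      proof (intro mult_right_mono ennreal_leI)
        have "(2::real) ^ (m * l) = (2 ^ (l - 1)) ^ m * 2 ^ m"
        proof -
          have "m * l = (l - 1) * m + m" using False by (cases l) auto
          then show ?thesis by (simp add: power_add power_mult)
        qed
        then have "\<eta> = (local_const m * 2 ^ m) * (1 / 2 ^ (m * l))" by (simp add: \<eta>_def)
        then have "\<eta> powr e = (local_const m * 2 ^ m) powr e * (1 / 2 ^ (m * l)) powr e" by (simp only: powr_mult)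
        then have "D * \<eta> powr e = (D * (local_const m * 2 ^ m) powr e) * (1 / 2 ^ (m * l)) powr e" by simp
        also have "\<dots> \<le> decay_const m * (1 / 2 ^ (m * l)) powr e" by (intro mult_right_mono) (auto simp: decay_const_def)
        finally show "D * \<eta> powr e \<le> decay_const m * (1 / 2 ^ (m * l)) powr e" .
      qed simp
      finally show ?thesis .
    qed
    then show "emeasure W (layer t l \<inter> ?I U) \<le> ennreal (decay_const m * ((1 / 2 ^ (m * l)) powr e)) * tail_weight (fst U) (snd U)"
      by (simp only: a_def c_def)
  qed
  also have "\<dots> = ennreal (decay_const m * ((1 / 2 ^ (m * l)) powr e)) * (\<integral>\<^sup>+U. tail_weight (fst U) (snd U) \<partial>count_space ?P)"
    by (rule nn_integral_cmult) simp
  also have "(\<integral>\<^sup>+U. tail_weight (fst U) (snd U) \<partial>count_space ?P) = tail_sum t"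
    using nn_integral_tails[OF fP sW, of "\<lambda>x. 1" q] unfolding tail_sum_def by simp
  finally show ?thesis .
qed

text \<open>The part of the integral up to the next good point. It increases to the integral over the
  whole half-line as \<open>t\<close> decreases to \<open>0\<close>.\<close>

definition potential_upto :: "real \<Rightarrow> real \<Rightarrow> ennreal" where
  "potential_upto t x = (\<integral>\<^sup>+y\<in>{x<..<nx t x}. ker x y \<partial>lebesgue)"

lemma potential_upto_measurable: "0 < t \<Longrightarrow> potential_upto t \<in> borel_measurable lebesgue"
  unfolding potential_upto_def[abs_def] by (intro kern_integral_measurable bm fm nx_measurable) auto

lemma ker_measurable: "ker x \<in> borel_measurable lebesgue"
  by (rule kern_measurable_snd[OF bm fm])

text \<open>The points \<open>next_good (lev (2 ^ n * t)) x\<close> decrease with \<open>n\<close> and reach \<open>x\<close> at the first empty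
  level. The finitely many points themselves form a null set.\<close>

lemma potential_upto_le_pieces:
  assumes t: "0 < t" and I: "lev (2 ^ I * t) = {}"
  shows "potential_upto t x \<le> (\<Sum>n<I. piece (2 ^ n * t) x)"
proof -
  let ?c = "\<lambda>n. nx (2 ^ n * t) x"
  have pos: "0 < 2 ^ n * t" for n using t by simp
  have mm: "(\<lambda>y. ker x y * indicator {?c (Suc n)<..<?c n} y) \<in> borel_measurable lebesgue" for n
    by (intro borel_measurable_times_ennreal borel_measurable_indicator ker_measurable) simp
  have cI: "?c I = x" using nx(3)[OF pos, of x I] I by simp
  have "finite (?c ` {..I})" by simp
  then have "?c ` {..I} \<in> null_sets lebesgue"
    by (intro null_sets_completionI countable_imp_null_set_lborel countable_finite)
  then have "AE y in lebesgue. y \<notin> ?c ` {..I}" by (rule AE_not_in)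
  then have "AE y in lebesgue. ker x y * indicator {x<..<nx t x} y \<le> (\<Sum>n<I. ker x y * indicator {?c (Suc n)<..<?c n} y)"
  proof eventually_elim
    case (elim y)
    show ?case
    proof (cases "y \<in> {x<..<nx t x}")
      case True
      define n where "n = (LEAST n. ?c n < y)"
      have ex: "?c I < y" using True cI by simp
      have n: "?c n < y" unfolding n_def by (rule LeastI[of "\<lambda>n. ?c n < y" I]) (rule ex)
      have nI: "n \<le> I" unfolding n_def by (rule Least_le) (rule ex)
      have "n \<noteq> 0" using n True by (intro notI) auto
      then obtain j where j: "n = Suc j" using not0_implies_Suc by blast
      have "\<not> ?c j < y" using not_less_Least[of j "\<lambda>n. ?c n < y"] j by (simp add: n_def)
      moreover have "y \<noteq> ?c j" using elim j nI by auto
      ultimately have yj: "y \<in> {?c (Suc j)<..<?c j}" using n j by auto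
      have "ker x y * indicator {x<..<nx t x} y = ker x y * indicator {?c (Suc j)<..<?c j} y" using True yj by simp
      also have "\<dots> \<le> (\<Sum>n<I. ker x y * indicator {?c (Suc n)<..<?c n} y)"
        by (rule member_le_sum) (use j nI in auto)
      finally show ?thesis .
    qed simp
  qed
  then have "potential_upto t x \<le> (\<integral>\<^sup>+y. (\<Sum>n<I. ker x y * indicator {?c (Suc n)<..<?c n} y) \<partial>lebesgue)"
    unfolding potential_upto_def by (rule nn_integral_mono_AE)
  also have "\<dots> = (\<Sum>n<I. piece (2 ^ n * t) x)"
    unfolding piece_def by (subst nn_integral_sum) (use mm in \<open>auto simp: mult.assoc\<close>)
  finally show ?thesis .
qed

definition main_const :: "nat \<Rightarrow> nat \<Rightarrow> real \<Rightarrow> real" where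
  "main_const m N K = 8 powr p * decay_const m * 2 * sum_const N K"

text \<open>The pieces are decomposed into layers. At \<open>x\<close> the layer \<open>l\<close> contributes \<open>2^l\<close> times the sum
  \<open>\<gamma> l x\<close> of the levels whose layer \<open>l\<close> contains \<open>x\<close>, which is a sum of distinct terms of a
  geometric progression. Hence \<open>p\<close>-th powers can be taken in both sums at the cost of \<open>4^(l p)\<close>.
  The choice of \<open>m\<close> makes the weight of layer \<open>l\<close> decay faster than this, and the sum over the
  levels is \<open>tail_sum_bound\<close>.\<close>

lemma potential_upto_estimate:
  assumes st: "step_const N K" "1 \<le> N" "0 < K" and t: "0 < t"
    and A: "Inf (lev (t / 2 ^ N)) \<le> - 3 * R - 2" and ne: "lev (t / 2 ^ N) \<noteq> {}" and m: "2 * p + 1 \<le> real m * e"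
  shows "(\<integral>\<^sup>+x. potential_upto t x epowr p \<partial>W) \<le> ennreal (main_const m N K * (B ^ k) powr p) * (G + ennreal (t powr p) * emeasure W {-R..R})"
proof -
  have m1: "1 \<le> m" using m p e by (cases m) auto
  obtain t1 where t1: "0 < t1" "\<And>s. t1 \<le> s \<Longrightarrow> lev s = {}" using lev_eventually_empty by blast
  obtain I where "t1 / t < 2 ^ I" using real_arch_pow[of 2 "t1 / t"] by auto
  then have "t1 \<le> 2 ^ I * t" using t by (simp add: field_simps)
  then have I: "lev (2 ^ I * t) = {}" by (rule t1(2))
  define Bk where "Bk = B ^ k"
  have Bk: "0 < Bk" using B by (simp add: Bk_def)
  have pos: "0 < 2 ^ n * t" for n :: nat using t by simp
  define \<gamma> where "\<gamma> l x = (\<Sum>n\<in>{n. n < I \<and> x \<in> layer (2 ^ n * t) l}. 2 ^ n * t)" for l x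
  have \<gamma>0: "0 \<le> \<gamma> l x" for l x unfolding \<gamma>_def using t by (intro sum_nonneg) simp
  have layerW: "layer (2 ^ n * t) l \<in> sets W" for n l using layer_measurable[OF pos] sW by simp
  have pw: "potential_upto t x \<le> ennreal (2 * Bk) * (\<Sum>l. ennreal (2 ^ l * \<gamma> l x))" for x
  proof -
    have single: "piece (2 ^ n * t) x \<le> (\<Sum>l. ennreal (2 * Bk) * (ennreal (2 ^ l * (2 ^ n * t)) * indicator (layer (2 ^ n * t) l) x))" for n
    proof (cases "x \<in> lev (2 ^ n * t)")
      case False then show ?thesis by (simp add: piece_zero[OF pos False])
    next
      case True
      let ?\<mu> = "Bk * (2 * (2 ^ n * t))"
      have "piece (2 ^ n * t) x \<le> ennreal ?\<mu> * (\<Sum>l. ennreal (2 ^ l) * (if l = 0 \<or> ennreal (2 ^ (l - 1) * ?\<mu>) < piece (2 ^ n * t) x then 1 else 0))"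
        by (rule layer_decomposition) (use Bk t in simp)
      also have "\<dots> = (\<Sum>l. ennreal ?\<mu> * (ennreal (2 ^ l) * indicator (layer (2 ^ n * t) l) x))"
        unfolding ennreal_suminf_cmult[symmetric] using True by (intro arg_cong[where f = suminf] ext) (simp add: layer_def indicator_def Bk_def)
      also have "\<dots> = (\<Sum>l. ennreal (2 * Bk) * (ennreal (2 ^ l * (2 ^ n * t)) * indicator (layer (2 ^ n * t) l) x))"
      proof (intro arg_cong[where f = suminf] ext)
        fix l
        have "ennreal ?\<mu> * ennreal (2 ^ l) = ennreal (2 * Bk) * ennreal (2 ^ l * (2 ^ n * t))"
          using Bk t by (simp add: mult_ac flip: ennreal_mult)
        then show "ennreal ?\<mu> * (ennreal (2 ^ l) * indicator (layer (2 ^ n * t) l) x) = ennreal (2 * Bk) * (ennreal (2 ^ l * (2 ^ n * t)) * indicator (layer (2 ^ n * t) l) x)"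
          by (simp only: mult.assoc[symmetric])
      qed
      finally show ?thesis .
    qed
    have "potential_upto t x \<le> (\<Sum>n<I. piece (2 ^ n * t) x)" by (rule potential_upto_le_pieces[OF t I])
    also have "\<dots> \<le> (\<Sum>n<I. \<Sum>l. ennreal (2 * Bk) * (ennreal (2 ^ l * (2 ^ n * t)) * indicator (layer (2 ^ n * t) l) x))"
      by (intro sum_mono single)
    also have "\<dots> = (\<Sum>l. \<Sum>n<I. ennreal (2 * Bk) * (ennreal (2 ^ l * (2 ^ n * t)) * indicator (layer (2 ^ n * t) l) x))"
      by (rule suminf_sum[symmetric]) auto
    also have "\<dots> = (\<Sum>l. ennreal (2 * Bk) * ennreal (2 ^ l * \<gamma> l x))"
    proof (intro arg_cong[where f = suminf] ext)
      fix l
      have "(\<Sum>n<I. ennreal (2 ^ l * (2 ^ n * t)) * indicator (layer (2 ^ n * t) l) x) = (\<Sum>n\<in>{n. n < I \<and> x \<in> layer (2 ^ n * t) l}. ennreal (2 ^ l * (2 ^ n * t)))"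
        by (rule sum.mono_neutral_cong_right) (auto simp: indicator_def)
      also have "\<dots> = ennreal (\<Sum>n\<in>{n. n < I \<and> x \<in> layer (2 ^ n * t) l}. 2 ^ l * (2 ^ n * t))" using t by (intro sum_ennreal) simp
      also have "\<dots> = ennreal (2 ^ l * \<gamma> l x)" by (simp add: \<gamma>_def sum_distrib_left)
      finally show "(\<Sum>n<I. ennreal (2 * Bk) * (ennreal (2 ^ l * (2 ^ n * t)) * indicator (layer (2 ^ n * t) l) x)) = ennreal (2 * Bk) * ennreal (2 ^ l * \<gamma> l x)"
        by (simp only: sum_distrib_left[symmetric])
    qed
    also have "\<dots> = ennreal (2 * Bk) * (\<Sum>l. ennreal (2 ^ l * \<gamma> l x))" by (rule ennreal_suminf_cmult)
    finally show ?thesis .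
  qed
  let ?c1 = "(2 * Bk) powr p * 2 powr p"
  have pw2: "potential_upto t x epowr p \<le> ennreal ?c1 * (\<Sum>l. \<Sum>n<I. ennreal ((4 ^ l) powr p * 2 powr p * (2 ^ n * t) powr p) * indicator (layer (2 ^ n * t) l) x)" for x
  proof -
    have "potential_upto t x epowr p \<le> (ennreal (2 * Bk) * (\<Sum>l. ennreal (2 ^ l * \<gamma> l x))) epowr p"
      by (rule epowr_mono[OF pw]) (use p in simp)
    also have "\<dots> = ennreal ((2 * Bk) powr p) * ((\<Sum>l. ennreal (2 ^ l * \<gamma> l x)) epowr p)"
      using Bk by (simp only: epowr_mult[OF p(1)] epowr_ennreal mult_nonneg_nonneg zero_le_numeral less_imp_le)
    also have "\<dots> \<le> ennreal ((2 * Bk) powr p) * (ennreal (2 powr p) * (\<Sum>l. ennreal ((4 ^ l * \<gamma> l x) powr p)))"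
      by (intro mult_left_mono layer_epowr_le p \<gamma>0) simp
    also have "\<dots> \<le> ennreal ((2 * Bk) powr p) * (ennreal (2 powr p) * (\<Sum>l. \<Sum>n<I. ennreal ((4 ^ l) powr p * 2 powr p * (2 ^ n * t) powr p) * indicator (layer (2 ^ n * t) l) x))"
    proof (intro mult_left_mono suminf_le)
      fix l
      let ?J = "{n. n < I \<and> x \<in> layer (2 ^ n * t) l}"
      have "(4 ^ l * \<gamma> l x) powr p = (4 ^ l) powr p * \<gamma> l x powr p" by (rule powr_mult)
      also have "\<dots> \<le> (4 ^ l) powr p * (2 powr p * (\<Sum>n\<in>?J. (2 ^ n * t) powr p))"
        unfolding \<gamma>_def by (intro mult_left_mono lacunary_sum_powr_le t p) auto
      also have "\<dots> = (\<Sum>n\<in>?J. (4 ^ l) powr p * 2 powr p * (2 ^ n * t) powr p)" by (simp add: sum_distrib_left mult.assoc)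
      finally have "ennreal ((4 ^ l * \<gamma> l x) powr p) \<le> ennreal (\<Sum>n\<in>?J. (4 ^ l) powr p * 2 powr p * (2 ^ n * t) powr p)" by (rule ennreal_leI)
      also have "\<dots> = (\<Sum>n\<in>?J. ennreal ((4 ^ l) powr p * 2 powr p * (2 ^ n * t) powr p))" by (rule sum_ennreal[symmetric]) simp
      also have "\<dots> = (\<Sum>n<I. ennreal ((4 ^ l) powr p * 2 powr p * (2 ^ n * t) powr p) * indicator (layer (2 ^ n * t) l) x)"
        by (rule sum.mono_neutral_cong_left) (auto simp: indicator_def)
      finally show "ennreal ((4 ^ l * \<gamma> l x) powr p) \<le> (\<Sum>n<I. ennreal ((4 ^ l) powr p * 2 powr p * (2 ^ n * t) powr p) * indicator (layer (2 ^ n * t) l) x)" .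
    qed auto
    also have "\<dots> = ennreal ?c1 * (\<Sum>l. \<Sum>n<I. ennreal ((4 ^ l) powr p * 2 powr p * (2 ^ n * t) powr p) * indicator (layer (2 ^ n * t) l) x)"
      by (subst ennreal_mult) (auto simp: mult.assoc)
    finally show ?thesis .
  qed
  let ?h = "\<lambda>l n x. ennreal ((4 ^ l) powr p * 2 powr p * (2 ^ n * t) powr p) * indicator (layer (2 ^ n * t) l) x"
  have hm: "?h l n \<in> borel_measurable W" for l n
    by (intro borel_measurable_times_ennreal borel_measurable_indicator layerW borel_measurable_const)
  have hsm: "(\<lambda>x. \<Sum>n<I. ?h l n x) \<in> borel_measurable W" for l by (intro borel_measurable_sum hm)
  let ?Z = "\<Sum>n<I. ennreal ((2 ^ n * t) powr p) * tail_sum (2 ^ n * t)"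
  have dc: "0 < decay_const m" by (simp add: decay_const_def)
  have "(\<integral>\<^sup>+x. potential_upto t x epowr p \<partial>W) \<le> (\<integral>\<^sup>+x. ennreal ?c1 * (\<Sum>l. \<Sum>n<I. ?h l n x) \<partial>W)"
    by (intro nn_integral_mono pw2)
  also have "\<dots> = ennreal ?c1 * (\<integral>\<^sup>+x. (\<Sum>l. \<Sum>n<I. ?h l n x) \<partial>W)"
    by (rule nn_integral_cmult) (intro borel_measurable_suminf_order hsm)
  also have "(\<integral>\<^sup>+x. (\<Sum>l. \<Sum>n<I. ?h l n x) \<partial>W) = (\<Sum>l. \<integral>\<^sup>+x. (\<Sum>n<I. ?h l n x) \<partial>W)"
    by (rule nn_integral_suminf) (rule hsm)
  also have "\<dots> \<le> (\<Sum>l. ennreal (2 powr p * decay_const m * (1/2) ^ l) * ?Z)"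
  proof (rule suminf_le)
    fix l
    have dec: "(4 ^ l) powr p * (1 / 2 ^ (m * l)) powr e \<le> (1/2) ^ l"
    proof -
      have 1: "((4::real) ^ l) powr p = 2 powr (2 * p * real l)"
      proof -
        have "(4::real) ^ l = 2 ^ (2 * l)" by (simp add: power_mult)
        also have "\<dots> = 2 powr real (2 * l)" by (rule powr_realpow[symmetric]) simp
        finally have a: "(4::real) ^ l = 2 powr real (2 * l)" .
        have b: "real (2 * l) * p = 2 * p * real l" by simp
        show ?thesis unfolding a powr_powr b ..
      qed
      have 2: "(1 / (2::real) ^ (m * l)) powr e = 2 powr (- (real m * e * real l))"
      proof -
        have a: "1 / (2::real) ^ (m * l) = 2 powr (- real (m * l))"
          by (simp add: powr_minus powr_realpow inverse_eq_divide del: of_nat_mult)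
        have b: "- real (m * l) * e = - (real m * e * real l)" by simp
        show ?thesis unfolding a powr_powr b ..
      qed
      have "(4 ^ l) powr p * (1 / 2 ^ (m * l)) powr e = 2 powr ((2 * p - real m * e) * real l)"
        unfolding 1 2 by (simp add: powr_add[symmetric] algebra_simps)
      also have "\<dots> \<le> 2 powr (- real l)"
      proof (rule powr_mono)
        have "(2 * p - real m * e) * real l \<le> (- 1) * real l" using m by (intro mult_right_mono) auto
        then show "(2 * p - real m * e) * real l \<le> - real l" by simp
      qed simp
      also have "\<dots> = (1/2) ^ l" by (simp add: powr_minus powr_realpow power_one_over inverse_eq_divide)
      finally show ?thesis .
    qed
    have "(\<integral>\<^sup>+x. (\<Sum>n<I. ?h l n x) \<partial>W) = (\<Sum>n<I. ennreal ((4 ^ l) powr p * 2 powr p * (2 ^ n * t) powr p) * emeasure W (layer (2 ^ n * t) l))"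
      by (subst nn_integral_sum[OF hm]) (simp only: nn_integral_cmult_indicator[OF layerW])
    also have "\<dots> \<le> (\<Sum>n<I. ennreal (2 powr p * decay_const m * (1/2) ^ l) * (ennreal ((2 ^ n * t) powr p) * tail_sum (2 ^ n * t)))"
    proof (rule sum_mono)
      fix n
      have "ennreal ((4 ^ l) powr p * 2 powr p * (2 ^ n * t) powr p) * emeasure W (layer (2 ^ n * t) l)
        \<le> ennreal ((4 ^ l) powr p * 2 powr p * (2 ^ n * t) powr p) * (ennreal (decay_const m * ((1 / 2 ^ (m * l)) powr e)) * tail_sum (2 ^ n * t))"
        by (intro mult_left_mono layer_weight pos m1) simp
      also have "\<dots> = ennreal (((4 ^ l) powr p * (1 / 2 ^ (m * l)) powr e) * (2 powr p * decay_const m * (2 ^ n * t) powr p)) * tail_sum (2 ^ n * t)"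
        using dc by (subst mult.assoc[symmetric], subst ennreal_mult[symmetric]) (auto simp: mult_ac)
      also have "\<dots> \<le> ennreal ((1/2) ^ l * (2 powr p * decay_const m * (2 ^ n * t) powr p)) * tail_sum (2 ^ n * t)"
        using dc dec by (intro mult_right_mono ennreal_leI) auto
      also have "(1/2) ^ l * (2 powr p * decay_const m * (2 ^ n * t) powr p) = (2 powr p * decay_const m * (1/2) ^ l) * (2 ^ n * t) powr p" by simp
      also have "ennreal \<dots> * tail_sum (2 ^ n * t) = ennreal (2 powr p * decay_const m * (1/2) ^ l) * (ennreal ((2 ^ n * t) powr p) * tail_sum (2 ^ n * t))"
        using dc by (subst ennreal_mult) (auto simp: mult.assoc)
      finally show "ennreal ((4 ^ l) powr p * 2 powr p * (2 ^ n * t) powr p) * emeasure W (layer (2 ^ n * t) l)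
        \<le> ennreal (2 powr p * decay_const m * (1/2) ^ l) * (ennreal ((2 ^ n * t) powr p) * tail_sum (2 ^ n * t))" .
    qed
    also have "\<dots> = ennreal (2 powr p * decay_const m * (1/2) ^ l) * ?Z" by (simp only: sum_distrib_left)
    finally show "(\<integral>\<^sup>+x. (\<Sum>n<I. ?h l n x) \<partial>W) \<le> ennreal (2 powr p * decay_const m * (1/2) ^ l) * ?Z" .
  qed auto
  also have "\<dots> = (\<Sum>l. ennreal (2 powr p * decay_const m * (1/2) ^ l)) * ?Z" by (rule ennreal_suminf_multc)
  also have "(\<Sum>l. ennreal (2 powr p * decay_const m * (1/2) ^ l)) = ennreal (2 powr p * decay_const m * 2)"
  proof (rule suminf_ennreal_eq)
    have "(\<lambda>l. 2 powr p * decay_const m * (1/2) ^ l) sums (2 powr p * decay_const m * (1 / (1 - 1/2)))" by (intro sums_mult geometric_sums) simp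
    then show "(\<lambda>l. 2 powr p * decay_const m * (1/2) ^ l) sums (2 powr p * decay_const m * 2)" by simp
  qed (use dc in auto)
  also have "?Z \<le> ennreal (sum_const N K) * (G + ennreal (t powr p) * emeasure W {-R..R})"
    by (rule tail_sum_bound[OF st t A ne])
  finally have "(\<integral>\<^sup>+x. potential_upto t x epowr p \<partial>W) \<le> ennreal ?c1 * (ennreal (2 powr p * decay_const m * 2) * (ennreal (sum_const N K) * (G + ennreal (t powr p) * emeasure W {-R..R})))"
    by (simp add: mult_left_mono)
  also have "\<dots> = (ennreal ?c1 * ennreal (2 powr p * decay_const m * 2) * ennreal (sum_const N K)) * (G + ennreal (t powr p) * emeasure W {-R..R})"
    by (simp only: mult.assoc)
  also have "ennreal ?c1 * ennreal (2 powr p * decay_const m * 2) * ennreal (sum_const N K) = ennreal (main_const m N K * (B ^ k) powr p)"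
  proof -
    have "1 < (2::real) powr p" using p by (intro gr_one_powr) auto
    then have sc: "0 \<le> sum_const N K" using st by (auto simp: sum_const_def intro!: add_nonneg_nonneg divide_nonneg_nonneg)
    have "ennreal ?c1 * ennreal (2 powr p * decay_const m * 2) * ennreal (sum_const N K) = ennreal (?c1 * (2 powr p * decay_const m * 2) * sum_const N K)"
      using dc sc by (simp only: ennreal_mult[symmetric] mult_nonneg_nonneg powr_ge_zero less_imp_le zero_le_numeral)
    also have "?c1 * (2 powr p * decay_const m * 2) * sum_const N K = main_const m N K * (B ^ k) powr p"
    proof -
      have "(8::real) powr p = 2 powr p * 2 powr p * 2 powr p" by (simp flip: powr_mult)
      then show ?thesis by (simp add: main_const_def powr_mult Bk_def)
    qed
    finally show ?thesis .
  qed
  finally show ?thesis .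
qed

definition potential :: "real \<Rightarrow> ennreal" where
  "potential x = (\<integral>\<^sup>+y\<in>{x<..}. ker x y \<partial>lebesgue)"

text \<open>Beyond a point that is good for \<open>t\<close> there is little mass: the support has bounded length, and
  the modular dominates the mass.\<close>

lemma mass_beyond_next_good:
  assumes t: "0 < t"
  shows "(\<integral>\<^sup>+y\<in>{nx t x<..}. ennreal (f y) \<partial>lebesgue) \<le> ennreal ((R + 1 + \<bar>x\<bar>) * t)"
proof -
  define z where "z = nx t x"
  have xz: "x \<le> z" and good: "z \<notin> lev t" using nx[OF t] by (auto simp: z_def)
  define h where "h = max 1 (R + 1 - z)"
  have h: "1 \<le> h" "h \<le> R + 1 + \<bar>x\<bar>" using xz R by (auto simp: h_def)
  have c: "0 < h powr \<alpha> / t" using h t by simp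
  have "(\<integral>\<^sup>+y\<in>{z<..}. ennreal (f y) \<partial>lebesgue) \<le> (\<integral>\<^sup>+y. ennreal (t / h powr \<alpha>) * (ennreal (LlogL k (f y * (h powr \<alpha> / t))) * indicator {z<..<z + h} y) \<partial>lebesgue)"
  proof (rule nn_integral_mono)
    fix y
    show "ennreal (f y) * indicator {z<..} y \<le> ennreal (t / h powr \<alpha>) * (ennreal (LlogL k (f y * (h powr \<alpha> / t))) * indicator {z<..<z + h} y)"
    proof (cases "R < \<bar>y\<bar>")
      case True then show ?thesis by (simp add: supp)
    next
      case False
      have "f y = (t / h powr \<alpha>) * (f y * (h powr \<alpha> / t))" using h t by simp
      also have "\<dots> \<le> (t / h powr \<alpha>) * LlogL k (f y * (h powr \<alpha> / t))"
        using f0 c t by (intro mult_left_mono LlogL_ge) auto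
      finally have "ennreal (f y) \<le> ennreal ((t / h powr \<alpha>) * LlogL k (f y * (h powr \<alpha> / t)))" by (rule ennreal_leI)
      also have "\<dots> = ennreal (t / h powr \<alpha>) * ennreal (LlogL k (f y * (h powr \<alpha> / t)))"
        using f0 t by (intro ennreal_mult) auto
      finally show ?thesis using False by (auto simp: indicator_def h_def)
    qed
  qed
  also have "\<dots> = ennreal (t / h powr \<alpha>) * mass (h powr \<alpha> / t) {z<..<z + h}"
    unfolding orlicz_mass_def by (rule nn_integral_cmult) (intro borel_measurable_times_ennreal borel_measurable_indicator, auto)
  also have "\<dots> \<le> ennreal (t / h powr \<alpha>) * ennreal h"
    by (intro mult_left_mono good_point_mass_le[OF good]) (use h in auto)
  also have "\<dots> = ennreal (t / h powr \<alpha> * h)" using h t by (intro ennreal_mult[symmetric]) auto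
  also have "\<dots> \<le> ennreal ((R + 1 + \<bar>x\<bar>) * t)"
  proof (rule ennreal_leI)
    have "1 \<le> h powr \<alpha>" using h \<alpha> by (simp add: ge_one_powr_ge_zero)
    then have "t / h powr \<alpha> \<le> t" using t by (simp add: divide_le_eq mult_le_cancel_left1)
    then have "t / h powr \<alpha> * h \<le> t * (R + 1 + \<bar>x\<bar>)" using h t by (intro mult_mono) auto
    then show "t / h powr \<alpha> * h \<le> (R + 1 + \<bar>x\<bar>) * t" by (simp only: mult.commute)
  qed
  finally show ?thesis by (simp only: z_def)
qed

text \<open>Almost no mass of \<open>f\<close> lies beyond all the next good points, by \<open>mass_beyond_next_good\<close>, so
  they exhaust the integral.\<close>

lemma potential_le_SUP:
  assumes \<tau>: "0 < \<tau>"
  shows "potential x \<le> (SUP j. potential_upto (\<tau> / 2 ^ j) x)" "incseq (\<lambda>j. potential_upto (\<tau> / 2 ^ j) x)"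
proof -
  let ?t = "\<lambda>j::nat. \<tau> / 2 ^ j"
  have pos: "0 < ?t j" for j using \<tau> by simp
  have dec: "?t j \<le> ?t i" if "i \<le> j" for i j
    using \<tau> that by (intro divide_left_mono power_increasing) auto
  have mono_c: "nx (?t i) x \<le> nx (?t j) x" if "i \<le> j" for i j by (rule nx_antimono[OF pos dec[OF that]])
  define u where "u j y = ker x y * indicator {x<..<nx (?t j) x} y" for j y
  have um: "u j \<in> borel_measurable lebesgue" for j
    unfolding u_def by (intro borel_measurable_times_ennreal borel_measurable_indicator ker_measurable) simp
  have uinc: "incseq u"
    unfolding incseq_def le_fun_def
  proof (intro allI impI)
    fix i j :: nat and y assume "i \<le> j"
    from mono_c[OF this] show "u i y \<le> u j y" by (auto simp: u_def indicator_def)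
  qed
  show "incseq (\<lambda>j. potential_upto (?t j) x)"
    unfolding incseq_def potential_upto_def
  proof (intro allI impI nn_set_integral_set_mono)
    fix i j :: nat assume "i \<le> j"
    from mono_c[OF this] show "{x<..<nx (?t i) x} \<subseteq> {x<..<nx (?t j) x}" by auto
  qed
  define Nx where "Nx = (\<Inter>j. {nx (?t j) x..})"
  have Nm: "Nx \<in> sets lebesgue" unfolding Nx_def by (intro sets.countable_INT) auto
  have Nint: "(\<integral>\<^sup>+y. ennreal (f y) * indicator Nx y \<partial>lebesgue) = 0"
  proof -
    have le: "(\<integral>\<^sup>+y. ennreal (f y) * indicator Nx y \<partial>lebesgue) \<le> ennreal ((R + 1 + \<bar>x\<bar>) * ?t j)" for j
    proof -
      have "(\<integral>\<^sup>+y. ennreal (f y) * indicator Nx y \<partial>lebesgue) \<le> (\<integral>\<^sup>+y\<in>{nx (?t j) x<..}. ennreal (f y) \<partial>lebesgue)"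
      proof (rule nn_integral_mono_AE)
        have "AE y in lebesgue. y \<noteq> nx (?t j) x" by (auto intro!: AE_completion AE_lborel_singleton)
        then show "AE y in lebesgue. ennreal (f y) * indicator Nx y \<le> ennreal (f y) * indicator {nx (?t j) x<..} y"
        proof eventually_elim
          case (elim y)
          have "nx (?t j) x \<le> y" if "y \<in> Nx" using that unfolding Nx_def by blast
          then show ?case using elim by (auto simp: indicator_def)
        qed
      qed
      also have "\<dots> \<le> ennreal ((R + 1 + \<bar>x\<bar>) * ?t j)" by (rule mass_beyond_next_good[OF pos])
      finally show ?thesis .
    qed
    have "(\<lambda>j. (1/2::real) ^ j) \<longlonglongrightarrow> 0" by (rule LIMSEQ_power_zero) simp
    then have "(\<lambda>j. ((R + 1 + \<bar>x\<bar>) * \<tau>) * (1/2) ^ j) \<longlonglongrightarrow> 0" by (rule tendsto_mult_right_zero)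
    moreover have "((R + 1 + \<bar>x\<bar>) * \<tau>) * (1/2) ^ j = (R + 1 + \<bar>x\<bar>) * ?t j" for j by (simp add: power_one_over)
    ultimately have "(\<lambda>j. (R + 1 + \<bar>x\<bar>) * ?t j) \<longlonglongrightarrow> 0" by (simp only:)
    then have "(\<lambda>j. ennreal ((R + 1 + \<bar>x\<bar>) * ?t j)) \<longlonglongrightarrow> ennreal 0" by (rule tendsto_ennrealI)
    then have "(\<integral>\<^sup>+y. ennreal (f y) * indicator Nx y \<partial>lebesgue) \<le> ennreal 0"
      by (rule LIMSEQ_le_const) (use le in auto)
    then show ?thesis by simp
  qed
  have "AE y in lebesgue. ennreal (f y) * indicator Nx y = 0"
    using Nint by (subst (asm) nn_integral_0_iff_AE) (use Nm in \<open>auto intro!: borel_measurable_times_ennreal borel_measurable_indicator\<close>)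
  then have AEu: "AE y in lebesgue. ker x y * indicator {x<..} y \<le> (SUP j. u j y)"
  proof eventually_elim
    case (elim y)
    show ?case
    proof (cases "x < y")
      case True
      show ?thesis
      proof (cases "y \<in> Nx")
        case True
        then have "ennreal (f y) = 0" using elim by simp
        then have "f y = 0" using f0[of y] by simp
        then show ?thesis by (simp add: kern_def)
      next
        case False
        then obtain j where "y < nx (?t j) x" by (auto simp: Nx_def not_le)
        then have "ker x y * indicator {x<..} y = u j y" using True by (simp add: u_def)
        also have "\<dots> \<le> (SUP j. u j y)" by (rule SUP_upper) simp
        finally show ?thesis .
      qed
    qed simp
  qed
  have "potential x \<le> (\<integral>\<^sup>+y. (SUP j. u j y) \<partial>lebesgue)"
    unfolding potential_def by (rule nn_integral_mono_AE) (rule AEu)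
  also have "\<dots> = (SUP j. integral\<^sup>N lebesgue (u j))"
    by (rule nn_integral_monotone_convergence_SUP[OF uinc um])
  also have "\<dots> = (SUP j. potential_upto (?t j) x)" by (simp only: potential_upto_def u_def[abs_def])
  finally show "potential x \<le> (SUP j. potential_upto (?t j) x)" .
qed

text \<open>The bound for the part up to the next good point has the error \<open>t^p W [-R, R]\<close>, which
  disappears in the limit.\<close>

lemma potential_estimate:
  assumes st: "step_const N K" "1 \<le> N" "0 < K" and m: "2 * p + 1 \<le> real m * e"
  shows "(\<integral>\<^sup>+x. potential x epowr p \<partial>W) \<le> ennreal (main_const m N K * (B ^ k) powr p) * G"
proof -
  \<comment> \<open>The left end \<open>- 3 R - 2\<close> is the one required by \<open>hull_tail_pointwise\<close>.\<close>
  have "R \<le> 3 * R + 2" using R by simp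
  from lev_reaches_far_left[OF nonzero this]
  obtain \<tau> where \<tau>: "0 < \<tau>" and far: "\<And>t. 0 < t \<Longrightarrow> t \<le> \<tau> \<Longrightarrow> - (3 * R + 2) \<in> lev t" by blast
  let ?t = "\<lambda>j::nat. \<tau> / 2 ^ j"
  let ?C = "main_const m N K * (B ^ k) powr p"
  have pos: "0 < ?t j" for j using \<tau> by simp
  have dec: "?t j \<le> ?t i" if "i \<le> j" for i j
    using \<tau> that by (intro divide_left_mono power_increasing) auto
  have est: "(\<integral>\<^sup>+x. potential_upto (?t j) x epowr p \<partial>W) \<le> ennreal ?C * (G + ennreal (?t j powr p) * emeasure W {-R..R})" for j
  proof (rule potential_upto_estimate[OF st pos _ _ m])
    have "?t j / 2 ^ N = ?t (j + N)" by (simp add: power_add)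
    also have "?t (j + N) \<le> ?t 0" by (rule dec) simp
    finally have "?t j / 2 ^ N \<le> \<tau>" by simp
    moreover have p2: "0 < ?t j / 2 ^ N" using \<tau> by simp
    ultimately have mem: "- (3 * R + 2) \<in> lev (?t j / 2 ^ N)" by (intro far) auto
    then show "lev (?t j / 2 ^ N) \<noteq> {}" by blast
    have "Inf (lev (?t j / 2 ^ N)) \<le> - (3 * R + 2)" by (rule cInf_lower[OF mem bdd_lev(2)[OF p2]])
    then show "Inf (lev (?t j / 2 ^ N)) \<le> - 3 * R - 2" by simp
  qed
  let ?v = "\<lambda>j x. potential_upto (?t j) x epowr p"
  have vm: "?v j \<in> borel_measurable W" for j
    by (rule measurable_lebesgue_sets[OF sW]) (rule measurable_compose[OF potential_upto_measurable[OF pos] epowr_measurable])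
  have vinc: "incseq ?v"
    unfolding incseq_def le_fun_def
  proof (intro allI impI epowr_mono)
    fix i j :: nat and x assume "i \<le> j"
    then show "potential_upto (?t i) x \<le> potential_upto (?t j) x" using potential_le_SUP(2)[OF \<tau>, of x] by (simp add: incseq_def)
  qed (use p in simp)
  have X: "(\<integral>\<^sup>+x. potential x epowr p \<partial>W) \<le> (SUP j. integral\<^sup>N W (?v j))"
  proof -
    have "(\<integral>\<^sup>+x. potential x epowr p \<partial>W) \<le> (\<integral>\<^sup>+x. (SUP j. ?v j x) \<partial>W)"
    proof (rule nn_integral_mono)
      fix x
      have "potential x epowr p \<le> (SUP j. potential_upto (?t j) x) epowr p" by (rule epowr_mono[OF potential_le_SUP(1)[OF \<tau>]]) (use p in simp)
      also have "\<dots> \<le> (SUP j. ?v j x)" by (rule SUP_epowr_le[OF p(1)])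
      finally show "potential x epowr p \<le> (SUP j. ?v j x)" .
    qed
    also have "\<dots> = (SUP j. integral\<^sup>N W (?v j))" by (rule nn_integral_monotone_convergence_SUP[OF vinc vm])
    finally show ?thesis .
  qed
  have bound: "(\<integral>\<^sup>+x. potential x epowr p \<partial>W) \<le> ennreal ?C * (G + ennreal (?t J powr p) * emeasure W {-R..R})" for J
  proof (rule order_trans[OF X SUP_least])
    fix j
    have "integral\<^sup>N W (?v j) \<le> integral\<^sup>N W (?v (max j J))"
      using vinc by (intro nn_integral_mono) (auto simp: incseq_def le_fun_def)
    also have "\<dots> \<le> ennreal ?C * (G + ennreal (?t (max j J) powr p) * emeasure W {-R..R})" by (rule est)
    also have "\<dots> \<le> ennreal ?C * (G + ennreal (?t J powr p) * emeasure W {-R..R})"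
      using \<tau> p dec[of J "max j J"] by (intro mult_left_mono add_left_mono mult_right_mono ennreal_leI powr_mono2) auto
    finally show "integral\<^sup>N W (?v j) \<le> ennreal ?C * (G + ennreal (?t J powr p) * emeasure W {-R..R})" .
  qed
  obtain \<gamma> where \<gamma>: "G = ennreal \<gamma>" "0 \<le> \<gamma>" using fing by (cases G) auto
  obtain \<beta> where \<beta>: "emeasure W {-R..R} = ennreal \<beta>" "0 \<le> \<beta>" using finW[of R] by (cases "emeasure W {-R..R}") auto
  have "(\<lambda>J. ennreal \<gamma> + ennreal (?t J powr p * \<beta>)) \<longlonglongrightarrow> ennreal \<gamma> + ennreal (0 * \<beta>)"
  proof (intro tendsto_intros tendsto_ennrealI)
    have "1 < (2::real) powr p" using p by (intro gr_one_powr) auto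
    then have "(\<lambda>J. (1 / (2::real) powr p) ^ J) \<longlonglongrightarrow> 0" by (intro LIMSEQ_power_zero) simp
    then have "(\<lambda>J. \<tau> powr p * (1 / 2 powr p) ^ J) \<longlonglongrightarrow> 0" by (rule tendsto_mult_right_zero)
    moreover have "?t J powr p = \<tau> powr p * (1 / 2 powr p) ^ J" for J
    proof -
      have "((2::real) ^ J) powr p = (2 powr p) ^ J"
        by (rule two_power_powr)
      then show ?thesis by (simp add: powr_divide power_one_over)
    qed
    ultimately show "(\<lambda>J. ?t J powr p) \<longlonglongrightarrow> 0" by (simp only:)
  qed
  then have "(\<lambda>J. ennreal ?C * (ennreal \<gamma> + ennreal (?t J powr p * \<beta>))) \<longlonglongrightarrow> ennreal ?C * (ennreal \<gamma> + ennreal (0 * \<beta>))"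
    by (intro tendsto_mult_ennreal tendsto_const) auto
  then have "(\<integral>\<^sup>+x. potential x epowr p \<partial>W) \<le> ennreal ?C * (ennreal \<gamma> + ennreal (0 * \<beta>))"
  proof (rule LIMSEQ_le_const)
    show "\<exists>N. \<forall>n\<ge>N. (\<integral>\<^sup>+x. potential x epowr p \<partial>W) \<le> ennreal ?C * (ennreal \<gamma> + ennreal (?t n powr p * \<beta>))"
      using bound unfolding \<gamma> \<beta> by (auto simp: ennreal_mult \<beta>(2))
  qed
  then show ?thesis by (simp add: \<gamma>)
qed

end

section \<open>Reduction of the commutator to bounded functions\<close>

lemma M_plus_frac_ge_level:
  assumes f: "\<And>y. 0 \<le> f y" "\<And>y. f y \<le> \<bar>f0 y\<bar>" and t: "0 < t" and x: "x \<in> level \<alpha> k f t"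
  shows "ennreal t \<le> M_plus_frac_LlogL \<alpha> k f0 x"
proof -
  obtain h where h: "0 < h" and lt: "ennreal h < orlicz_mass k f (h powr \<alpha> / t) {x<..<x + h}" using x by (auto simp: level_def)
  have ha: "0 < h powr \<alpha>" using h by simp
  have "ennreal (t / h powr \<alpha>) \<le> luxemburg_avg (LlogL k) f0 {x<..<x + h}"
    unfolding luxemburg_avg_def
  proof (rule INF_greatest)
    fix s assume "s \<in> {s. 0 < s \<and> (\<integral>\<^sup>+y\<in>{x<..<x + h}. ennreal (LlogL k (\<bar>f0 y\<bar> / s)) \<partial>lebesgue) / emeasure lebesgue {x<..<x + h} \<le> 1}"
    then have s: "0 < s" and le: "(\<integral>\<^sup>+y\<in>{x<..<x + h}. ennreal (LlogL k (\<bar>f0 y\<bar> / s)) \<partial>lebesgue) / ennreal h \<le> 1" using h by auto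
    have mle: "orlicz_mass k (\<lambda>y. \<bar>f0 y\<bar>) (1 / s) {x<..<x + h} \<le> ennreal h"
    proof -
      have "orlicz_mass k (\<lambda>y. \<bar>f0 y\<bar>) (1 / s) {x<..<x + h} = (\<integral>\<^sup>+y\<in>{x<..<x + h}. ennreal (LlogL k (\<bar>f0 y\<bar> / s)) \<partial>lebesgue) / ennreal h * ennreal h"
        using h by (simp add: orlicz_mass_def ennreal_divide_times)
      also have "\<dots> \<le> 1 * ennreal h" by (intro mult_right_mono le) simp
      finally show ?thesis by simp
    qed
    show "ennreal (t / h powr \<alpha>) \<le> ennreal s"
    proof (rule ccontr)
      assume "\<not> ?thesis"
      then have "s < t / h powr \<alpha>" by (meson ennreal_leI not_le)
      then have "h powr \<alpha> / t \<le> 1 / s" using s t ha by (simp add: field_simps)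
      then have "orlicz_mass k f (h powr \<alpha> / t) {x<..<x + h} \<le> orlicz_mass k (\<lambda>y. \<bar>f0 y\<bar>) (1 / s) {x<..<x + h}"
        using f t by (intro orlicz_mass_mono) auto
      with mle lt show False by (meson leD less_le_trans order_trans)
    qed
  qed
  then have "ennreal (h powr \<alpha>) * ennreal (t / h powr \<alpha>) \<le> ennreal (h powr \<alpha>) * luxemburg_avg (LlogL k) f0 {x<..<x + h}"
    by (rule mult_left_mono) simp
  also have "\<dots> \<le> M_plus_frac_LlogL \<alpha> k f0 x"
    unfolding M_plus_frac_LlogL_def by (rule SUP_upper) (use h in simp)
  also have "ennreal (h powr \<alpha>) * ennreal (t / h powr \<alpha>) = ennreal t" using h t by (simp flip: ennreal_mult)
  finally show ?thesis .
qed

text \<open>One half of the integration formula for densities, without measurability of \<open>g\<close>.\<close>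

lemma nn_integral_density_le:
  assumes [measurable]: "w \<in> borel_measurable M"
  shows "(\<integral>\<^sup>+x. g x \<partial>density M w) \<le> (\<integral>\<^sup>+x. w x * g x \<partial>M)"
  unfolding nn_integral_def[of "density M w"]
proof (rule SUP_least)
  fix s assume "s \<in> {s. simple_function (density M w) s \<and> s \<le> g}"
  then have s: "simple_function (density M w) s" and le: "\<And>x. s x \<le> g x" by (auto simp: le_fun_def)
  have sm: "s \<in> borel_measurable M" using borel_measurable_simple_function[OF s] by simp
  have "integral\<^sup>S (density M w) s = (\<integral>\<^sup>+x. s x \<partial>density M w)" using s by (rule nn_integral_eq_simple_integral[symmetric])
  also have "\<dots> = (\<integral>\<^sup>+x. w x * s x \<partial>M)" by (rule nn_integral_density) (use sm in auto)
  also have "\<dots> \<le> (\<integral>\<^sup>+x. w x * g x \<partial>M)" by (intro nn_integral_mono mult_left_mono le) simp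
  finally show "integral\<^sup>S (density M w) s \<le> (\<integral>\<^sup>+x. w x * g x \<partial>M)" .
qed

definition truncate :: "(real \<Rightarrow> real) \<Rightarrow> nat \<Rightarrow> real \<Rightarrow> real" where
  "truncate f n y = (if \<bar>y\<bar> \<le> real n + 1 then min \<bar>f y\<bar> (real n + 1) else 0)"

lemma truncated_truncate:
  assumes "0 < \<alpha>" "\<alpha> < 1" and [measurable]: "f \<in> borel_measurable lebesgue"
  shows "truncated \<alpha> (real n + 1) (real n + 1) (truncate f n)"
proof
  have [measurable]: "(\<lambda>y::real. y) \<in> borel_measurable lebesgue" by (rule measurable_completion) simp
  show "truncate f n \<in> borel_measurable lebesgue" unfolding truncate_def[abs_def] by measurable
qed (use assms in \<open>auto simp: truncate_def\<close>)

text \<open>The constants come from the weight, \<open>p\<close>, \<open>\<alpha>\<close> and \<open>k\<close> alone, so the bound for the truncations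
  of \<open>\<bar>f\<bar>\<close> passes to the limit. Two cases escape the general estimate and are immediate: the
  right-hand side may be infinite, and a truncation may vanish almost everywhere.\<close>

theorem positive_commutator_bound:
  assumes \<alpha>: "0 < \<alpha>" "\<alpha> < 1" and p: "0 < p" and \<epsilon>: "0 < \<epsilon>" and w: "weight w" and C: "w \<in> C_plus (max p 1 + \<epsilon>)"
  shows "\<exists>C>0. \<forall>b B f. loc_integrable b \<longrightarrow> 0 < B \<longrightarrow> bmo_norm b \<le> ennreal B \<longrightarrow> loc_integrable f \<longrightarrow>
    (\<integral>\<^sup>+x. (\<integral>\<^sup>+y\<in>{x<..}. kern \<alpha> k b (\<lambda>y. \<bar>f y\<bar>) x y \<partial>lebesgue) epowr p * ennreal (w x) \<partial>lebesgue)
      \<le> ennreal (C * (B ^ k) powr p) * (\<integral>\<^sup>+x. M_plus_frac_LlogL \<alpha> k f x epowr p * ennreal (w x) \<partial>lebesgue)"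
proof -
  define q where "q = max p 1 + \<epsilon>"
  define W where "W = density lebesgue (\<lambda>x. ennreal (w x))"
  have q: "1 < q" "p < q" using \<epsilon> by (auto simp: q_def)
  have w0: "0 \<le> w x" for x using w by (simp add: weight_def)
  have locw: "loc_integrable w" using w by (simp add: weight_def)
  have wm [measurable]: "w \<in> borel_measurable lebesgue" by (rule loc_integrable_measurable[OF locw])
  have wm': "(\<lambda>x. ennreal (w x)) \<in> borel_measurable lebesgue" by measurable
  obtain e D where e: "0 < e" and D: "0 < D" and wb: "whitney_bound W q e D"
  proof -
    have "\<exists>e>0. \<exists>D>0. whitney_bound W q e D"
      unfolding W_def by (rule C_plus_imp_whitney_bound) (use C q in \<open>auto simp: q_def\<close>)
    then show thesis using that by (elim exE conjE)
  qed
  have osw: "one_sided_weight W q e D p"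
  proof
    show "sets W = sets lebesgue" by (simp add: W_def)
    show "emeasure W {x} = 0" for x
    proof -
      have "{x} \<in> null_sets lebesgue" by (intro null_sets_completionI countable_imp_null_set_lborel) simp
      then have "AE y in lebesgue. y \<notin> {x}" by (rule AE_not_in)
      then have "(\<integral>\<^sup>+y. ennreal (w y) * indicator {x} y \<partial>lebesgue) = (\<integral>\<^sup>+(y::real). 0 \<partial>lebesgue)"
        by (intro nn_integral_cong_AE) (auto elim!: eventually_mono)
      then show ?thesis unfolding W_def by (subst emeasure_density[OF wm']) auto
    qed
    show "emeasure W {-r..r} < top" for r
    proof -
      have "integrable lebesgue (\<lambda>x. indicat_real {-r..r} x *\<^sub>R w x)"
        using loc_integrable_on_interval(3)[OF locw, of "-r" r] by (simp only: set_integrable_def)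
      then have "(\<integral>\<^sup>+x. ennreal (norm (indicat_real {-r..r} x *\<^sub>R w x)) \<partial>lebesgue) < \<infinity>" by (simp only: integrable_iff_bounded)
      also have "(\<integral>\<^sup>+x. ennreal (norm (indicat_real {-r..r} x *\<^sub>R w x)) \<partial>lebesgue) = (\<integral>\<^sup>+x. ennreal (w x) * indicator {-r..r} x \<partial>lebesgue)"
        by (rule nn_integral_cong) (use w0 in \<open>auto simp: indicator_def\<close>)
      also have "\<dots> = emeasure W {-r..r}" unfolding W_def by (rule emeasure_density[OF wm', symmetric]) simp
      finally show ?thesis by simp
    qed
  qed (use wb q e D p in auto)
  obtain N K where st: "one_sided_weight.step_const W q p N K" "1 \<le> N" "0 < K"
    using one_sided_weight.step_const_exists[OF osw] by blast
  obtain m :: nat where "(2 * p + 1) / e \<le> real m" using real_arch_simple by blast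
  then have m: "2 * p + 1 \<le> real m * e" using e by (simp add: field_simps)
  define M0 where "M0 = commutator_setting.main_const e D p \<alpha> k m N K"
  define CC where "CC = max 1 M0"
  show ?thesis
  proof (intro exI[of _ CC] conjI allI impI)
    show "0 < CC" by (simp add: CC_def)
    fix b B f assume locb: "loc_integrable b" and B: "0 < B" and bmo: "bmo_norm b \<le> ennreal B" and locf: "loc_integrable f"
    have fm [measurable]: "f \<in> borel_measurable lebesgue" by (rule loc_integrable_measurable[OF locf])
    have bm: "b \<in> borel_measurable lebesgue" by (rule loc_integrable_measurable[OF locb])
    define g where "g x = M_plus_frac_LlogL \<alpha> k f x epowr p" for x
    let ?G = "\<integral>\<^sup>+x. g x \<partial>W"
    let ?F = "\<lambda>n x. \<integral>\<^sup>+y\<in>{x<..}. kern \<alpha> k b (truncate f n) x y \<partial>lebesgue"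
    let ?C = "ennreal (CC * (B ^ k) powr p)"
    have Cpos: "0 < CC * (B ^ k) powr p" using B by (simp add: CC_def)
    have tr: "truncated \<alpha> (real n + 1) (real n + 1) (truncate f n)" for n by (rule truncated_truncate[OF \<alpha> fm])
    have tm: "truncate f n \<in> borel_measurable lebesgue" for n using tr by (rule truncated.fm)
    have each: "(\<integral>\<^sup>+x. ?F n x epowr p \<partial>W) \<le> ?C * ?G" for n
    proof (cases "?G < top \<and> 0 < (\<integral>\<^sup>+y. ennreal (truncate f n y) \<partial>lebesgue)")
      case True
      have cs: "commutator_setting W q e D p \<alpha> (real n + 1) (real n + 1) k (truncate f n) g b B"
      proof (intro commutator_setting.intro weighted_truncated.intro truncated_bmo.intro osw tr)
        show "weighted_truncated_axioms W p \<alpha> k (truncate f n) g"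
        proof
          fix t x assume t: "(0::real) < t" and x: "x \<in> level \<alpha> k (truncate f n) t"
          have "ennreal t \<le> M_plus_frac_LlogL \<alpha> k f x"
            by (rule M_plus_frac_ge_level[OF _ _ t x]) (auto simp: truncate_def)
          then have "ennreal t epowr p \<le> g x" unfolding g_def by (rule epowr_mono) (use p in simp)
          then show "ennreal (t powr p) \<le> g x" using t by (simp add: epowr_ennreal)
        qed (use True in auto)
        show "truncated_bmo_axioms b B" by (intro truncated_bmo_axioms.intro locb bmo B)
      qed
      have "(\<integral>\<^sup>+x. ?F n x epowr p \<partial>W) \<le> ennreal (M0 * (B ^ k) powr p) * ?G"
        using commutator_setting.potential_estimate[OF cs st m] unfolding commutator_setting.potential_def[OF cs] M0_def .
      also have "\<dots> \<le> ?C * ?G" by (intro mult_right_mono ennreal_leI) (auto simp: CC_def)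
      finally show ?thesis .
    next
      case False
      then consider "?G = top" | "(\<integral>\<^sup>+y. ennreal (truncate f n y) \<partial>lebesgue) = 0"
        using top.not_eq_extremum[of ?G] by auto
      then show ?thesis
      proof cases
        case 1
        have "?C \<noteq> 0" using Cpos by (simp only: ennreal_eq_0_iff not_le)
        then have "?C * ?G = top" unfolding 1 by (simp only: ennreal_mult_top if_False)
        then show ?thesis by (simp only: top_greatest)
      next
        case 2
        then have "AE y in lebesgue. ennreal (truncate f n y) = 0"
          by (subst (asm) nn_integral_0_iff_AE) (use tm in auto)
        then have "AE y in lebesgue. truncate f n y = 0"
          by (rule eventually_mono) (auto simp: truncate_def split: if_splits)
        then have "?F n x = (\<integral>\<^sup>+(y::real). 0 \<partial>lebesgue)" for x
          by (intro nn_integral_cong_AE) (auto elim!: eventually_mono simp: kern_def)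
        then have "?F n x = 0" for x by simp
        then show ?thesis using p by (simp add: epowr_def)
      qed
    qed
    let ?v = "\<lambda>n x. ?F n x epowr p"
    have vm0: "?v n \<in> borel_measurable lebesgue" for n
      by (rule measurable_compose[OF kern_integral_measurable_full[OF bm tm] epowr_measurable])
    have vm: "?v n \<in> borel_measurable W" for n by (rule measurable_lebesgue_sets[OF _ vm0]) (simp add: W_def)
    have tinc: "truncate f i y \<le> truncate f j y" if "i \<le> j" for i j y using that by (auto simp: truncate_def)
    have kinc: "kern \<alpha> k b (truncate f i) x y \<le> kern \<alpha> k b (truncate f j) x y" if "i \<le> j" for i j x y
      unfolding kern_def using tinc[OF that, of y] by (intro ennreal_leI mult_left_mono mult_right_mono) auto
    have vinc: "incseq ?v"
      unfolding incseq_def le_fun_def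
      using p by (intro allI impI epowr_mono nn_integral_mono mult_right_mono kinc) auto
    have sup: "(\<integral>\<^sup>+y\<in>{x<..}. kern \<alpha> k b (\<lambda>y. \<bar>f y\<bar>) x y \<partial>lebesgue) \<le> (SUP n. ?F n x)" for x
    proof -
      have "(\<integral>\<^sup>+y\<in>{x<..}. kern \<alpha> k b (\<lambda>y. \<bar>f y\<bar>) x y \<partial>lebesgue) \<le> (\<integral>\<^sup>+y. (SUP n. kern \<alpha> k b (truncate f n) x y * indicator {x<..} y) \<partial>lebesgue)"
      proof (rule nn_integral_mono)
        fix y
        obtain n where n: "max \<bar>y\<bar> \<bar>f y\<bar> \<le> real n" using real_arch_simple by blast
        then have "truncate f n y = \<bar>f y\<bar>" by (auto simp: truncate_def)
        then have "kern \<alpha> k b (\<lambda>y. \<bar>f y\<bar>) x y * indicator {x<..} y = kern \<alpha> k b (truncate f n) x y * indicator {x<..} y" by (simp add: kern_def)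
        also have "\<dots> \<le> (SUP n. kern \<alpha> k b (truncate f n) x y * indicator {x<..} y)" by (rule SUP_upper) simp
        finally show "kern \<alpha> k b (\<lambda>y. \<bar>f y\<bar>) x y * indicator {x<..} y \<le> (SUP n. kern \<alpha> k b (truncate f n) x y * indicator {x<..} y)" .
      qed
      also have "\<dots> = (SUP n. ?F n x)"
      proof (rule nn_integral_monotone_convergence_SUP)
        show "incseq (\<lambda>n y. kern \<alpha> k b (truncate f n) x y * indicator {x<..} y)"
          unfolding incseq_def le_fun_def by (intro allI impI mult_right_mono kinc) auto
        show "(\<lambda>y. kern \<alpha> k b (truncate f n) x y * indicator {x<..} y) \<in> borel_measurable lebesgue" for n
          by (intro borel_measurable_times_ennreal borel_measurable_indicator kern_measurable_snd bm tm) simp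
      qed
      finally show ?thesis .
    qed
    let ?T = "\<lambda>x. (\<integral>\<^sup>+y\<in>{x<..}. kern \<alpha> k b (\<lambda>y. \<bar>f y\<bar>) x y \<partial>lebesgue) epowr p"
    have Tm: "?T \<in> borel_measurable lebesgue"
      by (rule measurable_compose[OF kern_integral_measurable_full[OF bm] epowr_measurable]) measurable
    have "(\<integral>\<^sup>+x. ?T x * ennreal (w x) \<partial>lebesgue) = (\<integral>\<^sup>+x. ?T x \<partial>W)"
      unfolding W_def by (subst nn_integral_density[OF wm' Tm]) (simp only: mult.commute)
    also have "\<dots> \<le> (\<integral>\<^sup>+x. (SUP n. ?v n x) \<partial>W)"
    proof (rule nn_integral_mono)
      fix x
      have "?T x \<le> (SUP n. ?F n x) epowr p" by (rule epowr_mono[OF sup]) (use p in simp)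
      also have "\<dots> \<le> (SUP n. ?v n x)" by (rule SUP_epowr_le[OF p])
      finally show "?T x \<le> (SUP n. ?v n x)" .
    qed
    also have "\<dots> = (SUP n. integral\<^sup>N W (?v n))" by (rule nn_integral_monotone_convergence_SUP[OF vinc vm])
    also have "\<dots> \<le> ?C * ?G" by (rule SUP_least) (rule each)
    also have "\<dots> \<le> ?C * (\<integral>\<^sup>+x. M_plus_frac_LlogL \<alpha> k f x epowr p * ennreal (w x) \<partial>lebesgue)"
    proof (rule mult_left_mono)
      have "?G \<le> (\<integral>\<^sup>+x. ennreal (w x) * g x \<partial>lebesgue)" unfolding W_def by (rule nn_integral_density_le[OF wm'])
      then show "?G \<le> (\<integral>\<^sup>+x. M_plus_frac_LlogL \<alpha> k f x epowr p * ennreal (w x) \<partial>lebesgue)" by (simp only: g_def mult.commute)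
    qed simp
    finally show "(\<integral>\<^sup>+x. ?T x * ennreal (w x) \<partial>lebesgue) \<le> ?C * (\<integral>\<^sup>+x. M_plus_frac_LlogL \<alpha> k f x epowr p * ennreal (w x) \<partial>lebesgue)" .
  qed
qed

text \<open>Where the defining integral does not converge absolutely, the commutator is \<open>0\<close> by the
  convention for the Bochner integral, so the bound holds there too.\<close>

lemma weyl_commutator_le_kern:
  "ennreal \<bar>weyl_commutator \<alpha> k b f x\<bar> \<le> (\<integral>\<^sup>+y\<in>{x<..}. kern \<alpha> k b (\<lambda>y. \<bar>f y\<bar>) x y \<partial>lebesgue)"
proof (cases "integrable lebesgue (\<lambda>y. indicat_real {x<..} y *\<^sub>R commutator_integrand \<alpha> k b f x y)")
  case True
  have "ennreal \<bar>weyl_commutator \<alpha> k b f x\<bar> \<le> (\<integral>\<^sup>+y. ennreal (norm (indicat_real {x<..} y *\<^sub>R commutator_integrand \<alpha> k b f x y)) \<partial>lebesgue)"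
    unfolding weyl_commutator_def set_lebesgue_integral_def real_norm_def[symmetric]
    by (rule integral_norm_bound_ennreal[OF True])
  also have "\<dots> = (\<integral>\<^sup>+y\<in>{x<..}. kern \<alpha> k b (\<lambda>y. \<bar>f y\<bar>) x y \<partial>lebesgue)"
  proof (rule nn_integral_cong)
    fix y
    show "ennreal (norm (indicat_real {x<..} y *\<^sub>R commutator_integrand \<alpha> k b f x y)) = kern \<alpha> k b (\<lambda>y. \<bar>f y\<bar>) x y * indicator {x<..} y"
    proof (cases "x < y")
      case True
      have "(y - x) powr (\<alpha> - 1) = 1 / (y - x) powr (1 - \<alpha>)"
        using powr_minus_divide[of "y - x" "1 - \<alpha>"] by simp
      then show ?thesis using True by (simp add: commutator_integrand_def kern_def abs_mult power_abs)
    qed simp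
  qed
  finally show ?thesis .
next
  case False
  then show ?thesis unfolding weyl_commutator_def set_lebesgue_integral_def by (simp add: not_integrable_integral_eq)
qed

text \<open>The degenerate case \<open>\<parallel>b\<parallel> = 0\<close>: the general estimate needs a positive bound \<open>B\<close>, but then \<open>b\<close>
  is almost everywhere constant.\<close>

lemma weyl_commutator_bmo_0:
  assumes b: "loc_integrable b" and 0: "bmo_norm b = 0" and k: "0 < k"
  shows "AE x in lebesgue. weyl_commutator \<alpha> k b f x = 0"
proof -
  have bm: "b \<in> borel_measurable lebesgue" by (rule loc_integrable_measurable[OF b])
  define A where "A n = average b (- (real n + 1)) (real n + 1)" for n :: nat
  have "AE x in lebesgue. x \<in> {- (real n + 1)..<real n + 1} \<longrightarrow> b x = A n" for n
  proof -
    have "(\<integral>\<^sup>+x\<in>{- (real n + 1)..<real n + 1}. ennreal \<bar>b x - A n\<bar> \<partial>lebesgue) \<le> ennreal (0 * (real n + 1 - - (real n + 1)))"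
      unfolding A_def by (rule bmo_norm_le_imp_oscillation) (use 0 in auto)
    then have z: "(\<integral>\<^sup>+x. ennreal \<bar>b x - A n\<bar> * indicator {- (real n + 1)..<real n + 1} x \<partial>lebesgue) = 0" by simp
    have m: "(\<lambda>x. ennreal \<bar>b x - A n\<bar> * indicator {- (real n + 1)..<real n + 1} x) \<in> borel_measurable lebesgue"
      by (intro borel_measurable_times_ennreal borel_measurable_indicator) (use bm in auto)
    have "AE x in lebesgue. ennreal \<bar>b x - A n\<bar> * indicator {- (real n + 1)..<real n + 1} x = 0"
      using z nn_integral_0_iff_AE[OF m] by blast
    then show ?thesis by (rule eventually_mono) (auto simp: indicator_def split: if_splits)
  qed
  then have ae: "AE x in lebesgue. \<forall>n::nat. x \<in> {- (real n + 1)..<real n + 1} \<longrightarrow> b x = A n"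
    by (simp only: AE_all_countable) auto
  show ?thesis
    using ae
  proof eventually_elim
    case (elim x)
    have "AE y in lebesgue. indicat_real {x<..} y *\<^sub>R commutator_integrand \<alpha> k b f x y = 0"
      using ae
    proof eventually_elim
      case (elim y)
      obtain n where n: "max \<bar>x\<bar> \<bar>y\<bar> \<le> real n" using real_arch_simple by blast
      then have "x \<in> {- (real n + 1)..<real n + 1}" "y \<in> {- (real n + 1)..<real n + 1}" by auto
      then have "b x = b y" using elim \<open>\<forall>n::nat. x \<in> {- (real n + 1)..<real n + 1} \<longrightarrow> b x = A n\<close> by auto
      then show ?case using k by (simp add: commutator_integrand_def)
    qed
    then show ?case unfolding weyl_commutator_def set_lebesgue_integral_def by (rule integral_eq_zero_AE)
  qed
qed

text \<open>One takes \<open>p\<close>-th roots in \<open>positive_commutator_bound\<close>, with the norm of \<open>b\<close> as \<open>B\<close> wherever it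
  is positive.\<close>

theorem theorem11:
  fixes \<alpha> p \<epsilon> :: real and k :: nat and w :: "real \<Rightarrow> real"
  assumes "0 < \<alpha>" and "\<alpha> < 1"
    and "0 < p" and "0 < \<epsilon>"
    and "weight w" and "w \<in> C_plus (max p 1 + \<epsilon>)"
  shows "\<exists>C::real. 0 < C \<and>
    (\<forall>b \<in> BMO. \<forall>f. loc_integrable f \<and>
       (AE x in lebesgue. set_integrable lebesgue {x<..} (commutator_integrand \<alpha> k b f x)) \<longrightarrow>
       weighted_Lp_norm p w (\<lambda>x. ennreal \<bar>weyl_commutator \<alpha> k b f x\<bar>)
         \<le> ennreal C * bmo_norm b ^ k * weighted_Lp_norm p w (M_plus_frac_LlogL \<alpha> k f))"
proof -
  obtain C0 where C0: "0 < C0" and bd: "\<forall>b B f. loc_integrable b \<longrightarrow> 0 < B \<longrightarrow> bmo_norm b \<le> ennreal B \<longrightarrow> loc_integrable f \<longrightarrow>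
    (\<integral>\<^sup>+x. (\<integral>\<^sup>+y\<in>{x<..}. kern \<alpha> k b (\<lambda>y. \<bar>f y\<bar>) x y \<partial>lebesgue) epowr p * ennreal (w x) \<partial>lebesgue)
      \<le> ennreal (C0 * (B ^ k) powr p) * (\<integral>\<^sup>+x. M_plus_frac_LlogL \<alpha> k f x epowr p * ennreal (w x) \<partial>lebesgue)"
    using positive_commutator_bound[OF assms, of k] by (elim exE conjE) (rule that)
  define C where "C = C0 powr (1 / p)"
  have C: "0 < C" using C0 by (simp add: C_def)
  show ?thesis
  proof (intro exI[of _ C] conjI ballI allI impI C, elim conjE)
    fix b f assume b: "b \<in> BMO" and f: "loc_integrable f"
    have locb: "loc_integrable b" and fin: "bmo_norm b < top" using b by (auto simp: BMO_def)
    obtain \<beta> where \<beta>: "bmo_norm b = ennreal \<beta>" "0 \<le> \<beta>" using fin by (cases "bmo_norm b") auto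
    let ?L = "weighted_Lp_norm p w (\<lambda>x. ennreal \<bar>weyl_commutator \<alpha> k b f x\<bar>)"
    let ?M = "weighted_Lp_norm p w (M_plus_frac_LlogL \<alpha> k f)"
    have main: "?L \<le> ennreal (C * B ^ k) * ?M" if B: "0 < B" "\<beta> \<le> B" for B
    proof -
      have "(\<integral>\<^sup>+x. (ennreal \<bar>weyl_commutator \<alpha> k b f x\<bar> epowr p) * ennreal (w x) \<partial>lebesgue)
         \<le> (\<integral>\<^sup>+x. (\<integral>\<^sup>+y\<in>{x<..}. kern \<alpha> k b (\<lambda>y. \<bar>f y\<bar>) x y \<partial>lebesgue) epowr p * ennreal (w x) \<partial>lebesgue)"
        using assms(3) by (intro nn_integral_mono mult_right_mono epowr_mono weyl_commutator_le_kern) auto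
      also have "\<dots> \<le> ennreal (C0 * (B ^ k) powr p) * (\<integral>\<^sup>+x. M_plus_frac_LlogL \<alpha> k f x epowr p * ennreal (w x) \<partial>lebesgue)"
        by (rule bd[rule_format, OF locb B(1) _ f]) (use \<beta> B in \<open>auto intro: ennreal_leI\<close>)
      finally have "?L \<le> (ennreal (C0 * (B ^ k) powr p) * (\<integral>\<^sup>+x. M_plus_frac_LlogL \<alpha> k f x epowr p * ennreal (w x) \<partial>lebesgue)) epowr (1 / p)"
        unfolding weighted_Lp_norm_def by (rule epowr_mono) (use assms(3) in simp)
      also have "\<dots> = (ennreal (C0 * (B ^ k) powr p) epowr (1 / p)) * ?M"
        unfolding weighted_Lp_norm_def by (rule epowr_mult) (use assms(3) in simp)
      also have "ennreal (C0 * (B ^ k) powr p) epowr (1 / p) = ennreal ((C0 * (B ^ k) powr p) powr (1 / p))"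
        using C0 by (intro epowr_ennreal) simp
      also have "(C0 * (B ^ k) powr p) powr (1 / p) = C * B ^ k"
        using B assms(3) by (simp add: powr_mult powr_powr C_def)
      finally show ?thesis .
    qed
    show "?L \<le> ennreal C * bmo_norm b ^ k * ?M"
    proof (cases "k = 0")
      case True
      \<comment> \<open>Here \<open>B^k = 1\<close> for every \<open>B\<close>, and \<open>b\<close> may be constant.\<close>
      then show ?thesis using main[of "max 1 \<beta>"] by simp
    next
      case False
      show ?thesis
      proof (cases "\<beta> = 0")
        case True
        have "AE x in lebesgue. weyl_commutator \<alpha> k b f x = 0"
          by (rule weyl_commutator_bmo_0[OF locb]) (use True \<beta> False in auto)
        then have "(\<integral>\<^sup>+x. (ennreal \<bar>weyl_commutator \<alpha> k b f x\<bar> epowr p) * ennreal (w x) \<partial>lebesgue) = (\<integral>\<^sup>+(x::real). 0 \<partial>lebesgue)"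
          using assms(3) by (intro nn_integral_cong_AE) (auto elim!: eventually_mono simp: epowr_def)
        then have "?L = 0" using assms(3) by (simp add: weighted_Lp_norm_def epowr_def)
        then show ?thesis by simp
      next
        case False
        then have "0 < \<beta>" using \<beta> by simp
        then have "?L \<le> ennreal (C * \<beta> ^ k) * ?M" by (rule main) simp
        also have "ennreal (C * \<beta> ^ k) = ennreal C * bmo_norm b ^ k"
          unfolding \<beta>(1) using C \<beta>(2) by (simp add: ennreal_mult ennreal_power)
        finally show ?thesis .
      qed
    qed
  qed
qed

end
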